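(* Let $f:S_d\to[0,+\infty]$ be convex, positively $1$-homogeneous and lower semicontinuous, with $\operatorname{dom}(f)\subset S_d^+$, $\operatorname{dom}(f)\neq\emptyset$, and $\operatorname{dom}(f)\cap S_d^{++}$ dense in $\operatorname{dom}(f)$. Assume that $f$ is coercive, that $\operatorname{dom}(f)=S_d^+$, and that there is $\kappa_1>0$ with $f(A)\le\kappa_1\operatorname{tr}(A)$ for all $A\in S_d^+$. Then for all $\mu,\nu\in\mathcal P_2(\mathbb R^d)$, $$H(\mu,\nu)=\sup\left\{\int_{\mathbb R^d}\psi\,d\nu-\int_{\mathbb R^d}\psi\,d\mu \;:\; \psi\in C_b(\mathbb R^d),\ -\psi=(-\psi)^G\text{ on }\mathbb R^d\right\}.$$
   Context: $S_d$ is the space of real symmetric $d\times d$ matrices with inner product $A:B=\operatorname{tr}(A^{T}B)$ and norm $\|A\|=\sqrt{A:A}$; $S_d^+$ (resp. $S_d^{++}$) is the set of nonnegative (resp. positive) definite ones. $\operatorname{dom}(f)=\{M\in S_d: f(M)<+\infty\}$. Positively $1$-homogeneous means $f(tA)=tf(A)$ for all $A\in S_d$, $t\ge 0$. Coercive means $f(A)\to+\infty$ as $\|A\|\to\infty$. $C_b(\mathbb R^d)$ is the space of bounded continuous functions $\mathbb R^d\to\mathbb R$. $\mathcal P_2(\mathbb R^d)$ is the set of Borel probability measures on $\mathbb R^d$ with finite second moment; $\mathcal P_2((0,1)\times\mathbb R^d)$ is the set of Borel probability measures $\varrho$ on $(0,1)\times\mathbb R^d$ with $\int |x|^2\,d\varrho(t,x)<\infty$.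 $\mathcal M((0,1)\times\mathbb R^d,S_d^+)$ is the set of $S_d$-valued Borel measures $\lambda$ on $(0,1)\times\mathbb R^d$ with $\lambda(E)\in S_d^+$ for every Borel $E$; $|\cdot|$ of a measure is its total variation measure. $C_b^{1,2}((0,1)\times\mathbb R^d)$ is the space of functions $\varphi$ that are once continuously differentiable in $t$ and twice in $x$ with $\partial_t\varphi$ and $\nabla_x^2\varphi$ uniformly bounded. Fokker-Planck equation. A pair $(\varrho,\lambda)\in\mathcal P_2((0,1)\times\mathbb R^d)\times\mathcal M((0,1)\times\mathbb R^d,S_d^+)$ which can be disintegrated as $\varrho=\varrho_t\otimes\mathcal L^1|_{(0,1)}$, $\lambda=\lambda_t\otimes\mathcal L^1|_{(0,1)}$ solves $\partial_t\varrho=\operatorname{tr}(\frac12\nabla^2\lambda)$ if $\int_0^1|\lambda_t|(\mathbb R^d)\,dt<\infty$ and $$\int_0^1\int_{\mathbb R^d}\partial_t\varphi\,d\varrho_t\,dt=-\int_0^1\int_{\mathbb R^d}\tfrac12\nabla_x^2\varphi:d\lambda_t\,dt$$ for all $\varphi\in C_b^{1,2}((0,1)\times\mathbb R^d)$ whose closed support is contained in $(0,1)\times\mathbb R^d$. For such a solution $t\mapsto\varrho_t$ has a narrowly continuous representative on $[0,1]$ with values in $\mathcal P_2(\mathbb R^d)$, which is always used; $\varrho_0,\varrho_1$ denote its endpoint values. Dynamic cost: $$F(\mu,\nu)=\inf\left\{\int_0^1\int_{\mathbb R^d}f\left(\frac{d\lambda_t}{d|\lambda_t|}\right)d|\lambda_t|\,dt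 \;:\; \partial_t\varrho=\operatorname{tr}\left(\tfrac12\nabla^2\lambda\right),\ \varrho_0=\mu,\ \varrho_1=\nu\right\},$$ with $\inf\emptyset=+\infty$. Weak transport. $G(x,p)=F(\delta_x,p)$ for $x\in\mathbb R^d$, $p\in\mathcal P_2(\mathbb R^d)$. $\Pi(\mu,\nu)$ is the set of Borel probability measures on $\mathbb R^d\times\mathbb R^d$ with first marginal $\mu$ and second marginal $\nu$; each is disintegrated as $\gamma=\gamma^x\otimes\mu$. Then $H(\mu,\nu)=\inf\{\int_{\mathbb R^d}G(x,\gamma^x)\,d\mu(x):\gamma\in\Pi(\mu,\nu)\}$. $G$-transform. For a universally measurable $\varphi:\mathbb R^d\to\mathbb R$ with $|\varphi(x)|\le C(1+|x|^2)$ for some $C>0$, $\varphi^G(x)=\inf\{\int_{\mathbb R^d}\varphi\,dp+G(x,p): p\in\mathcal P_2(\mathbb R^d)\}$. *)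

theory Defs
  imports "HOL-Probability.Probability"
begin

text \<open>Matrices: the inner product and norm of the library on \<open>real^'d^'d\<close> are entrywise, i.e.
  \<open>A \<bullet> B = trace (transpose A ** B)\<close> and \<open>norm\<close> is the Frobenius norm.\<close>

definition Sym :: "(real^'d^'d) set"
  where "Sym = {A. transpose A = A}"

definition PSD :: "(real^'d^'d) set"
  where "PSD = {A \<in> Sym. \<forall>x. 0 \<le> x \<bullet> (A *v x)}"

definition PD :: "(real^'d^'d) set"
  where "PD = {A \<in> Sym. \<forall>x. x \<noteq> 0 \<longrightarrow> 0 < x \<bullet> (A *v x)}"

text \<open>A function on symmetric matrices is represented by a function on all matrices; no definition
  below looks at its values off \<open>Sym\<close>, except possibly on a null set.\<close>

definition dom_fun :: "(real^'d^'d \<Rightarrow> ennreal) \<Rightarrow> (real^'d^'d) set"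
  where "dom_fun f = {A \<in> Sym. f A < \<infinity>}"

definition convex_fun :: "(real^'d^'d \<Rightarrow> ennreal) \<Rightarrow> bool"
  where "convex_fun f \<longleftrightarrow> (\<forall>A\<in>Sym. \<forall>B\<in>Sym. \<forall>u\<ge>0. \<forall>v\<ge>0. u + v = 1 \<longrightarrow>
           f (u *\<^sub>R A + v *\<^sub>R B) \<le> ennreal u * f A + ennreal v * f B)"

definition pos_homogeneous :: "(real^'d^'d \<Rightarrow> ennreal) \<Rightarrow> bool"
  where "pos_homogeneous f \<longleftrightarrow> (\<forall>A\<in>Sym. \<forall>t\<ge>0. f (t *\<^sub>R A) = ennreal t * f A)"

definition lower_semicont :: "(real^'d^'d \<Rightarrow> ennreal) \<Rightarrow> bool"
  where "lower_semicont f \<longleftrightarrow> (\<forall>A\<in>Sym. f A \<le> Liminf (at A within Sym) f)"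

definition coercive :: "(real^'d^'d \<Rightarrow> ennreal) \<Rightarrow> bool"
  where "coercive f \<longleftrightarrow> (f \<longlongrightarrow> \<infinity>) (inf at_infinity (principal Sym))"


text \<open>Vector-valued measures on the measurable space \<open>M\<close>. Only the values on \<open>sets M\<close> matter.
  Applying the condition to the constant sequence of empty sets gives \<open>L {} = 0\<close>.\<close>

definition vector_measure :: "'a measure \<Rightarrow> ('a set \<Rightarrow> 'b::real_normed_vector) \<Rightarrow> bool"
  where "vector_measure M L \<longleftrightarrow> (\<forall>A :: nat \<Rightarrow> 'a set. range A \<subseteq> sets M \<longrightarrow> disjoint_family A \<longrightarrow>
           (\<lambda>n. L (A n)) sums L (\<Union>n. A n))"

definition PSD_measure :: "'a measure \<Rightarrow> ('a set \<Rightarrow> real^'d^'d) \<Rightarrow> bool"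
  where "PSD_measure M L \<longleftrightarrow> vector_measure M L \<and> (\<forall>E\<in>sets M. L E \<in> PSD)"

definition total_variation :: "'a measure \<Rightarrow> ('a set \<Rightarrow> 'b::real_normed_vector) \<Rightarrow> 'a measure"
  where "total_variation M L = measure_of (space M) (sets M)
           (\<lambda>E. SUP P\<in>{P. finite P \<and> P \<subseteq> sets M \<and> partition_on E P}. \<Sum>A\<in>P. ennreal (norm (L A)))"

text \<open>The density of \<open>L\<close> with respect to its total variation; it is determined up to null sets.\<close>

definition polar_density ::
    "'a measure \<Rightarrow> ('a set \<Rightarrow> 'b::{banach, second_countable_topology}) \<Rightarrow> 'a \<Rightarrow> 'b"
  where "polar_density M L = (SOME g. integrable (total_variation M L) g \<and>
           (\<forall>E\<in>sets M. L E = (LINT x:E|total_variation M L. g x)))"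

definition integral_matrix :: "'a measure \<Rightarrow> ('a \<Rightarrow> real^'d^'d) \<Rightarrow> ('a set \<Rightarrow> real^'d^'d) \<Rightarrow> real"
  where "integral_matrix M B L = (LINT x|total_variation M L. B x \<bullet> polar_density M L x)"


abbreviation time_strip :: "(real \<times> (real^'d)) set"
  where "time_strip \<equiv> {0<..<1} \<times> UNIV"

abbreviation strip_borel :: "(real \<times> (real^'d)) measure"
  where "strip_borel \<equiv> restrict_space borel time_strip"

abbreviation unit_time :: "real measure"
  where "unit_time \<equiv> restrict_space lborel {0<..<1}"

definition P2 :: "(real^'d) measure set"
  where "P2 = {\<mu>. prob_space \<mu> \<and> sets \<mu> = sets borel \<and> (\<integral>\<^sup>+x. ennreal ((norm x)\<^sup>2) \<partial>\<mu>) < \<infinity>}"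

definition P2_strip :: "(real \<times> (real^'d)) measure set"
  where "P2_strip = {\<rho>. prob_space \<rho> \<and> sets \<rho> = sets strip_borel \<and>
           (\<integral>\<^sup>+z. ennreal ((norm (snd z))\<^sup>2) \<partial>\<rho>) < \<infinity>}"

definition disintegrates ::
    "('a \<times> (real^'d)) measure \<Rightarrow> 'a measure \<Rightarrow> ('a \<Rightarrow> (real^'d) measure) \<Rightarrow> bool"
  where "disintegrates \<gamma> \<mu> k \<longleftrightarrow> k \<in> \<mu> \<rightarrow>\<^sub>M prob_algebra borel \<and>
           (\<forall>E\<in>sets \<gamma>. emeasure \<gamma> E = (\<integral>\<^sup>+x. emeasure (k x) (Pair x -` E) \<partial>\<mu>))"

definition disintegrates_matrix ::
    "((real \<times> (real^'d)) set \<Rightarrow> real^'d^'d) \<Rightarrow> (real \<Rightarrow> (real^'d) set \<Rightarrow> real^'d^'d) \<Rightarrow> bool"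
  where "disintegrates_matrix \<Lambda> l \<longleftrightarrow> (\<forall>t\<in>{0<..<1}. PSD_measure borel (l t)) \<and>
           (\<forall>E\<in>sets strip_borel. integrable unit_time (\<lambda>t. l t (Pair t -` E)) \<and>
              \<Lambda> E = (LINT t|unit_time. l t (Pair t -` E)))"

text \<open>\<open>C12b_test \<phi> \<phi>' D\<close>: \<open>\<phi>\<close> is in $C_b^{1,2}$ on the strip, with time derivative \<open>\<phi>'\<close> and spatial
  Hessian \<open>D\<close>, and its support is contained in the open strip. The closure is taken in the whole
  of \<open>real \<times> (real^'d)\<close>: relative to the strip the support condition would be void.\<close>

definition C12b_test ::
    "(real \<times> (real^'d) \<Rightarrow> real) \<Rightarrow> (real \<times> (real^'d) \<Rightarrow> real) \<Rightarrow> (real \<times> (real^'d) \<Rightarrow> real^'d^'d) \<Rightarrow> bool"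
  where "C12b_test \<phi> \<phi>' D \<longleftrightarrow> (\<exists>g :: real \<times> (real^'d) \<Rightarrow> real^'d.
           (\<forall>t\<in>{0<..<1}. \<forall>x.
              ((\<lambda>s. \<phi> (s, x)) has_real_derivative \<phi>' (t, x)) (at t) \<and>
              ((\<lambda>y. \<phi> (t, y)) has_derivative (\<lambda>h. g (t, x) \<bullet> h)) (at x) \<and>
              ((\<lambda>y. g (t, y)) has_derivative (\<lambda>h. D (t, x) *v h)) (at x)) \<and>
           continuous_on time_strip \<phi>' \<and> continuous_on time_strip g \<and> continuous_on time_strip D) \<and>
         bounded (\<phi>' ` time_strip) \<and> bounded (D ` time_strip) \<and>
         closure {z \<in> time_strip. \<phi> z \<noteq> 0} \<subseteq> time_strip"

text \<open>\<open>FP_solution \<rho> \<Lambda> r l\<close>: the pair \<open>(\<rho>, \<Lambda>)\<close>, with disintegrations \<open>r\<close> and \<open>l\<close> in time, solves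
  $\partial_t\varrho = \mathrm{tr}(\frac12\nabla^2\lambda)$.\<close>

definition FP_solution ::
    "(real \<times> (real^'d)) measure \<Rightarrow> ((real \<times> (real^'d)) set \<Rightarrow> real^'d^'d) \<Rightarrow>
     (real \<Rightarrow> (real^'d) measure) \<Rightarrow> (real \<Rightarrow> (real^'d) set \<Rightarrow> real^'d^'d) \<Rightarrow> bool"
  where "FP_solution \<rho> \<Lambda> r l \<longleftrightarrow>
           \<rho> \<in> P2_strip \<and> PSD_measure strip_borel \<Lambda> \<and>
           disintegrates \<rho> unit_time r \<and> disintegrates_matrix \<Lambda> l \<and>
           (\<integral>\<^sup>+t. emeasure (total_variation borel (l t)) UNIV \<partial>unit_time) < \<infinity> \<and>
           (\<forall>\<phi> \<phi>' D. C12b_test \<phi> \<phi>' D \<longrightarrow>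
              (LINT t|unit_time. LINT x|r t. \<phi>' (t, x)) =
              - (LINT t|unit_time. integral_matrix borel (\<lambda>x. (1/2) *\<^sub>R D (t, x)) (l t)))"

definition narrowly_continuous_P2 :: "(real \<Rightarrow> (real^'d) measure) \<Rightarrow> bool"
  where "narrowly_continuous_P2 r \<longleftrightarrow> (\<forall>t\<in>{0..1}. r t \<in> P2) \<and>
           (\<forall>h\<in>bcontfun. continuous_on {0..1} (\<lambda>t. (LINT x|r t. h x :: real)))"

definition FP_cost ::
    "(real^'d^'d \<Rightarrow> ennreal) \<Rightarrow> (real \<Rightarrow> (real^'d) set \<Rightarrow> real^'d^'d) \<Rightarrow> ennreal"
  where "FP_cost f l = (\<integral>\<^sup>+t. (\<integral>\<^sup>+x. f (polar_density borel (l t) x) \<partial>total_variation borel (l t)) \<partial>unit_time)"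

text \<open>The disintegration \<open>r\<close> is taken to be the narrowly continuous representative on \<open>[0,1]\<close>,
  whose endpoint values are those of the solution.\<close>

definition dyn_cost ::
    "(real^'d^'d \<Rightarrow> ennreal) \<Rightarrow> (real^'d) measure \<Rightarrow> (real^'d) measure \<Rightarrow> ennreal"
  where "dyn_cost f \<mu> \<nu> = Inf {FP_cost f l | \<rho> \<Lambda> r l.
           FP_solution \<rho> \<Lambda> r l \<and> narrowly_continuous_P2 r \<and> r 0 = \<mu> \<and> r 1 = \<nu>}"

definition G_cost :: "(real^'d^'d \<Rightarrow> ennreal) \<Rightarrow> real^'d \<Rightarrow> (real^'d) measure \<Rightarrow> ennreal"
  where "G_cost f x p = dyn_cost f (return borel x) p"

definition couplings ::
    "(real^'d) measure \<Rightarrow> (real^'d) measure \<Rightarrow> ((real^'d) \<times> (real^'d)) measure set"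
  where "couplings \<mu> \<nu> = {\<gamma>. prob_space \<gamma> \<and> sets \<gamma> = sets borel \<and>
           distr \<gamma> borel fst = \<mu> \<and> distr \<gamma> borel snd = \<nu>}"

definition weak_transport ::
    "(real^'d^'d \<Rightarrow> ennreal) \<Rightarrow> (real^'d) measure \<Rightarrow> (real^'d) measure \<Rightarrow> ennreal"
  where "weak_transport f \<mu> \<nu> = Inf {(\<integral>\<^sup>+x. G_cost f x (k x) \<partial>\<mu>) | \<gamma> k.
           \<gamma> \<in> couplings \<mu> \<nu> \<and> disintegrates \<gamma> \<mu> k}"

text \<open>Meaningful for universally measurable \<open>\<phi>\<close> of at most quadratic growth, for which the Bochner
  integral below is a genuine one.\<close>

definition G_transform :: "(real^'d^'d \<Rightarrow> ennreal) \<Rightarrow> (real^'d \<Rightarrow> real) \<Rightarrow> real^'d \<Rightarrow> ereal"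
  where "G_transform f \<phi> x = (INF p\<in>P2. ereal (LINT y|completion p. \<phi> y) + enn2ereal (G_cost f x p))"

end

theory Submission
  imports Defs
begin

text \<open>The supremum on the right is a dual problem.  Its competitors are the bounded continuous functions
  \<open>\<psi>\<close> with $\int\psi\,dp-\psi(x)\le G(x,p)$ for all \<open>x\<close> and \<open>p\<close>, called feasible below: the inequality
  says that $-\psi$ lies below its transform, and the point mass at \<open>x\<close>, where the cost vanishes,
  gives equality (\<open>feasible_iff_G_transform\<close>).  Integrating the inequality along a disintegrated
  coupling shows that no gap exceeds the transport cost (\<open>gap_le_weak_transport\<close>).

  The converse rests on smooth potentials, the bounded \<open>C\<^sup>2\<close> functions with
  $\frac12\nabla^2\psi:A\le f(A)$ for nonnegative \<open>A\<close>.  The dynamic cost of two measures is the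
  supremum of the gaps of such potentials.  Testing the equation with a potential times a
  cutoff in time gives one inequality (\<open>potential_gap_le_dyn_cost\<close>).  For the other
  (\<open>dyn_cost_le_potential_gap\<close>), suppose that all gaps are at most \<open>s\<close>.  A separation argument yields a
  positive linear functional on the bounded functions of a position and a matrix of trace at most
  one; it is represented by a measure, whose matrix moment is a flux \<open>\<Lambda>\<close> with
  $\frac12\mathrm{tr}\nabla^2\Lambda=\nu-\mu$ and cost at most \<open>s\<close> (\<open>static_measure\<close>).  As the cost does
  not see the density, the flux can be kept constant in time while the density moves on the
  segment from \<open>\<mu>\<close> to \<open>\<nu>\<close>.

  The weak transport problem is treated by a second separation, now on pairs of points
  (\<open>optimal_kernel\<close>).  The cone contains the functions $\varphi(x,y)-ws$ such that $\varphi(x,\cdot)$ is a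
  potential of level \<open>w\<close> with $\varphi(x,x)=0$, and the centred functions of one variable.  An element with
  a positive lower bound would contradict the choice of \<open>s\<close>: the lower envelope of the potentials
  above the part that depends on \<open>y\<close> is Lipschitz and feasible (\<open>potential_envelope\<close>), and its gap
  would be too large.  Hence there is a functional below zero on the cone.  Its first marginal is \<open>\<mu>\<close>,
  so it is given by a kernel \<open>k\<close> (\<open>kernel_of_mean\<close>), and its second marginal is \<open>\<nu>\<close>, so no mass
  escapes and \<open>k\<close> comes from a coupling.  The functions $\varphi$ may use a different potential on each
  piece of a partition of the \<open>x\<close> space; since countably many potentials suffice
  (\<open>countable_potentials\<close>), this bounds the integral of
  $\sup_\psi(\int\psi\,dk^x-\psi(x))=G(x,k^x)$ by \<open>s\<close>.

  The functionals are finitely additive and act on all bounded functions, so that separation needs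
  neither compactness of the space nor measurable selection of almost optimal measures.  To extract a
  kernel from such a functional, Euclidean space is coded by the unit interval: along a
  Schoenberg curve compactly supported functions become continuous functions of one real variable,
  and a kernel on the interval is built from its distribution functions.\<close>

section \<open>Means on bounded functions\<close>

definition bdd_on :: "'a set \<Rightarrow> ('a \<Rightarrow> real) set"
  where "bdd_on X = {u. bounded (u ` X)}"

text \<open>Positive normalised functionals.  Positivity and normalisation are both contained in the last
  clause, which for constants \<open>C\<close> of both signs bounds the value by the range of the function on \<open>X\<close>.
  Linearity and bounds are required on all bounded functions, so that separation does not meet any
  question of measurability.\<close>

definition mean_on :: "'a set \<Rightarrow> (('a \<Rightarrow> real) \<Rightarrow> real) \<Rightarrow> bool"
  where "mean_on X L \<longleftrightarrow>
    (\<forall>u\<in>bdd_on X. \<forall>v\<in>bdd_on X. L (\<lambda>x. u x + v x) = L u + L v) \<and>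
    (\<forall>u\<in>bdd_on X. \<forall>c. L (\<lambda>x. c * u x) = c * L u) \<and>
    (\<forall>u\<in>bdd_on X. \<forall>C. (\<forall>x\<in>X. u x \<le> C) \<longrightarrow> L u \<le> C)"

lemma bdd_onI: "(\<And>x. x \<in> X \<Longrightarrow> \<bar>u x\<bar> \<le> C) \<Longrightarrow> u \<in> bdd_on X"
  unfolding bdd_on_def bounded_iff by auto

lemma bdd_onE:
  assumes "u \<in> bdd_on X" obtains C where "C \<ge> 0" "\<And>x. x \<in> X \<Longrightarrow> \<bar>u x\<bar> \<le> C"
proof -
  obtain B where "\<forall>y\<in>u ` X. norm y \<le> B" using assms by (auto simp: bdd_on_def bounded_iff)
  then show thesis by (intro that[of "max B 0"]) (fastforce simp: max_def)+
qed

lemma bdd_on_add: "u \<in> bdd_on X \<Longrightarrow> v \<in> bdd_on X \<Longrightarrow> (\<lambda>x. u x + v x) \<in> bdd_on X"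
proof -
  assume "u \<in> bdd_on X" "v \<in> bdd_on X"
  then obtain C D where "\<And>x. x \<in> X \<Longrightarrow> \<bar>u x\<bar> \<le> C" "\<And>x. x \<in> X \<Longrightarrow> \<bar>v x\<bar> \<le> D" by (metis bdd_onE)
  then show ?thesis by (intro bdd_onI[of _ _ "C + D"]) (smt (verit))
qed

lemma bdd_on_mult: "u \<in> bdd_on X \<Longrightarrow> v \<in> bdd_on X \<Longrightarrow> (\<lambda>x. u x * v x) \<in> bdd_on X"
proof -
  assume "u \<in> bdd_on X" "v \<in> bdd_on X"
  then obtain C D where C: "C \<ge> 0" "\<And>x. x \<in> X \<Longrightarrow> \<bar>u x\<bar> \<le> C" and D: "\<And>x. x \<in> X \<Longrightarrow> \<bar>v x\<bar> \<le> D" by (metis bdd_onE)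
  show ?thesis by (intro bdd_onI[of _ _ "C * D"]) (use C D in \<open>auto simp: abs_mult intro!: mult_mono\<close>)
qed

lemma bdd_on_const: "(\<lambda>x. c) \<in> bdd_on X" by (rule bdd_onI[of _ _ "\<bar>c\<bar>"]) auto

lemma bdd_on_cmult: "u \<in> bdd_on X \<Longrightarrow> (\<lambda>x. c * u x) \<in> bdd_on X"
  by (rule bdd_on_mult[OF bdd_on_const])

lemma bdd_on_diff: "u \<in> bdd_on X \<Longrightarrow> v \<in> bdd_on X \<Longrightarrow> (\<lambda>x. u x - v x) \<in> bdd_on X"
  using bdd_on_add[OF _ bdd_on_cmult[of v X "-1"]] by simp

lemma bdd_on_sum: "(\<And>i. i \<in> I \<Longrightarrow> u i \<in> bdd_on X) \<Longrightarrow> (\<lambda>x. \<Sum>i\<in>I. u i x) \<in> bdd_on X"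
  by (induction I rule: infinite_finite_induct) (auto intro: bdd_on_add bdd_on_const)

text \<open>Sublinear functionals on the bounded functions; a minimal one is linear, because for every
  direction \<open>a\<close> the functional $u\mapsto\inf_{t\ge0}(p(u+ta)-t\,p(a))$ is again sublinear and
  below $p$, and its value at $-a$ is at most $-p(a)$.\<close>

definition sublinear_on :: "'a set \<Rightarrow> (('a \<Rightarrow> real) \<Rightarrow> real) \<Rightarrow> bool"
  where "sublinear_on X p \<longleftrightarrow>
    (\<forall>u\<in>bdd_on X. \<forall>v\<in>bdd_on X. p (\<lambda>x. u x + v x) \<le> p u + p v) \<and>
    (\<forall>u\<in>bdd_on X. \<forall>c\<ge>0. p (\<lambda>x. c * u x) = c * p u)"

lemma sublinear_onI:
  assumes "\<And>u v. u \<in> bdd_on X \<Longrightarrow> v \<in> bdd_on X \<Longrightarrow> p (\<lambda>x. u x + v x) \<le> p u + p v"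
    and "\<And>u c. u \<in> bdd_on X \<Longrightarrow> c > 0 \<Longrightarrow> p (\<lambda>x. c * u x) \<le> c * p u"
    and "p (\<lambda>x. 0) = 0"
  shows "sublinear_on X p"
  unfolding sublinear_on_def
proof (intro conjI ballI allI impI)
  fix u and c :: real assume u: "u \<in> bdd_on X" "c \<ge> 0"
  show "p (\<lambda>x. c * u x) = c * p u"
  proof (cases "c = 0")
    case False
    then have c: "c > 0" using u by auto
    have "p (\<lambda>x. (1/c) * (c * u x)) \<le> (1/c) * p (\<lambda>x. c * u x)"
      by (rule assms(2)[OF bdd_on_cmult[OF u(1)]]) (use c in simp)
    moreover have "(\<lambda>x. (1/c) * (c * u x)) = u" using c by auto
    ultimately have "p u \<le> (1/c) * p (\<lambda>x. c * u x)" by simp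
    then have "c * p u \<le> p (\<lambda>x. c * u x)" using c by (simp add: field_simps)
    then show ?thesis using assms(2)[OF u(1) c] by simp
  qed (simp add: assms(3))
qed (use assms(1) in auto)

lemma sublinear_onD:
  assumes "sublinear_on X p" "u \<in> bdd_on X"
  shows "v \<in> bdd_on X \<Longrightarrow> p (\<lambda>x. u x + v x) \<le> p u + p v"
    and "c \<ge> 0 \<Longrightarrow> p (\<lambda>x. c * u x) = c * p u"
  using assms unfolding sublinear_on_def by auto

lemma sublinear_on_zero: "sublinear_on X p \<Longrightarrow> p (\<lambda>x. 0) = 0"
  using sublinear_onD(2)[of X p "\<lambda>x. 0" 0] bdd_on_const[of 0 X] by simp

lemma sublinear_on_neg:
  assumes "sublinear_on X p" "u \<in> bdd_on X"
  shows "- p u \<le> p (\<lambda>x. - u x)"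
  using sublinear_onD(1)[OF assms, of "\<lambda>x. - u x"] bdd_on_cmult[OF assms(2), of "-1"]
    sublinear_on_zero[OF assms(1)] by simp

text \<open>By Zorn's lemma there is a minimal sublinear functional below \<open>q\<close>: a chain of them is bounded
  below by $-q(-u)$, and its infimum is sublinear.\<close>

lemma Hahn_Banach_bdd_on:
  assumes q: "sublinear_on X q"
  obtains L where "\<And>u. u \<in> bdd_on X \<Longrightarrow> L u \<le> q u"
    and "\<And>u v. u \<in> bdd_on X \<Longrightarrow> v \<in> bdd_on X \<Longrightarrow> L (\<lambda>x. u x + v x) = L u + L v"
    and "\<And>u c. u \<in> bdd_on X \<Longrightarrow> L (\<lambda>x. c * u x) = c * L u"
proof -
  let ?E = "bdd_on X"
  define S where "S = {p. sublinear_on X p \<and> (\<forall>u\<in>?E. p u \<le> q u) \<and> (\<forall>u. u \<notin> ?E \<longrightarrow> p u = 0)}"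
  have restrict_S: "(\<lambda>u. if u \<in> ?E then p u else 0) \<in> S"
    if "sublinear_on X p" "\<And>u. u \<in> ?E \<Longrightarrow> p u \<le> q u" for p
    using that unfolding S_def sublinear_on_def by (auto simp: bdd_on_add bdd_on_cmult)
  have "\<exists>p\<in>S. \<forall>p'\<in>S. p' \<le> p \<longrightarrow> p' = p"
  proof -
    have "\<exists>p\<in>S. \<forall>p'\<in>S. p \<ge> p' \<longrightarrow> p' = p"
    proof (rule predicate_Zorn)
      show "partial_order_on S (relation_of (\<lambda>p p'. p' \<le> p) S)"
        by (rule partial_order_on_relation_ofI) auto
      fix C assume "C \<in> Chains (relation_of (\<lambda>p p'. p' \<le> p) S)"
      then have CS: "C \<subseteq> S" and ch: "\<And>p p'. p \<in> C \<Longrightarrow> p' \<in> C \<Longrightarrow> p \<le> p' \<or> p' \<le> p"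
        unfolding Chains_def relation_of_def by auto
      show "\<exists>p\<in>S. \<forall>p'\<in>C. p \<le> p'"
      proof (cases "C = {}")
        case True then show ?thesis using restrict_S[OF q] by auto
      next
        case False
        define r where "r u = (INF p\<in>C. p u)" for u
        have lower: "p u \<ge> - q (\<lambda>x. - u x)" if "p \<in> C" "u \<in> ?E" for p u
        proof -
          have "(\<lambda>x. - u x) \<in> ?E" using bdd_on_cmult[OF that(2), of "-1"] by simp
          then show ?thesis using sublinear_on_neg[of X p "\<lambda>x. - u x"] that CS unfolding S_def by force
        qed
        have bd: "bdd_below ((\<lambda>p. p u) ` C)" if "u \<in> ?E" for u
          using lower[OF _ that] by (auto simp: bdd_below_def)
        have le: "r u \<le> p u" if "p \<in> C" "u \<in> ?E" for p u
          unfolding r_def by (rule cINF_lower[OF bd[OF that(2)] that(1)])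
        have ge: "b \<le> r u" if "\<And>p. p \<in> C \<Longrightarrow> b \<le> p u" for b u
          unfolding r_def by (rule cINF_greatest[OF False that])
        have "sublinear_on X r"
        proof (rule sublinear_onI)
          fix u v assume u: "u \<in> ?E" and v: "v \<in> ?E"
          have uv: "(\<lambda>x. u x + v x) \<in> ?E" using u v by (rule bdd_on_add)
          have *: "r (\<lambda>x. u x + v x) \<le> p u + p' v" if p: "p \<in> C" "p' \<in> C" for p p'
          proof -
            obtain p'' where p'': "p'' \<in> C" "p'' \<le> p" "p'' \<le> p'" using ch[OF p] p by auto
            have "r (\<lambda>x. u x + v x) \<le> p'' (\<lambda>x. u x + v x)" using le p'' uv by auto
            also have "\<dots> \<le> p'' u + p'' v" using sublinear_onD(1)[of X p'' u v] p'' CS u v S_def by auto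
            also have "\<dots> \<le> p u + p' v" using p'' by (auto simp: le_fun_def intro!: add_mono)
            finally show ?thesis .
          qed
          have "r (\<lambda>x. u x + v x) - p u \<le> r v" if "p \<in> C" for p
            by (rule ge) (use *[OF that] in \<open>force simp: algebra_simps\<close>)
          then have "r (\<lambda>x. u x + v x) - r v \<le> r u"
            by (intro ge) (force simp: algebra_simps)
          then show "r (\<lambda>x. u x + v x) \<le> r u + r v" by simp
        next
          fix u and c :: real assume u: "u \<in> ?E" and c: "c > 0"
          have "r (\<lambda>x. c * u x) / c \<le> r u"
          proof (rule ge)
            fix p assume p: "p \<in> C"
            have "r (\<lambda>x. c * u x) \<le> p (\<lambda>x. c * u x)" using le[OF p bdd_on_cmult[OF u]] .
            also have "\<dots> = c * p u" using sublinear_onD(2)[of X p u c] p CS u c S_def by auto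
            finally show "r (\<lambda>x. c * u x) / c \<le> p u" using c by (simp add: field_simps)
          qed
          then show "r (\<lambda>x. c * u x) \<le> c * r u" using c by (simp add: field_simps)
        next
          have "p (\<lambda>x. 0) = 0" if "p \<in> C" for p
            using that CS sublinear_on_zero[of X p] unfolding S_def by auto
          then have "(\<lambda>p. p (\<lambda>x. 0)) ` C = (\<lambda>p. 0) ` C" by (rule image_cong[OF refl])
          then show "r (\<lambda>x. 0) = 0" unfolding r_def using False by simp
        qed
        moreover have "r u \<le> q u" if "u \<in> ?E" for u
        proof -
          obtain p where "p \<in> C" using False by auto
          then show ?thesis using le[of p u] CS that unfolding S_def by force
        qed
        ultimately have "(\<lambda>u. if u \<in> ?E then r u else 0) \<in> S" by (rule restrict_S)
        moreover have "\<forall>p\<in>C. (\<lambda>u. if u \<in> ?E then r u else 0) \<le> p"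
          using le CS unfolding S_def le_fun_def by auto
        ultimately show ?thesis by blast
      qed
    qed
    then show ?thesis by auto
  qed
  then obtain p where p: "p \<in> S" and min: "\<And>p'. p' \<in> S \<Longrightarrow> p' \<le> p \<Longrightarrow> p' = p" by blast
  have sub: "sublinear_on X p" using p S_def by auto
  have neg: "p (\<lambda>x. - a x) = - p a" if a: "a \<in> ?E" for a
  proof -
    define r where "r u = (INF t\<in>{0..}. p (\<lambda>x. u x + t * a x) - t * p a)" for u
    have ta: "(\<lambda>x. t * a x) \<in> ?E" for t using bdd_on_cmult[OF a] .
    have uta: "(\<lambda>x. u x + t * a x) \<in> ?E" if "u \<in> ?E" for t u using bdd_on_add[OF that ta] .
    have lower: "p (\<lambda>x. u x + t * a x) - t * p a \<ge> - p (\<lambda>x. - u x)" if u: "u \<in> ?E" and t: "t \<ge> 0" for u t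
    proof -
      have "(\<lambda>x. - u x) \<in> ?E" using bdd_on_cmult[OF u, of "-1"] by simp
      from sublinear_onD(1)[OF sub uta[OF u, of t] this] show ?thesis
        using sublinear_onD(2)[OF sub a t] by simp
    qed
    have bd: "bdd_below ((\<lambda>t. p (\<lambda>x. u x + t * a x) - t * p a) ` {0..})" if "u \<in> ?E" for u
      unfolding bdd_below_def using lower[OF that] by auto
    have le: "r u \<le> p (\<lambda>x. u x + t * a x) - t * p a" if "t \<ge> 0" "u \<in> ?E" for t u
      unfolding r_def by (rule cINF_lower[OF bd[OF that(2)]]) (use that in auto)
    have ge: "b \<le> r u" if "\<And>t. t \<ge> 0 \<Longrightarrow> b \<le> p (\<lambda>x. u x + t * a x) - t * p a" for b u
      unfolding r_def by (rule cINF_greatest) (use that in auto)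
    have rp: "r u \<le> p u" if "u \<in> ?E" for u using le[of 0 u] that by simp
    have "sublinear_on X r"
    proof (rule sublinear_onI)
      fix u v assume u: "u \<in> ?E" and v: "v \<in> ?E"
      have uv: "(\<lambda>x. u x + v x) \<in> ?E" using u v by (rule bdd_on_add)
      have *: "r (\<lambda>x. u x + v x) \<le> (p (\<lambda>x. u x + t * a x) - t * p a) + (p (\<lambda>x. v x + s * a x) - s * p a)"
        if ts: "t \<ge> 0" "s \<ge> 0" for t s
      proof -
        have "r (\<lambda>x. u x + v x) \<le> p (\<lambda>x. (u x + v x) + (t + s) * a x) - (t + s) * p a"
          by (rule le) (use ts uv in auto)
        also have "(\<lambda>x. (u x + v x) + (t + s) * a x) = (\<lambda>x. (u x + t * a x) + (v x + s * a x))"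
          by (auto simp: algebra_simps)
        also have "p \<dots> \<le> p (\<lambda>x. u x + t * a x) + p (\<lambda>x. v x + s * a x)"
          by (rule sublinear_onD(1)[OF sub uta[OF u] uta[OF v]])
        finally show ?thesis by (simp add: algebra_simps)
      qed
      have "r (\<lambda>x. u x + v x) - (p (\<lambda>x. u x + t * a x) - t * p a) \<le> r v" if "t \<ge> 0" for t
        by (rule ge) (use *[OF that] in \<open>force simp: algebra_simps\<close>)
      then have "r (\<lambda>x. u x + v x) - r v \<le> r u"
        by (intro ge) (force simp: algebra_simps)
      then show "r (\<lambda>x. u x + v x) \<le> r u + r v" by simp
    next
      fix u and c :: real assume u: "u \<in> ?E" and c: "c > 0"
      have "r (\<lambda>x. c * u x) / c \<le> r u"
      proof (rule ge)
        fix t :: real assume t: "t \<ge> 0"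
        have "r (\<lambda>x. c * u x) \<le> p (\<lambda>x. c * u x + (c * t) * a x) - (c * t) * p a"
          by (rule le) (use t c bdd_on_cmult[OF u] in auto)
        also have "(\<lambda>x. c * u x + (c * t) * a x) = (\<lambda>x. c * (u x + t * a x))" by (auto simp: algebra_simps)
        also have "p \<dots> = c * p (\<lambda>x. u x + t * a x)" using sublinear_onD(2)[OF sub uta[OF u]] c by auto
        finally show "r (\<lambda>x. c * u x) / c \<le> p (\<lambda>x. u x + t * a x) - t * p a"
          using c by (simp add: field_simps)
      qed
      then show "r (\<lambda>x. c * u x) \<le> c * r u" using c by (simp add: field_simps)
    next
      have "p (\<lambda>x. 0 + t * a x) - t * p a = 0" if "t \<ge> 0" for t
        using sublinear_onD(2)[OF sub a that] by simp
      then show "r (\<lambda>x. 0) = 0" unfolding r_def by simp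
    qed
    moreover have "r u \<le> q u" if "u \<in> ?E" for u
      using rp[OF that] p that unfolding S_def by force
    ultimately have "(\<lambda>u. if u \<in> ?E then r u else 0) \<in> S" by (rule restrict_S)
    moreover have "(\<lambda>u. if u \<in> ?E then r u else 0) \<le> p"
      using rp p unfolding S_def le_fun_def by auto
    ultimately have eq: "(\<lambda>u. if u \<in> ?E then r u else 0) = p" by (rule min)
    have ma: "(\<lambda>x. - a x) \<in> ?E" using bdd_on_cmult[OF a, of "-1"] by simp
    have "p (\<lambda>x. - a x) = r (\<lambda>x. - a x)" using eq ma by (auto dest!: fun_cong[of _ _ "\<lambda>x. - a x"])
    also have "\<dots> \<le> - p a" using le[of 1 "\<lambda>x. - a x"] ma sublinear_on_zero[OF sub] by simp
    finally show ?thesis using sublinear_on_neg[OF sub a] by simp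
  qed
  show thesis
  proof
    show "p u \<le> q u" if "u \<in> ?E" for u using p that S_def by auto
    show "p (\<lambda>x. u x + v x) = p u + p v" if u: "u \<in> ?E" and v: "v \<in> ?E" for u v
    proof -
      have "p (\<lambda>x. (u x + v x) + - v x) \<le> p (\<lambda>x. u x + v x) + p (\<lambda>x. - v x)"
        by (rule sublinear_onD(1)[OF sub bdd_on_add[OF u v]]) (use bdd_on_cmult[OF v, of "-1"] in simp)
      then show ?thesis using neg[OF v] sublinear_onD(1)[OF sub u v] by simp
    qed
    show "p (\<lambda>x. c * u x) = c * p u" if u: "u \<in> ?E" for u c
    proof (cases "c \<ge> 0")
      case True then show ?thesis using sublinear_onD(2)[OF sub u] by auto
    next
      case False
      then have "p (\<lambda>x. (-c) * u x) = (-c) * p u" by (intro sublinear_onD(2)[OF sub u]) auto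
      moreover have "p (\<lambda>x. - (c * u x)) = - p (\<lambda>x. c * u x)" using neg[OF bdd_on_cmult[OF u]] .
      ultimately show ?thesis by simp
    qed
  qed
qed

text \<open>A cone of bounded functions without an element of positive lower bound is separated from the
  positive functions.  The functional $u\mapsto\inf_{h\in H}\sup_X(u-h)$ is finite exactly because of
  this hypothesis; it is sublinear, at most $\sup_X u$, and at most zero on the cone, and so is a
  linear functional below it.\<close>

lemma mean_alternative:
  fixes H :: "('a \<Rightarrow> real) set"
  assumes X: "X \<noteq> {}" and H: "H \<subseteq> bdd_on X" and zero: "(\<lambda>x. 0) \<in> H"
    and add: "\<And>h k. h \<in> H \<Longrightarrow> k \<in> H \<Longrightarrow> (\<lambda>x. h x + k x) \<in> H"
    and scale: "\<And>h c. h \<in> H \<Longrightarrow> c > 0 \<Longrightarrow> (\<lambda>x. c * h x) \<in> H"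
    and no: "\<And>h \<epsilon>. h \<in> H \<Longrightarrow> \<epsilon> > 0 \<Longrightarrow> \<exists>x\<in>X. h x < \<epsilon>"
  obtains L where "mean_on X L" "\<And>h. h \<in> H \<Longrightarrow> L h \<le> 0"
proof -
  let ?E = "bdd_on X"
  define q where "q u = (INF h\<in>H. SUP x\<in>X. u x - h x)" for u
  have bda: "bdd_above ((\<lambda>x. u x - h x) ` X)" if "u \<in> ?E" "h \<in> H" for u h
  proof -
    have "(\<lambda>x. u x - h x) \<in> ?E" using bdd_on_diff that H by blast
    then show ?thesis unfolding bdd_on_def using bounded_imp_bdd_above by auto
  qed
  have sup_le: "(SUP x\<in>X. u x) \<le> b" if "\<And>x. x \<in> X \<Longrightarrow> u x \<le> b" for u and b :: real
    by (rule cSUP_least[OF X that])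
  have le_sup: "u x - h x \<le> (SUP x\<in>X. u x - h x)" if "x \<in> X" "u \<in> ?E" "h \<in> H" for u h x
    by (rule cSUP_upper[OF that(1) bda[OF that(2,3)]])
  have low: "(SUP x\<in>X. u x - h x) \<ge> - C" if u: "u \<in> ?E" and h: "h \<in> H" and C: "\<And>x. x \<in> X \<Longrightarrow> \<bar>u x\<bar> \<le> C" for u h C
  proof (rule ccontr)
    assume neg: "\<not> ?thesis"
    define e where "e = - C - (SUP x\<in>X. u x - h x)"
    have "e > 0" using neg e_def by auto
    then obtain x where x: "x \<in> X" "h x < e" using no[OF h] by auto
    then have "u x - h x > - C - e" using C[OF x(1)] by (auto simp: abs_le_iff)
    then show False using le_sup[OF x(1) u h] e_def by auto
  qed
  have bdb: "bdd_below ((\<lambda>h. SUP x\<in>X. u x - h x) ` H)" if u: "u \<in> ?E" for u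
  proof -
    obtain C where "\<And>x. x \<in> X \<Longrightarrow> \<bar>u x\<bar> \<le> C" using bdd_onE[OF u] by blast
    then show ?thesis unfolding bdd_below_def using low[OF u] by blast
  qed
  have q_le: "q u \<le> b" if "u \<in> ?E" "h \<in> H" "\<And>x. x \<in> X \<Longrightarrow> u x - h x \<le> b" for u h b
    unfolding q_def using cINF_lower[OF bdb[OF that(1)] that(2)] sup_le[OF that(3)] by fastforce
  have q_ge: "b \<le> q u" if "\<And>h. h \<in> H \<Longrightarrow> b \<le> (SUP x\<in>X. u x - h x)" for b u
    unfolding q_def by (rule cINF_greatest) (use that zero in auto)
  have "sublinear_on X q"
  proof (rule sublinear_onI)
    fix u v assume u: "u \<in> ?E" and v: "v \<in> ?E"
    have *: "q (\<lambda>x. u x + v x) \<le> (SUP x\<in>X. u x - h x) + (SUP x\<in>X. v x - k x)" if hk: "h \<in> H" "k \<in> H" for h k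
    proof (rule q_le[OF bdd_on_add[OF u v] add[OF hk]])
      fix x assume "x \<in> X"
      from le_sup[OF this u hk(1)] le_sup[OF this v hk(2)]
      show "u x + v x - (h x + k x) \<le> (SUP x\<in>X. u x - h x) + (SUP x\<in>X. v x - k x)" by simp
    qed
    have "q (\<lambda>x. u x + v x) - (SUP x\<in>X. u x - h x) \<le> q v" if "h \<in> H" for h
      by (rule q_ge) (use *[OF that] in \<open>force simp: algebra_simps\<close>)
    then have "q (\<lambda>x. u x + v x) - q v \<le> q u" by (intro q_ge) (force simp: algebra_simps)
    then show "q (\<lambda>x. u x + v x) \<le> q u + q v" by simp
  next
    fix u and c :: real assume u: "u \<in> ?E" and c: "c > 0"
    have "q (\<lambda>x. c * u x) / c \<le> q u"
    proof (rule q_ge)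
      fix h assume h: "h \<in> H"
      have "q (\<lambda>x. c * u x) \<le> c * (SUP x\<in>X. u x - h x)"
      proof (rule q_le[OF bdd_on_cmult[OF u] scale[OF h c]])
        fix x assume "x \<in> X"
        then show "c * u x - c * h x \<le> c * (SUP x\<in>X. u x - h x)"
          using le_sup[OF _ u h] c by (simp flip: right_diff_distrib)
      qed
      then show "q (\<lambda>x. c * u x) / c \<le> (SUP x\<in>X. u x - h x)" using c by (simp add: field_simps)
    qed
    then show "q (\<lambda>x. c * u x) \<le> c * q u" using c by (simp add: field_simps)
  next
    have "q (\<lambda>x. 0) \<le> 0" by (rule q_le[OF bdd_on_const zero]) auto
    moreover have "0 \<le> q (\<lambda>x. 0)" by (rule q_ge) (use low[OF bdd_on_const, of _ 0 0] in auto)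
    ultimately show "q (\<lambda>x. 0) = 0" by simp
  qed
  from Hahn_Banach_bdd_on[OF this] obtain L
    where Lq: "\<And>u. u \<in> ?E \<Longrightarrow> L u \<le> q u"
      and L: "\<And>u v. u \<in> ?E \<Longrightarrow> v \<in> ?E \<Longrightarrow> L (\<lambda>x. u x + v x) = L u + L v"
        "\<And>u c. u \<in> ?E \<Longrightarrow> L (\<lambda>x. c * u x) = c * L u" by blast
  show thesis
  proof
    show "mean_on X L" unfolding mean_on_def
    proof (intro conjI ballI allI impI)
      fix u C assume u: "u \<in> ?E" "\<forall>x\<in>X. u x \<le> C"
      have "q u \<le> C" by (rule q_le[OF u(1) zero]) (use u in auto)
      then show "L u \<le> C" using Lq[OF u(1)] by simp
    qed (use L in auto)
    show "L h \<le> 0" if h: "h \<in> H" for h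
    proof -
      have hE: "h \<in> ?E" using h H by auto
      have "q h \<le> 0" by (rule q_le[OF hE h]) auto
      then show ?thesis using Lq[OF hE] by simp
    qed
  qed
qed

lemma mean_on_add: "mean_on X L \<Longrightarrow> u \<in> bdd_on X \<Longrightarrow> v \<in> bdd_on X \<Longrightarrow> L (\<lambda>x. u x + v x) = L u + L v"
  and mean_on_cmult: "mean_on X L \<Longrightarrow> u \<in> bdd_on X \<Longrightarrow> L (\<lambda>x. c * u x) = c * L u"
  and mean_on_le: "mean_on X L \<Longrightarrow> u \<in> bdd_on X \<Longrightarrow> (\<And>x. x \<in> X \<Longrightarrow> u x \<le> C) \<Longrightarrow> L u \<le> C"
  unfolding mean_on_def by auto

lemma mean_on_diff: "mean_on X L \<Longrightarrow> u \<in> bdd_on X \<Longrightarrow> v \<in> bdd_on X \<Longrightarrow> L (\<lambda>x. u x - v x) = L u - L v"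
  using mean_on_add[of X L u "\<lambda>x. (-1) * v x"] mean_on_cmult[of X L v "-1"] bdd_on_cmult[of v X "-1"] by simp

lemma mean_on_mono:
  assumes "mean_on X L" "u \<in> bdd_on X" "v \<in> bdd_on X" "\<And>x. x \<in> X \<Longrightarrow> u x \<le> v x" shows "L u \<le> L v"
  using mean_on_le[OF assms(1) bdd_on_diff[OF assms(2,3)], of 0] mean_on_diff[OF assms(1-3)] assms(4) by fastforce

lemma mean_on_const: "mean_on X L \<Longrightarrow> L (\<lambda>x. c) = c"
  using mean_on_le[of X L "\<lambda>x. c" c] mean_on_le[of X L "\<lambda>x. -1 * c" "-c"] mean_on_cmult[of X L "\<lambda>x. c" "-1"]
    bdd_on_const[of c X] bdd_on_const[of "-1*c" X] by fastforce

lemma mean_on_sum: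
  assumes "mean_on X L" "finite I" "\<And>i. i \<in> I \<Longrightarrow> u i \<in> bdd_on X"
  shows "L (\<lambda>x. \<Sum>i\<in>I. u i x) = (\<Sum>i\<in>I. L (u i))"
  using assms(2,3)
proof (induction I rule: finite_induct)
  case (insert i I)
  have "L (\<lambda>x. u i x + (\<Sum>i\<in>I. u i x)) = L (u i) + L (\<lambda>x. \<Sum>i\<in>I. u i x)"
    by (rule mean_on_add[OF assms(1)]) (use insert in \<open>auto intro: bdd_on_sum\<close>)
  then show ?case using insert by simp
qed (use mean_on_const[OF assms(1), of 0] in simp)

section \<open>A continuous curve through the cube and a Borel section of it\<close>

text \<open>A continuous function with period two that vanishes on $[0,\frac13]$ and equals one on
  $[\frac23,1]$: applied to $3^nt$ it reads the digit number \<open>n\<close> off a point of the Cantor set.\<close>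

definition bit_ramp :: "real \<Rightarrow> real"
  where "bit_ramp t = max 0 (min 1 (1/2 - cos (pi * t)))"

lemma continuous_bit_ramp: "continuous_on UNIV bit_ramp"
  unfolding bit_ramp_def by (intro continuous_intros)

lemma bit_ramp_bounds: "0 \<le> bit_ramp t" "bit_ramp t \<le> 1"
  unfolding bit_ramp_def by auto

lemma bit_ramp_even_shift: "bit_ramp (2 * of_int k + r) = bit_ramp r"
proof -
  have "pi * (2 * of_int k + r) = pi * r + of_int k * (2 * pi)" by (simp add: algebra_simps)
  then show ?thesis unfolding bit_ramp_def using cos.plus_of_int[of "pi * r" k] by simp
qed

lemma bit_ramp_0: assumes "0 \<le> r" "r \<le> 1/3" shows "bit_ramp r = 0"
proof -
  have "cos (pi * r) \<ge> cos (pi / 3)"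
    by (rule cos_monotone_0_pi_le) (use assms mult_left_mono[of r "1/3" pi] in auto)
  then show ?thesis unfolding bit_ramp_def by (simp add: cos_60)
qed

lemma bit_ramp_1: assumes "2/3 \<le> r" "r \<le> 1" shows "bit_ramp r = 1"
proof -
  have "cos (pi * r) \<le> cos (pi * (2/3))"
    by (rule cos_monotone_0_pi_le) (use assms in auto)
  also have "cos (pi * (2/3)) = - (1/2)" using cos_120 by (simp add: mult.commute)
  finally show ?thesis unfolding bit_ramp_def by simp
qed

text \<open>The point of the Cantor set with the given digits.\<close>

definition cantor_code :: "(nat \<Rightarrow> real) \<Rightarrow> real"
  where "cantor_code b = (\<Sum>m. 2 * b m / 3 ^ Suc m)"

lemma cantor_summable:
  assumes "\<And>m. b m \<in> {0, 1::real}" shows "summable (\<lambda>m. 2 * b (m + n) / 3 ^ Suc m)"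
proof (rule summable_comparison_test')
  show "summable (\<lambda>m. 2/3 * (1/3::real) ^ m)" by (intro summable_mult summable_geometric) auto
  show "norm (2 * b (m + n) / 3 ^ Suc m) \<le> 2/3 * (1/3) ^ m" for m
    using assms[of "m + n"] by (auto simp: power_divide)
qed

lemma cantor_tail_bounds:
  assumes "\<And>m. b m \<in> {0, 1::real}"
  shows "0 \<le> (\<Sum>m. 2 * b (m + n) / 3 ^ Suc m)" "(\<Sum>m. 2 * b (m + n) / 3 ^ Suc m) \<le> 1"
proof -
  have nn: "0 \<le> 2 * b (m + n) / 3 ^ Suc m" for m using assms[of "m + n"] by auto
  then show "0 \<le> (\<Sum>m. 2 * b (m + n) / 3 ^ Suc m)" by (intro suminf_nonneg cantor_summable assms)
  have "(\<Sum>m. 2 * b (m + n) / 3 ^ Suc m) \<le> (\<Sum>m. 2/3 * (1/3::real) ^ m)"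
  proof (rule suminf_le)
    show "2 * b (m + n) / 3 ^ Suc m \<le> 2/3 * (1/3) ^ m" for m
      using assms[of "m + n"] by (auto simp: power_divide)
    show "summable (\<lambda>m. 2/3 * (1/3::real) ^ m)" by (intro summable_mult summable_geometric) auto
  qed (intro cantor_summable assms)
  also have "\<dots> = 1" by (subst suminf_mult) (auto simp: suminf_geometric summable_geometric)
  finally show "(\<Sum>m. 2 * b (m + n) / 3 ^ Suc m) \<le> 1" .
qed

lemma cantor_code_bounds:
  assumes "\<And>m. b m \<in> {0, 1::real}" shows "0 \<le> cantor_code b" "cantor_code b \<le> 1"
  using cantor_tail_bounds[of b 0, OF assms] unfolding cantor_code_def by simp_all

text \<open>Multiplication by a power of three turns the leading digits into an even integer, which
  the periodicity of the ramp discards.\<close>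

lemma cantor_code_shift:
  assumes b: "\<And>m. b m \<in> {0, 1::real}"
  shows "\<exists>k. 3 ^ n * cantor_code b = 2 * of_int k + (\<Sum>m. 2 * b (m + n) / 3 ^ Suc m)"
proof (induction n)
  case 0 then show ?case by (intro exI[of _ 0]) (simp add: cantor_code_def)
next
  case (Suc n)
  then obtain k where k: "3 ^ n * cantor_code b = 2 * of_int k + (\<Sum>m. 2 * b (m + n) / 3 ^ Suc m)" by auto
  obtain j :: int where j: "b n = of_int j" using b[of n] by (metis insert_iff of_int_0 of_int_1 singletonD)
  have "(\<Sum>m. 2 * b (m + n) / 3 ^ Suc m) = (\<Sum>m. 2 * b (Suc m + n) / 3 ^ Suc (Suc m)) + 2 * b n / 3"
    using suminf_split_head[OF cantor_summable[of b n, OF b]] by simp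
  also have "(\<Sum>m. 2 * b (Suc m + n) / 3 ^ Suc (Suc m)) = (\<Sum>m. (1/3) * (2 * b (m + Suc n) / 3 ^ Suc m))"
    by simp
  also have "\<dots> = (1/3) * (\<Sum>m. 2 * b (m + Suc n) / 3 ^ Suc m)"
    by (rule suminf_mult) (rule cantor_summable[OF b])
  finally have "3 ^ Suc n * cantor_code b = 2 * of_int (3 * k + j) + (\<Sum>m. 2 * b (m + Suc n) / 3 ^ Suc m)"
    using k j by simp
  then show ?case by blast
qed

lemma bit_ramp_cantor_code:
  assumes b: "\<And>m. b m \<in> {0, 1::real}"
  shows "bit_ramp (3 ^ n * cantor_code b) = b n"
proof -
  obtain k where k: "3 ^ n * cantor_code b = 2 * of_int k + (\<Sum>m. 2 * b (m + n) / 3 ^ Suc m)"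
    using cantor_code_shift[of b n, OF b] by blast
  define r where "r = (\<Sum>m. 2 * b (m + n) / 3 ^ Suc m)"
  have "r = (\<Sum>m. 2 * b (Suc m + n) / 3 ^ Suc (Suc m)) + 2 * b n / 3"
    using suminf_split_head[OF cantor_summable[of b n, OF b]] by (simp add: r_def)
  also have "(\<Sum>m. 2 * b (Suc m + n) / 3 ^ Suc (Suc m)) = (\<Sum>m. (1/3) * (2 * b (m + Suc n) / 3 ^ Suc m))"
    by simp
  also have "\<dots> = (1/3) * (\<Sum>m. 2 * b (m + Suc n) / 3 ^ Suc m)"
    by (rule suminf_mult) (rule cantor_summable[OF b])
  finally have r: "2 * b n / 3 \<le> r" "r \<le> 2 * b n / 3 + 1/3"
    using cantor_tail_bounds[of b "Suc n", OF b] by auto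
  have "bit_ramp (3 ^ n * cantor_code b) = bit_ramp r" unfolding k r_def by (rule bit_ramp_even_shift)
  also have "\<dots> = b n" using b[of n] r bit_ramp_0[of r] bit_ramp_1[of r] by auto
  finally show ?thesis .
qed

definition binary_digit :: "real \<Rightarrow> nat \<Rightarrow> real"
  where "binary_digit u k = of_int (\<lfloor>2 ^ Suc k * u\<rfloor> - 2 * \<lfloor>2 ^ k * u\<rfloor>)"

lemma binary_digit_01: "binary_digit u k \<in> {0, 1}"
proof -
  have "2 * \<lfloor>2 ^ k * u\<rfloor> \<le> \<lfloor>2 ^ Suc k * u\<rfloor>" "\<lfloor>2 ^ Suc k * u\<rfloor> \<le> 2 * \<lfloor>2 ^ k * u\<rfloor> + 1"
    by (simp_all add: le_floor_iff floor_le_iff) linarith+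
  then have "\<lfloor>2 ^ Suc k * u\<rfloor> - 2 * \<lfloor>2 ^ k * u\<rfloor> \<in> {0, 1}" by auto
  then show ?thesis unfolding binary_digit_def by auto
qed

lemma binary_digit_sums:
  assumes "0 \<le> u" "u < 1" shows "(\<lambda>k. binary_digit u k / 2 ^ Suc k) sums u"
proof -
  have partial: "(\<Sum>k<n. binary_digit u k / 2 ^ Suc k) = of_int \<lfloor>2 ^ n * u\<rfloor> / 2 ^ n" for n
  proof (induction n)
    case 0 then show ?case using assms by (simp add: floor_eq_iff)
  next
    case (Suc n)
    then show ?case by (simp add: binary_digit_def field_simps)
  qed
  have "(\<lambda>n. of_int \<lfloor>2 ^ n * u\<rfloor> / 2 ^ n :: real) \<longlonglongrightarrow> u"
  proof (rule tendsto_sandwich[where f="\<lambda>n. u - (1/2) ^ n" and h="\<lambda>n. u"])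
    have "(\<lambda>n. u - (1/2) ^ n) \<longlonglongrightarrow> u - 0" by (intro tendsto_intros LIMSEQ_power_zero) auto
    then show "(\<lambda>n. u - (1/2) ^ n) \<longlonglongrightarrow> u" by simp
    have le: "of_int \<lfloor>2 ^ n * u\<rfloor> / 2 ^ n \<le> u" for n :: nat
      using of_int_floor_le[of "2 ^ n * u"] by (simp add: divide_le_eq mult.commute)
    have ge: "u - (1/2) ^ n \<le> of_int \<lfloor>2 ^ n * u\<rfloor> / 2 ^ n" for n :: nat
    proof -
      have "u - (1/2) ^ n = (2 ^ n * u - 1) / 2 ^ n" by (simp add: power_one_over field_simps)
      also have "\<dots> \<le> of_int \<lfloor>2 ^ n * u\<rfloor> / 2 ^ n" by (rule divide_right_mono) (linarith, simp)
      finally show ?thesis .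
    qed
    show "\<forall>\<^sub>F n in sequentially. u - (1/2) ^ n \<le> of_int \<lfloor>2 ^ n * u\<rfloor> / 2 ^ n"
      "\<forall>\<^sub>F n in sequentially. of_int \<lfloor>2 ^ n * u\<rfloor> / 2 ^ n \<le> u"
      using le ge by (auto intro: always_eventually)
  qed auto
  then show ?thesis unfolding sums_def partial .
qed

text \<open>The $j$-th coordinate of Schoenberg's space-filling curve.\<close>

definition schoenberg :: "nat \<Rightarrow> real \<Rightarrow> real"
  where "schoenberg j t = (\<Sum>k. bit_ramp (3 ^ prod_encode (j, k) * t) / 2 ^ Suc k)"

lemma schoenberg_bounds: "0 \<le> schoenberg j t" "schoenberg j t \<le> 1"
proof -
  have half: "summable (\<lambda>k. (1/2) ^ Suc k :: real)" "(\<Sum>k. (1/2) ^ Suc k :: real) = 1"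
    using power_half_series by (auto simp: sums_iff)
  have b: "0 \<le> bit_ramp (3 ^ prod_encode (j, k) * t) / 2 ^ Suc k"
    "bit_ramp (3 ^ prod_encode (j, k) * t) / 2 ^ Suc k \<le> (1/2) ^ Suc k" for k
    using bit_ramp_bounds[of "3 ^ prod_encode (j, k) * t"] by (simp_all add: power_divide divide_simps)
  have s: "summable (\<lambda>k. bit_ramp (3 ^ prod_encode (j, k) * t) / 2 ^ Suc k)"
    by (rule summable_comparison_test'[OF half(1), of 0]) (simp only: real_norm_def abs_of_nonneg[OF b(1)] b(2))
  show "0 \<le> schoenberg j t" unfolding schoenberg_def by (rule suminf_nonneg[OF s b(1)])
  have "schoenberg j t \<le> (\<Sum>k. (1/2) ^ Suc k)" unfolding schoenberg_def by (rule suminf_le[OF b(2) s half(1)])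
  then show "schoenberg j t \<le> 1" using half(2) by simp
qed

lemma continuous_schoenberg: "continuous_on UNIV (schoenberg j)"
proof -
  have "uniform_limit UNIV (\<lambda>n t. \<Sum>k<n. bit_ramp (3 ^ prod_encode (j, k) * t) / 2 ^ Suc k)
      (\<lambda>t. \<Sum>k. bit_ramp (3 ^ prod_encode (j, k) * t) / 2 ^ Suc k) sequentially"
  proof (rule Weierstrass_m_test)
    show "norm (bit_ramp (3 ^ prod_encode (j, k) * t) / 2 ^ Suc k) \<le> (1/2) ^ Suc k" for k and t :: real
      using bit_ramp_bounds[of "3 ^ prod_encode (j, k) * t"] by (simp add: power_divide divide_simps)
    show "summable (\<lambda>k. (1/2) ^ Suc k :: real)" by (intro summable_Suc_iff[THEN iffD2] summable_geometric) auto
  qed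
  then show ?thesis unfolding schoenberg_def
  proof (rule uniform_limit_theorem[rotated])
    show "\<forall>\<^sub>F n in sequentially. continuous_on UNIV (\<lambda>t. \<Sum>k<n. bit_ramp (3 ^ prod_encode (j, k) * t) / 2 ^ Suc k)"
      by (intro always_eventually allI continuous_intros continuous_on_compose2[OF continuous_bit_ramp]) auto
  qed auto
qed

definition cube_code :: "(nat \<Rightarrow> real) \<Rightarrow> real"
  where "cube_code u = cantor_code (\<lambda>m. case prod_decode m of (j, k) \<Rightarrow> binary_digit (u j) k)"

lemma cube_code_bounds: "0 \<le> cube_code u" "cube_code u \<le> 1"
  unfolding cube_code_def
  by (rule cantor_code_bounds; use binary_digit_01 in \<open>auto split: prod.split\<close>)+

text \<open>The bits of all coordinates are interleaved in one point of the Cantor set, from which the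
  curve reads them back.\<close>

lemma schoenberg_cube_code:
  assumes "0 \<le> u j" "u j < 1" shows "schoenberg j (cube_code u) = u j"
proof -
  have "bit_ramp (3 ^ prod_encode (j, k) * cube_code u) = binary_digit (u j) k" for k
    unfolding cube_code_def
    by (subst bit_ramp_cantor_code) (use binary_digit_01 in \<open>auto split: prod.split\<close>)
  then show ?thesis unfolding schoenberg_def using binary_digit_sums[OF assms] by (simp add: sums_iff)
qed

text \<open>The homeomorphism of the line with the open unit interval, and its inverse.\<close>

definition squash :: "real \<Rightarrow> real" where "squash y = 1/2 + y / (2 * (1 + \<bar>y\<bar>))"
definition unsquash :: "real \<Rightarrow> real" where "unsquash u = (2 * u - 1) / (1 - \<bar>2 * u - 1\<bar>)"

lemma squash_bounds: "0 < squash y" "squash y < 1"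
  unfolding squash_def by (auto simp: field_simps abs_if)

lemma unsquash_squash: "unsquash (squash y) = y"
proof -
  have 1: "2 * squash y - 1 = y / (1 + \<bar>y\<bar>)" unfolding squash_def by (simp add: field_simps)
  have 2: "1 - \<bar>y / (1 + \<bar>y\<bar>)\<bar> = 1 / (1 + \<bar>y\<bar>)" by (simp add: field_simps abs_divide)
  have "1 + \<bar>y\<bar> \<noteq> 0" by linarith
  then show ?thesis unfolding unsquash_def 1 2 by simp
qed

definition basis_enum :: "nat \<Rightarrow> 'a::euclidean_space"
  where "basis_enum = (SOME e. bij_betw e {..<DIM('a)} Basis)"

lemma basis_enum: "bij_betw (basis_enum :: nat \<Rightarrow> 'a::euclidean_space) {..<DIM('a)} Basis"
proof -
  have "\<exists>e. bij_betw e {..<DIM('a)} (Basis :: 'a set)"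
    using ex_bij_betw_nat_finite[of "Basis :: 'a set"] by (simp add: atLeast0LessThan)
  then show ?thesis unfolding basis_enum_def by (rule someI_ex)
qed

text \<open>The code is an injection of the whole space into the unit interval and the curve is a left
  inverse of it.  The curve passes through infinity where a coordinate of the cube is \<open>0\<close> or \<open>1\<close>; the set
  \<open>inside_code\<close> consists of the other parameters.\<close>

definition space_code :: "'a::euclidean_space \<Rightarrow> real"
  where "space_code y = cube_code (\<lambda>j. squash (y \<bullet> basis_enum j))"

definition inside_code :: "'a::euclidean_space itself \<Rightarrow> real set"
  where "inside_code _ = {t. \<forall>j<DIM('a). 0 < schoenberg j t \<and> schoenberg j t < 1}"

definition space_curve :: "real \<Rightarrow> 'a::euclidean_space"
  where "space_curve t = (\<Sum>j<DIM('a). unsquash (schoenberg j t) *\<^sub>R basis_enum j)"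

lemma space_code_bounds: "0 \<le> space_code y" "space_code y \<le> 1"
  unfolding space_code_def by (rule cube_code_bounds)+

lemma schoenberg_space_code: "schoenberg j (space_code y) = squash (y \<bullet> basis_enum j)"
  unfolding space_code_def
  using schoenberg_cube_code[of "\<lambda>j. squash (y \<bullet> basis_enum j)" j] squash_bounds[of "y \<bullet> basis_enum j"] by simp

lemma space_curve_code: "space_curve (space_code y) = (y :: 'a::euclidean_space)"
proof -
  have "space_curve (space_code y) = (\<Sum>j<DIM('a). (y \<bullet> basis_enum j) *\<^sub>R (basis_enum j :: 'a))"
    unfolding space_curve_def schoenberg_space_code unsquash_squash ..
  also have "\<dots> = (\<Sum>b\<in>Basis. (y \<bullet> b) *\<^sub>R b)"
    using sum.reindex_bij_betw[OF basis_enum, of "\<lambda>b. (y \<bullet> b) *\<^sub>R b"] by simp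
  finally show ?thesis by (simp add: euclidean_representation)
qed

lemma space_code_inside: "space_code (y :: 'a::euclidean_space) \<in> inside_code TYPE('a)"
  unfolding inside_code_def by (simp add: schoenberg_space_code squash_bounds)

lemma borel_measurable_schoenberg [measurable]: "schoenberg j \<in> borel_measurable borel"
  by (rule borel_measurable_continuous_onI[OF continuous_schoenberg])

lemma inside_code_measurable [measurable]: "inside_code TYPE('a::euclidean_space) \<in> sets borel"
  unfolding inside_code_def by measurable

lemma borel_measurable_space_curve [measurable]: "space_curve \<in> borel_measurable borel"
proof -
  have [measurable]: "unsquash \<in> borel_measurable borel" unfolding unsquash_def by measurable
  show ?thesis unfolding space_curve_def by measurable
qed

text \<open>A function of compact support in space becomes a continuous function of the curve parameter,
  if it is read as zero where the curve is at infinity.\<close>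

lemma continuous_along_curve:
  fixes h :: "'a::euclidean_space \<Rightarrow> real"
  assumes h: "continuous_on UNIV h" and supp: "bounded {y. h y \<noteq> 0}"
  shows "continuous_on UNIV (\<lambda>t. if t \<in> inside_code TYPE('a) then h (space_curve t) else 0)" (is "continuous_on UNIV ?k")
proof -
  obtain R where R: "\<And>y. h y \<noteq> 0 \<Longrightarrow> norm y \<le> R" using supp by (auto simp: bounded_iff)
  define R' where "R' = max R 0 + 1"
  have R': "R' > 0" "R < R'" unfolding R'_def by auto
  \<comment> \<open>In terms of the coordinates \<open>u\<close> of the cube, the modulus of \<open>unsquash u\<close> is less than \<open>R'\<close>
      on \<open>U\<close>, written without division so that the condition is open up to the boundary.\<close>
  define U where "U = {t. \<forall>j<DIM('a). R' * (1 - \<bar>2 * schoenberg j t - 1\<bar>) > \<bar>2 * schoenberg j t - 1\<bar>}"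
  define C where "C = {t. \<exists>j<DIM('a). R * (1 - \<bar>2 * schoenberg j t - 1\<bar>) < \<bar>2 * schoenberg j t - 1\<bar>}"
  have cs: "continuous_on UNIV (\<lambda>t. schoenberg j t)" for j using continuous_schoenberg[of j] .
  have U_eq: "U = (\<Inter>j\<in>{..<DIM('a)}. {t. R' * (1 - \<bar>2 * schoenberg j t - 1\<bar>) > \<bar>2 * schoenberg j t - 1\<bar>})"
    and C_eq: "C = (\<Union>j\<in>{..<DIM('a)}. {t. R * (1 - \<bar>2 * schoenberg j t - 1\<bar>) < \<bar>2 * schoenberg j t - 1\<bar>})"
    unfolding U_def C_def by auto
  have oU: "open U" unfolding U_eq
    by (intro open_INT ballI open_Collect_less continuous_intros cs) auto
  have oC: "open C" unfolding C_eq
    by (intro open_UN ballI open_Collect_less continuous_intros cs)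
  have pos: "1 - \<bar>2 * schoenberg j t - 1\<bar> > 0" if "t \<in> U" "j < DIM('a)" for t j
  proof (rule ccontr)
    assume "\<not> ?thesis"
    then have "R' * (1 - \<bar>2 * schoenberg j t - 1\<bar>) \<le> 0" using R' by (simp add: mult_nonneg_nonpos)
    then show False using that unfolding U_def by fastforce
  qed
  have U_in: "t \<in> inside_code TYPE('a)" if "t \<in> U" for t
    unfolding inside_code_def using pos[OF that] by (force simp: abs_if split: if_splits)
  have C_zero: "?k t = 0" if tC: "t \<in> C" for t
  proof (rule ccontr)
    assume k: "?k t \<noteq> 0"
    then have t: "t \<in> inside_code TYPE('a)" "h (space_curve t) \<noteq> 0" by (auto split: if_splits)
    obtain j where j: "j < DIM('a)" "R * (1 - \<bar>2 * schoenberg j t - 1\<bar>) < \<bar>2 * schoenberg j t - 1\<bar>"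
      using tC unfolding C_def by blast
    have d: "1 - \<bar>2 * schoenberg j t - 1\<bar> > 0" using t j unfolding inside_code_def by (auto simp: abs_if)
    have "(space_curve t :: 'a) \<bullet> basis_enum j = unsquash (schoenberg j t)"
    proof -
      have "(space_curve t :: 'a) \<bullet> basis_enum j = (\<Sum>i<DIM('a). unsquash (schoenberg i t) * (basis_enum i \<bullet> (basis_enum j :: 'a)))"
        unfolding space_curve_def by (simp add: inner_sum_left)
      also have "\<dots> = (\<Sum>i<DIM('a). if i = j then unsquash (schoenberg i t) else 0)"
      proof (rule sum.cong)
        fix i assume i: "i \<in> {..<DIM('a)}"
        have "(basis_enum i :: 'a) \<in> Basis" "(basis_enum j :: 'a) \<in> Basis"
          using basis_enum[where 'a='a] i j by (auto dest: bij_betwE)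
        moreover have "(basis_enum i :: 'a) = basis_enum j \<longleftrightarrow> i = j"
          using basis_enum[where 'a='a] i j by (auto simp: bij_betw_def inj_on_def)
        ultimately show "unsquash (schoenberg i t) * (basis_enum i \<bullet> (basis_enum j :: 'a)) = (if i = j then unsquash (schoenberg i t) else 0)"
          by (auto simp: inner_Basis)
      qed simp
      finally show ?thesis using j by simp
    qed
    moreover have "\<bar>(space_curve t :: 'a) \<bullet> basis_enum j\<bar> \<le> norm (space_curve t :: 'a)"
      using basis_enum[where 'a='a] j by (intro Basis_le_norm) (auto dest: bij_betwE)
    ultimately have "\<bar>unsquash (schoenberg j t)\<bar> \<le> R" using R[OF t(2)] by simp
    then have "\<bar>2 * schoenberg j t - 1\<bar> / (1 - \<bar>2 * schoenberg j t - 1\<bar>) \<le> R"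
      unfolding unsquash_def using d by (simp add: abs_divide)
    then show False using j d by (simp add: field_simps)
  qed
  have "continuous_on U ?k"
  proof -
    have "continuous_on U (\<lambda>t. h (space_curve t))"
      unfolding space_curve_def unsquash_def
      by (intro continuous_on_compose2[OF h] continuous_intros continuous_on_subset[OF cs]) (use pos in fastforce)+
    then show ?thesis by (rule continuous_on_cong[THEN iffD1, rotated -1]) (use U_in in auto)
  qed
  moreover have "continuous_on C ?k" using C_zero by (subst continuous_on_cong[of C C ?k "\<lambda>_. 0"]) auto
  moreover have "U \<union> C = UNIV"
  proof -
    have "t \<in> U" if "t \<notin> C" for t
    proof -
      have "\<bar>2 * schoenberg j t - 1\<bar> < R' * (1 - \<bar>2 * schoenberg j t - 1\<bar>)" if j: "j < DIM('a)" for j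
      proof -
        let ?v = "\<bar>2 * schoenberg j t - 1\<bar>"
        have le: "?v \<le> R * (1 - ?v)" using \<open>t \<notin> C\<close> j unfolding C_def by force
        have sb: "0 \<le> schoenberg j t" "schoenberg j t \<le> 1" by (rule schoenberg_bounds)+
        have "?v \<noteq> 1" using le by auto
        then have "0 < 1 - ?v" using sb by (auto simp: abs_if split: if_splits)
        then have "R * (1 - ?v) < R' * (1 - ?v)" using R' by simp
        then show ?thesis using le by simp
      qed
      then show ?thesis unfolding U_def by auto
    qed
    then show ?thesis by auto
  qed
  ultimately show ?thesis using continuous_on_open_Un[OF oU oC] by metis
qed

section \<open>Kernels from finitely additive means\<close>

text \<open>Domination by a measure turns finite into countable additivity, because the charge of a
  sequence decreasing to the empty set tends to zero.  Then Radon-Nikodym applies, and the density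
  can be clipped to the unit interval.\<close>

lemma dominated_charge_density:
  fixes f :: "'b set \<Rightarrow> real"
  assumes "finite_measure M"
    and add: "\<And>A B. A \<in> sets M \<Longrightarrow> B \<in> sets M \<Longrightarrow> A \<inter> B = {} \<Longrightarrow> f (A \<union> B) = f A + f B"
    and nonneg: "\<And>A. A \<in> sets M \<Longrightarrow> 0 \<le> f A"
    and dom: "\<And>A. A \<in> sets M \<Longrightarrow> f A \<le> measure M A"
  obtains g where "g \<in> borel_measurable M" "\<And>x. 0 \<le> g x" "\<And>x. g x \<le> 1"
    "\<And>A. A \<in> sets M \<Longrightarrow> f A = (LINT x:A|M. g x)"
proof -
  interpret finite_measure M by fact
  define N where "N = measure_of (space M) (sets M) (\<lambda>A. ennreal (f A))"
  have f0: "f {} = 0" using add[of "{}" "{}"] by simp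
  have pos: "positive (sets M) (\<lambda>A. ennreal (f A))" unfolding positive_def using f0 by simp
  have "countably_additive (sets M) (\<lambda>A. ennreal (f A))"
  proof (rule sets.empty_continuous_imp_countably_additive[OF pos])
    show "additive (sets M) (\<lambda>A. ennreal (f A))"
      unfolding additive_def using add nonneg by (auto simp: ennreal_plus)
    fix A :: "nat \<Rightarrow> 'b set" assume A: "range A \<subseteq> sets M" "decseq A" "(\<Inter>i. A i) = {}"
    have "(\<lambda>i. measure M (A i)) \<longlonglongrightarrow> measure M (\<Inter>i. A i)"
      by (rule finite_Lim_measure_decseq[OF A(1,2)])
    then have lim: "(\<lambda>i. measure M (A i)) \<longlonglongrightarrow> 0" using A(3) by simp
    have "(\<lambda>i. f (A i)) \<longlonglongrightarrow> 0"
      by (rule tendsto_sandwich[OF _ _ tendsto_const lim]) (use nonneg dom A in \<open>auto intro!: always_eventually\<close>)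
    from tendsto_ennrealI[OF this] show "(\<lambda>i. ennreal (f (A i))) \<longlonglongrightarrow> 0" by simp
  qed auto
  then have emN: "emeasure N A = ennreal (f A)" if "A \<in> sets M" for A
    unfolding N_def using that pos by (intro emeasure_measure_of_sigma sets.sigma_algebra_axioms) auto
  have sN: "sets N = sets M" unfolding N_def by simp
  have spN: "space N = space M" unfolding N_def by simp
  have "absolutely_continuous M N" unfolding absolutely_continuous_def
  proof
    fix A assume "A \<in> null_sets M"
    then have A: "A \<in> sets M" "measure M A = 0" by (auto simp: measure_def)
    then have "f A = 0" using nonneg[of A] dom[of A] by simp
    then show "A \<in> null_sets N" using A sN emN by (intro null_setsI) auto
  qed
  then obtain u where u[measurable]: "u \<in> borel_measurable M" and uN: "density M u = N"
    using Radon_Nikodym sN by blast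
  have emu: "(\<integral>\<^sup>+x. u x * indicator A x \<partial>M) = ennreal (f A)" if "A \<in> sets M" for A
    using emN[OF that] uN emeasure_density[OF u that] by simp
  have le1: "AE x in M. u x \<le> 1"
  proof (rule ccontr)
    assume notle: "\<not> ?thesis"
    define B where "B n = {x\<in>space M. u x \<ge> 1 + ennreal (1 / Suc n)}" for n :: nat
    have B[measurable]: "B n \<in> sets M" for n unfolding B_def by measurable
    have "B n \<in> null_sets M" for n
    proof -
      have "(1 + ennreal (1 / Suc n)) * emeasure M (B n) = (\<integral>\<^sup>+x. (1 + ennreal (1 / Suc n)) * indicator (B n) x \<partial>M)"
        by (simp add: nn_integral_cmult_indicator)
      also have "\<dots> \<le> (\<integral>\<^sup>+x. u x * indicator (B n) x \<partial>M)"
        by (intro nn_integral_mono) (auto simp: B_def split: split_indicator)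
      also have "\<dots> = ennreal (f (B n))" by (rule emu[OF B])
      also have "\<dots> \<le> emeasure M (B n)" using dom[OF B] by (simp add: emeasure_eq_measure ennreal_leI)
      finally have "ennreal ((1 + 1 / Suc n) * measure M (B n)) \<le> ennreal (measure M (B n))"
        by (simp add: emeasure_eq_measure ennreal_mult ennreal_plus[symmetric] del: ennreal_plus flip: ennreal_1)
      then have "(1 + 1 / Suc n) * measure M (B n) \<le> measure M (B n)" by (simp add: ennreal_le_iff)
      then have "(1 / real (Suc n)) * measure M (B n) \<le> 0" by (simp add: algebra_simps)
      then have "measure M (B n) = 0"
        using mult_le_0_iff[of "1 / real (Suc n)" "measure M (B n)"] measure_nonneg[of M "B n"] by auto
      then show ?thesis by (intro null_setsI) (simp_all add: emeasure_eq_measure)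
    qed
    then have "(\<Union>n. B n) \<in> null_sets M" by auto
    moreover have "{x\<in>space M. \<not> u x \<le> 1} \<subseteq> (\<Union>n. B n)"
    proof
      fix x assume x: "x \<in> {x\<in>space M. \<not> u x \<le> 1}"
      show "x \<in> (\<Union>n. B n)"
      proof (cases "u x = \<top>")
        case True then show ?thesis using x by (auto simp: B_def)
      next
        case False
        then obtain r where r: "u x = ennreal r" "r \<ge> 0" by (cases "u x") auto
        with x have "r > 1" by (auto simp: ennreal_le_1)
        then obtain n where "1 / real (Suc n) < r - 1" using reals_Archimedean[of "r - 1"] by (auto simp: inverse_eq_divide)
        then have "ennreal (1 + 1 / Suc n) \<le> ennreal r" by (intro ennreal_leI) linarith
        moreover have "ennreal (1 + 1 / Suc n) = 1 + ennreal (1 / Suc n)" by (subst ennreal_plus) auto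
        ultimately have "1 + ennreal (1 / Suc n) \<le> u x" unfolding r by simp
        then show ?thesis using x by (auto simp: B_def)
      qed
    qed
    ultimately have "AE x in M. u x \<le> 1" by (rule AE_I'[where N="\<Union>n. B n"])
    then show False using notle by simp
  qed
  define g where "g x = enn2real (min 1 (u x))" for x
  have g[measurable]: "g \<in> borel_measurable M" unfolding g_def by measurable
  have gb: "0 \<le> g x" "g x \<le> 1" for x
    unfolding g_def by (auto simp: enn2real_leI)
  show thesis
  proof (rule that[OF g gb])
    fix A assume A[measurable]: "A \<in> sets M"
    have "ennreal (LINT x:A|M. g x) = (\<integral>\<^sup>+x. ennreal (indicator A x * g x) \<partial>M)"
      unfolding set_lebesgue_integral_def
      by (subst nn_integral_eq_integral)
        (auto intro!: integrable_const_bound[of _ 1] simp: gb abs_mult mult_le_one split: split_indicator)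
    also have "\<dots> = (\<integral>\<^sup>+x. u x * indicator A x \<partial>M)"
    proof (rule nn_integral_cong_AE)
      show "AE x in M. ennreal (indicator A x * g x) = u x * indicator A x"
        using le1
      proof eventually_elim
        case (elim x)
        have "min 1 (u x) < \<top>" by (simp add: min_less_iff_disj)
        then have "ennreal (g x) = min 1 (u x)" unfolding g_def by (rule ennreal_enn2real)
        then have "ennreal (g x) = u x" using elim by (simp add: min_absorb2)
        then show ?case by (simp split: split_indicator)
      qed
    qed
    also have "\<dots> = ennreal (f A)" by (rule emu[OF A])
    finally show "f A = (LINT x:A|M. g x)"
      using nonneg[OF A] by (subst (asm) ennreal_inj)
        (auto simp: set_lebesgue_integral_def gb intro!: integral_nonneg_AE split: split_indicator)
  qed
qed

subsection \<open>Functionals on the unit interval that share their distribution function\<close>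

text \<open>A finitely additive functional on the interval need not agree with any measure on indicators of
  half lines, since mass may sit infinitesimally close to the end point.  On continuous functions this
  ambiguity disappears: two functionals agree there if the same function \<open>\<Phi>\<close> can serve as
  distribution function for both.\<close>

definition bdd_borel :: "(real \<Rightarrow> real) set"
  where "bdd_borel = {h \<in> borel_measurable borel. bounded (range h)}"

locale interval_functional =
  fixes A :: "(real \<Rightarrow> real) \<Rightarrow> real"
  assumes add: "u \<in> bdd_borel \<Longrightarrow> v \<in> bdd_borel \<Longrightarrow> A (\<lambda>t. u t + v t) = A u + A v"
    and cmult: "u \<in> bdd_borel \<Longrightarrow> A (\<lambda>t. c * u t) = c * A u"
    and nonneg: "u \<in> bdd_borel \<Longrightarrow> (\<And>t. t \<in> {0..1} \<Longrightarrow> 0 \<le> u t) \<Longrightarrow> 0 \<le> A u"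

lemma bdd_borelI: "h \<in> borel_measurable borel \<Longrightarrow> (\<And>t. \<bar>h t\<bar> \<le> C) \<Longrightarrow> h \<in> bdd_borel"
  unfolding bdd_borel_def bounded_iff by auto

lemma bdd_borelE:
  assumes "u \<in> bdd_borel" obtains C where "u \<in> borel_measurable borel" "\<And>t. \<bar>u t\<bar> \<le> C"
proof -
  have u: "u \<in> borel_measurable borel" "bounded (range u)" using assms by (simp_all add: bdd_borel_def)
  from u(2) obtain C where "\<forall>y\<in>range u. norm y \<le> C" unfolding bounded_iff ..
  then have "\<bar>u t\<bar> \<le> C" for t by simp
  with u(1) show thesis by (rule that)
qed

lemma bdd_borel_cmult: "u \<in> bdd_borel \<Longrightarrow> (\<lambda>t. c * u t) \<in> bdd_borel"
proof -
  assume "u \<in> bdd_borel"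
  then obtain C where u[measurable]: "u \<in> borel_measurable borel" and C: "\<And>t. \<bar>u t\<bar> \<le> C"
    by (metis bdd_borelE)
  show ?thesis
  proof (rule bdd_borelI[of _ "\<bar>c\<bar> * C"])
    show "\<bar>c * u t\<bar> \<le> \<bar>c\<bar> * C" for t using mult_left_mono[OF C, of "\<bar>c\<bar>" t] by (simp add: abs_mult)
  qed measurable
qed

lemma bdd_borel_add: "u \<in> bdd_borel \<Longrightarrow> v \<in> bdd_borel \<Longrightarrow> (\<lambda>t. u t + v t) \<in> bdd_borel"
proof -
  assume u: "u \<in> bdd_borel" and v: "v \<in> bdd_borel"
  from u obtain C where [measurable]: "u \<in> borel_measurable borel" and C: "\<And>t. \<bar>u t\<bar> \<le> C" by (metis bdd_borelE)
  from v obtain D where [measurable]: "v \<in> borel_measurable borel" and D: "\<And>t. \<bar>v t\<bar> \<le> D" by (metis bdd_borelE)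
  show ?thesis
  proof (rule bdd_borelI[of _ "C + D"])
    show "\<bar>u t + v t\<bar> \<le> C + D" for t using C[of t] D[of t] by linarith
  qed measurable
qed

lemma bdd_borel_const: "(\<lambda>t. c) \<in> bdd_borel"
  by (rule bdd_borelI[of _ "\<bar>c\<bar>"]) simp_all

lemma bdd_borel_sum: "(\<And>i. i \<in> I \<Longrightarrow> u i \<in> bdd_borel) \<Longrightarrow> (\<lambda>t. \<Sum>i\<in>I. u i t) \<in> bdd_borel"
proof (induction I rule: infinite_finite_induct)
  case (insert i I)
  then show ?case using bdd_borel_add[of "u i" "\<lambda>t. \<Sum>i\<in>I. u i t"] by simp
qed (simp_all add: bdd_borel_const)

lemma bdd_borel_diff: "u \<in> bdd_borel \<Longrightarrow> v \<in> bdd_borel \<Longrightarrow> (\<lambda>t. u t - v t) \<in> bdd_borel"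
  using bdd_borel_add[of u "\<lambda>t. -1 * v t"] bdd_borel_cmult[of v "-1"] by simp

lemma interval_functional_diff:
    "interval_functional A \<Longrightarrow> u \<in> bdd_borel \<Longrightarrow> v \<in> bdd_borel \<Longrightarrow> A (\<lambda>t. u t - v t) = A u - A v"
  using interval_functional.add[of A u "\<lambda>t. -1 * v t"] interval_functional.cmult[of A v "-1"] bdd_borel_cmult[of v "-1"]
  by simp

lemma interval_functional_mono:
  assumes "interval_functional A" "u \<in> bdd_borel" "v \<in> bdd_borel" "\<And>t. t \<in> {0..1} \<Longrightarrow> u t \<le> v t"
  shows "A u \<le> A v"
proof -
  have "0 \<le> A (\<lambda>t. v t - u t)"
    by (rule interval_functional.nonneg[OF assms(1) bdd_borel_diff[OF assms(3,2)]]) (use assms(4) in simp)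
  then show ?thesis using interval_functional_diff[OF assms(1,3,2)] by simp
qed

lemma interval_functional_sum:
  assumes A: "interval_functional A" and "finite I" "\<And>i. i \<in> I \<Longrightarrow> u i \<in> bdd_borel"
  shows "A (\<lambda>t. \<Sum>i\<in>I. u i t) = (\<Sum>i\<in>I. A (u i))"
  using assms(2,3)
proof (induction I rule: finite_induct)
  case empty
  have "A (\<lambda>t. 0 * 0) = 0 * A (\<lambda>t. 0)" by (rule interval_functional.cmult[OF A bdd_borel_const])
  then show ?case by simp
next
  case (insert i I)
  have "A (\<lambda>t. u i t + (\<Sum>i\<in>I. u i t)) = A (u i) + A (\<lambda>t. \<Sum>i\<in>I. u i t)"
    by (rule interval_functional.add[OF A]) (use insert.prems in \<open>simp_all add: bdd_borel_sum\<close>)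
  moreover have "A (\<lambda>t. \<Sum>i\<in>I. u i t) = (\<Sum>i\<in>I. A (u i))" by (rule insert.IH) (use insert.prems in simp)
  ultimately show ?case using insert.hyps by simp
qed

definition ramp :: "real \<Rightarrow> real \<Rightarrow> real \<Rightarrow> real"
  where "ramp a b t = max 0 (min 1 ((b - t) / (b - a)))"

lemma ramp_bounds: "0 \<le> ramp a b t" "ramp a b t \<le> 1" unfolding ramp_def by auto

lemma ramp_bdd_borel: "ramp a b \<in> bdd_borel"
proof (rule bdd_borelI[of _ 1])
  show "ramp a b \<in> borel_measurable borel" unfolding ramp_def by measurable
qed (use ramp_bounds in \<open>auto simp: abs_le_iff intro: order_trans[of _ 0]\<close>)

lemma ramp_left: "a < b \<Longrightarrow> t \<le> a \<Longrightarrow> ramp a b t = 1" unfolding ramp_def by (auto simp: field_simps)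
lemma ramp_right: "a < b \<Longrightarrow> b \<le> t \<Longrightarrow> ramp a b t = 0" unfolding ramp_def by (auto simp: field_simps max_def min_def)

lemma sum_unit_clamps:
  "(\<Sum>i<n. max 0 (min 1 (real i + 1 - u))) = max 0 (min (real n) (real n - u))"
  by (induction n) (auto simp: max_def min_def)

text \<open>A ramp is the average of \<open>n\<close> steeper ramps with disjoint slopes.  This is what makes errors at the
  single end points negligible.\<close>

lemma ramp_subdivide:
  fixes a b :: real assumes "a < b" "n > 0"
  shows "(\<Sum>i<n. ramp (a + real i * ((b - a) / n)) (a + real (Suc i) * ((b - a) / n)) t) = n * ramp a b t"
proof -
  define u where "u = n * (t - a) / (b - a)"
  have n: "real n > 0" using assms by simp
  have "ramp (a + real i * ((b - a) / n)) (a + real (Suc i) * ((b - a) / n)) t = max 0 (min 1 (real i + 1 - u))" for i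
  proof -
    have "(a + real (Suc i) * \<delta>) - (a + real i * \<delta>) = \<delta>" for \<delta> by (simp add: algebra_simps)
    then have "(a + real (Suc i) * ((b - a) / n)) - (a + real i * ((b - a) / n)) = (b - a) / n" .
    moreover have "(a + real (Suc i) * ((b - a) / n) - t) / ((b - a) / n) = real i + 1 - u"
      using assms n by (simp add: u_def field_simps)
    ultimately show ?thesis unfolding ramp_def by simp
  qed
  then have "(\<Sum>i<n. ramp (a + real i * ((b - a) / n)) (a + real (Suc i) * ((b - a) / n)) t) = max 0 (min (real n) (real n - u))"
    by (simp add: sum_unit_clamps)
  also have "\<dots> = n * ramp a b t"
  proof -
    have "real n - u = n * ((b - t) / (b - a))" using assms by (simp add: u_def field_simps)
    then have "max 0 (min (real n) (real n - u)) = max (n * 0) (min (n * 1) (n * ((b - t) / (b - a))))" by simp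
    also have "\<dots> = n * ramp a b t" unfolding ramp_def using n by (simp only: min_mult_distrib_left max_mult_distrib_left) simp
    finally show ?thesis .
  qed
  finally show ?thesis .
qed

text \<open>The interpolating polygon of a function, written as a combination of ramps.\<close>

lemma linear_interpolation:
  fixes h :: "real \<Rightarrow> real"
  assumes n: "n > 0" and t: "t \<in> {0..1}"
    and osc: "\<And>s s'. s \<in> {0..1} \<Longrightarrow> s' \<in> {0..1} \<Longrightarrow> \<bar>s - s'\<bar> \<le> 1 / n \<Longrightarrow> \<bar>h s - h s'\<bar> \<le> \<epsilon>"
  shows "\<bar>h t - (h 1 - (\<Sum>i<n. (h (Suc i / n) - h (i / n)) * ramp (i / n) (Suc i / n) t))\<bar> \<le> \<epsilon>"
proof -
  obtain j where j: "j < n" "j / n \<le> t" "t \<le> Suc j / n"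
  proof (cases "t = 1")
    case True
    show thesis by (rule that[of "n - 1"]) (use n True in \<open>auto simp: field_simps\<close>)
  next
    case False
    then have t1: "0 \<le> t" "t < 1" using t by auto
    show thesis
    proof (rule that[of "nat \<lfloor>n * t\<rfloor>"])
      have "n * t < n" using t1 n by simp
      then show "nat \<lfloor>n * t\<rfloor> < n" using t1 by (simp add: nat_less_iff floor_less_iff)
      have "real (nat \<lfloor>n * t\<rfloor>) \<le> n * t" "n * t \<le> real (Suc (nat \<lfloor>n * t\<rfloor>))"
        using t1 by (simp_all add: of_nat_nat) linarith
      then show "real (nat \<lfloor>n * t\<rfloor>) / n \<le> t" "t \<le> real (Suc (nat \<lfloor>n * t\<rfloor>)) / n"
        using n by (simp_all add: field_simps)
    qed
  qed
  let ?d = "\<lambda>i. (h (Suc i / n) - h (i / n)) * ramp (i / n) (Suc i / n) t"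
  have lt: "real i / n < real (Suc i) / n" for i using n by (simp add: divide_strict_right_mono)
  define r where "r = ramp (j / n) (Suc j / n) t"
  have zero: "(\<Sum>i<m. ?d i) = 0" if "m \<le> j" for m
  proof (rule sum.neutral, rule ballI)
    fix i assume "i \<in> {..<m}"
    then have "real (Suc i) / n \<le> j / n" using that by (intro divide_right_mono) auto
    then show "?d i = 0" using ramp_right[OF lt, of i t] j by simp
  qed
  have tele: "(\<Sum>i<Suc j + k. ?d i) = (h (Suc j / n) - h (j / n)) * r + (h ((Suc j + k) / n) - h (Suc j / n))" for k
  proof (induction k)
    case 0 then show ?case using zero[of j] by (simp add: r_def)
  next
    case (Suc k)
    have "real (Suc j) / n \<le> (Suc j + k) / n" by (intro divide_right_mono) auto
    then have "ramp ((Suc j + k) / n) (Suc (Suc j + k) / n) t = 1" using j by (intro ramp_left[OF lt]) simp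
    then show ?case using Suc by (simp add: algebra_simps)
  qed
  have "(\<Sum>i<n. ?d i) = (h (Suc j / n) - h (j / n)) * r + (h 1 - h (Suc j / n))"
    using tele[of "n - Suc j"] j n by simp
  then have eq: "h t - (h 1 - (\<Sum>i<n. ?d i)) = (1 - r) * (h t - h (Suc j / n)) + r * (h t - h (j / n))"
    by (simp add: algebra_simps)
  have S: "real (Suc j) / n = j / n + 1 / n" by (simp add: add_divide_distrib)
  have "real (Suc j) \<le> n" using j by linarith
  then have mem: "real (Suc j) / n \<in> {0..1}" "real j / n \<in> {0..1}" using n by (auto simp: field_simps)
  have 1: "\<bar>h t - h (Suc j / n)\<bar> \<le> \<epsilon>" by (rule osc[OF t mem(1)]) (use j S in linarith)
  have 2: "\<bar>h t - h (j / n)\<bar> \<le> \<epsilon>" by (rule osc[OF t mem(2)]) (use j S in linarith)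
  have rb: "0 \<le> r" "r \<le> 1" unfolding r_def by (rule ramp_bounds)+
  have "\<bar>(1 - r) * (h t - h (Suc j / n)) + r * (h t - h (j / n))\<bar> \<le> (1 - r) * \<epsilon> + r * \<epsilon>"
  proof -
    have "\<bar>(1 - r) * (h t - h (Suc j / n)) + r * (h t - h (j / n))\<bar>
        \<le> \<bar>(1 - r) * (h t - h (Suc j / n))\<bar> + \<bar>r * (h t - h (j / n))\<bar>" by (rule abs_triangle_ineq)
    also have "\<dots> = (1 - r) * \<bar>h t - h (Suc j / n)\<bar> + r * \<bar>h t - h (j / n)\<bar>"
      using rb by (simp add: abs_mult)
    also have "\<dots> \<le> (1 - r) * \<epsilon> + r * \<epsilon>"
      using rb by (intro add_mono mult_left_mono 1 2) auto
    finally show ?thesis .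
  qed
  then show ?thesis unfolding eq by (simp add: algebra_simps)
qed

text \<open>On each ramp the two functionals differ by at most the increment of \<open>\<Phi>\<close> over its slope.  After
  a subdivision into \<open>n\<close> ramps the increments telescope, and so the difference is at most
  $(\Phi(b)-\Phi(a))/n$.  Continuous functions are uniform limits of combinations of ramps.\<close>

lemma interval_functional_unique:
  assumes A: "interval_functional A" and B: "interval_functional B"
    and low: "\<And>q. q \<in> \<rat> \<Longrightarrow> \<Phi> q \<le> A (indicator {..q})" "\<And>q. q \<in> \<rat> \<Longrightarrow> \<Phi> q \<le> B (indicator {..q})"
    and up: "\<And>q. q \<in> \<rat> \<Longrightarrow> A (indicator {..<q}) \<le> \<Phi> q" "\<And>q. q \<in> \<rat> \<Longrightarrow> B (indicator {..<q}) \<le> \<Phi> q"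
    and one: "A (\<lambda>_. 1) = B (\<lambda>_. 1)"
    and h: "h \<in> bdd_borel" "continuous_on {0..1} h"
  shows "A h = B h"
proof -
  have ind: "(indicator S :: real \<Rightarrow> real) \<in> bdd_borel" if "S \<in> sets borel" for S
    using that by (intro bdd_borelI[of _ 1]) (auto split: split_indicator)
  have ramp_between: "\<Phi> a \<le> C (ramp a b)" "C (ramp a b) \<le> \<Phi> b"
    if C: "interval_functional C" and "\<And>q. q \<in> \<rat> \<Longrightarrow> \<Phi> q \<le> C (indicator {..q})" "\<And>q. q \<in> \<rat> \<Longrightarrow> C (indicator {..<q}) \<le> \<Phi> q"
      and ab: "a \<in> \<rat>" "b \<in> \<rat>" "a < b" for C a b
  proof -
    have "C (indicator {..a}) \<le> C (ramp a b)"
      by (rule interval_functional_mono[OF C ind ramp_bdd_borel])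
        (use ab ramp_bounds ramp_left in \<open>auto split: split_indicator\<close>)
    then show "\<Phi> a \<le> C (ramp a b)" using that(2)[OF ab(1)] by simp
    have "C (ramp a b) \<le> C (indicator {..<b})"
      by (rule interval_functional_mono[OF C ramp_bdd_borel ind])
        (use ab ramp_bounds ramp_right in \<open>auto split: split_indicator\<close>)
    then show "C (ramp a b) \<le> \<Phi> b" using that(3)[OF ab(2)] by simp
  qed
  have ramp_eq: "A (ramp a b) = B (ramp a b)" if ab: "a \<in> \<rat>" "b \<in> \<rat>" "a < b" for a b
  proof -
    have "\<bar>A (ramp a b) - B (ramp a b)\<bar> \<le> (\<Phi> b - \<Phi> a) / n" if n: "n > 0" for n :: nat
    proof -
      define c where "c i = a + real i * ((b - a) / n)" for i
      have cQ: "c i \<in> \<rat>" for i unfolding c_def using ab by (intro Rats_add Rats_mult Rats_divide Rats_diff) auto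
      have clt: "c i < c (Suc i)" for i
      proof -
        have "a + real (Suc i) * \<delta> = (a + real i * \<delta>) + \<delta>" for \<delta> by (simp add: algebra_simps)
        then have "c (Suc i) = c i + (b - a) / n" unfolding c_def .
        then show ?thesis using ab n by simp
      qed
      have split: "real n * C (ramp a b) = (\<Sum>i<n. C (ramp (c i) (c (Suc i))))" if C: "interval_functional C" for C :: "(real \<Rightarrow> real) \<Rightarrow> real"
      proof -
        have "real n * C (ramp a b) = C (\<lambda>t. real n * ramp a b t)" using interval_functional.cmult[OF C ramp_bdd_borel] by simp
        also have "(\<lambda>t. real n * ramp a b t) = (\<lambda>t. \<Sum>i<n. ramp (c i) (c (Suc i)) t)"
          unfolding c_def using ramp_subdivide[OF ab(3) n] by auto
        also have "C \<dots> = (\<Sum>i<n. C (ramp (c i) (c (Suc i))))"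
          by (rule interval_functional_sum[OF C]) (auto intro: ramp_bdd_borel)
        finally show ?thesis .
      qed
      have "\<bar>real n * A (ramp a b) - real n * B (ramp a b)\<bar> = \<bar>\<Sum>i<n. A (ramp (c i) (c (Suc i))) - B (ramp (c i) (c (Suc i)))\<bar>"
        unfolding split[OF A] split[OF B] by (simp add: sum_subtractf)
      also have "\<dots> \<le> (\<Sum>i<n. \<bar>A (ramp (c i) (c (Suc i))) - B (ramp (c i) (c (Suc i)))\<bar>)" by (rule sum_abs)
      also have "\<dots> \<le> (\<Sum>i<n. \<Phi> (c (Suc i)) - \<Phi> (c i))"
      proof (rule sum_mono)
        fix i
        show "\<bar>A (ramp (c i) (c (Suc i))) - B (ramp (c i) (c (Suc i)))\<bar> \<le> \<Phi> (c (Suc i)) - \<Phi> (c i)"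
          using ramp_between[OF A low(1) up(1) cQ cQ clt, of i] ramp_between[OF B low(2) up(2) cQ cQ clt, of i] by linarith
      qed
      also have "\<dots> = \<Phi> b - \<Phi> a" using sum_lessThan_telescope[of "\<lambda>i. \<Phi> (c i)" n] n by (simp add: c_def)
      finally have "real n * \<bar>A (ramp a b) - B (ramp a b)\<bar> \<le> \<Phi> b - \<Phi> a"
        by (simp add: abs_mult flip: right_diff_distrib)
      then show ?thesis using n by (simp add: field_simps)
    qed
    moreover have "(\<lambda>n. (\<Phi> b - \<Phi> a) / real n) \<longlonglongrightarrow> 0" by (rule lim_const_over_n)
    ultimately have "\<bar>A (ramp a b) - B (ramp a b)\<bar> \<le> 0"
      by (intro LIMSEQ_le_const[where X="\<lambda>n. (\<Phi> b - \<Phi> a) / real n"]) (auto intro!: exI[of _ 1])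
    then show ?thesis by simp
  qed
  have one_b: "(\<lambda>_. 1::real) \<in> bdd_borel" by (rule bdd_borelI[of _ 1]) auto
  have A1: "0 \<le> A (\<lambda>_. 1)" by (rule interval_functional.nonneg[OF A one_b]) simp
  have "\<bar>A h - B h\<bar> \<le> 2 * \<epsilon> * A (\<lambda>_. 1)" if e: "\<epsilon> > 0" for \<epsilon>
  proof -
    have "uniformly_continuous_on {0..1} h" by (rule compact_uniformly_continuous[OF h(2)]) simp
    then obtain d where d: "d > 0" "\<And>s s'. s \<in> {0..1} \<Longrightarrow> s' \<in> {0..1} \<Longrightarrow> dist s' s < d \<Longrightarrow> dist (h s') (h s) < \<epsilon>"
      unfolding uniformly_continuous_on_def using e by metis
    obtain n :: nat where n: "n > 0" "1 / n < d"
      using d(1) by (metis nat_approx_posE zero_less_Suc)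
    define g where "g t = h 1 * 1 - (\<Sum>i<n. (h (Suc i / n) - h (i / n)) * ramp (i / n) (Suc i / n) t)" for t
    have osc: "\<bar>h t - g t\<bar> \<le> \<epsilon>" if "t \<in> {0..1}" for t
    proof -
      have "\<bar>h s - h s'\<bar> \<le> \<epsilon>" if "s \<in> {0..1}" "s' \<in> {0..1}" "\<bar>s - s'\<bar> \<le> 1 / n" for s s'
        using d(2)[of s' s] that n(2) by (simp add: dist_real_def)
      from linear_interpolation[OF n(1) that this] show ?thesis unfolding g_def by simp
    qed
    have sb: "(\<lambda>t. \<Sum>i<n. (h (Suc i / n) - h (i / n)) * ramp (i / n) (Suc i / n) t) \<in> bdd_borel"
      by (intro bdd_borel_sum bdd_borel_cmult ramp_bdd_borel)
    have g: "g \<in> bdd_borel" unfolding g_def by (intro bdd_borel_diff bdd_borel_cmult one_b sb)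
    have Cg: "C g = h 1 * C (\<lambda>_. 1) - (\<Sum>i<n. (h (Suc i / n) - h (i / n)) * C (ramp (i / n) (Suc i / n)))"
      if C: "interval_functional C" for C
    proof -
      have "C g = C (\<lambda>t. h 1 * 1) - C (\<lambda>t. \<Sum>i<n. (h (Suc i / n) - h (i / n)) * ramp (i / n) (Suc i / n) t)"
        unfolding g_def by (rule interval_functional_diff[OF C bdd_borel_cmult[OF one_b] sb])
      also have "C (\<lambda>t. \<Sum>i<n. (h (Suc i / n) - h (i / n)) * ramp (i / n) (Suc i / n) t)
        = (\<Sum>i<n. C (\<lambda>t. (h (Suc i / n) - h (i / n)) * ramp (i / n) (Suc i / n) t))"
        by (rule interval_functional_sum[OF C]) (auto intro: bdd_borel_cmult ramp_bdd_borel)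
      finally show ?thesis
        using interval_functional.cmult[OF C one_b, of "h 1"] interval_functional.cmult[OF C ramp_bdd_borel] by simp
    qed
    have "A (ramp (real i / n) (real (Suc i) / n)) = B (ramp (real i / n) (real (Suc i) / n))" for i
      by (rule ramp_eq) (use n in \<open>auto simp: divide_strict_right_mono\<close>)
    then have AB: "A g = B g" using Cg[OF A] Cg[OF B] one by simp
    have close: "\<bar>C h - C g\<bar> \<le> \<epsilon> * C (\<lambda>_. 1)" if C: "interval_functional C" for C
    proof -
      have "C (\<lambda>t. h t - g t) \<le> C (\<lambda>t. \<epsilon> * 1)" "C (\<lambda>t. -1 * (h t - g t)) \<le> C (\<lambda>t. \<epsilon> * 1)"
        by (intro interval_functional_mono[OF C] bdd_borel_diff bdd_borel_cmult h g one_b; use osc in fastforce)+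
      then show ?thesis
        using interval_functional.cmult[OF C one_b, of \<epsilon>] interval_functional_diff[OF C h(1) g]
          interval_functional.cmult[OF C bdd_borel_diff[OF h(1) g], of "-1"] by simp
    qed
    show ?thesis using close[OF A] close[OF B] AB unfolding one[symmetric] by linarith
  qed
  note bound = this
  show ?thesis
  proof (rule ccontr)
    assume "A h \<noteq> B h"
    then have p: "\<bar>A h - B h\<bar> > 0" by simp
    define \<epsilon> where "\<epsilon> = \<bar>A h - B h\<bar> / (4 * (1 + A (\<lambda>_. 1)))"
    have "\<epsilon> > 0" unfolding \<epsilon>_def using p A1 by simp
    from bound[OF this] have "\<bar>A h - B h\<bar> \<le> \<bar>A h - B h\<bar> * (2 * A (\<lambda>_. 1) / (4 * (1 + A (\<lambda>_. 1))))"
      unfolding \<epsilon>_def by (simp add: field_simps)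
    moreover have "2 * A (\<lambda>_. 1) / (4 * (1 + A (\<lambda>_. 1))) < 1" using A1 by (simp add: field_simps)
    ultimately show False using mult_strict_left_mono[OF _ p, of "2 * A (\<lambda>_. 1) / (4 * (1 + A (\<lambda>_. 1)))" 1] by simp
  qed
qed

subsection \<open>From means to kernels\<close>

lemma bdd_on_fst_snd:
  assumes "u \<in> bdd_borel" shows "(\<lambda>z. indicator E (fst z) * u (snd z)) \<in> bdd_on X"
proof -
  obtain C where "\<And>t. \<bar>u t\<bar> \<le> C" using assms by (metis bdd_borelE)
  then show ?thesis by (intro bdd_onI[of _ _ C]) (auto split: split_indicator intro: order_trans[of 0 "\<bar>u t\<bar>" for t])
qed

text \<open>For a rational threshold \<open>q\<close> the charge $E\mapsto T(1_E(x)1_{t\le q})$ is dominated by \<open>M\<close> and has a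
  density.  These densities, made monotone in \<open>q\<close> outside a null set and then continuous from the right,
  are the distribution functions of the kernel.\<close>

lemma kernel_on_interval:
  fixes T :: "('b \<times> real \<Rightarrow> real) \<Rightarrow> real"
  assumes M: "prob_space M" and T: "mean_on (space M \<times> {0..1}) T"
    and marginal: "\<And>E. E \<in> sets M \<Longrightarrow> T (\<lambda>z. indicator E (fst z)) = measure M E"
  obtains \<kappa> where "\<kappa> \<in> M \<rightarrow>\<^sub>M prob_algebra borel"
    "\<And>E h. E \<in> sets M \<Longrightarrow> h \<in> bdd_borel \<Longrightarrow> continuous_on {0..1} h \<Longrightarrow>
      T (\<lambda>z. indicator E (fst z) * h (snd z)) = (LINT x:E|M. LINT t|\<kappa> x. h t)"
proof -
  interpret prob_space M by (rule M)
  let ?X = "space M \<times> {0..1::real}"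
  define \<Phi> where "\<Phi> E q = T (\<lambda>z. indicator E (fst z) * indicator {..q} (snd z))" for E and q :: real
  have ib: "(\<lambda>z. indicator E (fst z) * u (snd z)) \<in> bdd_on ?X" if "u \<in> bdd_borel" for E and u :: "real \<Rightarrow> real"
    using that by (rule bdd_on_fst_snd)
  have ind: "(indicator S :: real \<Rightarrow> real) \<in> bdd_borel" if "S \<in> sets borel" for S
    using that by (intro bdd_borelI[of _ 1]) (auto split: split_indicator)
  have one: "(\<lambda>_. 1::real) \<in> bdd_borel" by (rule bdd_borel_const)
  have \<Phi>_le: "\<Phi> E q \<le> measure M E" if "E \<in> sets M" for E q
    unfolding \<Phi>_def marginal[OF that, symmetric]
    by (rule mean_on_mono[OF T ib[OF ind]]) (use ib[OF one, of E] in \<open>auto split: split_indicator\<close>)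
  have \<Phi>_ge: "0 \<le> \<Phi> E q" for E q
  proof -
    have "T (\<lambda>z. 0) \<le> \<Phi> E q" unfolding \<Phi>_def
      by (rule mean_on_mono[OF T bdd_on_const ib[OF ind]]) (auto split: split_indicator)
    then show ?thesis by (simp add: mean_on_const[OF T])
  qed
  have "\<exists>g. g \<in> borel_measurable M \<and> (\<forall>x. 0 \<le> g x \<and> g x \<le> 1) \<and> (\<forall>E\<in>sets M. \<Phi> E q = (LINT x:E|M. g x))" for q
  proof -
    have fm: "finite_measure M" by unfold_locales
    have "\<Phi> (A \<union> B) q = \<Phi> A q + \<Phi> B q" if "A \<inter> B = {}" for A B
    proof -
      have "T (\<lambda>z. indicator A (fst z) * indicator {..q} (snd z) + indicator B (fst z) * indicator {..q} (snd z)) = \<Phi> A q + \<Phi> B q"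
        unfolding \<Phi>_def by (rule mean_on_add[OF T ib[OF ind] ib[OF ind]]) auto
      also have "(\<lambda>z. indicator A (fst z) * indicator {..q} (snd z) + indicator B (fst z) * indicator {..q} (snd z))
         = (\<lambda>z. indicator (A \<union> B) (fst z) * indicator {..q} (snd z) :: real)"
        using that by (auto simp: fun_eq_iff split: split_indicator)
      finally show ?thesis unfolding \<Phi>_def .
    qed
    from dominated_charge_density[where f="\<lambda>E. \<Phi> E q", OF fm this \<Phi>_ge \<Phi>_le] show ?thesis by metis
  qed
  then obtain F where F[measurable]: "\<And>q. F q \<in> borel_measurable M" and Fb: "\<And>q x. 0 \<le> F q x" "\<And>q x. F q x \<le> 1"
    and F_int: "\<And>q E. E \<in> sets M \<Longrightarrow> \<Phi> E q = (LINT x:E|M. F q x)" by metis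
  define F' where "F' q x = (if q < 0 then 0 else if q \<ge> 1 then 1 else F q x)" for q x
  have F'[measurable]: "F' q \<in> borel_measurable M" for q unfolding F'_def by measurable
  have F'b: "0 \<le> F' q x" "F' q x \<le> 1" for q x unfolding F'_def using Fb by auto
  have iF': "integrable M (F' q)" for q
    by (rule integrable_const_bound[of _ 1]) (use F'b in \<open>auto simp: abs_le_iff intro: order_trans[of _ 0]\<close>)
  have F'_int: "\<Phi> E q = (LINT x:E|M. F' q x)" if E[measurable]: "E \<in> sets M" for q E
  proof (cases "q < 0")
    case True
    have "\<Phi> E q \<le> T (\<lambda>z. 0)" unfolding \<Phi>_def
      by (rule mean_on_mono[OF T ib[OF ind] bdd_on_const]) (use True in \<open>auto split: split_indicator\<close>)
    then show ?thesis using \<Phi>_ge[of E q] True by (simp add: mean_on_const[OF T] F'_def)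
  next
    case False
    show ?thesis
    proof (cases "q \<ge> 1")
      case True
      have "measure M E \<le> \<Phi> E q" unfolding \<Phi>_def marginal[OF E, symmetric]
        by (rule mean_on_mono[OF T _ ib[OF ind]]) (use True ib[OF one, of E] in \<open>auto split: split_indicator\<close>)
      then have "\<Phi> E q = measure M E" using \<Phi>_le[OF E, of q] by simp
      then show ?thesis using True False sets.sets_into_space[OF E]
        by (simp add: F'_def set_lebesgue_integral_def Int_absorb2)
    qed (use False F_int[OF E, of q] in \<open>simp add: F'_def\<close>)
  qed
  have \<Phi>_mono: "\<Phi> E p \<le> \<Phi> E q" if "p \<le> q" for E p q
    unfolding \<Phi>_def by (rule mean_on_mono[OF T ib[OF ind] ib[OF ind]]) (use that in \<open>auto split: split_indicator\<close>)
  have F'_mono: "AE x in M. F' p x \<le> F' q x" if "p \<le> q" for p q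
  proof -
    have "AE x in M. 0 \<le> F' q x - F' p x"
    proof (rule density_nonneg)
      show "integrable M (\<lambda>x. F' q x - F' p x)" by (intro Bochner_Integration.integrable_diff iF')
      fix A assume A: "A \<in> sets M"
      have "(LINT x:A|M. F' q x - F' p x) = (LINT x:A|M. F' q x) - (LINT x:A|M. F' p x)"
        by (intro set_integral_diff) (simp_all only: set_integrable_def integrable_mult_indicator[OF A iF'])
      then show "0 \<le> (LINT x:A|M. F' q x - F' p x)" using \<Phi>_mono[OF that, of A] F'_int[OF A] by simp
    qed
    then show ?thesis by simp
  qed
  have cQ: "countable {p\<in>\<rat>. P p}" for P :: "real \<Rightarrow> bool" by (rule countable_subset[OF _ countable_rat]) auto
  \<comment> \<open>Monotone in \<open>q\<close> for every \<open>x\<close>, and for rational \<open>q\<close> almost everywhere unchanged.\<close>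
  define H where "H q x = (SUP p\<in>{p\<in>\<rat>. p \<le> q}. F' p x)" for q x
  have Qne: "{p\<in>\<rat>. p \<le> q} \<noteq> {}" "{p\<in>\<rat>. q < p} \<noteq> {}" for q :: real
    using Rats_dense_in_real[of "q - 1" q] Rats_dense_in_real[of q "q + 1"] by force+
  have bdA: "bdd_above ((\<lambda>p. F' p x) ` S)" for x S by (rule bdd_aboveI[of _ 1]) (use F'b in auto)
  have H_ge: "F' p x \<le> H q x" if "p \<in> \<rat>" "p \<le> q" for p q x
    unfolding H_def by (rule cSUP_upper[OF _ bdA]) (use that in auto)
  have H_le: "H q x \<le> b" if "\<And>p. p \<in> \<rat> \<Longrightarrow> p \<le> q \<Longrightarrow> F' p x \<le> b" for q x b
    unfolding H_def by (rule cSUP_least[OF Qne(1)]) (use that in auto)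
  have H[measurable]: "H q \<in> borel_measurable M" for q
    unfolding H_def by (rule borel_measurable_cSUP) (use cQ bdA in auto)
  have Hb: "0 \<le> H q x" "H q x \<le> 1" for q x
  proof -
    obtain p where "p \<in> \<rat>" "p \<le> q" using Qne(1)[of q] by auto
    then show "0 \<le> H q x" using H_ge[of p q x] F'b(1)[of p x] by simp
    show "H q x \<le> 1" by (rule H_le) (rule F'b)
  qed
  have H_mono: "H p x \<le> H q x" if "p \<le> q" for p q x by (rule H_le) (use that in \<open>auto intro: H_ge\<close>)
  have H_neg: "H q x = 0" if "q < 0" for q x
    using Hb(1)[of q x] H_le[of q x 0] that by (force simp: F'_def)
  have H_one: "H q x = 1" if "q \<ge> 1" for q x
    using Hb(2)[of q x] H_ge[of 1 q x] that by (simp add: F'_def)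
  have iH: "integrable M (H q)" for q
    by (rule integrable_const_bound[of _ 1]) (use Hb in \<open>auto simp: abs_le_iff intro: order_trans[of _ 0]\<close>)
  have H_int: "\<Phi> E q = (LINT x:E|M. H q x)" if E: "E \<in> sets M" and q: "q \<in> \<rat>" for E q
  proof -
    have "AE x in M. \<forall>p\<in>{p\<in>\<rat>. p \<le> q}. F' p x \<le> F' q x"
      by (subst AE_ball_countable[OF cQ]) (use F'_mono in auto)
    then have "AE x in M. F' q x = H q x"
      by eventually_elim (use q in \<open>auto intro!: antisym H_ge H_le\<close>)
    then have "(LINT x:E|M. F' q x) = (LINT x:E|M. H q x)"
      by (intro set_lebesgue_integral_cong_AE) (use E in auto)
    then show ?thesis using F'_int[OF E] by simp
  qed
  \<comment> \<open>The regularisation from the right.  It may change the value at the rationals; the two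
      functionals below still share the distribution function \<open>\<Phi> E\<close> in the weak sense required above.\<close>
  define G where "G x t = (INF q\<in>{q\<in>\<rat>. t < q}. H q x)" for x t
  have bdB: "bdd_below ((\<lambda>q. H q x) ` S)" for x S by (rule bdd_belowI[of _ 0]) (use Hb in auto)
  have G_le: "G x t \<le> H q x" if "q \<in> \<rat>" "t < q" for q x t
    unfolding G_def by (rule cINF_lower[OF bdB]) (use that in auto)
  have G_ge: "b \<le> G x t" if "\<And>q. q \<in> \<rat> \<Longrightarrow> t < q \<Longrightarrow> b \<le> H q x" for b x t
    unfolding G_def by (rule cINF_greatest[OF Qne(2)]) (use that in auto)
  have G_H: "H t x \<le> G x t" for x t by (rule G_ge) (auto intro: H_mono)
  have G_mono: "G x s \<le> G x t" if "s \<le> t" for x s t by (rule G_ge) (use that in \<open>auto intro: G_le\<close>)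
  have G_neg: "G x t = 0" if t: "t < 0" for x t
  proof -
    obtain q where "q \<in> \<rat>" "t < q" "q < 0" using Rats_dense_in_real[OF t] by auto
    then have "G x t \<le> 0" using G_le[of q t x] H_neg by simp
    moreover have "0 \<le> G x t" by (rule G_ge) (rule Hb)
    ultimately show ?thesis by simp
  qed
  have G_one: "G x t = 1" if t: "t \<ge> 1" for x t
  proof -
    obtain q where "q \<in> \<rat>" "t < q" using Qne(2)[of t] by auto
    then have "G x t \<le> 1" using G_le[of q t x] Hb(2)[of q x] by simp
    moreover have "1 \<le> G x t" by (rule G_ge) (use t H_one in simp)
    ultimately show ?thesis by simp
  qed
  have G_right: "continuous (at_right t) (G x)" for x t
    unfolding continuous_within
  proof (rule order_tendstoI)
    fix a assume "a < G x t"
    then show "\<forall>\<^sub>F s in at_right t. a < G x s"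
      by (intro eventually_at_rightI[of t "t + 1"]) (auto intro: less_le_trans[OF _ G_mono])
  next
    fix a assume "G x t < a"
    then obtain q where q: "q \<in> \<rat>" "t < q" "H q x < a"
      unfolding G_def using cINF_less_iff[OF Qne(2) bdB] by auto
    show "\<forall>\<^sub>F s in at_right t. G x s < a"
      by (rule eventually_at_rightI[of t q]) (use q in \<open>auto intro: le_less_trans[OF G_le]\<close>)
  qed
  have G_bot: "(G x \<longlongrightarrow> 0) at_bot" for x
    by (rule tendsto_eventually) (auto simp: eventually_at_bot_dense G_neg intro: exI[of _ 0])
  have G_top: "(G x \<longlongrightarrow> 1) at_top" for x
    by (rule tendsto_eventually) (auto simp: eventually_at_top_linorder G_one intro: exI[of _ 1])
  have G[measurable]: "(\<lambda>x. G x t) \<in> borel_measurable M" for t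
    unfolding G_def by (rule borel_measurable_cINF) (use cQ bdB in auto)
  define \<kappa> where "\<kappa> x = interval_measure (G x)" for x
  have \<kappa>_dist: "real_distribution (\<kappa> x)" for x
    unfolding \<kappa>_def by (rule real_distribution_interval_measure[OF G_mono G_right G_bot G_top])
  have \<kappa>_cdf: "emeasure (\<kappa> x) {..t} = ennreal (G x t)" "measure (\<kappa> x) {..t} = G x t" for x t
    unfolding \<kappa>_def by (rule emeasure_interval_measure_Iic measure_interval_measure_Iic; rule G_mono G_right G_bot; assumption?)+
  have sets_\<kappa>[simp]: "sets (\<kappa> x) = sets borel" "space (\<kappa> x) = UNIV" for x unfolding \<kappa>_def by simp_all
  have \<kappa>p: "prob_space (\<kappa> x)" for x using \<kappa>_dist[of x] by (simp add: real_distribution_def)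
  have \<kappa>_meas[measurable]: "\<kappa> \<in> M \<rightarrow>\<^sub>M prob_algebra borel"
  proof (rule measurable_prob_algebra_generated[where \<Omega>=UNIV and G="range (\<lambda>a::real. {..a})"])
    show "sets borel = sigma_sets UNIV (range (\<lambda>a::real. {..a}))" by (subst borel_eq_atMost) simp
    show "Int_stable (range (\<lambda>a::real. {..a}))"
      unfolding Int_stable_def by (auto simp: image_iff)
    fix A assume "A \<in> range (\<lambda>a::real. {..a})"
    then obtain a where "A = {..a}" by auto
    then show "(\<lambda>x. emeasure (\<kappa> x) A) \<in> borel_measurable M" by (simp add: \<kappa>_cdf)
  qed (auto intro: \<kappa>p)
  have left: "measure (\<kappa> x) {..<q} \<le> b" if "\<And>t. t < q \<Longrightarrow> G x t \<le> b" for x q b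
  proof -
    interpret K: prob_space "\<kappa> x" by (rule \<kappa>p)
    have "(\<lambda>n. measure (\<kappa> x) {..q - 1 / Suc n}) \<longlonglongrightarrow> measure (\<kappa> x) (\<Union>n. {..q - 1 / Suc n})"
    proof (rule K.finite_Lim_measure_incseq)
      show "incseq (\<lambda>n. {..q - 1 / Suc n})"
        unfolding incseq_def by (auto intro!: order_trans[OF _ diff_left_mono] divide_left_mono)
    qed auto
    moreover have "(\<Union>n. {..q - 1 / Suc n}) = {..<q}"
    proof (intro equalityI subsetI)
      fix t assume "t \<in> {..<q}"
      then obtain n where "inverse (of_nat (Suc n)) < q - t" using reals_Archimedean[of "q - t"] by auto
      then show "t \<in> (\<Union>n. {..q - 1 / Suc n})" by (auto simp: inverse_eq_divide intro!: exI[of _ n])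
    next
      fix t assume "t \<in> (\<Union>n. {..q - 1 / Suc n})"
      then obtain n where n: "t \<le> q - 1 / Suc n" by auto
      have "0 < 1 / real (Suc n)" by simp
      then have "t < q" using n by linarith
      then show "t \<in> {..<q}" by simp
    qed
    ultimately have lim: "(\<lambda>n. measure (\<kappa> x) {..q - 1 / Suc n}) \<longlonglongrightarrow> measure (\<kappa> x) {..<q}" by simp
    show ?thesis
      by (rule LIMSEQ_le_const2[OF lim]) (auto simp: \<kappa>_cdf intro!: that exI[of _ 0])
  qed
  have \<kappa>_AE: "AE t in \<kappa> x. t \<in> {0..1}" for x
  proof -
    interpret K: prob_space "\<kappa> x" by (rule \<kappa>p)
    have "measure (\<kappa> x) {..<0} \<le> 0" by (rule left) (simp add: G_neg)
    then have 0: "measure (\<kappa> x) {..<0} = 0" using measure_nonneg[of "\<kappa> x"] by (meson order_antisym)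
    have "{..<0} \<in> null_sets (\<kappa> x)" by (rule null_setsI) (use 0 in \<open>simp_all add: K.emeasure_eq_measure\<close>)
    moreover have "AE t in \<kappa> x. t \<in> {..1}"
      by (rule K.AE_prob_1) (simp add: \<kappa>_cdf G_one)
    ultimately show ?thesis by (auto dest!: AE_not_in elim: eventually_elim2)
  qed
  have int_\<kappa>: "integrable (\<kappa> x) h" if hb: "h \<in> bdd_borel" for h x
  proof -
    interpret K: prob_space "\<kappa> x" by (rule \<kappa>p)
    obtain C where C: "h \<in> borel_measurable borel" "\<And>t. \<bar>h t\<bar> \<le> C" using hb by (metis bdd_borelE)
    have "h \<in> borel_measurable (\<kappa> x)" using C(1) by (simp cong: measurable_cong_sets)
    then show ?thesis by (intro K.integrable_const_bound[of _ C]) (use C in auto)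
  qed
  have \<kappa>_sub: "\<kappa> \<in> M \<rightarrow>\<^sub>M subprob_algebra borel" by (rule measurable_prob_algebraD[OF \<kappa>_meas])
  have meas_int: "(\<lambda>x. LINT t|\<kappa> x. h t) \<in> borel_measurable M" if "h \<in> bdd_borel" for h :: "real \<Rightarrow> real"
  proof -
    have "h \<in> borel_measurable borel" using that by (simp add: bdd_borel_def)
    from measurable_compose[OF \<kappa>_sub integral_measurable_subprob_algebra[OF this]] show ?thesis .
  qed
  have bound_int: "\<bar>LINT t|\<kappa> x. h t\<bar> \<le> C" if "h \<in> bdd_borel" "\<And>t. \<bar>h t\<bar> \<le> C" for h C x
  proof -
    interpret K: prob_space "\<kappa> x" by (rule \<kappa>p)
    have "\<bar>LINT t|\<kappa> x. h t\<bar> \<le> (LINT t|\<kappa> x. \<bar>h t\<bar>)" by (rule integral_abs_bound)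
    also have "\<dots> \<le> (LINT t|\<kappa> x. C)" by (rule integral_mono[OF integrable_abs[OF int_\<kappa>[OF that(1)]] K.integrable_const]) (rule that(2))
    finally show ?thesis using K.prob_space by simp
  qed
  have int2: "integrable M (\<lambda>x. LINT t|\<kappa> x. h t)" if hb: "h \<in> bdd_borel" for h
  proof -
    obtain C where "\<And>t. \<bar>h t\<bar> \<le> C" using hb by (metis bdd_borelE)
    then show ?thesis using bound_int[OF hb] by (intro integrable_const_bound[of _ C]) (auto intro: meas_int hb)
  qed
  have sint: "set_integrable M E (\<lambda>x. LINT t|\<kappa> x. h t)" if "h \<in> bdd_borel" "E \<in> sets M" for h E
    unfolding set_integrable_def by (rule integrable_mult_indicator[OF that(2) int2[OF that(1)]])
  show thesis
  proof (rule that[OF \<kappa>_meas])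
    fix E and h :: "real \<Rightarrow> real" assume E: "E \<in> sets M" and h: "h \<in> bdd_borel" "continuous_on {0..1} h"
    have A: "interval_functional (\<lambda>h. T (\<lambda>z. indicator E (fst z) * h (snd z)))"
    proof
      fix u v :: "real \<Rightarrow> real" assume u: "u \<in> bdd_borel" and v: "v \<in> bdd_borel"
      show "T (\<lambda>z. indicator E (fst z) * (u (snd z) + v (snd z))) =
          T (\<lambda>z. indicator E (fst z) * u (snd z)) + T (\<lambda>z. indicator E (fst z) * v (snd z))"
        using mean_on_add[OF T ib[OF u] ib[OF v], of E E] by (simp add: distrib_left)
    next
      fix u :: "real \<Rightarrow> real" and c assume u: "u \<in> bdd_borel"
      show "T (\<lambda>z. indicator E (fst z) * (c * u (snd z))) = c * T (\<lambda>z. indicator E (fst z) * u (snd z))"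
        using mean_on_cmult[OF T ib[OF u, of E], of c] by (simp add: mult.left_commute)
    next
      fix u :: "real \<Rightarrow> real" assume u: "u \<in> bdd_borel" and nn: "\<And>t. t \<in> {0..1} \<Longrightarrow> 0 \<le> u t"
      have "T (\<lambda>z. 0) \<le> T (\<lambda>z. indicator E (fst z) * u (snd z))"
        by (rule mean_on_mono[OF T bdd_on_const ib[OF u]]) (use nn in \<open>auto split: split_indicator\<close>)
      then show "0 \<le> T (\<lambda>z. indicator E (fst z) * u (snd z))" by (simp add: mean_on_const[OF T])
    qed
    have B: "interval_functional (\<lambda>h. LINT x:E|M. LINT t|\<kappa> x. h t)"
    proof
      fix u v :: "real \<Rightarrow> real" assume u: "u \<in> bdd_borel" and v: "v \<in> bdd_borel"
      show "(LINT x:E|M. LINT t|\<kappa> x. u t + v t) = (LINT x:E|M. LINT t|\<kappa> x. u t) + (LINT x:E|M. LINT t|\<kappa> x. v t)"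
        by (subst Bochner_Integration.integral_add[OF int_\<kappa>[OF u] int_\<kappa>[OF v]]) (rule set_integral_add[OF sint[OF u E] sint[OF v E]])
    next
      fix u :: "real \<Rightarrow> real" and c assume u: "u \<in> bdd_borel"
      show "(LINT x:E|M. LINT t|\<kappa> x. c * u t) = c * (LINT x:E|M. LINT t|\<kappa> x. u t)" by simp
    next
      fix u :: "real \<Rightarrow> real" assume u: "u \<in> bdd_borel" and nn: "\<And>t. t \<in> {0..1} \<Longrightarrow> 0 \<le> u t"
      have "0 \<le> (LINT t|\<kappa> x. u t)" for x
        by (rule integral_nonneg_AE) (use \<kappa>_AE[of x] in eventually_elim, use nn in simp)
      then show "0 \<le> (LINT x:E|M. LINT t|\<kappa> x. u t)"
        unfolding set_lebesgue_integral_def by (intro integral_nonneg_AE) (auto split: split_indicator)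
    qed
    have indk: "(LINT t|\<kappa> x. indicator S t) = measure (\<kappa> x) S" if "S \<in> sets borel" for x S by simp
    have "T (\<lambda>z. indicator E (fst z) * h (snd z)) = (LINT x:E|M. LINT t|\<kappa> x. h t)"
    proof (rule interval_functional_unique[OF A B, of "\<Phi> E"])
      fix q :: real assume q: "q \<in> \<rat>"
      show "\<Phi> E q \<le> T (\<lambda>z. indicator E (fst z) * indicator {..q} (snd z))" by (simp add: \<Phi>_def)
      show "T (\<lambda>z. indicator E (fst z) * indicator {..<q} (snd z)) \<le> \<Phi> E q"
        unfolding \<Phi>_def by (rule mean_on_mono[OF T ib[OF ind] ib[OF ind]]) (auto split: split_indicator)
      have sH: "set_integrable M E (H q)"
        unfolding set_integrable_def by (rule integrable_mult_indicator[OF E iH])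
      have "(LINT x:E|M. H q x) \<le> (LINT x:E|M. LINT t|\<kappa> x. indicator {..q} t)"
        by (rule set_integral_mono[OF sH sint[OF ind E]]) (auto simp: \<kappa>_cdf G_H)
      then show "\<Phi> E q \<le> (LINT x:E|M. LINT t|\<kappa> x. indicator {..q} t)" using H_int[OF E q] by simp
      have "(LINT x:E|M. LINT t|\<kappa> x. indicator {..<q} t) \<le> (LINT x:E|M. H q x)"
        by (rule set_integral_mono[OF sint[OF ind E] sH]) (auto intro!: left G_le q)
      then show "(LINT x:E|M. LINT t|\<kappa> x. indicator {..<q} t) \<le> \<Phi> E q" using H_int[OF E q] by simp
    next
      have "(LINT t|\<kappa> x. 1) = (1::real)" for x using prob_space.prob_space[OF \<kappa>p[of x]] by simp
      then show "T (\<lambda>z. indicator E (fst z) * 1) = (LINT x:E|M. LINT t|\<kappa> x. 1)"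
        using marginal[OF E] sets.sets_into_space[OF E] by (simp add: set_lebesgue_integral_def Int_absorb2)
    qed (rule h)+
    then show "T (\<lambda>z. indicator E (fst z) * h (snd z)) = (LINT x:E|M. LINT t|\<kappa> x. h t)" .
  qed
qed

lemma continuous_bounded_support_bound:
  fixes h :: "'a::euclidean_space \<Rightarrow> real"
  assumes "continuous_on UNIV h" "bounded {y. h y \<noteq> 0}"
  obtains C where "C \<ge> 0" "\<And>y. \<bar>h y\<bar> \<le> C"
proof -
  have "compact (closure {y. h y \<noteq> 0})" using assms(2) by simp
  then have "bounded (h ` closure {y. h y \<noteq> 0})"
    by (intro compact_imp_bounded compact_continuous_image continuous_on_subset[OF assms(1)]) auto
  then obtain C where C: "\<forall>v\<in>h ` closure {y. h y \<noteq> 0}. norm v \<le> C" unfolding bounded_iff ..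
  have "\<bar>h y\<bar> \<le> max C 0" for y
  proof (cases "h y = 0")
    case False
    then have "y \<in> closure {y. h y \<noteq> 0}" using closure_subset[of "{y. h y \<noteq> 0}"] by blast
    then have "\<bar>h y\<bar> \<le> C" using C by auto
    then show ?thesis by simp
  qed simp
  then show thesis by (intro that[of "max C 0"]) simp
qed

text \<open>Transport along the curve: the code turns a mean on a product with Euclidean space into one on a
  product with the unit interval.  The part of the kernel that sits where the curve is at infinity is
  dropped, which is why the kernel is only sub-stochastic.\<close>

theorem kernel_of_mean:
  fixes L :: "('b \<times> 'a::euclidean_space \<Rightarrow> real) \<Rightarrow> real"
  assumes M: "prob_space M" and L: "mean_on (space M \<times> X) L"
    and marginal: "\<And>E. E \<in> sets M \<Longrightarrow> L (\<lambda>z. indicator E (fst z)) = measure M E"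
  obtains k where "k \<in> M \<rightarrow>\<^sub>M subprob_algebra borel"
    "\<And>E \<psi>. E \<in> sets M \<Longrightarrow> continuous_on UNIV \<psi> \<Longrightarrow> bounded {y. \<psi> y \<noteq> 0} \<Longrightarrow>
      L (\<lambda>z. indicator E (fst z) * \<psi> (snd z)) = (LINT x:E|M. LINT y|k x. \<psi> y)"
proof -
  define T where "T u = L (\<lambda>z. u (fst z, space_code (snd z)))" for u :: "'b \<times> real \<Rightarrow> real"
  have T_bdd: "(\<lambda>z. u (fst z, space_code (snd z))) \<in> bdd_on (space M \<times> X)"
    if u: "u \<in> bdd_on (space M \<times> {0..1})" for u :: "'b \<times> real \<Rightarrow> real"
  proof -
    obtain C where "\<And>z. z \<in> space M \<times> {0..1} \<Longrightarrow> \<bar>u z\<bar> \<le> C" using u by (metis bdd_onE)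
    then show ?thesis by (intro bdd_onI[of _ _ C]) (auto simp: space_code_bounds)
  qed
  have T: "mean_on (space M \<times> {0..1}) T"
    unfolding mean_on_def T_def
  proof (intro conjI ballI allI impI)
    fix u v :: "'b \<times> real \<Rightarrow> real" and C c
    assume u: "u \<in> bdd_on (space M \<times> {0..1})"
    show "L (\<lambda>z. c * u (fst z, space_code (snd z))) = c * L (\<lambda>z. u (fst z, space_code (snd z)))"
      by (rule mean_on_cmult[OF L T_bdd[OF u]])
    show "L (\<lambda>z. u (fst z, space_code (snd z))) \<le> C" if "\<forall>x\<in>space M \<times> {0..1}. u x \<le> C"
      by (rule mean_on_le[OF L T_bdd[OF u]]) (use that in \<open>auto simp: space_code_bounds\<close>)
    assume v: "v \<in> bdd_on (space M \<times> {0..1})"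
    show "L (\<lambda>z. u (fst z, space_code (snd z)) + v (fst z, space_code (snd z))) =
        L (\<lambda>z. u (fst z, space_code (snd z))) + L (\<lambda>z. v (fst z, space_code (snd z)))"
      by (rule mean_on_add[OF L T_bdd[OF u] T_bdd[OF v]])
  qed
  have "T (\<lambda>z. indicator E (fst z)) = measure M E" if "E \<in> sets M" for E
    using marginal[OF that] by (simp add: T_def)
  from kernel_on_interval[OF M T this] obtain \<kappa> where \<kappa>[measurable]: "\<kappa> \<in> M \<rightarrow>\<^sub>M prob_algebra borel"
    and \<kappa>T: "\<And>E h. E \<in> sets M \<Longrightarrow> h \<in> bdd_borel \<Longrightarrow> continuous_on {0..1} h \<Longrightarrow>
      T (\<lambda>z. indicator E (fst z) * h (snd z)) = (LINT x:E|M. LINT t|\<kappa> x. h t)" by blast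
  have \<kappa>_sub[measurable]: "\<kappa> \<in> M \<rightarrow>\<^sub>M subprob_algebra borel" by (rule measurable_prob_algebraD[OF \<kappa>])
  let ?I = "inside_code TYPE('a)"
  define k where "k x = distr (density (\<kappa> x) (\<lambda>t. ennreal (indicator ?I t))) borel (space_curve :: real \<Rightarrow> 'a)" for x
  have s\<kappa>: "sets (\<kappa> x) = sets borel" "space (\<kappa> x) = UNIV" "prob_space (\<kappa> x)" if "x \<in> space M" for x
    using measurable_space[OF \<kappa> that] by (auto simp: space_prob_algebra dest: sets_eq_imp_space_eq)
  have curve: "(space_curve :: real \<Rightarrow> 'a) \<in> borel_measurable (\<kappa> x)" "?I \<in> sets (\<kappa> x)" if "x \<in> space M" for x
    using s\<kappa>[OF that] by (simp_all cong: measurable_cong_sets)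
  have k_em: "emeasure (k x) A = emeasure (\<kappa> x) (?I \<inter> space_curve -` A)" if x: "x \<in> space M" and A: "A \<in> sets borel" for x A
  proof -
    have c: "(space_curve :: real \<Rightarrow> 'a) \<in> borel_measurable (\<kappa> x)" and I: "?I \<in> sets (\<kappa> x)" using curve[OF x] by auto
    have pre: "space_curve -` A \<in> sets (\<kappa> x)" using measurable_sets[OF c A] s\<kappa>[OF x] by simp
    have "emeasure (k x) A = emeasure (density (\<kappa> x) (\<lambda>t. ennreal (indicator ?I t))) (space_curve -` A)"
      unfolding k_def using c A s\<kappa>[OF x] by (subst emeasure_distr) auto
    also have "\<dots> = (\<integral>\<^sup>+t. ennreal (indicator ?I t) * indicator (space_curve -` A) t \<partial>\<kappa> x)"
      by (rule emeasure_density[OF _ pre]) (use I in measurable)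
    also have "\<dots> = (\<integral>\<^sup>+t. indicator (?I \<inter> space_curve -` A) t \<partial>\<kappa> x)"
      by (intro nn_integral_cong) (auto split: split_indicator)
    also have "\<dots> = emeasure (\<kappa> x) (?I \<inter> space_curve -` A)" using pre I by (intro nn_integral_indicator) auto
    finally show ?thesis .
  qed
  have k: "k \<in> M \<rightarrow>\<^sub>M subprob_algebra borel"
  proof (rule measurable_subprob_algebra)
    fix x assume x: "x \<in> space M"
    interpret K: prob_space "\<kappa> x" by (rule s\<kappa>[OF x])
    show "sets (k x) = sets borel" unfolding k_def by simp
    show "subprob_space (k x)"
    proof (rule subprob_spaceI)
      show "emeasure (k x) (space (k x)) \<le> 1" using k_em[OF x, of UNIV] K.emeasure_le_1 by (simp add: k_def)
      show "space (k x) \<noteq> {}" unfolding k_def by simp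
    qed
  next
    fix A :: "'a set" assume A: "A \<in> sets borel"
    have "?I \<inter> space_curve -` A \<in> sets borel" using measurable_sets[OF borel_measurable_space_curve A] by simp
    from measurable_compose[OF \<kappa>_sub measurable_emeasure_subprob_algebra[OF this]]
    show "(\<lambda>x. emeasure (k x) A) \<in> borel_measurable M" by (subst measurable_cong[OF k_em[OF _ A]])
  qed
  show thesis
  proof (rule that[OF k])
    fix E and \<psi> :: "'a \<Rightarrow> real" assume E: "E \<in> sets M" and \<psi>: "continuous_on UNIV \<psi>" "bounded {y. \<psi> y \<noteq> 0}"
    define h where "h t = (if t \<in> ?I then \<psi> (space_curve t) else 0)" for t
    have hc: "continuous_on UNIV h" unfolding h_def by (rule continuous_along_curve[OF \<psi>])
    obtain C where C: "C \<ge> 0" "\<And>y. \<bar>\<psi> y\<bar> \<le> C" using continuous_bounded_support_bound[OF \<psi>] by metis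
    have hb: "h \<in> bdd_borel"
      by (rule bdd_borelI[of _ C]) (use C hc in \<open>auto simp: h_def intro: borel_measurable_continuous_onI\<close>)
    have "L (\<lambda>z. indicator E (fst z) * \<psi> (snd z)) = T (\<lambda>z. indicator E (fst z) * h (snd z))"
      unfolding T_def h_def by (simp add: space_code_inside space_curve_code)
    also have "\<dots> = (LINT x:E|M. LINT t|\<kappa> x. h t)"
      by (rule \<kappa>T[OF E hb continuous_on_subset[OF hc]]) simp
    also have "\<dots> = (LINT x:E|M. LINT y|k x. \<psi> y)"
    proof (rule set_lebesgue_integral_cong)
      show "E \<in> sets M" by (rule E)
      have "(LINT t|\<kappa> x. h t) = (LINT y|k x. \<psi> y)" if x: "x \<in> space M" for x
      proof -
        have c: "(space_curve :: real \<Rightarrow> 'a) \<in> borel_measurable (\<kappa> x)" and I: "?I \<in> sets (\<kappa> x)" using curve[OF x] by auto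
        have \<psi>m: "\<psi> \<in> borel_measurable borel" by (rule borel_measurable_continuous_onI[OF \<psi>(1)])
        have "(LINT y|k x. \<psi> y) = (LINT t|density (\<kappa> x) (\<lambda>t. ennreal (indicator ?I t)). \<psi> (space_curve t))"
          unfolding k_def by (rule integral_distr) (use c \<psi>m in auto)
        also have "\<dots> = (LINT t|\<kappa> x. indicator ?I t *\<^sub>R \<psi> (space_curve t))"
          by (rule integral_density) (use c I \<psi>m in \<open>auto intro: measurable_compose\<close>)
        also have "\<dots> = (LINT t|\<kappa> x. h t)" by (intro Bochner_Integration.integral_cong) (auto simp: h_def)
        finally show ?thesis by simp
      qed
      then show "\<forall>x. x \<in> E \<longrightarrow> (LINT t|\<kappa> x. h t) = (LINT y|k x. \<psi> y)" using sets.sets_into_space[OF E] by auto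
    qed
    finally show "L (\<lambda>z. indicator E (fst z) * \<psi> (snd z)) = (LINT x:E|M. LINT y|k x. \<psi> y)" .
  qed
qed

text \<open>The case of a one point space is a form of the Riesz representation theorem.\<close>

corollary measure_of_mean:
  fixes L :: "('a::euclidean_space \<Rightarrow> real) \<Rightarrow> real"
  assumes L: "mean_on X L"
  obtains m where "subprob_space m" "sets m = sets borel"
    "\<And>\<psi>. continuous_on UNIV \<psi> \<Longrightarrow> bounded {y. \<psi> y \<noteq> 0} \<Longrightarrow> L \<psi> = (LINT y|m. \<psi> y)"
proof -
  let ?M = "return (count_space UNIV) ()"
  define L' where "L' u = L (\<lambda>y. u ((), y))" for u :: "unit \<times> 'a \<Rightarrow> real"
  have b: "(\<lambda>y. u ((), y)) \<in> bdd_on X" if ub: "u \<in> bdd_on (UNIV \<times> X)" for u :: "unit \<times> 'a \<Rightarrow> real"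
  proof -
    obtain C where "\<And>z. z \<in> UNIV \<times> X \<Longrightarrow> \<bar>u z\<bar> \<le> C" using ub by (metis bdd_onE)
    then show ?thesis by (intro bdd_onI[of _ _ C]) auto
  qed
  have M: "prob_space ?M" by (rule prob_space_return) simp
  have "mean_on (UNIV \<times> X) L'" unfolding mean_on_def L'_def
  proof (intro conjI ballI allI impI)
    fix u v :: "unit \<times> 'a \<Rightarrow> real" and C c
    assume u: "u \<in> bdd_on (UNIV \<times> X)"
    show "L (\<lambda>y. c * u ((), y)) = c * L (\<lambda>y. u ((), y))" by (rule mean_on_cmult[OF L b[OF u]])
    show "L (\<lambda>y. u ((), y)) \<le> C" if "\<forall>x\<in>UNIV \<times> X. u x \<le> C"
      by (rule mean_on_le[OF L b[OF u]]) (use that in auto)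
    assume v: "v \<in> bdd_on (UNIV \<times> X)"
    show "L (\<lambda>y. u ((), y) + v ((), y)) = L (\<lambda>y. u ((), y)) + L (\<lambda>y. v ((), y))"
      by (rule mean_on_add[OF L b[OF u] b[OF v]])
  qed
  then have L': "mean_on (space ?M \<times> X) L'" by simp
  have "L' (\<lambda>z. indicator E (fst z)) = measure ?M E" for E :: "unit set"
    unfolding L'_def by (simp add: mean_on_const[OF L] measure_return)
  from kernel_of_mean[OF M L' this] obtain k where k: "k \<in> ?M \<rightarrow>\<^sub>M subprob_algebra borel"
    and kL: "\<And>E \<psi>. E \<in> sets ?M \<Longrightarrow> continuous_on UNIV \<psi> \<Longrightarrow> bounded {y. \<psi> y \<noteq> 0} \<Longrightarrow>
      L' (\<lambda>z. indicator E (fst z) * \<psi> (snd z)) = (LINT x:E|?M. LINT y|k x. \<psi> y)" by blast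
  have "k () \<in> space (subprob_algebra borel)" using measurable_space[OF k, of "()"] by simp
  then have "subprob_space (k ())" "sets (k ()) = sets borel" by (simp_all add: space_subprob_algebra)
  moreover have "L \<psi> = (LINT y|k (). \<psi> y)" if "continuous_on UNIV \<psi>" "bounded {y. \<psi> y \<noteq> 0}" for \<psi>
  proof -
    have "L \<psi> = L' (\<lambda>z. indicator UNIV (fst z) * \<psi> (snd z))" by (simp add: L'_def)
    also have "\<dots> = (LINT x:UNIV|?M. LINT y|k x. \<psi> y)" by (rule kL[OF _ that]) simp
    also have "\<dots> = (LINT y|k (). \<psi> y)" using prob_space.prob_space[OF M] by (simp add: set_lebesgue_integral_def integral_return)
    finally show ?thesis .
  qed
  ultimately show thesis by (rule that)
qed

section \<open>Matrix-valued measures\<close>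

lemma vector_measure_empty: assumes "vector_measure M L" shows "L {} = 0"
proof -
  have "(\<lambda>n::nat. L {}) sums L (\<Union>n::nat. {})"
    using assms[unfolded vector_measure_def, rule_format, of "\<lambda>_. {}"] by (simp add: disjoint_family_on_def)
  then have "(\<lambda>n::nat. L {}) \<longlonglongrightarrow> 0" by (intro summable_LIMSEQ_zero sums_summable)
  then show ?thesis using LIMSEQ_unique[OF tendsto_const] by blast
qed

lemma vector_measure_Un:
  assumes L: "vector_measure M L" and "A \<in> sets M" "B \<in> sets M" "A \<inter> B = {}"
  shows "L (A \<union> B) = L A + L B"
proof -
  have "disjoint_family (binaryset A B)" using assms(4) by (auto simp: disjoint_family_on_def binaryset_def)
  moreover have "range (binaryset A B) \<subseteq> sets M" using assms(2,3) by (auto simp: range_binaryset_eq)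
  ultimately have "(\<lambda>n. L (binaryset A B n)) sums L (\<Union>n. binaryset A B n)"
    using L unfolding vector_measure_def by blast
  moreover have "(\<lambda>n. L (binaryset A B n)) sums (L A + L B)"
    using LIMSEQ_binaryset[of L A B] vector_measure_empty[OF L] unfolding sums_def by simp
  ultimately show ?thesis by (simp add: UN_binaryset_eq sums_unique2)
qed

lemma trace_eq_inner: "trace (A :: real^'d^'d) = mat 1 \<bullet> A"
  by (simp add: trace_def inner_vec_def mat_def if_distrib if_distribR sum.delta cong: if_cong)

lemma bounded_linear_trace: "bounded_linear (trace :: real^'d^'d \<Rightarrow> real)"
  unfolding trace_eq_inner[abs_def] by (rule bounded_linear_inner_right)

lemma inner_matrix_axis:
  fixes A :: "real^'d^'d" shows "axis i 1 \<bullet> (A *v axis j 1) = A $ i $ j"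
  by (simp add: inner_axis' matrix_vector_mul_component inner_axis)

lemma PSD_diag_nonneg: "A \<in> PSD \<Longrightarrow> 0 \<le> A $ i $ i"
  using inner_matrix_axis[of i A i] unfolding PSD_def by (metis (mono_tags, lifting) mem_Collect_eq)

lemma PSD_symmetric: "A \<in> PSD \<Longrightarrow> A $ i $ j = A $ j $ i"
  unfolding PSD_def Sym_def by (auto simp: transpose_def vec_eq_iff)

lemma PSD_trace_nonneg: "A \<in> PSD \<Longrightarrow> 0 \<le> trace A"
  unfolding trace_def by (intro sum_nonneg PSD_diag_nonneg)

text \<open>The quadratic form at $e_i\pm e_j$ bounds an entry by the diagonal.\<close>

lemma PSD_entry_le_trace:
  assumes A: "A \<in> PSD" shows "\<bar>A $ i $ j\<bar> \<le> trace A"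
proof (cases "i = j")
  case True
  have "A $ i $ i \<le> trace A" unfolding trace_def by (rule member_le_sum) (use PSD_diag_nonneg[OF A] in auto)
  then show ?thesis using True PSD_diag_nonneg[OF A, of i] by simp
next
  case False
  have q: "0 \<le> A $ i $ i + s * (2 * A $ i $ j) + s * s * A $ j $ j" for s
  proof -
    have "0 \<le> (axis i 1 + s *\<^sub>R axis j 1) \<bullet> (A *v (axis i 1 + s *\<^sub>R axis j 1))"
      using A unfolding PSD_def by blast
    also have "\<dots> = A $ i $ i + s * (A $ i $ j + A $ j $ i) + s * s * A $ j $ j"
      by (simp add: matrix_vector_right_distrib matrix_vector_mult_scaleR inner_add_left inner_add_right
          inner_matrix_axis algebra_simps)
    finally show ?thesis using PSD_symmetric[OF A, of j i] by (simp add: algebra_simps)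
  qed
  have "(\<Sum>k\<in>{i, j}. A $ k $ k) \<le> trace A"
    unfolding trace_def by (rule sum_mono2) (use PSD_diag_nonneg[OF A] in auto)
  then have "A $ i $ i + A $ j $ j \<le> trace A" using False by simp
  then show ?thesis using q[of 1] q[of "-1"] PSD_diag_nonneg[OF A, of i] PSD_diag_nonneg[OF A, of j] by auto
qed

lemma matrix_units: "(A :: real^'d^'d) = (\<Sum>i\<in>UNIV. \<Sum>j\<in>UNIV. (A $ i $ j) *\<^sub>R axis i (axis j 1))"
proof -
  have "(\<Sum>i\<in>UNIV. \<Sum>j\<in>UNIV. (A $ i $ j) *\<^sub>R axis i (axis j 1)) $ k $ l = A $ k $ l" for k l
  proof -
    have "(\<Sum>i\<in>UNIV. \<Sum>j\<in>UNIV. (A $ i $ j) *\<^sub>R (axis i (axis j 1) :: real^'d^'d)) $ k $ l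
        = (\<Sum>i\<in>UNIV. \<Sum>j\<in>UNIV. if i = k then (if j = l then A $ i $ j else 0) else 0)"
      by (auto simp: axis_def intro!: sum.cong)
    also have "\<dots> = (\<Sum>i\<in>UNIV. if i = k then A $ i $ l else 0)"
      by (rule sum.cong) (auto simp: sum.delta)
    also have "\<dots> = A $ k $ l" by (simp add: sum.delta)
    finally show ?thesis .
  qed
  then show ?thesis by (simp add: vec_eq_iff)
qed

lemma norm_matrix_unit: "norm (axis i (axis j 1) :: real^'d^'d) = 1"
  by (simp add: norm_eq_sqrt_inner inner_axis_axis)

lemma PSD_norm_le_trace:
  assumes A: "(A :: real^'d^'d) \<in> PSD" shows "norm A \<le> (real CARD('d))\<^sup>2 * trace A"
proof -
  have "norm A \<le> (\<Sum>i\<in>UNIV. \<Sum>j\<in>UNIV. norm ((A $ i $ j) *\<^sub>R (axis i (axis j 1) :: real^'d^'d)))"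
    by (subst matrix_units) (intro order_trans[OF norm_sum] sum_mono order_refl norm_sum)
  also have "\<dots> \<le> (\<Sum>i\<in>(UNIV::'d set). \<Sum>j\<in>(UNIV::'d set). trace A)"
    by (intro sum_mono) (simp add: norm_matrix_unit PSD_entry_le_trace[OF A])
  finally show ?thesis by (simp add: power2_eq_square)
qed

lemma closed_PSD: "closed (PSD :: (real^'d^'d) set)"
proof -
  have eq: "(PSD :: (real^'d^'d) set) = (\<Inter>x. {A. 0 \<le> x \<bullet> (A *v x)}) \<inter> (\<Inter>i. \<Inter>j. {A. A $ i $ j = A $ j $ i})"
    unfolding PSD_def Sym_def by (auto simp: transpose_def vec_eq_iff)
  have "closed {A::real^'d^'d. 0 \<le> x \<bullet> (A *v x)}" for x :: "real^'d"
  proof (rule closed_Collect_le)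
    show "continuous_on UNIV (\<lambda>A::real^'d^'d. x \<bullet> (A *v x))"
      unfolding matrix_vector_mult_def inner_vec_def by (simp, intro continuous_intros)
  qed simp
  moreover have "closed {A::real^'d^'d. A $ i $ j = A $ j $ i}" for i j
    by (intro closed_Collect_eq continuous_intros)
  ultimately show ?thesis unfolding eq by (intro closed_Int closed_INT ballI)
qed

lemma PSD_scaleR: "A \<in> PSD \<Longrightarrow> 0 \<le> c \<Longrightarrow> c *\<^sub>R A \<in> PSD"
  unfolding PSD_def Sym_def by (auto simp: transpose_def vec_eq_iff scaleR_matrix_vector_assoc[symmetric])

lemma zero_PSD: "0 \<in> PSD" unfolding PSD_def Sym_def by (simp add: transpose_def vec_eq_iff)

text \<open>Every entry of a measure with values in the nonnegative matrices is dominated by the trace, so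
  the measure has a bounded density with respect to its trace.\<close>

lemma PSD_measure_density:
  fixes L :: "'a set \<Rightarrow> real^'d^'d"
  assumes L: "PSD_measure M L"
  obtains \<tau> g C where "finite_measure \<tau>" "sets \<tau> = sets M" "g \<in> borel_measurable \<tau>" "\<And>x. norm (g x) \<le> C"
    "\<And>E. E \<in> sets M \<Longrightarrow> L E = (LINT x:E|\<tau>. g x)"
proof -
  have vL: "vector_measure M L" and psd: "\<And>E. E \<in> sets M \<Longrightarrow> L E \<in> PSD" using L by (auto simp: PSD_measure_def)
  define \<tau> where "\<tau> = measure_of (space M) (sets M) (\<lambda>E. ennreal (trace (L E)))"
  have nn: "0 \<le> trace (L E)" if "E \<in> sets M" for E by (rule PSD_trace_nonneg[OF psd[OF that]])
  have pos: "positive (sets M) (\<lambda>E. ennreal (trace (L E)))"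
    unfolding positive_def vector_measure_empty[OF vL] by (simp add: trace_def)
  have ca: "countably_additive (sets M) (\<lambda>E. ennreal (trace (L E)))"
    unfolding countably_additive_def
  proof (intro allI impI)
    fix A :: "nat \<Rightarrow> 'a set" assume A: "range A \<subseteq> sets M" "disjoint_family A" "\<Union> (range A) \<in> sets M"
    then have "(\<lambda>n. L (A n)) sums L (\<Union>n. A n)" using vL unfolding vector_measure_def by blast
    then have "(\<lambda>n. trace (L (A n))) sums trace (L (\<Union>n. A n))" by (rule bounded_linear.sums[OF bounded_linear_trace])
    then show "(\<Sum>i. ennreal (trace (L (A i)))) = ennreal (trace (L (\<Union> (range A))))"
      using A nn by (intro sums_unique[symmetric]) (auto simp: sums_ennreal)
  qed
  have em: "emeasure \<tau> E = ennreal (trace (L E))" if "E \<in> sets M" for E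
    unfolding \<tau>_def using that pos ca by (intro emeasure_measure_of_sigma sets.sigma_algebra_axioms) auto
  have s\<tau>: "sets \<tau> = sets M" "space \<tau> = space M" unfolding \<tau>_def by simp_all
  have fm: "finite_measure \<tau>" by (rule finite_measureI) (simp add: s\<tau> em)
  have m\<tau>: "measure \<tau> E = trace (L E)" if "E \<in> sets M" for E
    using em[OF that] nn[OF that] by (simp add: measure_def)
  have "\<exists>u. u \<in> borel_measurable \<tau> \<and> (\<forall>x. 0 \<le> u x \<and> u x \<le> 1) \<and>
      (\<forall>E\<in>sets \<tau>. (L E $ i $ j + trace (L E)) / 2 = (LINT x:E|\<tau>. u x))" for i j
  proof -
    have add: "(L (A \<union> B) $ i $ j + trace (L (A \<union> B))) / 2 = (L A $ i $ j + trace (L A)) / 2 + (L B $ i $ j + trace (L B)) / 2"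
      if "A \<in> sets \<tau>" "B \<in> sets \<tau>" "A \<inter> B = {}" for A B
      using vector_measure_Un[OF vL _ _ that(3)] that s\<tau>
      by (simp add: trace_def sum.distrib add_divide_distrib)
    have b: "0 \<le> (L A $ i $ j + trace (L A)) / 2" "(L A $ i $ j + trace (L A)) / 2 \<le> measure \<tau> A" if "A \<in> sets \<tau>" for A
      using PSD_entry_le_trace[OF psd, of A i j] m\<tau>[of A] that s\<tau> by auto
    show ?thesis
    proof (rule dominated_charge_density[OF fm, where f="\<lambda>E. (L E $ i $ j + trace (L E)) / 2"], goal_cases)
      case (1 A B) then show ?case by (rule add)
    next
      case (2 A) then show ?case by (rule b)
    next
      case (3 A) then show ?case by (rule b)
    next
      case (4 g) then show ?case by blast
    qed
  qed
  then obtain u where u: "\<And>i j. u i j \<in> borel_measurable \<tau>" and ub: "\<And>i j x. 0 \<le> u i j x" "\<And>i j x. u i j x \<le> 1"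
    and ui: "\<And>i j E. E \<in> sets \<tau> \<Longrightarrow> (L E $ i $ j + trace (L E)) / 2 = (LINT x:E|\<tau>. u i j x)" by metis
  interpret finite_measure \<tau> by (rule fm)
  have iu: "integrable \<tau> (u i j)" for i j
    by (rule integrable_const_bound[of _ 1]) (use ub u in \<open>auto simp: abs_le_iff intro: order_trans[of _ 0]\<close>)
  define g where "g x = (\<Sum>i\<in>UNIV. \<Sum>j\<in>UNIV. (2 * u i j x - 1) *\<^sub>R (axis i (axis j 1) :: real^'d^'d))" for x
  show thesis
  proof (rule that[OF fm s\<tau>(1)])
    show "g \<in> borel_measurable \<tau>" unfolding g_def using u by measurable
    show "norm (g x) \<le> (\<Sum>i\<in>(UNIV::'d set). \<Sum>j\<in>(UNIV::'d set). 1)" for x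
    proof -
      have "norm (g x) \<le> (\<Sum>i\<in>UNIV. \<Sum>j\<in>UNIV. norm ((2 * u i j x - 1) *\<^sub>R (axis i (axis j 1) :: real^'d^'d)))"
        unfolding g_def by (intro order_trans[OF norm_sum] sum_mono order_refl norm_sum)
      also have "\<dots> \<le> (\<Sum>i\<in>(UNIV::'d set). \<Sum>j\<in>(UNIV::'d set). 1)"
        by (intro sum_mono) (use ub in \<open>simp add: norm_matrix_unit abs_le_iff\<close>)
      finally show ?thesis .
    qed
    fix E assume E: "E \<in> sets M"
    have sE: "set_integrable \<tau> E (u i j)" for i j
      unfolding set_integrable_def using E s\<tau> by (intro integrable_mult_indicator iu) auto
    have entry: "integrable \<tau> (\<lambda>x. indicator E x * (2 * u i j x - 1))" "(LINT x|\<tau>. indicator E x * (2 * u i j x - 1)) = L E $ i $ j" for i j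
    proof -
      have 1: "integrable \<tau> (\<lambda>x. indicator E x * u i j x)" using sE by (simp add: set_integrable_def)
      have 2: "integrable \<tau> (indicator E :: 'a \<Rightarrow> real)" using E s\<tau> by (simp add: emeasure_eq_measure less_top)
      have eq: "(\<lambda>x. indicator E x * (2 * u i j x - 1)) = (\<lambda>x. 2 * (indicator E x * u i j x) - indicator E x)"
        by (auto simp: algebra_simps)
      show "integrable \<tau> (\<lambda>x. indicator E x * (2 * u i j x - 1))" unfolding eq using 1 2 by auto
      have "(LINT x|\<tau>. indicator E x * (2 * u i j x - 1)) = 2 * (LINT x|\<tau>. indicator E x * u i j x) - (LINT x|\<tau>. indicator E x)"
        unfolding eq using 1 2 by (subst Bochner_Integration.integral_diff) auto
      also have "(LINT x|\<tau>. indicator E x * u i j x) = (L E $ i $ j + trace (L E)) / 2"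
        using ui[of E i j] E s\<tau> by (simp add: set_lebesgue_integral_def)
      also have "(LINT x|\<tau>. indicator E x) = trace (L E)" using m\<tau>[OF E] E s\<tau> sets.sets_into_space[OF E] by (simp add: Int_absorb2)
      finally show "(LINT x|\<tau>. indicator E x * (2 * u i j x - 1)) = L E $ i $ j" by (simp add: field_simps)
    qed
    have "(LINT x:E|\<tau>. g x) = (LINT x|\<tau>. (\<Sum>i\<in>UNIV. \<Sum>j\<in>UNIV. (indicator E x * (2 * u i j x - 1)) *\<^sub>R (axis i (axis j 1) :: real^'d^'d)))"
      unfolding set_lebesgue_integral_def g_def by (simp add: scaleR_sum_right)
    also have "\<dots> = (\<Sum>i\<in>UNIV. \<Sum>j\<in>UNIV. (L E $ i $ j) *\<^sub>R axis i (axis j 1))"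
      using entry by (subst Bochner_Integration.integral_sum; (intro Bochner_Integration.integrable_sum integrable_scaleR_left)?; simp)+
    also have "\<dots> = L E" by (rule matrix_units[symmetric])
    finally show "L E = (LINT x:E|\<tau>. g x)" by simp
  qed
qed

text \<open>For a measure with density \<open>g\<close> the supremum over finite partitions is the integral of the norm:
  on the level sets of a simple function close to \<open>g\<close> the triangle inequality is almost sharp.\<close>

lemma total_variation_density:
  fixes L :: "'a set \<Rightarrow> 'b::{banach, second_countable_topology}"
  assumes "finite_measure \<tau>" and s\<tau>: "sets \<tau> = sets M" and g: "integrable \<tau> g"
    and Lg: "\<And>E. E \<in> sets M \<Longrightarrow> L E = (LINT x:E|\<tau>. g x)"
  shows "total_variation M L = density \<tau> (\<lambda>x. ennreal (norm (g x)))"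
proof -
  interpret finite_measure \<tau> by fact
  have sp: "space \<tau> = space M" using sets_eq_imp_space_eq[OF s\<tau>] .
  have gm[measurable]: "g \<in> borel_measurable \<tau>" using g by auto
  let ?N = "density \<tau> (\<lambda>x. ennreal (norm (g x)))"
  let ?P = "\<lambda>E. {P. finite P \<and> P \<subseteq> sets M \<and> partition_on E P}"
  have emN: "emeasure ?N A = (\<integral>\<^sup>+x\<in>A. norm (g x) \<partial>\<tau>)" if "A \<in> sets M" for A
    using that s\<tau> by (subst emeasure_density) auto
  have upper: "(\<Sum>A\<in>P. ennreal (norm (L A))) \<le> emeasure ?N E" if P: "P \<in> ?P E" for P E
  proof -
    have "(\<Sum>A\<in>P. ennreal (norm (L A))) \<le> (\<Sum>A\<in>P. emeasure ?N A)"
    proof (rule sum_mono)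
      fix A assume "A \<in> P"
      then have A: "A \<in> sets M" using P by auto
      have "ennreal (norm (L A)) \<le> (\<integral>\<^sup>+x. norm (indicator A x *\<^sub>R g x) \<partial>\<tau>)"
        unfolding Lg[OF A] set_lebesgue_integral_def
        by (rule integral_norm_bound_ennreal) (use A s\<tau> g in \<open>auto intro: integrable_mult_indicator\<close>)
      also have "\<dots> = emeasure ?N A" unfolding emN[OF A]
        by (intro nn_integral_cong) (auto split: split_indicator)
      finally show "ennreal (norm (L A)) \<le> emeasure ?N A" .
    qed
    also have "\<dots> = emeasure ?N (\<Union>A\<in>P. A)"
      by (rule sum_emeasure) (use P s\<tau> in \<open>auto simp: partition_on_def disjoint_def disjoint_family_on_def\<close>)
    also have "(\<Union>A\<in>P. A) = E" using P by (auto simp: partition_on_def)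
    finally show ?thesis .
  qed
  have lower: "emeasure ?N E \<le> (SUP P\<in>?P E. \<Sum>A\<in>P. ennreal (norm (L A)))" if E: "E \<in> sets M" for E
  proof (rule ennreal_le_epsilon)
    fix e :: real assume e: "e > 0"
    from g obtain x where "has_bochner_integral \<tau> g x" by (auto simp: integrable.simps)
    then obtain s where s: "\<And>i. Bochner_Integration.simple_bochner_integrable \<tau> (s i)"
      and lim: "(\<lambda>i. \<integral>\<^sup>+x. norm (g x - s i x) \<partial>\<tau>) \<longlonglongrightarrow> 0" by (auto elim!: has_bochner_integral.cases)
    have "eventually (\<lambda>i. (\<integral>\<^sup>+x. norm (g x - s i x) \<partial>\<tau>) < ennreal (e / 2)) sequentially"
      using order_tendstoD(2)[OF lim, of "ennreal (e / 2)"] e by simp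
    then obtain i where i: "(\<integral>\<^sup>+x. norm (g x - s i x) \<partial>\<tau>) < ennreal (e / 2)"
      by (auto simp: eventually_sequentially)
    define h where "h = s i"
    have hs: "simple_function \<tau> h" using s[of i] unfolding h_def by (auto elim: Bochner_Integration.simple_bochner_integrable.cases)
    have hm[measurable]: "h \<in> borel_measurable \<tau>" by (rule borel_measurable_simple_function[OF hs])
    define P where "P = (\<lambda>v. E \<inter> (h -` {v} \<inter> space M)) ` h ` space M - {{}}"
    have cell: "E \<inter> (h -` {v} \<inter> space M) \<in> sets M" for v
      using E simple_functionD(2)[OF hs, of "{v}"] s\<tau> sp by auto
    have P: "P \<in> ?P E"
    proof -
      have "finite P" unfolding P_def using simple_functionD(1)[OF hs] sp by auto
      moreover have "partition_on E P" unfolding partition_on_def P_def disjoint_def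
        using sets.sets_into_space[OF E] by auto
      ultimately show ?thesis using cell unfolding P_def by auto
    qed
    have bound: "emeasure ?N A \<le> ennreal (norm (L A)) + 2 * (\<integral>\<^sup>+x\<in>A. norm (g x - h x) \<partial>\<tau>)" if A: "A \<in> P" for A
    proof -
      obtain v where v: "A = E \<inter> (h -` {v} \<inter> space M)" using A unfolding P_def by auto
      have As: "A \<in> sets M" using cell v by auto
      then have A\<tau>[measurable]: "A \<in> sets \<tau>" using s\<tau> by simp
      let ?D = "\<integral>\<^sup>+x\<in>A. norm (g x - h x) \<partial>\<tau>"
      have "emeasure ?N A \<le> (\<integral>\<^sup>+x. ennreal (norm v) * indicator A x + ennreal (norm (g x - h x)) * indicator A x \<partial>\<tau>)"
        unfolding emN[OF As]
      proof (rule nn_integral_mono)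
        fix x
        have "ennreal (norm (g x)) \<le> ennreal (norm v) + ennreal (norm (g x - h x))" if "x \<in> A"
          using that v norm_triangle_sub[of "g x" "h x"] by (simp flip: ennreal_plus)
        then show "ennreal (norm (g x)) * indicator A x \<le> ennreal (norm v) * indicator A x + ennreal (norm (g x - h x)) * indicator A x"
          by (auto split: split_indicator)
      qed
      also have "\<dots> = ennreal (norm v) * emeasure \<tau> A + ?D"
        by (subst nn_integral_add) (auto simp: nn_integral_cmult_indicator)
      also have "ennreal (norm v) * emeasure \<tau> A \<le> ennreal (norm (L A)) + ?D"
      proof -
        have iv: "integrable \<tau> (\<lambda>x. indicator A x *\<^sub>R v)" by (intro integrable_scaleR_left) (simp add: emeasure_eq_measure less_top)
        have ig: "integrable \<tau> (\<lambda>x. indicator A x *\<^sub>R g x)" by (intro integrable_mult_indicator g) simp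
        have id: "integrable \<tau> (\<lambda>x. indicator A x *\<^sub>R (g x - h x))"
        proof -
          have "(\<lambda>x. indicator A x *\<^sub>R (g x - h x)) = (\<lambda>x. indicator A x *\<^sub>R g x - indicator A x *\<^sub>R v)"
            using v by (auto simp: fun_eq_iff scaleR_diff_right split: split_indicator)
          then show ?thesis using ig iv by simp
        qed
        have "measure \<tau> A *\<^sub>R v = (LINT x|\<tau>. indicator A x *\<^sub>R v)"
          using As sets.sets_into_space[OF As] sp by (simp add: Int_absorb2 emeasure_eq_measure less_top)
        also have "\<dots> = (LINT x|\<tau>. indicator A x *\<^sub>R g x - indicator A x *\<^sub>R (g x - h x))"
          using v by (intro Bochner_Integration.integral_cong) (auto split: split_indicator)
        also have "\<dots> = L A - (LINT x|\<tau>. indicator A x *\<^sub>R (g x - h x))"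
          using Lg[OF As] by (simp add: Bochner_Integration.integral_diff[OF ig id] set_lebesgue_integral_def)
        finally have "norm v * measure \<tau> A \<le> norm (L A) + norm (LINT x|\<tau>. indicator A x *\<^sub>R (g x - h x))"
          using norm_triangle_ineq4[of "L A" "LINT x|\<tau>. indicator A x *\<^sub>R (g x - h x)"]
          by (metis norm_scaleR abs_of_nonneg measure_nonneg mult.commute)
        then have "ennreal (norm v * measure \<tau> A) \<le> ennreal (norm (L A)) + ennreal (norm (LINT x|\<tau>. indicator A x *\<^sub>R (g x - h x)))"
          by (simp add: ennreal_leI flip: ennreal_plus)
        also have "ennreal (norm (LINT x|\<tau>. indicator A x *\<^sub>R (g x - h x))) \<le> (\<integral>\<^sup>+x. norm (indicator A x *\<^sub>R (g x - h x)) \<partial>\<tau>)"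
          by (rule integral_norm_bound_ennreal[OF id])
        also have "(\<integral>\<^sup>+x. norm (indicator A x *\<^sub>R (g x - h x)) \<partial>\<tau>) = ?D"
          by (intro nn_integral_cong) (auto split: split_indicator)
        finally show ?thesis by (simp add: emeasure_eq_measure ennreal_mult)
      qed
      finally show ?thesis by (simp add: mult_2 add.assoc)
    qed
    have disj: "disjoint_family_on (\<lambda>A. A) P" using P by (auto simp: partition_on_def disjoint_def disjoint_family_on_def)
    have "emeasure ?N E = (\<Sum>A\<in>P. emeasure ?N A)"
      using sum_emeasure[of "\<lambda>A. A" P ?N] P s\<tau> disj by (auto simp: partition_on_def)
    also have "\<dots> \<le> (\<Sum>A\<in>P. ennreal (norm (L A)) + 2 * (\<integral>\<^sup>+x\<in>A. norm (g x - h x) \<partial>\<tau>))"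
      by (rule sum_mono[OF bound])
    also have "\<dots> = (\<Sum>A\<in>P. ennreal (norm (L A))) + 2 * (\<Sum>A\<in>P. \<integral>\<^sup>+x\<in>A. norm (g x - h x) \<partial>\<tau>)"
      by (simp add: sum.distrib sum_distrib_left)
    also have "(\<Sum>A\<in>P. \<integral>\<^sup>+x\<in>A. norm (g x - h x) \<partial>\<tau>) \<le> ennreal (e / 2)"
    proof -
      let ?K = "density \<tau> (\<lambda>x. ennreal (norm (g x - h x)))"
      have "(\<Sum>A\<in>P. \<integral>\<^sup>+x\<in>A. norm (g x - h x) \<partial>\<tau>) = (\<Sum>A\<in>P. emeasure ?K A)"
        by (rule sum.cong) (use P s\<tau> in \<open>auto simp: emeasure_density\<close>)
      also have "\<dots> = emeasure ?K (\<Union>A\<in>P. A)"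
        by (rule sum_emeasure) (use P s\<tau> disj in auto)
      also have "\<dots> \<le> emeasure ?K (space ?K)" by (rule emeasure_space)
      also have "\<dots> = (\<integral>\<^sup>+x. norm (g x - h x) \<partial>\<tau>)"
        by (subst emeasure_density) (auto intro!: nn_integral_cong)
      also have "\<dots> \<le> ennreal (e / 2)" using i unfolding h_def by simp
      finally show ?thesis .
    qed
    also have "2 * ennreal (e / 2) = ennreal e" using ennreal_mult'[of 2 "e / 2"] by simp
    finally have "emeasure ?N E \<le> (\<Sum>A\<in>P. ennreal (norm (L A))) + ennreal e"
      by (simp add: add_left_mono mult_left_mono)
    also have "\<dots> \<le> (SUP P\<in>?P E. \<Sum>A\<in>P. ennreal (norm (L A))) + ennreal e"
      by (rule add_right_mono) (rule SUP_upper[OF P])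
    finally show "emeasure ?N E \<le> (SUP P\<in>?P E. \<Sum>A\<in>P. ennreal (norm (L A))) + ennreal e" .
  qed
  have "total_variation M L = measure_of (space M) (sets M) (emeasure ?N)"
    unfolding total_variation_def
  proof (rule measure_of_eq)
    show "sets M \<subseteq> Pow (space M)" by (rule sets.space_closed)
    fix E assume "E \<in> sigma_sets (space M) (sets M)"
    then have E: "E \<in> sets M" by (simp add: sets.sigma_sets_eq)
    show "(SUP P\<in>?P E. \<Sum>A\<in>P. ennreal (norm (L A))) = emeasure ?N E"
      by (rule antisym[OF SUP_least[OF upper] lower[OF E]])
  qed
  also have "\<dots> = ?N" using measure_of_of_measure[of ?N] s\<tau> sp by simp
  finally show ?thesis .
qed

text \<open>Normalising a density to norm one gives a density with respect to the total variation, so that the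
  defining choice of the polar density succeeds.  Almost every value is a nonnegative matrix, because the averages
  over all sets of positive measure are and these matrices form a closed set.\<close>

lemma polar_density_spec:
  assumes L: "PSD_measure M L"
  shows "finite_measure (total_variation M L)"
    and "sets (total_variation M L) = sets M"
    and "integrable (total_variation M L) (polar_density M L)"
    and "\<And>E. E \<in> sets M \<Longrightarrow> L E = (LINT x:E|total_variation M L. polar_density M L x)"
    and "AE x in total_variation M L. polar_density M L x \<in> PSD"
proof -
  from PSD_measure_density[OF L] obtain \<tau> g C where fm: "finite_measure \<tau>" and s\<tau>: "sets \<tau> = sets M"
    and gm[measurable]: "g \<in> borel_measurable \<tau>" and gb: "\<And>x. norm (g x) \<le> C"
    and Lg: "\<And>E. E \<in> sets M \<Longrightarrow> L E = (LINT x:E|\<tau>. g x)" by metis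
  interpret finite_measure \<tau> by (rule fm)
  have ig: "integrable \<tau> g" by (rule integrable_const_bound[of _ C]) (use gb in auto)
  let ?V = "total_variation M L"
  have V: "?V = density \<tau> (\<lambda>x. ennreal (norm (g x)))" by (rule total_variation_density[OF fm s\<tau> ig Lg])
  show sV: "sets ?V = sets M" unfolding V using s\<tau> by simp
  show fV: "finite_measure ?V"
  proof (rule finite_measureI)
    have "emeasure ?V (space ?V) = (\<integral>\<^sup>+x. norm (g x) \<partial>\<tau>)"
      unfolding V by (subst emeasure_density) (auto intro!: nn_integral_cong)
    also have "\<dots> < \<infinity>" using ig by (simp add: integrable_iff_bounded)
    finally show "emeasure ?V (space ?V) \<noteq> \<infinity>" by simp
  qed
  interpret V: finite_measure ?V by (rule fV)
  define h where "h x = sgn (g x)" for x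
  have hm: "h \<in> borel_measurable \<tau>" unfolding h_def sgn_div_norm by measurable
  have "h \<in> borel_measurable ?V" using hm unfolding V by simp
  then have ih: "integrable ?V h"
    by (rule V.integrable_const_bound[of _ 1, rotated]) (simp add: h_def norm_sgn)
  have Lh: "L E = (LINT x:E|?V. h x)" if E: "E \<in> sets M" for E
  proof -
    have [measurable]: "E \<in> sets \<tau>" using E s\<tau> by simp
    have "(LINT x:E|?V. h x) = (LINT x|\<tau>. norm (g x) *\<^sub>R (indicator E x *\<^sub>R h x))"
      unfolding V set_lebesgue_integral_def by (rule integral_density) (use hm in auto)
    also have "\<dots> = (LINT x:E|\<tau>. g x)"
      unfolding set_lebesgue_integral_def h_def by (intro Bochner_Integration.integral_cong) (auto simp: sgn_div_norm)
    finally show ?thesis using Lg[OF E] by simp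
  qed
  have ex: "integrable ?V (polar_density M L) \<and> (\<forall>E\<in>sets M. L E = (LINT x:E|?V. polar_density M L x))"
    unfolding polar_density_def by (rule someI[of _ h]) (use ih Lh in auto)
  then show ip: "integrable ?V (polar_density M L)"
    and Lp: "\<And>E. E \<in> sets M \<Longrightarrow> L E = (LINT x:E|?V. polar_density M L x)" by auto
  show "AE x in ?V. polar_density M L x \<in> PSD"
  proof (rule V.averaging_theorem[OF ip closed_PSD])
    fix A assume A: "A \<in> sets ?V" "measure ?V A > 0"
    then have "L A \<in> PSD" using L sV unfolding PSD_measure_def by auto
    then show "(1 / measure ?V A) *\<^sub>R (LINT x:A|?V. polar_density M L x) \<in> PSD"
      using Lp[of A] A sV by (auto intro: PSD_scaleR)
  qed
qed

text \<open>A vector measure may be written as an image measure with a density in more than one way; the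
  integral of a bounded function is the same for all, by approximation with simple functions.  In this
  way integrals against the polar density are computed from any other representation.\<close>

lemma vector_measure_integral_unique:
  fixes a1 :: "'c \<Rightarrow> 'b::euclidean_space" and a2 :: "'e \<Rightarrow> 'b" and B :: "'a \<Rightarrow> 'b"
  assumes a1: "integrable N1 a1" and a2: "integrable N2 a2"
    and p1[measurable]: "p1 \<in> N1 \<rightarrow>\<^sub>M M" and p2[measurable]: "p2 \<in> N2 \<rightarrow>\<^sub>M M"
    and eq: "\<And>E. E \<in> sets M \<Longrightarrow>
      (LINT z|N1. indicator E (p1 z) *\<^sub>R a1 z) = (LINT z|N2. indicator E (p2 z) *\<^sub>R a2 z)"
    and B[measurable]: "B \<in> borel_measurable M" and bound: "\<And>x. x \<in> space M \<Longrightarrow> norm (B x) \<le> C"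
  shows "(LINT z|N1. B (p1 z) \<bullet> a1 z) = (LINT z|N2. B (p2 z) \<bullet> a2 z)"
proof -
  obtain s where s_all: "(\<forall>i. simple_function M (s i)) \<and> (\<forall>x\<in>space M. (\<lambda>i. s i x) \<longlonglongrightarrow> B x) \<and>
      (\<forall>i. \<forall>x\<in>space M. dist (s i x) 0 \<le> 2 * dist (B x) 0)"
    using borel_measurable_implies_sequence_metric[OF B, of 0] by blast
  then have s: "\<And>i. simple_function M (s i)" and lim: "\<And>x. x \<in> space M \<Longrightarrow> (\<lambda>i. s i x) \<longlonglongrightarrow> B x"
    and sb: "\<And>i x. x \<in> space M \<Longrightarrow> norm (s i x) \<le> 2 * norm (B x)" by (auto simp: dist_norm)
  have s_meas[measurable]: "s i \<in> borel_measurable M" for i by (rule borel_measurable_simple_function[OF s])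
  have conv: "(\<lambda>i. LINT z|N. s i (p z) \<bullet> a z) \<longlonglongrightarrow> (LINT z|N. B (p z) \<bullet> a z)"
    if a: "integrable N a" and p[measurable]: "p \<in> N \<rightarrow>\<^sub>M M" for N and a :: "'f \<Rightarrow> 'b" and p
  proof (rule integral_dominated_convergence[where w="\<lambda>z. 2 * C * norm (a z)"])
    have [measurable]: "a \<in> borel_measurable N" using a by auto
    show "(\<lambda>z. B (p z) \<bullet> a z) \<in> borel_measurable N" "(\<lambda>z. s i (p z) \<bullet> a z) \<in> borel_measurable N" for i by measurable
    show "integrable N (\<lambda>z. 2 * C * norm (a z))" using a by auto
    show "AE z in N. (\<lambda>i. s i (p z) \<bullet> a z) \<longlonglongrightarrow> B (p z) \<bullet> a z"
      using measurable_space[OF p] by (intro AE_I2 tendsto_intros lim) auto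
    show "AE z in N. norm (s i (p z) \<bullet> a z) \<le> 2 * C * norm (a z)" for i
    proof (rule AE_I2)
      fix z assume "z \<in> space N"
      then have "p z \<in> space M" using measurable_space[OF p] by auto
      then have "norm (s i (p z)) \<le> 2 * C" using sb[of "p z" i] bound[of "p z"] by simp
      then show "norm (s i (p z) \<bullet> a z) \<le> 2 * C * norm (a z)"
        using Cauchy_Schwarz_ineq2[of "s i (p z)" "a z"] mult_right_mono[of "norm (s i (p z))" "2 * C" "norm (a z)"] by simp
    qed
  qed
  have simple: "(LINT z|N. s i (p z) \<bullet> a z) = (\<Sum>v\<in>s i ` space M. v \<bullet> (LINT z|N. indicator (s i -` {v} \<inter> space M) (p z) *\<^sub>R a z))"
    if a: "integrable N a" and p[measurable]: "p \<in> N \<rightarrow>\<^sub>M M" for N and a :: "'f \<Rightarrow> 'b" and p i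
  proof -
    have fin: "finite (s i ` space M)" by (rule simple_functionD(1)[OF s])
    have int: "integrable N (\<lambda>z. indicator (s i -` {v} \<inter> space M) (p z) *\<^sub>R a z)" for v
    proof -
      have "(\<lambda>z. indicator (s i -` {v} \<inter> space M) (p z) :: real) \<in> borel_measurable N"
        using simple_functionD(2)[OF s, of i "{v}"] by measurable
      then show ?thesis
        by (intro Bochner_Integration.integrable_bound[OF a]) (use a in \<open>auto split: split_indicator\<close>)
    qed
    have "(LINT z|N. s i (p z) \<bullet> a z) = (LINT z|N. (\<Sum>v\<in>s i ` space M. v \<bullet> (indicator (s i -` {v} \<inter> space M) (p z) *\<^sub>R a z)))"
    proof (rule Bochner_Integration.integral_cong[OF refl])
      fix z assume "z \<in> space N"
      then have pz: "p z \<in> space M" using measurable_space[OF p] by auto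
      have "(\<Sum>v\<in>s i ` space M. v \<bullet> (indicator (s i -` {v} \<inter> space M) (p z) *\<^sub>R a z)) = (\<Sum>v\<in>s i ` space M. if v = s i (p z) then v \<bullet> a z else 0)"
        using pz by (intro sum.cong) (auto split: split_indicator)
      also have "\<dots> = s i (p z) \<bullet> a z" using fin pz by (simp add: sum.delta)
      finally show "s i (p z) \<bullet> a z = (\<Sum>v\<in>s i ` space M. v \<bullet> (indicator (s i -` {v} \<inter> space M) (p z) *\<^sub>R a z))" by simp
    qed
    also have "\<dots> = (\<Sum>v\<in>s i ` space M. v \<bullet> (LINT z|N. indicator (s i -` {v} \<inter> space M) (p z) *\<^sub>R a z))"
      using int by (subst Bochner_Integration.integral_sum) (auto intro!: sum.cong integrable_inner_right simp del: inner_scaleR_right)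
    finally show ?thesis .
  qed
  have "(LINT z|N1. s i (p1 z) \<bullet> a1 z) = (LINT z|N2. s i (p2 z) \<bullet> a2 z)" for i
    unfolding simple[OF a1 p1] simple[OF a2 p2]
  proof (rule sum.cong[OF refl])
    fix v
    show "v \<bullet> (LINT z|N1. indicator (s i -` {v} \<inter> space M) (p1 z) *\<^sub>R a1 z) =
        v \<bullet> (LINT z|N2. indicator (s i -` {v} \<inter> space M) (p2 z) *\<^sub>R a2 z)"
      by (simp only: eq[OF simple_functionD(2)[OF s]])
  qed
  then have "(\<lambda>i. LINT z|N1. s i (p1 z) \<bullet> a1 z) \<longlonglongrightarrow> (LINT z|N2. B (p2 z) \<bullet> a2 z)"
    using conv[OF a2 p2] by (simp only:)
  then show ?thesis by (rule LIMSEQ_unique[OF conv[OF a1 p1]])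
qed

text \<open>To integrate a countable supremum it is enough to test every selection of finitely many of its
  members on disjoint sets: such a selection attains the finite maxima.\<close>

lemma nn_integral_SUP_le:
  fixes u :: "nat \<Rightarrow> 'a \<Rightarrow> real"
  assumes int: "\<And>i. integrable M (u i)" and zero: "\<And>x. u 0 x = 0"
    and sel: "\<And>n E. (\<And>i. E i \<in> sets M) \<Longrightarrow> disjoint_family E \<Longrightarrow> (\<Sum>i\<le>n. LINT x:E i|M. u i x) \<le> s"
  shows "(\<integral>\<^sup>+x. (SUP i. ennreal (u i x)) \<partial>M) \<le> ennreal s"
proof -
  define w where "w n x = Max ((\<lambda>i. u i x) ` {..n})" for n x
  have wub: "u i x \<le> w n x" if "i \<le> n" for i n x unfolding w_def by (rule Max_ge) (use that in auto)
  have wmem: "\<exists>i\<le>n. w n x = u i x" for n x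
  proof -
    have "w n x \<in> (\<lambda>i. u i x) ` {..n}" unfolding w_def by (rule Max_in) auto
    then show ?thesis by auto
  qed
  have wn: "0 \<le> w n x" for n x using wub[of 0 n x] zero by simp
  have [measurable]: "u i \<in> borel_measurable M" for i using int[of i] by auto
  have wm[measurable]: "w n \<in> borel_measurable M" for n unfolding w_def by measurable
  have sup: "(SUP i. ennreal (u i x)) = (SUP n. ennreal (w n x))" for x
  proof (rule antisym)
    show "(SUP i. ennreal (u i x)) \<le> (SUP n. ennreal (w n x))"
      by (rule SUP_mono) (use wub in \<open>blast intro: ennreal_leI\<close>)
    show "(SUP n. ennreal (w n x)) \<le> (SUP i. ennreal (u i x))"
    proof (rule SUP_least)
      fix n obtain i where "w n x = u i x" using wmem by blast
      then show "ennreal (w n x) \<le> (SUP i. ennreal (u i x))" by (auto intro: SUP_upper)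
    qed
  qed
  have mono: "w n x \<le> w (Suc n) x" for n x
  proof -
    obtain i where "i \<le> n" "w n x = u i x" using wmem by blast
    then show ?thesis using wub[of i "Suc n" x] by simp
  qed
  have each: "(\<integral>\<^sup>+x. ennreal (w n x) \<partial>M) \<le> ennreal s" for n
  proof -
    define E where "E i = {x\<in>space M. i \<le> n \<and> w n x = u i x \<and> (\<forall>j<i. w n x \<noteq> u j x)}" for i
    have E: "E i \<in> sets M" for i unfolding E_def by measurable
    have disj: "disjoint_family E"
      unfolding disjoint_family_on_def
    proof (intro ballI impI equals0I)
      fix i j x assume ij: "i \<noteq> j" and x: "x \<in> E i \<inter> E j"
      have "i < j \<or> j < i" using ij by arith
      then show False using x unfolding E_def by blast
    qed
    have split: "w n x = (\<Sum>i\<le>n. indicator (E i) x * u i x)" if x: "x \<in> space M" for x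
    proof -
      define i where "i = (LEAST i. w n x = u i x)"
      obtain k where k: "k \<le> n" "w n x = u k x" using wmem by blast
      have i: "w n x = u i x" "i \<le> n" "\<forall>j<i. w n x \<noteq> u j x"
        unfolding i_def
        by (rule LeastI[where P="\<lambda>i. w n x = u i x", OF k(2)])
          (rule order_trans[OF Least_le[where P="\<lambda>i. w n x = u i x", OF k(2)] k(1)], blast dest: not_less_Least)
      have iff: "x \<in> E j \<longleftrightarrow> j = i" if "j \<le> n" for j
      proof
        assume xj: "x \<in> E j"
        have "\<not> i < j" using xj i(1) unfolding E_def by blast
        moreover have "\<not> j < i" using xj i(3) unfolding E_def by blast
        ultimately show "j = i" by arith
      next
        assume "j = i" then show "x \<in> E j" unfolding E_def using x i by blast
      qed
      have "(\<Sum>j\<le>n. indicator (E j) x * u j x) = (\<Sum>j\<le>n. if j = i then u j x else 0)"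
        by (rule sum.cong) (auto simp: iff split: split_indicator)
      also have "\<dots> = w n x" using i by (simp add: sum.delta)
      finally show ?thesis by simp
    qed
    have iE: "integrable M (\<lambda>x. indicator (E i) x * u i x)" for i
      using integrable_mult_indicator[OF E int, of i i] by simp
    have "integrable M (\<lambda>x. \<Sum>i\<le>n. indicator (E i) x * u i x)" by (intro Bochner_Integration.integrable_sum iE)
    then have iw: "integrable M (w n)" by (rule Bochner_Integration.integrable_cong[THEN iffD1, rotated -1]) (simp_all add: split)
    have "(\<integral>\<^sup>+x. ennreal (w n x) \<partial>M) = ennreal (LINT x|M. w n x)"
      by (rule nn_integral_eq_integral[OF iw]) (simp add: wn)
    also have "(LINT x|M. w n x) = (LINT x|M. (\<Sum>i\<le>n. indicator (E i) x * u i x))"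
      by (rule Bochner_Integration.integral_cong) (simp_all add: split)
    also have "\<dots> = (\<Sum>i\<le>n. LINT x:E i|M. u i x)"
      by (subst Bochner_Integration.integral_sum) (auto simp: set_lebesgue_integral_def intro: iE)
    also have "\<dots> \<le> s" by (rule sel[OF E disj])
    finally show ?thesis by (simp add: ennreal_leI)
  qed
  have "(\<integral>\<^sup>+x. (SUP i. ennreal (u i x)) \<partial>M) = (\<integral>\<^sup>+x. (SUP n. ennreal (w n x)) \<partial>M)" by (simp add: sup)
  also have "\<dots> = (SUP n. \<integral>\<^sup>+x. ennreal (w n x) \<partial>M)"
    by (rule nn_integral_monotone_convergence_SUP) (auto simp: incseq_Suc_iff le_fun_def intro!: ennreal_leI mono)
  also have "\<dots> \<le> ennreal s" by (rule SUP_least[OF each])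
  finally show ?thesis .
qed

section \<open>The cost function as a support function\<close>

text \<open>The cost as it enters the proof: finite exactly on the nonnegative matrices, and there between two
  multiples of the trace.\<close>

locale cost_function =
  fixes f :: "real^'d^'d \<Rightarrow> ennreal" and \<kappa> :: real
  assumes convex: "convex_fun f" and homogeneous: "pos_homogeneous f" and lsc: "lower_semicont f"
    and coercive: "coercive f" and dom: "dom_fun f = PSD" and \<kappa>_pos: "\<kappa> > 0"
    and upper: "\<And>A. A \<in> PSD \<Longrightarrow> f A \<le> ennreal (\<kappa> * trace A)"
begin

text \<open>The cost as a real function; it is meaningful on the nonnegative matrices, where the cost is
  finite.\<close>

definition fr :: "real^'d^'d \<Rightarrow> real" where "fr A = enn2real (f A)"

lemma PSD_Sym: "A \<in> PSD \<Longrightarrow> A \<in> Sym" unfolding PSD_def by simp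

lemma f_eq_fr: "A \<in> PSD \<Longrightarrow> f A = ennreal (fr A)"
  using dom unfolding fr_def dom_fun_def by (auto simp: ennreal_enn2real_if less_top)

lemma fr_nonneg: "0 \<le> fr A" unfolding fr_def by simp

lemma fr_upper: "A \<in> PSD \<Longrightarrow> fr A \<le> \<kappa> * trace A"
  using upper[of A] f_eq_fr[of A] PSD_trace_nonneg[of A] \<kappa>_pos by (simp add: ennreal_le_iff)

lemma fr_scale: "A \<in> PSD \<Longrightarrow> 0 \<le> t \<Longrightarrow> fr (t *\<^sub>R A) = t * fr A"
  using homogeneous PSD_Sym[of A] unfolding pos_homogeneous_def fr_def by (simp add: enn2real_mult)

lemma fr_zero: "fr 0 = 0" using fr_scale[OF zero_PSD, of 0] by simp

lemma PSD_add: "A \<in> PSD \<Longrightarrow> B \<in> PSD \<Longrightarrow> A + B \<in> (PSD :: (real^'d^'d) set)"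
  unfolding PSD_def Sym_def by (auto simp: transpose_def vec_eq_iff matrix_vector_mult_add_rdistrib inner_add_right)

lemma fr_convex:
  assumes "A \<in> PSD" "B \<in> PSD" "0 \<le> u" "0 \<le> v" "u + v = 1"
  shows "fr (u *\<^sub>R A + v *\<^sub>R B) \<le> u * fr A + v * fr B"
proof -
  have "f (u *\<^sub>R A + v *\<^sub>R B) \<le> ennreal u * f A + ennreal v * f B"
    using convex assms PSD_Sym unfolding convex_fun_def by auto
  also have "\<dots> = ennreal (u * fr A + v * fr B)"
    using assms fr_nonneg by (simp add: f_eq_fr ennreal_mult ennreal_plus)
  finally have "f (u *\<^sub>R A + v *\<^sub>R B) \<le> ennreal (u * fr A + v * fr B)" .
  moreover have "f (u *\<^sub>R A + v *\<^sub>R B) = ennreal (fr (u *\<^sub>R A + v *\<^sub>R B))"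
    by (intro f_eq_fr PSD_add PSD_scaleR assms)
  ultimately have "ennreal (fr (u *\<^sub>R A + v *\<^sub>R B)) \<le> ennreal (u * fr A + v * fr B)" by (rule subst[rotated])
  moreover have "0 \<le> u * fr A + v * fr B" by (intro add_nonneg_nonneg mult_nonneg_nonneg assms fr_nonneg)
  ultimately show ?thesis using ennreal_le_iff by blast
qed

text \<open>Coercivity and homogeneity bound the cost below by a multiple of the norm, hence of the trace.\<close>

lemma fr_lower: "\<exists>c>0. \<forall>A\<in>PSD. c * trace A \<le> fr A"
proof -
  have "eventually (\<lambda>A. 1 < f A) (inf at_infinity (principal Sym))"
    using coercive unfolding coercive_def by (rule order_tendstoD) simp
  then obtain b where b: "\<And>A. b \<le> norm A \<Longrightarrow> A \<in> Sym \<Longrightarrow> 1 < f A"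
    by (auto simp: eventually_inf_principal eventually_at_infinity)
  define R where "R = max b 1"
  have R: "R \<ge> b" "R > 0" unfolding R_def by auto
  define I where "I = norm (mat 1 :: real^'d^'d)"
  have "(mat 1 :: real^'d^'d) \<noteq> 0" by (metis matrix_vector_mul_lid matrix_vector_mult_0 axis_eq_0_iff zero_neq_one)
  then have I: "I > 0" unfolding I_def by simp
  have "1 / (R * I) * trace A \<le> fr A" if A: "A \<in> PSD" for A
  proof (cases "A = 0")
    case True then show ?thesis by (simp add: trace_def fr_zero)
  next
    case False
    then have nA: "norm A > 0" by simp
    have tA: "trace A \<le> I * norm A" unfolding trace_eq_inner I_def by (rule norm_cauchy_schwarz)
    define B where "B = (R / norm A) *\<^sub>R A"
    have B: "B \<in> PSD" unfolding B_def by (rule PSD_scaleR[OF A]) (use R in auto)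
    have "norm B = R" unfolding B_def using nA R by simp
    then have "1 < f B" using b[of B] R PSD_Sym[OF B] by simp
    then have "1 < fr B" using f_eq_fr[OF B] by (simp add: ennreal_less_iff flip: ennreal_1)
    also have "fr B = R / norm A * fr A" unfolding B_def by (rule fr_scale[OF A]) (use R in auto)
    finally have "norm A \<le> R * fr A" using nA by (simp add: field_simps)
    then have "I * norm A \<le> I * (R * fr A)" using I by (intro mult_left_mono) auto
    then have "trace A \<le> I * (R * fr A)" using tA by linarith
    then show ?thesis using R I by (simp add: field_simps)
  qed
  then show ?thesis using R I by (intro exI[of _ "1 / (R * I)"]) auto
qed

text \<open>The linear functionals below the cost.\<close>

definition K :: "(real^'d^'d) set" where "K = {B. \<forall>A\<in>PSD. B \<bullet> A \<le> fr A}"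

lemma closed_epigraph: "closed {(A, r). A \<in> PSD \<and> fr A \<le> r}"
  unfolding closed_sequential_limits
proof (intro allI impI, elim conjE)
  fix x :: "nat \<Rightarrow> (real^'d^'d) \<times> real" and l
  assume x: "\<forall>n. x n \<in> {(A, r). A \<in> PSD \<and> fr A \<le> r}" and lim: "x \<longlonglongrightarrow> l"
  obtain A r where l: "l = (A, r)" by (cases l)
  have limA: "(\<lambda>n. fst (x n)) \<longlonglongrightarrow> A" and limr: "(\<lambda>n. snd (x n)) \<longlonglongrightarrow> r"
    using tendsto_fst[OF lim] tendsto_snd[OF lim] l by auto
  have xn: "fst (x n) \<in> PSD" "fr (fst (x n)) \<le> snd (x n)" for n using x by (auto simp: split_beta)
  have A: "A \<in> PSD" by (rule closed_sequentially[OF closed_PSD _ limA]) (use xn in auto)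
  have "fr A \<le> r"
  proof (rule ccontr)
    assume "\<not> ?thesis"
    then obtain s where s: "r < s" "s < fr A" using dense[of r "fr A"] by auto
    have "r \<ge> 0" by (rule LIMSEQ_le_const[OF limr]) (use xn fr_nonneg order_trans in blast)
    then have s0: "s \<ge> 0" using s by simp
    have "ennreal s < f A" using s s0 f_eq_fr[OF A] by (simp add: ennreal_less_iff)
    moreover have "f A \<le> Liminf (at A within Sym) f" using lsc A PSD_Sym unfolding lower_semicont_def by auto
    ultimately have "eventually (\<lambda>B. ennreal s < f B) (at A within Sym)" by (metis le_Liminf_iff)
    then have "eventually (\<lambda>B. B \<noteq> A \<longrightarrow> B \<in> Sym \<longrightarrow> ennreal s < f B) (nhds A)"
      by (simp add: eventually_at_filter)
    then have "eventually (\<lambda>B. B \<in> Sym \<longrightarrow> ennreal s < f B) (nhds A)"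
      by (rule eventually_mono) (use \<open>ennreal s < f A\<close> in auto)
    then have "eventually (\<lambda>n. fst (x n) \<in> Sym \<longrightarrow> ennreal s < f (fst (x n))) sequentially"
      by (rule eventually_compose_filterlim[OF _ limA])
    moreover have "eventually (\<lambda>n. snd (x n) < s) sequentially" using order_tendstoD(2)[OF limr s(1)] .
    ultimately have "eventually (\<lambda>n. False) sequentially"
    proof eventually_elim
      case (elim n)
      then have "ennreal s < ennreal (fr (fst (x n)))" using PSD_Sym[OF xn(1)] f_eq_fr[OF xn(1)] by metis
      then have "s < fr (fst (x n))" using s0 by (simp add: ennreal_less_iff)
      then show False using xn(2)[of n] elim by simp
    qed
    then show False by simp
  qed
  then show "l \<in> {(A, r). A \<in> PSD \<and> fr A \<le> r}" using l A by simp
qed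

lemma convex_epigraph: "convex {(A, r). A \<in> PSD \<and> fr A \<le> r}"
  unfolding convex_def
proof (intro ballI allI impI)
  fix x y and u v :: real
  assume x: "x \<in> {(A, r). A \<in> PSD \<and> fr A \<le> r}" and y: "y \<in> {(A, r). A \<in> PSD \<and> fr A \<le> r}"
    and uv: "0 \<le> u" "0 \<le> v" "u + v = 1"
  obtain A r B t where xy: "x = (A, r)" "y = (B, t)" by (cases x, cases y)
  have AB: "A \<in> PSD" "fr A \<le> r" "B \<in> PSD" "fr B \<le> t" using x y xy by auto
  have "u *\<^sub>R A + v *\<^sub>R B \<in> PSD" by (intro PSD_add PSD_scaleR AB uv)
  moreover have "fr (u *\<^sub>R A + v *\<^sub>R B) \<le> u * r + v * t"
    using fr_convex[OF AB(1,3) uv] mult_left_mono[OF AB(2) uv(1)] mult_left_mono[OF AB(4) uv(2)] by linarith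
  ultimately show "u *\<^sub>R x + v *\<^sub>R y \<in> {(A, r). A \<in> PSD \<and> fr A \<le> r}" unfolding xy by simp
qed

text \<open>The epigraph of the cost is a closed convex cone, so that a point strictly below it is separated by
  a hyperplane through the origin.  The hyperplane is not vertical: evaluated at the point of the graph
  above, the separation forces a nonzero coefficient of the vertical coordinate.\<close>

lemma support_above:
  assumes A0: "A0 \<in> PSD" and r0: "r0 < fr A0"
  obtains B where "B \<in> K" "r0 < B \<bullet> A0"
proof -
  let ?S = "{(A, r). A \<in> PSD \<and> fr A \<le> r}"
  have "(A0, r0) \<notin> ?S" using r0 by simp
  from separating_hyperplane_closed_point[OF convex_epigraph closed_epigraph this]
  obtain a b where a: "a \<bullet> (A0, r0) < b" "\<And>x. x \<in> ?S \<Longrightarrow> b < a \<bullet> x" by blast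
  obtain P q where Pq: "a = (P, q)" by (cases a)
  have z: "P \<bullet> A0 + q * r0 < b" using a(1) Pq by (simp add: inner_prod_def)
  have S: "b < P \<bullet> A + q * r" if "A \<in> PSD" "fr A \<le> r" for A r
    using a(2)[of "(A, r)"] that Pq by (simp add: inner_prod_def)
  have b0: "b < 0" using S[OF zero_PSD, of 0] fr_zero by simp
  have cone: "0 \<le> P \<bullet> A + q * r" if A: "A \<in> PSD" "fr A \<le> r" for A r
  proof (rule ccontr)
    assume neg: "\<not> ?thesis"
    define t where "t = b / (P \<bullet> A + q * r)"
    have t: "t > 0" unfolding t_def using b0 neg by (simp add: divide_neg_neg)
    have "fr (t *\<^sub>R A) \<le> t * r" using fr_scale[OF A(1), of t] t A(2) by simp
    then have "b < P \<bullet> (t *\<^sub>R A) + q * (t * r)" using PSD_scaleR[OF A(1), of t] t by (intro S) auto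
    also have "\<dots> = t * (P \<bullet> A + q * r)" by (simp add: algebra_simps)
    also have "\<dots> = b" unfolding t_def using neg by simp
    finally show False by simp
  qed
  have "0 \<le> P \<bullet> A0 + q * fr A0" by (rule cone[OF A0]) simp
  then have "0 < q * (fr A0 - r0)" using z b0 by (simp add: algebra_simps)
  then have q: "q > 0" using r0 by (simp add: zero_less_mult_iff)
  define B where "B = (- 1 / q) *\<^sub>R P"
  show thesis
  proof
    show "B \<in> K" unfolding K_def B_def
    proof (intro CollectI ballI)
      fix A :: "real^'d^'d" assume "A \<in> PSD"
      then have "0 \<le> P \<bullet> A + q * fr A" by (rule cone) simp
      then show "(- 1 / q) *\<^sub>R P \<bullet> A \<le> fr A" using q by (simp add: field_simps)
    qed
    show "r0 < B \<bullet> A0" unfolding B_def using z b0 q by (simp add: field_simps)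
  qed
qed

lemma zero_K: "0 \<in> K" unfolding K_def by (simp add: fr_nonneg)

text \<open>The index \<open>0\<close> carries the zero functional, so that finite suprema are nonnegative.\<close>

lemma countable_support:
  obtains B :: "nat \<Rightarrow> real^'d^'d" where "B 0 = 0" "\<And>i. B i \<in> K"
    "\<And>A. A \<in> PSD \<Longrightarrow> f A = (SUP i. ennreal (B i \<bullet> A))"
proof -
  obtain T where T: "countable T" "T \<subseteq> K" "K \<subseteq> closure T" by (rule separable)
  define B where "B i = from_nat_into (insert 0 T) i" for i
  define B' where "B' i = (case i of 0 \<Rightarrow> 0 | Suc j \<Rightarrow> B j)" for i
  have rB: "range B = insert 0 T" unfolding B_def using T(1) by (intro range_from_nat_into) auto
  have B'K: "B' i \<in> K" for i
  proof (cases i)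
    case (Suc j)
    have "B j \<in> range B" by simp
    then have "B j \<in> insert 0 T" unfolding rB .
    then show ?thesis using Suc T(2) zero_K by (auto simp: B'_def)
  qed (simp add: B'_def zero_K)
  show thesis
  proof
    show "B' 0 = 0" by (simp add: B'_def)
    show "B' i \<in> K" for i by (rule B'K)
    fix A :: "real^'d^'d" assume A: "A \<in> PSD"
    show "f A = (SUP i. ennreal (B' i \<bullet> A))"
    proof (rule antisym)
      show "(SUP i. ennreal (B' i \<bullet> A)) \<le> f A"
        using B'K A unfolding K_def f_eq_fr[OF A] by (intro SUP_least ennreal_leI) auto
      show "f A \<le> (SUP i. ennreal (B' i \<bullet> A))"
      proof (rule le_SUP_iff[THEN iffD2, rule_format])
        fix y assume "y < f A"
        then have y: "y < ennreal (fr A)" using f_eq_fr[OF A] by simp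
        then obtain r where r: "y = ennreal r" "0 \<le> r" by (cases y) (auto simp: top_unique)
        then have rA: "r < fr A" using y by (simp add: ennreal_less_iff)
        obtain C where C: "C \<in> K" "r < C \<bullet> A" using support_above[OF A rA] .
        have op: "open {X. r < X \<bullet> A}" by (intro open_Collect_less continuous_intros)
        have "C \<in> closure T" using C T by auto
        then obtain D where D: "D \<in> T" "r < D \<bullet> A"
          using op C(2) unfolding closure_iff_nhds_not_empty by blast
        have "D \<in> range B" unfolding rB using D(1) by simp
        then obtain j where "D = B j" by auto
        then have "B' (Suc j) = D" by (simp add: B'_def)
        moreover have "y < ennreal (D \<bullet> A)" unfolding r(1) using D(2) r(2) by (simp add: ennreal_less_iff)
        ultimately show "\<exists>i\<in>UNIV. y < ennreal (B' i \<bullet> A)" by (intro bexI[of _ "Suc j"]) simp_all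
      qed
    qed
  qed
qed

text \<open>The cost of a matrix measure is the supremum, over partitions and selections of functionals
  below the cost, of the corresponding finite sums.\<close>

lemma FP_cost_slice_le:
  assumes L: "PSD_measure M L"
    and B: "\<And>i::nat. B i \<in> K" "B 0 = 0" "\<And>A. A \<in> PSD \<Longrightarrow> f A = (SUP i. ennreal (B i \<bullet> A))"
    and sel: "\<And>n E. (\<And>i. E i \<in> sets M) \<Longrightarrow> disjoint_family E \<Longrightarrow> (\<Sum>i\<le>n. B i \<bullet> L (E i)) \<le> s"
  shows "(\<integral>\<^sup>+x. f (polar_density M L x) \<partial>total_variation M L) \<le> ennreal s"
proof -
  let ?V = "total_variation M L" and ?p = "polar_density M L"
  note P = polar_density_spec[OF L]
  have "(\<integral>\<^sup>+x. f (?p x) \<partial>?V) = (\<integral>\<^sup>+x. (SUP i. ennreal (B i \<bullet> ?p x)) \<partial>?V)"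
    by (rule nn_integral_cong_AE) (use P(5) in eventually_elim, rule B(3))
  also have "\<dots> \<le> ennreal s"
  proof (rule nn_integral_SUP_le)
    show "integrable ?V (\<lambda>x. B i \<bullet> ?p x)" for i using P(3) by auto
    show "B 0 \<bullet> ?p x = 0" for x using B(2) by simp
    fix n and E :: "nat \<Rightarrow> 'a set" assume E: "\<And>i. E i \<in> sets ?V" "disjoint_family E"
    have "(LINT x:E i|?V. B i \<bullet> ?p x) = B i \<bullet> L (E i)" for i
    proof -
      have Ei: "E i \<in> sets M" using E P(2) by auto
      have "(LINT x:E i|?V. B i \<bullet> ?p x) = (LINT x|?V. B i \<bullet> (indicator (E i) x *\<^sub>R ?p x))"
        unfolding set_lebesgue_integral_def by simp
      also have "\<dots> = B i \<bullet> (LINT x|?V. indicator (E i) x *\<^sub>R ?p x)"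
        by (rule integral_inner_right) (use integrable_mult_indicator[OF E(1) P(3)] in auto)
      finally show ?thesis using P(4)[OF Ei] by (simp add: set_lebesgue_integral_def)
    qed
    then have "(\<Sum>i\<le>n. LINT x:E i|?V. B i \<bullet> ?p x) = (\<Sum>i\<le>n. B i \<bullet> L (E i))" by (intro sum.cong refl)
    also have "\<dots> \<le> s"
    proof (rule sel[OF _ E(2)])
      show "E i \<in> sets M" for i using E(1)[of i] unfolding P(2) .
    qed
    finally show "(\<Sum>i\<le>n. LINT x:E i|?V. B i \<bullet> ?p x) \<le> s" .
  qed
  finally show ?thesis .
qed

end

section \<open>Smooth potentials\<close>

lemma pos_part_power_derivative:
  "((\<lambda>u::real. (max 0 u) ^ Suc (Suc n)) has_real_derivative real (Suc (Suc n)) * (max 0 u) ^ Suc n) (at u)"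
proof -
  consider "u > 0" | "u < 0" | "u = 0" by linarith
  then show ?thesis
  proof cases
    case 1
    have "((\<lambda>u::real. u ^ Suc (Suc n)) has_real_derivative real (Suc (Suc n)) * u ^ Suc n) (at u)"
      using DERIV_pow[of "Suc (Suc n)" u] by simp
    then have "((\<lambda>u::real. (max 0 u) ^ Suc (Suc n)) has_real_derivative real (Suc (Suc n)) * u ^ Suc n) (at u)"
      by (rule has_field_derivative_transform_within_open[where S="{0<..}"]) (use 1 in \<open>auto simp: max_def\<close>)
    then show ?thesis using 1 by (simp add: max_def)
  next
    case 2
    have "((\<lambda>u::real. 0) has_real_derivative 0) (at u)" by simp
    then have "((\<lambda>u::real. (max 0 u) ^ Suc (Suc n)) has_real_derivative 0) (at u)"
      by (rule has_field_derivative_transform_within_open[where S="{..<0}"]) (use 2 in \<open>auto simp: max_def\<close>)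
    then show ?thesis using 2 by (simp add: max_def)
  next
    case 3
    have "((\<lambda>h::real. ((max 0 (0 + h)) ^ Suc (Suc n) - (max 0 0) ^ Suc (Suc n)) / h) \<longlongrightarrow> 0) (at 0)"
    proof (rule Lim_null_comparison)
      show "\<forall>\<^sub>F h in at 0. norm (((max 0 (0 + h)) ^ Suc (Suc n) - (max 0 0) ^ Suc (Suc n)) / h) \<le> \<bar>h\<bar> ^ Suc n"
      proof (intro always_eventually allI)
        fix h :: real
        show "norm (((max 0 (0 + h)) ^ Suc (Suc n) - (max 0 0) ^ Suc (Suc n)) / h) \<le> \<bar>h\<bar> ^ Suc n"
        proof (cases "h > 0")
          case True then show ?thesis by (simp add: max_def)
        next
          case False
          then have "(max 0 (0 + h)) ^ Suc (Suc n) - (max 0 0) ^ Suc (Suc n) = 0" by simp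
          then show ?thesis by (simp only: div_0 norm_zero zero_le_power abs_ge_zero)
        qed
      qed
      have "((\<lambda>h::real. \<bar>h\<bar> ^ Suc n) \<longlongrightarrow> \<bar>0\<bar> ^ Suc n) (at 0)" by (intro tendsto_intros)
      then show "((\<lambda>h::real. \<bar>h\<bar> ^ Suc n) \<longlongrightarrow> 0) (at 0)" by simp
    qed
    then show ?thesis using 3 by (simp add: DERIV_def)
  qed
qed

text \<open>A continuously differentiable transition from \<open>0\<close> to \<open>1\<close> on the unit interval and its
  derivative, a tent of height two.\<close>

definition smooth_step :: "real \<Rightarrow> real"
  where "smooth_step u = 2 * (max 0 u)\<^sup>2 - 4 * (max 0 (u - 1/2))\<^sup>2 + 2 * (max 0 (u - 1))\<^sup>2"

definition hat :: "real \<Rightarrow> real"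
  where "hat u = 4 * max 0 u - 8 * max 0 (u - 1/2) + 4 * max 0 (u - 1)"

lemma smooth_step_derivative: "(smooth_step has_real_derivative hat u) (at u)"
proof -
  have 1: "((\<lambda>v. (max 0 (v - c))\<^sup>2) has_real_derivative 2 * max 0 (u - c)) (at u)" for c
  proof -
    have "((\<lambda>u::real. (max 0 u)\<^sup>2) has_real_derivative 2 * max 0 (u - c)) (at (u - c))"
      using pos_part_power_derivative[of 0 "u - c"] by (simp add: numeral_2_eq_2)
    moreover have "((\<lambda>v. v - c) has_real_derivative 1) (at u)" by (auto intro!: derivative_eq_intros)
    ultimately show ?thesis using DERIV_chain2[of "\<lambda>u. (max 0 u)\<^sup>2" _ "\<lambda>v. v - c" u 1 UNIV] by simp
  qed
  have "((\<lambda>v. 2 * (max 0 (v - 0))\<^sup>2 - 4 * (max 0 (v - 1/2))\<^sup>2 + 2 * (max 0 (v - 1))\<^sup>2) has_real_derivative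
      2 * (2 * max 0 (u - 0)) - 4 * (2 * max 0 (u - 1/2)) + 2 * (2 * max 0 (u - 1))) (at u)"
    by (intro DERIV_add DERIV_diff DERIV_cmult 1)
  then show ?thesis unfolding smooth_step_def[abs_def] hat_def by simp
qed

lemma hat_bounds: "0 \<le> hat u" "hat u \<le> 2" unfolding hat_def by (auto simp: max_def)

lemma hat_support: "hat u \<noteq> 0 \<Longrightarrow> 0 < u \<and> u < 1" unfolding hat_def by (auto simp: max_def split: if_splits)

lemma continuous_hat: "continuous_on S hat" unfolding hat_def by (intro continuous_intros)

lemma smooth_step_0: "u \<le> 0 \<Longrightarrow> smooth_step u = 0" unfolding smooth_step_def by (simp add: max_def)

lemma smooth_step_1: "1 \<le> u \<Longrightarrow> smooth_step u = 1"
  unfolding smooth_step_def by (simp add: max_def power2_eq_square algebra_simps)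

lemma smooth_step_mono: "u \<le> v \<Longrightarrow> smooth_step u \<le> smooth_step v"
  by (rule DERIV_nonneg_imp_nondecreasing) (use smooth_step_derivative hat_bounds in blast)+

lemma smooth_step_bounds: "0 \<le> smooth_step u" "smooth_step u \<le> 1"
  using smooth_step_mono[of "min u 0" u] smooth_step_mono[of u "max u 1"] smooth_step_0[of "min u 0"] smooth_step_1[of "max u 1"]
  by simp_all

subsection \<open>Integrals over the unit time interval\<close>

lemma finite_measure_unit_time: "finite_measure unit_time"
  by (rule finite_measureI) (simp add: emeasure_restrict_space space_restrict_space)

lemma unit_time_measurable: "continuous_on {0<..<1} u \<Longrightarrow> u \<in> borel_measurable unit_time"
  for u :: "real \<Rightarrow> real"
  using borel_measurable_continuous_on_restrict[of "{0<..<1}" u]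
  by (simp cong: measurable_cong_sets add: measurable_restrict_space1 sets_restrict_space_cong[of lborel borel])

lemma unit_time_integrable:
  fixes u :: "real \<Rightarrow> real"
  assumes u: "continuous_on {0<..<1} u" and b: "\<And>t. t \<in> {0<..<1} \<Longrightarrow> \<bar>u t\<bar> \<le> C"
  shows "integrable unit_time u"
proof -
  interpret finite_measure unit_time by (rule finite_measure_unit_time)
  show ?thesis
    by (rule integrable_const_bound[of _ C]) (use b unit_time_measurable[OF u] in \<open>auto simp: space_restrict_space\<close>)
qed

lemma unit_time_FTC:
  fixes F u :: "real \<Rightarrow> real"
  assumes u: "continuous_on {0..1} u" and F: "\<And>t. t \<in> {0..1} \<Longrightarrow> (F has_real_derivative u t) (at t)"
  shows "(LINT t|unit_time. u t) = F 1 - F 0"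
proof -
  have "(LBINT t=ereal 0..ereal 1. u t) = F 1 - F 0"
  proof (rule interval_integral_FTC_finite)
    show "continuous_on {min 0 1..max 0 1} u" using u by simp
    show "(F has_vector_derivative u x) (at x within {min 0 1..max 0 1})" if "min 0 1 \<le> x" "x \<le> max 0 1" for x
      using F[of x] that by (simp add: has_real_derivative_iff_has_vector_derivative has_vector_derivative_at_within)
  qed
  then show ?thesis
    by (simp add: interval_lebesgue_integral_def einterval_eq set_lebesgue_integral_def integral_restrict_space)
qed

text \<open>The right-hand side is an upper integral if \<open>v\<close> is not measurable, and an integral on the left that does
  not exist is zero.\<close>

lemma ennreal_integral_le_nn_integral:
  fixes u :: "'a \<Rightarrow> real"
  assumes "AE x in M. ennreal (u x) \<le> v x"
  shows "ennreal (LINT x|M. u x) \<le> (\<integral>\<^sup>+x. v x \<partial>M)"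
proof (cases "integrable M u")
  case True
  have "(LINT x|M. u x) \<le> (LINT x|M. max 0 (u x))" by (rule integral_mono) (use True in auto)
  then have "ennreal (LINT x|M. u x) \<le> ennreal (LINT x|M. max 0 (u x))" by (rule ennreal_leI)
  also have "\<dots> = (\<integral>\<^sup>+x. ennreal (max 0 (u x)) \<partial>M)"
    by (rule nn_integral_eq_integral[symmetric]) (use True in auto)
  also have "\<dots> \<le> (\<integral>\<^sup>+x. v x \<partial>M)"
    by (rule nn_integral_mono_AE) (use assms in eventually_elim, auto simp: max_def ennreal_neg)
  finally show ?thesis .
qed (simp add: not_integrable_integral_eq)

subsection \<open>Twice differentiable potentials\<close>

definition C2_map :: "(real^'d \<Rightarrow> real) \<Rightarrow> (real^'d \<Rightarrow> real^'d) \<Rightarrow> (real^'d \<Rightarrow> real^'d^'d) \<Rightarrow> bool"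
  where "C2_map \<psi> g D \<longleftrightarrow> (\<forall>x. (\<psi> has_derivative (\<lambda>h. g x \<bullet> h)) (at x)) \<and>
    (\<forall>x. (g has_derivative (\<lambda>h. D x *v h)) (at x)) \<and> continuous_on UNIV D"

lemma C2_mapD:
  assumes "C2_map \<psi> g D"
  shows "(\<psi> has_derivative (\<lambda>h. g x \<bullet> h)) (at x)" "(g has_derivative (\<lambda>h. D x *v h)) (at x)"
    "continuous_on UNIV D" "continuous_on UNIV g" "continuous_on UNIV \<psi>"
  using assms unfolding C2_map_def
  by (auto intro!: continuous_at_imp_continuous_on has_derivative_continuous)

lemma C2_map_add:
  assumes "C2_map \<psi>1 g1 D1" "C2_map \<psi>2 g2 D2"
  shows "C2_map (\<lambda>x. \<psi>1 x + \<psi>2 x) (\<lambda>x. g1 x + g2 x) (\<lambda>x. D1 x + D2 x)"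
  unfolding C2_map_def
proof (intro conjI allI)
  fix x
  show "((\<lambda>x. \<psi>1 x + \<psi>2 x) has_derivative (\<lambda>h. (g1 x + g2 x) \<bullet> h)) (at x)"
    unfolding inner_add_left by (rule has_derivative_add[OF C2_mapD(1)[OF assms(1)] C2_mapD(1)[OF assms(2)]])
  show "((\<lambda>x. g1 x + g2 x) has_derivative (\<lambda>h. (D1 x + D2 x) *v h)) (at x)"
    unfolding matrix_vector_mult_add_rdistrib by (rule has_derivative_add[OF C2_mapD(2)[OF assms(1)] C2_mapD(2)[OF assms(2)]])
  show "continuous_on UNIV (\<lambda>x. D1 x + D2 x)" by (intro continuous_on_add C2_mapD(3)[OF assms(1)] C2_mapD(3)[OF assms(2)])
qed

lemma C2_map_scale:
  assumes "C2_map \<psi> g D"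
  shows "C2_map (\<lambda>x. c * \<psi> x) (\<lambda>x. c *\<^sub>R g x) (\<lambda>x. c *\<^sub>R D x)"
  unfolding C2_map_def
proof (intro conjI allI)
  fix x
  show "((\<lambda>x. c * \<psi> x) has_derivative (\<lambda>h. (c *\<^sub>R g x) \<bullet> h)) (at x)"
    unfolding inner_scaleR_left by (intro has_derivative_mult_right C2_mapD(1)[OF assms])
  show "((\<lambda>x. c *\<^sub>R g x) has_derivative (\<lambda>h. (c *\<^sub>R D x) *v h)) (at x)"
    unfolding scaleR_matrix_vector_assoc[symmetric] by (intro has_derivative_scaleR_right C2_mapD(2)[OF assms])
  show "continuous_on UNIV (\<lambda>x. c *\<^sub>R D x)" by (intro continuous_on_scaleR continuous_on_const C2_mapD(3)[OF assms])
qed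

lemma C2_map_const: "C2_map (\<lambda>x::real^'a. c) (\<lambda>x. 0) (\<lambda>x. 0)"
proof -
  have "(\<lambda>h::real^'a. (0::real^'a) \<bullet> h) = (\<lambda>h. 0)" "(\<lambda>h::real^'a. (0::real^'a^'a) *v h) = (\<lambda>h. 0)"
    by (simp_all add: fun_eq_iff matrix_vector_mult_0)
  then show ?thesis unfolding C2_map_def by (simp only:) simp
qed

text \<open>Potentials are closed under translations, which later makes their lower envelope Lipschitz.\<close>

lemma C2_map_translate:
  assumes "C2_map \<psi> g D"
  shows "C2_map (\<lambda>x. \<psi> (x + z)) (\<lambda>x. g (x + z)) (\<lambda>x. D (x + z))"
  unfolding C2_map_def
proof (intro conjI allI)
  fix x
  have t: "((\<lambda>x. x + z) has_derivative (\<lambda>h. h)) (at x)" by (auto intro!: derivative_eq_intros)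
  show "((\<lambda>x. \<psi> (x + z)) has_derivative (\<lambda>h. g (x + z) \<bullet> h)) (at x)"
    using has_derivative_compose[OF t C2_mapD(1)[OF assms]] .
  show "((\<lambda>x. g (x + z)) has_derivative (\<lambda>h. D (x + z) *v h)) (at x)"
    using has_derivative_compose[OF t C2_mapD(2)[OF assms]] .
  show "continuous_on UNIV (\<lambda>x. D (x + z))"
    by (intro continuous_on_compose2[OF C2_mapD(3)[OF assms]] continuous_intros) auto
qed

context cost_function
begin

text \<open>The potentials whose half Hessian lies, up to the factor \<open>w\<close>, below the cost: these are the
  smooth functions that are dual feasible at level \<open>w\<close>.\<close>

definition potentials :: "real \<Rightarrow> (real^'d \<Rightarrow> real) set"
  where "potentials w = {\<psi>. \<exists>g D. C2_map \<psi> g D \<and> bounded (range \<psi>) \<and> bounded (range D) \<and>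
    (\<forall>x. \<forall>A\<in>PSD. D x \<bullet> A / 2 \<le> w * fr A)}"

lemma potentials_add:
  assumes "\<psi>1 \<in> potentials w1" "\<psi>2 \<in> potentials w2" shows "(\<lambda>x. \<psi>1 x + \<psi>2 x) \<in> potentials (w1 + w2)"
proof -
  obtain g1 D1 g2 D2 where
    1: "C2_map \<psi>1 g1 D1" "bounded (range \<psi>1)" "bounded (range D1)" "\<And>x A. A \<in> PSD \<Longrightarrow> D1 x \<bullet> A / 2 \<le> w1 * fr A" and
    2: "C2_map \<psi>2 g2 D2" "bounded (range \<psi>2)" "bounded (range D2)" "\<And>x A. A \<in> PSD \<Longrightarrow> D2 x \<bullet> A / 2 \<le> w2 * fr A"
    using assms unfolding potentials_def by blast
  have "(D1 x + D2 x) \<bullet> A / 2 \<le> (w1 + w2) * fr A" if "A \<in> PSD" for x A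
    using add_mono[OF 1(4)[OF that, of x] 2(4)[OF that, of x]] by (simp add: inner_add_left distrib_right add_divide_distrib)
  then show ?thesis unfolding potentials_def using C2_map_add[OF 1(1) 2(1)]
      bounded_plus_comp[OF 1(2) 2(2)] bounded_plus_comp[OF 1(3) 2(3)] by blast
qed

lemma bounded_range_cmult: "bounded (range u) \<Longrightarrow> bounded (range (\<lambda>x. c * u x :: real))"
  using bounded_scaleR_comp[of u UNIV c] by simp

lemma potentials_scale:
  assumes "\<psi> \<in> potentials w" "c \<ge> 0" shows "(\<lambda>x. c * \<psi> x) \<in> potentials (c * w)"
proof -
  obtain g D where
    1: "C2_map \<psi> g D" "bounded (range \<psi>)" "bounded (range D)" "\<And>x A. A \<in> PSD \<Longrightarrow> D x \<bullet> A / 2 \<le> w * fr A"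
    using assms unfolding potentials_def by blast
  have "(c *\<^sub>R D x) \<bullet> A / 2 \<le> c * w * fr A" if "A \<in> PSD" for x A
    using mult_left_mono[OF 1(4)[OF that, of x] assms(2)] by simp
  then show ?thesis unfolding potentials_def using C2_map_scale[OF 1(1), of c]
      bounded_range_cmult[OF 1(2), of c] bounded_scaleR_comp[OF 1(3), of c] by blast
qed

lemma potentials_const: "(\<lambda>x. c) \<in> potentials 0"
  unfolding potentials_def using C2_map_const[of c] by (intro CollectI exI conjI) auto

lemma potentials_add_const: "\<psi> \<in> potentials w \<Longrightarrow> (\<lambda>x. \<psi> x + c) \<in> potentials w"
  using potentials_add[of \<psi> w "\<lambda>x. c" 0] potentials_const by simp

lemma potentials_mono:
  assumes "\<psi> \<in> potentials w" "w \<le> w'" shows "\<psi> \<in> potentials w'"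
proof -
  have "w * fr A \<le> w' * fr A" for A by (intro mult_right_mono assms fr_nonneg)
  then show ?thesis using assms(1) unfolding potentials_def by (blast intro: order_trans)
qed

lemma potentials_translate:
  assumes "\<psi> \<in> potentials w" shows "(\<lambda>x. \<psi> (x + z)) \<in> potentials w"
proof -
  obtain g D where
    1: "C2_map \<psi> g D" "bounded (range \<psi>)" "bounded (range D)" "\<And>x A. A \<in> PSD \<Longrightarrow> D x \<bullet> A / 2 \<le> w * fr A"
    using assms unfolding potentials_def by blast
  have "bounded (range (\<lambda>x. \<psi> (x + z)))" "bounded (range (\<lambda>x. D (x + z)))"
    using 1 by (auto elim!: bounded_subset)
  then show ?thesis unfolding potentials_def using C2_map_translate[OF 1(1), of z] 1(4) by blast
qed

lemma potentials_continuous: "\<psi> \<in> potentials w \<Longrightarrow> continuous_on UNIV \<psi>"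
  unfolding potentials_def using C2_mapD(5) by blast

lemma potentials_bounded: "\<psi> \<in> potentials w \<Longrightarrow> bounded (range \<psi>)"
  unfolding potentials_def by blast

lemma potentials_bcontfun: "\<psi> \<in> potentials w \<Longrightarrow> \<psi> \<in> bcontfun"
  using potentials_continuous potentials_bounded unfolding bcontfun_def by blast

text \<open>The equation is tested with the potential times a cutoff in time that rises near time zero and
  falls near time one.  The narrowly continuous representative turns the two transitions into the end
  values of the potential, up to \<open>2 * \<delta>\<close>; in between, the half Hessian lies below the cost.\<close>

lemma potential_gap_le_FP_cost:
  assumes FP: "FP_solution \<rho> \<Lambda> r l" and nc: "narrowly_continuous_P2 r" and \<psi>: "\<psi> \<in> potentials 1"
  shows "ennreal ((LINT x|r 1. \<psi> x) - (LINT x|r 0. \<psi> x)) \<le> FP_cost f l"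
proof -
  obtain g D where C2: "C2_map \<psi> g D" and b\<psi>: "bounded (range \<psi>)" and bD: "bounded (range D)"
    and K: "\<And>x A. A \<in> PSD \<Longrightarrow> D x \<bullet> A / 2 \<le> 1 * fr A" using \<psi> unfolding potentials_def by blast
  note C2 = C2_mapD[OF C2]
  define \<Psi> where "\<Psi> t = (LINT x|r t. \<psi> x)" for t
  have \<Psi>c: "continuous_on {0..1} \<Psi>"
    using nc potentials_bcontfun[OF \<psi>] unfolding narrowly_continuous_P2_def \<Psi>_def by auto
  have "bounded (\<Psi> ` {0..1})" by (intro compact_imp_bounded compact_continuous_image \<Psi>c) simp
  then obtain C where "\<forall>y\<in>\<Psi> ` {0..1}. norm y \<le> C" unfolding bounded_iff ..
  then have C: "\<And>t. t \<in> {0..1} \<Longrightarrow> \<bar>\<Psi> t\<bar> \<le> C" by simp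
  have polar_le: "ennreal (integral_matrix borel (\<lambda>x. (1/2) *\<^sub>R (e *\<^sub>R D x)) (l t))
      \<le> (\<integral>\<^sup>+x. f (polar_density borel (l t) x) \<partial>total_variation borel (l t))"
    if t: "t \<in> {0<..<1}" and e: "0 \<le> e" "e \<le> 1" for t e
  proof -
    have L: "PSD_measure borel (l t)" using FP t unfolding FP_solution_def disintegrates_matrix_def by auto
    show ?thesis unfolding integral_matrix_def
    proof (rule ennreal_integral_le_nn_integral)
      show "AE x in total_variation borel (l t). ennreal ((1/2) *\<^sub>R (e *\<^sub>R D x) \<bullet> polar_density borel (l t) x)
          \<le> f (polar_density borel (l t) x)"
        using polar_density_spec(5)[OF L]
      proof eventually_elim
        case (elim x)
        let ?A = "polar_density borel (l t) x"
        have "(1/2) *\<^sub>R (e *\<^sub>R D x) \<bullet> ?A = e * (D x \<bullet> ?A / 2)" by simp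
        also have "\<dots> \<le> e * fr ?A" by (rule mult_left_mono) (use K[OF elim] e in auto)
        also have "\<dots> \<le> fr ?A" using e fr_nonneg[of ?A] by (simp add: mult_left_le_one_le)
        finally show ?case unfolding f_eq_fr[OF elim] by (rule ennreal_leI)
      qed
    qed
  qed
  have key: "ennreal (\<Psi> 1 - \<Psi> 0 - 2 * \<delta>) \<le> FP_cost f l" if \<delta>: "\<delta> > 0" for \<delta>
  proof -
    have "uniformly_continuous_on {0..1} \<Psi>" by (rule compact_uniformly_continuous[OF \<Psi>c]) simp
    then obtain d where d: "d > 0" "\<And>s s'. s \<in> {0..1} \<Longrightarrow> s' \<in> {0..1} \<Longrightarrow> dist s' s < d \<Longrightarrow> dist (\<Psi> s') (\<Psi> s) < \<delta>"
      unfolding uniformly_continuous_on_def using \<delta> by metis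
    define \<epsilon> where "\<epsilon> = min (1/4) (d / 4)"
    have \<epsilon>: "\<epsilon> > 0" "\<epsilon> \<le> 1/4" "2 * \<epsilon> < d" unfolding \<epsilon>_def using d(1) by auto
    define \<eta>0 where "\<eta>0 t = smooth_step ((t - \<epsilon>) / \<epsilon>)" for t
    define \<eta>1 where "\<eta>1 t = smooth_step ((t - (1 - 2 * \<epsilon>)) / \<epsilon>)" for t
    define h0 where "h0 t = hat ((t - \<epsilon>) / \<epsilon>) / \<epsilon>" for t
    define h1 where "h1 t = hat ((t - (1 - 2 * \<epsilon>)) / \<epsilon>) / \<epsilon>" for t
    have chain: "((\<lambda>t. smooth_step ((t - c) / \<epsilon>)) has_real_derivative hat ((t - c) / \<epsilon>) / \<epsilon>) (at t)" for c t
    proof -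
      have "((\<lambda>t. (t - c) / \<epsilon>) has_real_derivative 1 / \<epsilon>) (at t)"
        using \<epsilon> by (auto intro!: derivative_eq_intros)
      from DERIV_chain2[OF smooth_step_derivative this] show ?thesis by simp
    qed
    have d0: "(\<eta>0 has_real_derivative h0 t) (at t)" and d1: "(\<eta>1 has_real_derivative h1 t) (at t)" for t
      unfolding \<eta>0_def[abs_def] \<eta>1_def[abs_def] h0_def h1_def by (rule chain)+
    have ch: "continuous_on S h0" "continuous_on S h1" for S
      unfolding h0_def h1_def using \<epsilon> by (auto intro!: continuous_intros continuous_on_compose2[OF continuous_hat[of UNIV]])
    have hb: "0 \<le> h0 t" "h0 t \<le> 2 / \<epsilon>" "0 \<le> h1 t" "h1 t \<le> 2 / \<epsilon>" for t
      unfolding h0_def h1_def using hat_bounds \<epsilon> by (auto intro!: divide_right_mono)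
    have supp0: "\<epsilon> < t \<and> t < 2 * \<epsilon>" if "h0 t \<noteq> 0" for t
      using hat_support[of "(t - \<epsilon>) / \<epsilon>"] that \<epsilon> unfolding h0_def by (auto simp: field_simps)
    have supp1: "1 - 2 * \<epsilon> < t \<and> t < 1 - \<epsilon>" if "h1 t \<noteq> 0" for t
      using hat_support[of "(t - (1 - 2 * \<epsilon>)) / \<epsilon>"] that \<epsilon> unfolding h1_def by (auto simp: field_simps)
    define \<eta> where "\<eta> t = \<eta>0 t - \<eta>1 t" for t
    have \<eta>b: "0 \<le> \<eta> t" "\<eta> t \<le> 1" for t
    proof -
      have "(t - (1 - 2 * \<epsilon>)) / \<epsilon> \<le> (t - \<epsilon>) / \<epsilon>" using \<epsilon> by (intro divide_right_mono) auto
      then show "0 \<le> \<eta> t" unfolding \<eta>_def \<eta>0_def \<eta>1_def using smooth_step_mono by simp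
      show "\<eta> t \<le> 1" unfolding \<eta>_def \<eta>0_def \<eta>1_def
        using smooth_step_bounds(2)[of "(t - \<epsilon>) / \<epsilon>"] smooth_step_bounds(1)[of "(t - (1 - 2 * \<epsilon>)) / \<epsilon>"] by linarith
    qed
    have \<eta>supp: "\<epsilon> \<le> t \<and> t \<le> 1 - \<epsilon>" if "\<eta> t \<noteq> 0" for t
    proof (rule ccontr)
      assume neg: "\<not> ?thesis"
      then consider "t < \<epsilon>" | "t > 1 - \<epsilon>" by linarith
      then have "\<eta> t = 0"
      proof cases
        case 1
        have "(t - \<epsilon>) / \<epsilon> \<le> 0" "(t - (1 - 2 * \<epsilon>)) / \<epsilon> \<le> 0" using 1 \<epsilon> by (auto simp: divide_le_0_iff)
        then show ?thesis unfolding \<eta>_def \<eta>0_def \<eta>1_def by (simp add: smooth_step_0)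
      next
        case 2
        have "1 \<le> (t - \<epsilon>) / \<epsilon>" "1 \<le> (t - (1 - 2 * \<epsilon>)) / \<epsilon>" using 2 \<epsilon> by (auto simp: field_simps)
        then show ?thesis unfolding \<eta>_def \<eta>0_def \<eta>1_def by (simp add: smooth_step_1)
      qed
      then show False using that by simp
    qed
    define \<phi> where "\<phi> z = \<eta> (fst z) * \<psi> (snd z)" for z :: "real \<times> (real^'d)"
    define \<phi>' where "\<phi>' z = (h0 (fst z) - h1 (fst z)) * \<psi> (snd z)" for z :: "real \<times> (real^'d)"
    define D' where "D' z = \<eta> (fst z) *\<^sub>R D (snd z)" for z :: "real \<times> (real^'d)"
    define g' where "g' z = \<eta> (fst z) *\<^sub>R g (snd z)" for z :: "real \<times> (real^'d)"
    have \<eta>d: "(\<eta> has_real_derivative (h0 t - h1 t)) (at t)" for t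
      unfolding \<eta>_def[abs_def] by (intro DERIV_diff d0 d1)
    have \<eta>c: "continuous_on S \<eta>" for S
      by (rule continuous_at_imp_continuous_on) (use \<eta>d DERIV_isCont in blast)
    have comp: "continuous_on S (\<lambda>z. u (fst z))" if "continuous_on UNIV u" for u :: "real \<Rightarrow> real" and S :: "(real \<times> (real^'d)) set"
      by (rule continuous_on_compose2[OF that]) (auto intro: continuous_intros)
    have comp': "continuous_on S (\<lambda>z. u (snd z))" if "continuous_on UNIV u" for u :: "real^'d \<Rightarrow> 'z::topological_space" and S :: "(real \<times> (real^'d)) set"
      by (rule continuous_on_compose2[OF that]) (auto intro: continuous_intros)
    obtain C\<psi> where C\<psi>: "\<And>x. \<bar>\<psi> x\<bar> \<le> C\<psi>" using b\<psi> by (auto simp: bounded_iff)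
    obtain CD where CD: "\<And>x. norm (D x) \<le> CD" using bD by (auto simp: bounded_iff)
    have test: "C12b_test \<phi> \<phi>' D'"
      unfolding C12b_test_def
    proof (intro conjI exI[of _ g'] ballI allI)
      fix t x
      show "((\<lambda>s. \<phi> (s, x)) has_real_derivative \<phi>' (t, x)) (at t)"
        unfolding \<phi>_def \<phi>'_def by (auto intro!: DERIV_cmult_right \<eta>d)
      show "((\<lambda>y. \<phi> (t, y)) has_derivative (\<lambda>h. g' (t, x) \<bullet> h)) (at x)"
        unfolding \<phi>_def g'_def by (auto intro!: has_derivative_mult_right C2(1))
      show "((\<lambda>y. g' (t, y)) has_derivative (\<lambda>h. D' (t, x) *v h)) (at x)"
        unfolding D'_def g'_def by (auto simp: scaleR_matrix_vector_assoc[symmetric] intro!: has_derivative_scaleR_right C2(2))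
    next
      show "continuous_on time_strip \<phi>'" unfolding \<phi>'_def
        by (intro continuous_on_mult continuous_on_diff comp comp' ch C2(5))
      show "continuous_on time_strip g'" unfolding g'_def
        by (intro continuous_on_scaleR comp comp' \<eta>c C2(4))
      show "continuous_on time_strip D'" unfolding D'_def
        by (intro continuous_on_scaleR comp comp' \<eta>c C2(3))
      show "bounded (\<phi>' ` time_strip)" unfolding bounded_iff
      proof (intro exI ballI)
        fix y assume "y \<in> \<phi>' ` time_strip"
        then obtain z where y: "y = (h0 (fst z) - h1 (fst z)) * \<psi> (snd z)" unfolding \<phi>'_def by auto
        have "\<bar>h0 (fst z) - h1 (fst z)\<bar> \<le> 2 / \<epsilon>" using hb[of "fst z"] by (auto simp: abs_le_iff)
        then show "norm y \<le> 2 / \<epsilon> * C\<psi>" unfolding y real_norm_def abs_mult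
          by (rule mult_mono) (use C\<psi>[of "snd z"] \<epsilon> in auto)
      qed
      show "bounded (D' ` time_strip)" unfolding bounded_iff
      proof (intro exI ballI)
        fix y assume "y \<in> D' ` time_strip"
        then obtain z where y: "y = \<eta> (fst z) *\<^sub>R D (snd z)" unfolding D'_def by auto
        have "norm y = \<eta> (fst z) * norm (D (snd z))" unfolding y using \<eta>b(1)[of "fst z"] by simp
        also have "\<dots> \<le> 1 * norm (D (snd z))" by (rule mult_right_mono) (use \<eta>b in auto)
        finally show "norm y \<le> CD" using CD[of "snd z"] by simp
      qed
      have "closure {z \<in> time_strip. \<phi> z \<noteq> 0} \<subseteq> {\<epsilon>..1 - \<epsilon>} \<times> UNIV"
        by (rule closure_minimal) (use \<eta>supp in \<open>auto simp: \<phi>_def intro: closed_Times\<close>)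
      also have "\<dots> \<subseteq> time_strip" using \<epsilon> by auto
      finally show "closure {z \<in> time_strip. \<phi> z \<noteq> 0} \<subseteq> time_strip" .
    qed
    have "(LINT t|unit_time. LINT x|r t. \<phi>' (t, x)) = - (LINT t|unit_time. integral_matrix borel (\<lambda>x. (1/2) *\<^sub>R D' (t, x)) (l t))"
      using FP test unfolding FP_solution_def by blast
    then have eq: "- (LINT t|unit_time. (h0 t - h1 t) * \<Psi> t) = (LINT t|unit_time. integral_matrix borel (\<lambda>x. (1/2) *\<^sub>R (\<eta> t *\<^sub>R D x)) (l t))"
      unfolding \<phi>'_def D'_def \<Psi>_def by simp
    have "ennreal (LINT t|unit_time. integral_matrix borel (\<lambda>x. (1/2) *\<^sub>R (\<eta> t *\<^sub>R D x)) (l t)) \<le> FP_cost f l"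
      unfolding FP_cost_def
      by (intro ennreal_integral_le_nn_integral AE_I2 polar_le \<eta>b) (simp add: space_restrict_space)
    moreover have "\<Psi> 1 - \<Psi> 0 - 2 * \<delta> \<le> - (LINT t|unit_time. (h0 t - h1 t) * \<Psi> t)"
    proof -
      have c\<Psi>: "continuous_on {0<..<1} \<Psi>" by (rule continuous_on_subset[OF \<Psi>c]) auto
      have i0: "integrable unit_time h0" "integrable unit_time h1"
        using hb by (auto intro!: unit_time_integrable[of _ "2 / \<epsilon>"] ch simp: abs_le_iff intro: order_trans[of _ 0])
      have ih: "integrable unit_time (\<lambda>t. h0 t * \<Psi> t)" "integrable unit_time (\<lambda>t. h1 t * \<Psi> t)"
      proof -
        have hC: "\<bar>h t * \<Psi> t\<bar> \<le> 2 / \<epsilon> * C" if "0 \<le> h t" "h t \<le> 2 / \<epsilon>" "t \<in> {0<..<1}" for h t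
          unfolding abs_mult
        proof (rule mult_mono)
          show "\<bar>h t\<bar> \<le> 2 / \<epsilon>" using that by simp
          show "\<bar>\<Psi> t\<bar> \<le> C" using C[of t] that by simp
        qed (use \<epsilon> in simp_all)
        have "\<bar>h0 t * \<Psi> t\<bar> \<le> 2 / \<epsilon> * C" "\<bar>h1 t * \<Psi> t\<bar> \<le> 2 / \<epsilon> * C" if "t \<in> {0<..<1}" for t
          using hC[OF hb(1,2) that] hC[OF hb(3,4) that] by simp_all
        note hC2 = this
        show "integrable unit_time (\<lambda>t. h0 t * \<Psi> t)"
          by (rule unit_time_integrable[OF continuous_on_mult[OF ch(1) c\<Psi>] hC2(1)])
        show "integrable unit_time (\<lambda>t. h1 t * \<Psi> t)"
          by (rule unit_time_integrable[OF continuous_on_mult[OF ch(2) c\<Psi>] hC2(2)])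
      qed
      have one: "(LINT t|unit_time. h0 t) = 1" "(LINT t|unit_time. h1 t) = 1"
      proof -
        have "(0 - \<epsilon>) / \<epsilon> \<le> 0" "1 \<le> (1 - \<epsilon>) / \<epsilon>" "(0 - (1 - 2 * \<epsilon>)) / \<epsilon> \<le> 0" "1 \<le> (1 - (1 - 2 * \<epsilon>)) / \<epsilon>"
          using \<epsilon> by (auto simp: field_simps divide_le_0_iff)
        then have "\<eta>0 1 - \<eta>0 0 = 1" "\<eta>1 1 - \<eta>1 0 = 1" unfolding \<eta>0_def \<eta>1_def by (simp_all only: smooth_step_0 smooth_step_1)
        then show "(LINT t|unit_time. h0 t) = 1" "(LINT t|unit_time. h1 t) = 1"
          using unit_time_FTC[OF ch(1) d0] unit_time_FTC[OF ch(2) d1] by simp_all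
      qed
      have "(LINT t|unit_time. h0 t * \<Psi> t) \<le> (LINT t|unit_time. h0 t * (\<Psi> 0 + \<delta>))"
      proof (rule integral_mono[OF ih(1) integrable_mult_left[OF i0(1)]])
        fix t
        show "h0 t * \<Psi> t \<le> h0 t * (\<Psi> 0 + \<delta>)"
        proof (cases "h0 t = 0")
          case False
          then have "t \<in> {0..1}" "dist t 0 < d" using supp0[OF False] \<epsilon> by (auto simp: dist_real_def)
          then have "\<Psi> t \<le> \<Psi> 0 + \<delta>" using d(2)[of 0 t] by (auto simp: dist_real_def)
          then show ?thesis by (rule mult_left_mono) (rule hb)
        qed simp
      qed
      also have "\<dots> = \<Psi> 0 + \<delta>" using one by simp
      finally have A: "(LINT t|unit_time. h0 t * \<Psi> t) \<le> \<Psi> 0 + \<delta>" .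
      have "(LINT t|unit_time. h1 t * (\<Psi> 1 - \<delta>)) \<le> (LINT t|unit_time. h1 t * \<Psi> t)"
      proof (rule integral_mono[OF integrable_mult_left[OF i0(2)] ih(2)])
        fix t
        show "h1 t * (\<Psi> 1 - \<delta>) \<le> h1 t * \<Psi> t"
        proof (cases "h1 t = 0")
          case False
          then have "t \<in> {0..1}" "dist t 1 < d" using supp1[OF False] \<epsilon> by (auto simp: dist_real_def)
          then have "\<Psi> 1 - \<delta> \<le> \<Psi> t" using d(2)[of 1 t] by (auto simp: dist_real_def)
          then show ?thesis by (rule mult_left_mono) (rule hb)
        qed simp
      qed
      then have B: "\<Psi> 1 - \<delta> \<le> (LINT t|unit_time. h1 t * \<Psi> t)" using one by simp
      have "(LINT t|unit_time. (h0 t - h1 t) * \<Psi> t) = (LINT t|unit_time. h0 t * \<Psi> t) - (LINT t|unit_time. h1 t * \<Psi> t)"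
        using ih by (simp add: left_diff_distrib)
      then show ?thesis using A B by linarith
    qed
    ultimately show ?thesis unfolding eq by (blast intro: order_trans ennreal_leI)
  qed
  have "(\<lambda>n. 1 / real (Suc n)) \<longlonglongrightarrow> 0" by (rule LIMSEQ_Suc[OF lim_const_over_n])
  then have "(\<lambda>n. \<Psi> 1 - \<Psi> 0 - 2 * (1 / real (Suc n))) \<longlonglongrightarrow> \<Psi> 1 - \<Psi> 0 - 2 * 0"
    by (intro tendsto_diff tendsto_mult tendsto_const)
  from tendsto_ennrealI[OF this] have "ennreal (\<Psi> 1 - \<Psi> 0 - 2 * 0) \<le> FP_cost f l"
  proof (rule LIMSEQ_le_const2)
    have "ennreal (\<Psi> 1 - \<Psi> 0 - 2 * (1 / real (Suc n))) \<le> FP_cost f l" for n by (rule key) simp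
    then show "\<exists>N. \<forall>n\<ge>N. ennreal (\<Psi> 1 - \<Psi> 0 - 2 * (1 / real (Suc n))) \<le> FP_cost f l" by blast
  qed
  then show ?thesis unfolding \<Psi>_def by simp
qed

lemma potential_gap_le_dyn_cost:
  assumes "\<psi> \<in> potentials 1"
  shows "ennreal ((LINT x|\<nu>. \<psi> x) - (LINT x|\<mu>. \<psi> x)) \<le> dyn_cost f \<mu> \<nu>"
  unfolding dyn_cost_def by (rule Inf_greatest) (use potential_gap_le_FP_cost[OF _ _ assms] in blast)

end

section \<open>Test functions\<close>

lemma C12b_test_slice:
  assumes test: "C12b_test \<phi> \<phi>' D"
  obtains g where "\<And>t. t \<in> {0<..<1} \<Longrightarrow> C2_map (\<lambda>x. \<phi> (t, x)) (\<lambda>x. g (t, x)) (\<lambda>x. D (t, x))"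
proof -
  obtain g where g: "\<And>t x. t \<in> {0<..<1} \<Longrightarrow> ((\<lambda>y. \<phi> (t, y)) has_derivative (\<lambda>h. g (t, x) \<bullet> h)) (at x)"
      "\<And>t x. t \<in> {0<..<1} \<Longrightarrow> ((\<lambda>y. g (t, y)) has_derivative (\<lambda>h. D (t, x) *v h)) (at x)"
    and D: "continuous_on time_strip D" using test unfolding C12b_test_def by blast
  have "continuous_on UNIV (\<lambda>x. D (t, x))" if "t \<in> {0<..<1}" for t
    by (rule continuous_on_compose2[OF D]) (use that in \<open>auto intro!: continuous_intros\<close>)
  then show thesis using g by (intro that[of g]) (auto simp: C2_map_def)
qed

text \<open>Along each vertical line a test function vanishes near both end times, so that it extends by
  zero to a continuously differentiable function on the whole line.\<close>

lemma C12b_test_line: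
  fixes \<phi> :: "real \<times> (real^'d) \<Rightarrow> real"
  assumes test: "C12b_test \<phi> \<phi>' D"
  shows "((\<lambda>t. if t \<in> {0<..<1} then \<phi> (t, x) else 0) has_real_derivative
      (if t \<in> {0<..<1} then \<phi>' (t, x) else 0)) (at t)"
    and "continuous_on UNIV (\<lambda>t. if t \<in> {0<..<1} then \<phi>' (t, x) else 0)"
proof -
  let ?u = "\<lambda>t. if t \<in> {0<..<1} then \<phi> (t, x) else 0"
  let ?v = "\<lambda>t. if t \<in> {0<..<1} then \<phi>' (t, x) else 0"
  have d: "((\<lambda>s. \<phi> (s, x)) has_real_derivative \<phi>' (t, x)) (at t)" if "t \<in> {0<..<1}" for t
    using test that unfolding C12b_test_def by blast
  have c\<phi>': "continuous_on time_strip \<phi>'" using test unfolding C12b_test_def by blast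
  let ?S = "{z \<in> time_strip. \<phi> z \<noteq> 0}"
  have cl: "closure ?S \<subseteq> time_strip" using test unfolding C12b_test_def by blast
  have near: "\<exists>\<epsilon>>0. \<forall>t. \<bar>t - t0\<bar> < \<epsilon> \<longrightarrow> ?u t = 0" if t0: "t0 \<notin> {0<..<1}" for t0
  proof -
    have m: "(t0, x) \<in> - closure ?S" using cl t0 by blast
    obtain \<epsilon> where e: "\<epsilon> > 0" "ball (t0, x) \<epsilon> \<subseteq> - closure ?S"
      using openE[OF open_Compl[OF closed_closure] m] by blast
    have "?u t = 0" if "\<bar>t - t0\<bar> < \<epsilon>" for t
    proof (rule ccontr)
      assume nz: "?u t \<noteq> 0"
      then have "t \<in> {0<..<1}" by (auto split: if_splits)
      with nz have "(t, x) \<in> ?S" by simp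
      then have "(t, x) \<in> closure ?S" by (rule subsetD[OF closure_subset])
      moreover have "(t, x) \<in> ball (t0, x) \<epsilon>" using that by (simp add: dist_Pair_Pair dist_real_def abs_minus_commute)
      ultimately show False using e by blast
    qed
    then show ?thesis using e by blast
  qed
  have der: "(?u has_real_derivative ?v t) (at t)" for t
  proof (cases "t \<in> {0<..<1}")
    case True
    have "(?u has_real_derivative \<phi>' (t, x)) (at t)"
      by (rule has_field_derivative_transform_within_open[OF d[OF True], of "{0<..<1}"]) (use True in auto)
    then show ?thesis by (simp only: True if_True)
  next
    case False
    then obtain \<epsilon> where e: "\<epsilon> > 0" "\<And>s. \<bar>s - t\<bar> < \<epsilon> \<Longrightarrow> ?u s = 0" using near by blast
    have "((\<lambda>_. 0) has_real_derivative 0) (at t)" by simp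
    then have "(?u has_real_derivative 0) (at t)"
    proof (rule has_field_derivative_transform_within_open[of _ _ _ "ball t \<epsilon>"])
      show "0 = ?u s" if "s \<in> ball t \<epsilon>" for s using e(2)[of s] that by (simp add: dist_real_def abs_minus_commute)
    qed (use e in auto)
    then show ?thesis by (simp only: False if_False)
  qed
  then show "(?u has_real_derivative ?v t) (at t)" .
  show "continuous_on UNIV ?v"
    unfolding continuous_on_eq_continuous_at[OF open_UNIV]
  proof
    fix t
    show "isCont ?v t"
    proof (cases "t \<in> {0<..<1}")
      case True
      have "continuous_on {0<..<1} (\<lambda>t. \<phi>' (t, x))"
        by (rule continuous_on_compose2[OF c\<phi>']) (auto intro!: continuous_intros)
      then have "continuous_on {0<..<1} ?v" by (rule continuous_on_eq) simp
      then show ?thesis using True by (simp add: continuous_on_eq_continuous_at)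
    next
      case False
      then obtain \<epsilon> where e: "\<epsilon> > 0" "\<And>s. \<bar>s - t\<bar> < \<epsilon> \<Longrightarrow> ?u s = 0" using near by blast
      have "?v s = 0" if s: "s \<in> ball t \<epsilon>" for s
      proof -
        have "((\<lambda>_. 0) has_real_derivative 0) (at s)" by simp
        then have "(?u has_real_derivative 0) (at s)"
        proof (rule has_field_derivative_transform_within_open[of _ _ _ "ball t \<epsilon>"])
          show "0 = ?u r" if "r \<in> ball t \<epsilon>" for r using e(2)[of r] that by (simp add: dist_real_def abs_minus_commute)
        qed (use s in auto)
        then show ?thesis using DERIV_unique der by blast
      qed
      then have "continuous_on (ball t \<epsilon>) ?v" by (subst continuous_on_cong[OF refl, of _ _ "\<lambda>_. 0"]) auto
      then show ?thesis using e(1) by (simp add: continuous_on_eq_continuous_at)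
    qed
  qed
qed

text \<open>The function itself is bounded, since it vanishes at time zero and has a bounded time derivative.\<close>

lemma C12b_test_bounds:
  fixes \<phi> :: "real \<times> (real^'d) \<Rightarrow> real"
  assumes test: "C12b_test \<phi> \<phi>' D"
  obtains C where "C \<ge> 0" "\<And>z. z \<in> time_strip \<Longrightarrow> \<bar>\<phi>' z\<bar> \<le> C" "\<And>z. z \<in> time_strip \<Longrightarrow> norm (D z) \<le> C"
    "\<And>z. z \<in> time_strip \<Longrightarrow> \<bar>\<phi> z\<bar> \<le> C"
    "\<And>t s x. t \<in> {0<..<1} \<Longrightarrow> s \<in> {0<..<1} \<Longrightarrow> \<bar>\<phi> (t, x) - \<phi> (s, x)\<bar> \<le> C * \<bar>t - s\<bar>"
proof -
  have "bounded (\<phi>' ` time_strip)" "bounded (D ` time_strip)" using test unfolding C12b_test_def by blast+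
  then obtain C1 C2 where C1: "\<forall>y\<in>\<phi>' ` time_strip. norm y \<le> C1" and C2: "\<forall>y\<in>D ` time_strip. norm y \<le> C2"
    unfolding bounded_iff by blast
  define C where "C = max 0 (max C1 C2)"
  have C: "C \<ge> 0" "C1 \<le> C" "C2 \<le> C" unfolding C_def by auto
  have b1: "\<bar>\<phi>' z\<bar> \<le> C" if "z \<in> time_strip" for z
  proof -
    have "norm (\<phi>' z) \<le> C1" using C1 that by blast
    then show ?thesis using C by simp
  qed
  have b2: "norm (D z) \<le> C" if "z \<in> time_strip" for z
  proof -
    have "norm (D z) \<le> C2" using C2 that by blast
    then show ?thesis using C by simp
  qed
  have lip: "\<bar>(if t \<in> {0<..<1} then \<phi> (t, x) else 0) - (if s \<in> {0<..<1} then \<phi> (s, x) else 0)\<bar> \<le> C * \<bar>t - s\<bar>" for t s x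
  proof -
    have "norm ((if t \<in> {0<..<1} then \<phi> (t, x) else 0) - (if s \<in> {0<..<1} then \<phi> (s, x) else 0)) \<le> C * norm (t - s)"
    proof (rule field_differentiable_bound[where S=UNIV])
      show "((\<lambda>t. if t \<in> {0<..<1} then \<phi> (t, x) else 0) has_field_derivative (if r \<in> {0<..<1} then \<phi>' (r, x) else 0)) (at r within UNIV)" for r
        using C12b_test_line(1)[OF test, of x r] by simp
      show "norm (if r \<in> {0<..<1} then \<phi>' (r, x) else 0) \<le> C" for r using b1[of "(r, x)"] C by simp
    qed auto
    then show ?thesis by simp
  qed
  show thesis
  proof (rule that[OF C(1) b1 b2])
    show "\<bar>\<phi> z\<bar> \<le> C" if zs: "z \<in> time_strip" for z
    proof -
      obtain t x where "z = (t, x)" by (cases z)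
      then have z: "z = (t, x)" "t \<in> {0<..<1}" using zs by auto
      have "\<bar>\<phi> (t, x)\<bar> \<le> C * \<bar>t\<bar>" using lip[of t x 0] z(2) by simp
      also have "\<dots> \<le> C * 1" by (rule mult_left_mono) (use z C in auto)
      finally show ?thesis using z by simp
    qed
    show "\<bar>\<phi> (t, x) - \<phi> (s, x)\<bar> \<le> C * \<bar>t - s\<bar>" if "t \<in> {0<..<1}" "s \<in> {0<..<1}" for t s x
      using lip[of t x s] that by simp
  qed
qed

lemma C12b_test_continuous:
  fixes \<phi> :: "real \<times> (real^'d) \<Rightarrow> real"
  assumes test: "C12b_test \<phi> \<phi>' D"
  shows "continuous_on time_strip \<phi>"
proof -
  from C12b_test_bounds[OF test] obtain C where C: "C \<ge> 0"
    and lip: "\<And>t s x. t \<in> {0<..<1} \<Longrightarrow> s \<in> {0<..<1} \<Longrightarrow> \<bar>\<phi> (t, x) - \<phi> (s, x)\<bar> \<le> C * \<bar>t - s\<bar>" by metis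
  from C12b_test_slice[OF test] obtain g
    where g: "\<And>t. t \<in> {0<..<1} \<Longrightarrow> C2_map (\<lambda>x. \<phi> (t, x)) (\<lambda>x. g (t, x)) (\<lambda>x. D (t, x))" by blast
  show ?thesis unfolding continuous_on_def
  proof
    fix z :: "real \<times> (real^'d)" assume z: "z \<in> time_strip"
    obtain s y where sy1: "z = (s, y)" by (cases z)
    then have sy: "z = (s, y)" "s \<in> {0<..<1}" using z by auto
    have "isCont (\<lambda>x. \<phi> (s, x)) y"
      using C2_mapD(5)[OF g[OF sy(2)]] by (simp add: continuous_on_eq_continuous_at)
    then have "((\<lambda>w. \<phi> (s, snd w)) \<longlongrightarrow> \<phi> (s, snd z)) (at z within time_strip)"
      using sy by (intro isCont_tendsto_compose[where g="\<lambda>x. \<phi> (s, x)"] tendsto_snd tendsto_ident_at) auto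
    moreover have "((\<lambda>w. \<phi> w - \<phi> (s, snd w)) \<longlongrightarrow> 0) (at z within time_strip)"
    proof (rule Lim_null_comparison)
      show "\<forall>\<^sub>F w in at z within time_strip. norm (\<phi> w - \<phi> (s, snd w)) \<le> C * \<bar>fst w - s\<bar>"
        using lip sy(2) by (auto simp: eventually_at_filter intro!: always_eventually)
      have "((\<lambda>w. C * \<bar>fst w - s\<bar>) \<longlongrightarrow> C * \<bar>fst z - s\<bar>) (at z within time_strip)" by (intro tendsto_intros)
      then show "((\<lambda>w. C * \<bar>fst w - s\<bar>) \<longlongrightarrow> 0) (at z within time_strip)" using sy by simp
    qed
    ultimately have "((\<lambda>w. \<phi> (s, snd w) + (\<phi> w - \<phi> (s, snd w))) \<longlongrightarrow> \<phi> (s, snd z) + 0) (at z within time_strip)"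
      by (rule tendsto_add)
    then show "(\<phi> \<longlongrightarrow> \<phi> z) (at z within time_strip)" using sy by simp
  qed
qed

text \<open>The weights \<open>t\<close> and \<open>1 - t\<close> are the densities of the two end measures along the segment from one to
  the other.\<close>

lemma C12b_test_by_parts:
  fixes \<phi> :: "real \<times> (real^'d) \<Rightarrow> real"
  assumes test: "C12b_test \<phi> \<phi>' D"
  shows "(LINT t|unit_time. t * \<phi>' (t, x)) = - (LINT t|unit_time. \<phi> (t, x))"
    and "(LINT t|unit_time. (1 - t) * \<phi>' (t, x)) = (LINT t|unit_time. \<phi> (t, x))"
proof -
  define u where "u t = (if t \<in> {0<..<1} then \<phi> (t, x) else 0)" for t
  define v where "v t = (if t \<in> {0<..<1} then \<phi>' (t, x) else 0)" for t
  have du: "(u has_real_derivative v t) (at t)" for t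
    using C12b_test_line(1)[OF test, of x t] by (simp only: u_def[abs_def] v_def)
  have cv: "continuous_on S v" for S
    unfolding v_def[abs_def] by (rule continuous_on_subset[OF C12b_test_line(2)[OF test]]) simp
  have cu: "continuous_on S u" for S
    by (rule continuous_at_imp_continuous_on, rule ballI, rule DERIV_isCont[OF du])
  have F1: "(LINT t|unit_time. v t) = 0"
    using unit_time_FTC[OF cv du] by (simp add: u_def)
  have F2: "(LINT t|unit_time. u t + t * v t) = 0"
  proof -
    have "((\<lambda>t. t * u t) has_real_derivative u t + t * v t) (at t)" for t
      using du[of t] by (auto intro!: derivative_eq_intros)
    then have "(LINT t|unit_time. u t + t * v t) = 1 * u 1 - 0 * u 0"
      by (intro unit_time_FTC continuous_on_add continuous_on_mult continuous_on_id cu cv)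
    then show ?thesis by (simp add: u_def)
  qed
  have bnd: "\<exists>C. \<forall>t\<in>{0<..<1}. \<bar>w t\<bar> \<le> C" if "continuous_on {0..1} w" for w :: "real \<Rightarrow> real"
  proof -
    have "bounded (w ` {0..1})" by (intro compact_imp_bounded compact_continuous_image that) simp
    then obtain C where "\<forall>y\<in>w ` {0..1}. norm y \<le> C" unfolding bounded_iff ..
    then show ?thesis by (intro exI[of _ C]) auto
  qed
  have int: "integrable unit_time w" if cw: "continuous_on {0..1} w" for w :: "real \<Rightarrow> real"
  proof -
    obtain C where "\<forall>t\<in>{0<..<1}. \<bar>w t\<bar> \<le> C" using bnd[OF cw] by blast
    then show ?thesis by (intro unit_time_integrable[of _ C] continuous_on_subset[OF cw]) auto
  qed
  have "(LINT t|unit_time. u t) + (LINT t|unit_time. t * v t) = 0"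
    using F2 by (subst (asm) Bochner_Integration.integral_add) (auto intro!: int continuous_intros cu cv)
  moreover have eqv: "(LINT t|unit_time. w t * \<phi>' (t, x)) = (LINT t|unit_time. w t * v t)" for w
    by (rule Bochner_Integration.integral_cong) (auto simp: v_def space_restrict_space)
  moreover have equ: "(LINT t|unit_time. \<phi> (t, x)) = (LINT t|unit_time. u t)"
    by (rule Bochner_Integration.integral_cong) (auto simp: u_def space_restrict_space)
  ultimately show A: "(LINT t|unit_time. t * \<phi>' (t, x)) = - (LINT t|unit_time. \<phi> (t, x))" by simp
  have "(LINT t|unit_time. (1 - t) * v t) = (LINT t|unit_time. v t) - (LINT t|unit_time. t * v t)"
    by (subst Bochner_Integration.integral_diff[symmetric]) (auto intro!: int continuous_intros cu cv simp: left_diff_distrib)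
  then show "(LINT t|unit_time. (1 - t) * \<phi>' (t, x)) = (LINT t|unit_time. \<phi> (t, x))"
    using A F1 eqv[of "\<lambda>t. 1 - t"] eqv[of "\<lambda>t. t"] by simp
qed

lemma C2_map_local_zero:
  assumes C2: "C2_map \<psi> g D" and U: "open U" "x \<in> U" and zero: "\<And>y. y \<in> U \<Longrightarrow> \<psi> y = 0"
  shows "g x = 0" "D x = 0"
proof -
  have gz: "g y = 0" if y: "y \<in> U" for y
  proof -
    have "((\<lambda>_. 0) has_derivative (\<lambda>h. g y \<bullet> h)) (at y)"
      by (rule has_derivative_transform_within_open[OF C2_mapD(1)[OF C2] U(1) y]) (use zero in auto)
    then have "(\<lambda>h. g y \<bullet> h) = (\<lambda>h. 0)" using has_derivative_unique has_derivative_const by blast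
    then have "g y \<bullet> g y = 0" by metis
    then show ?thesis by simp
  qed
  then show "g x = 0" using U by blast
  have "((\<lambda>_. 0) has_derivative (\<lambda>h. D x *v h)) (at x)"
    by (rule has_derivative_transform_within_open[OF C2_mapD(2)[OF C2] U]) (use gz in auto)
  then have "(\<lambda>h. D x *v h) = (\<lambda>h. 0)" using has_derivative_unique has_derivative_const by blast
  then have "D x *v h = 0 *v h" for h by (metis matrix_vector_mult_0)
  then show "D x = 0" unfolding matrix_eq by blast
qed

lemma C2_map_Hessian_support:
  assumes C2: "C2_map \<psi> g D" and supp: "bounded {x. \<psi> x \<noteq> 0}"
  shows "bounded {x. D x \<noteq> 0}" "bounded (range D)"
proof -
  have sub: "{x. D x \<noteq> 0} \<subseteq> closure {x. \<psi> x \<noteq> 0}"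
  proof (rule ccontr)
    assume "\<not> ?thesis"
    then obtain x where x: "D x \<noteq> 0" "x \<in> - closure {x. \<psi> x \<noteq> 0}" by blast
    have "D x = 0"
    proof (rule C2_map_local_zero(2)[OF C2 _ x(2)])
      show "\<psi> y = 0" if "y \<in> - closure {x. \<psi> x \<noteq> 0}" for y using that closure_subset[of "{x. \<psi> x \<noteq> 0}"] by blast
    qed (rule open_Compl[OF closed_closure])
    then show False using x by simp
  qed
  show "bounded {x. D x \<noteq> 0}" by (rule bounded_subset[OF bounded_closure[OF supp] sub])
  have "compact (closure {x. \<psi> x \<noteq> 0})" using supp by simp
  then have "bounded (insert 0 (D ` closure {x. \<psi> x \<noteq> 0}))"
    by (simp add: compact_imp_bounded compact_continuous_image continuous_on_subset[OF C2_mapD(3)[OF C2]])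
  moreover have "range D \<subseteq> insert 0 (D ` closure {x. \<psi> x \<noteq> 0})" using sub by blast
  ultimately show "bounded (range D)" by (rule bounded_subset)
qed

section \<open>Measures with prescribed integrals\<close>

text \<open>The measure does not charge the complement of the closed set \<open>X\<close>, because compactly supported
  functions that vanish on \<open>X\<close> have mean zero.  The support of a test function is then only
  relevant within \<open>X\<close>.\<close>

lemma measure_of_mean_closed:
  fixes L :: "('a::euclidean_space \<Rightarrow> real) \<Rightarrow> real"
  assumes L: "mean_on X L" and X: "closed X" "X \<noteq> {}"
  obtains m where "finite_measure m" "sets m = sets borel" "AE z in m. z \<in> X"
    "\<And>u. continuous_on UNIV u \<Longrightarrow> u \<in> bdd_on X \<Longrightarrow> bounded {z \<in> X. u z \<noteq> 0} \<Longrightarrow> L u = (LINT z|m. u z)"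
proof -
  from measure_of_mean[OF L] obtain m where sp: "subprob_space m" and sm: "sets m = sets borel"
    and rep: "\<And>\<psi>. continuous_on UNIV \<psi> \<Longrightarrow> bounded {y. \<psi> y \<noteq> 0} \<Longrightarrow> L \<psi> = (LINT y|m. \<psi> y)" by blast
  interpret subprob_space m by (rule sp)
  have meas: "u \<in> borel_measurable m" if "continuous_on UNIV u" for u :: "'a \<Rightarrow> real"
    using borel_measurable_continuous_onI[OF that] sm by (simp cong: measurable_cong_sets)
  have L_eq: "L u = L v" if "u \<in> bdd_on X" "v \<in> bdd_on X" "\<And>x. x \<in> X \<Longrightarrow> u x = v x" for u v
    by (intro antisym mean_on_mono[OF L] that) (simp_all add: that)
  define \<zeta> where "\<zeta> R z = max 0 (min 1 (R + 1 - norm z))" for R :: real and z :: 'a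
  have c\<zeta>: "continuous_on S (\<zeta> R)" for S R unfolding \<zeta>_def by (intro continuous_intros)
  have \<zeta>b: "0 \<le> \<zeta> R z" "\<zeta> R z \<le> 1" for R z unfolding \<zeta>_def by auto
  have \<zeta>1: "\<zeta> R z = 1" if "norm z \<le> R" for R z using that unfolding \<zeta>_def by simp
  have supp: "bounded {z. u z * \<zeta> R z \<noteq> 0}" for u R
  proof (rule bounded_subset[OF bounded_cball[of 0 "R + 1"]], rule subsetI)
    fix z assume "z \<in> {z. u z * \<zeta> R z \<noteq> 0}"
    then show "z \<in> cball 0 (R + 1)" unfolding \<zeta>_def by (auto simp: max_def min_def split: if_splits)
  qed
  define \<beta> where "\<beta> z = min 1 (infdist z X)" for z
  have c\<beta>: "continuous_on S \<beta>" for S unfolding \<beta>_def by (intro continuous_intros)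
  have \<beta>b: "0 \<le> \<beta> z" "\<beta> z \<le> 1" for z unfolding \<beta>_def using infdist_nonneg[of z X] by auto
  have "AE z in m. \<beta> z * \<zeta> (real R) z = 0" for R :: nat
  proof -
    have cu: "continuous_on UNIV (\<lambda>z. \<beta> z * \<zeta> (real R) z)" by (intro continuous_on_mult c\<beta> c\<zeta>)
    have "\<beta> z * \<zeta> (real R) z = 0" if "z \<in> X" for z
      using that unfolding \<beta>_def by simp
    then have "L (\<lambda>z. \<beta> z * \<zeta> (real R) z) = L (\<lambda>z. 0)"
      by (intro L_eq bdd_onI[of _ _ 0]) auto
    then have "(LINT z|m. \<beta> z * \<zeta> (real R) z) = 0"
      using rep[OF cu supp] mean_on_const[OF L, of 0] by simp
    moreover have "integrable m (\<lambda>z. \<beta> z * \<zeta> (real R) z)"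
      by (rule integrable_const_bound[of _ 1]) (use \<beta>b \<zeta>b meas[OF cu] in \<open>auto simp: abs_mult intro!: mult_le_one\<close>)
    ultimately show ?thesis
      by (subst (asm) integral_nonneg_eq_0_iff_AE) (use \<beta>b \<zeta>b in auto)
  qed
  then have "AE z in m. \<forall>R::nat. \<beta> z * \<zeta> (real R) z = 0" by (subst AE_all_countable) blast
  then have AEX: "AE z in m. z \<in> X"
  proof eventually_elim
    case (elim z)
    obtain R :: nat where "norm z \<le> real R" using real_arch_simple by blast
    then have "\<beta> z = 0" using elim \<zeta>1[of z "real R"] by (metis mult.right_neutral)
    then have "infdist z X = 0" unfolding \<beta>_def by (auto simp: min_def split: if_splits)
    then show ?case using in_closed_iff_infdist_zero[OF X] by simp
  qed
  show thesis
  proof (rule that[OF _ sm AEX])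
    show "finite_measure m" by unfold_locales
    fix u :: "'a \<Rightarrow> real" assume u: "continuous_on UNIV u" "u \<in> bdd_on X" "bounded {z \<in> X. u z \<noteq> 0}"
    obtain R where R: "\<And>z. z \<in> X \<Longrightarrow> u z \<noteq> 0 \<Longrightarrow> norm z \<le> R" using u(3) by (auto simp: bounded_iff)
    have eq: "u z * \<zeta> R z = u z" if "z \<in> X" for z using R[OF that] \<zeta>1 by (cases "u z = 0") auto
    have cu: "continuous_on UNIV (\<lambda>z. u z * \<zeta> R z)" by (intro continuous_on_mult u c\<zeta>)
    have "L u = L (\<lambda>z. u z * \<zeta> R z)"
    proof (rule L_eq[OF u(2)])
      show "(\<lambda>z. u z * \<zeta> R z) \<in> bdd_on X"
        by (rule bdd_on_mult[OF u(2)]) (rule bdd_onI[of _ _ 1], use \<zeta>b in simp)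
    qed (simp add: eq)
    also have "\<dots> = (LINT z|m. u z * \<zeta> R z)" by (rule rep[OF cu supp])
    also have "\<dots> = (LINT z|m. u z)"
      by (rule integral_cong_AE[OF meas[OF cu] meas[OF u(1)]]) (use AEX in eventually_elim, rule eq)
    finally show "L u = (LINT z|m. u z)" .
  qed
qed

lemma PSD_measure_of_density:
  fixes a :: "'c \<Rightarrow> real^'d^'d"
  assumes a: "integrable N a" and psd: "AE z in N. a z \<in> PSD" and p[measurable]: "p \<in> N \<rightarrow>\<^sub>M M"
  shows "PSD_measure M (\<lambda>E. LINT z|N. indicator E (p z) *\<^sub>R a z)"
proof -
  have int: "integrable N (\<lambda>z. indicator E (p z) *\<^sub>R a z)" if [measurable]: "E \<in> sets M" for E
  proof -
    have [measurable]: "a \<in> borel_measurable N" using a by auto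
    show ?thesis by (rule Bochner_Integration.integrable_bound[OF a]) (auto split: split_indicator)
  qed
  have "vector_measure M (\<lambda>E. LINT z|N. indicator E (p z) *\<^sub>R a z)"
    unfolding vector_measure_def
  proof (intro allI impI)
    fix A :: "nat \<Rightarrow> 'a set" assume A: "range A \<subseteq> sets M" "disjoint_family A"
    have As: "A i \<in> sets M" for i using A by auto
    have "(\<lambda>n. LINT z|N. (\<Sum>i<n. indicator (A i) (p z) *\<^sub>R a z)) \<longlonglongrightarrow> (LINT z|N. indicator (\<Union>i. A i) (p z) *\<^sub>R a z)"
    proof (rule integral_dominated_convergence[where w="\<lambda>z. norm (a z)"])
      show "(\<lambda>z. indicator (\<Union>i. A i) (p z) *\<^sub>R a z) \<in> borel_measurable N"
        by (rule borel_measurable_integrable[OF int]) (use As in auto)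
      show "(\<lambda>z. \<Sum>i<n. indicator (A i) (p z) *\<^sub>R a z) \<in> borel_measurable N" for n
        by (intro borel_measurable_sum borel_measurable_integrable[OF int] As)
      show "integrable N (\<lambda>z. norm (a z))" using a by auto
      have sum: "(\<Sum>i<n. indicator (A i) (p z) *\<^sub>R a z) = indicator (\<Union>i<n. A i) (p z) *\<^sub>R a z" for n z
      proof -
        have "indicator (\<Union>i<n. A i) (p z) = (\<Sum>i<n. indicator (A i) (p z) :: real)"
          by (rule indicator_UN_disjoint) (use A(2) in \<open>auto simp: disjoint_family_on_def\<close>)
        then show ?thesis by (simp add: scaleR_sum_left)
      qed
      show "AE z in N. (\<lambda>n. \<Sum>i<n. indicator (A i) (p z) *\<^sub>R a z) \<longlonglongrightarrow> indicator (\<Union>i. A i) (p z) *\<^sub>R a z"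
      proof (rule AE_I2)
        fix z
        show "(\<lambda>n. \<Sum>i<n. indicator (A i) (p z) *\<^sub>R a z) \<longlonglongrightarrow> indicator (\<Union>i. A i) (p z) *\<^sub>R a z"
        proof (cases "p z \<in> (\<Union>i. A i)")
          case True
          then obtain j where j: "p z \<in> A j" by auto
          have "\<forall>\<^sub>F n in sequentially. (\<Sum>i<n. indicator (A i) (p z) *\<^sub>R a z) = indicator (\<Union>i. A i) (p z) *\<^sub>R a z"
            unfolding sum using j by (intro eventually_sequentiallyI[of "Suc j"]) (auto split: split_indicator)
          then show ?thesis by (rule tendsto_eventually)
        next
          case False
          then show ?thesis by simp
        qed
      qed
      show "AE z in N. norm (\<Sum>i<n. indicator (A i) (p z) *\<^sub>R a z) \<le> norm (a z)" for n
        unfolding sum by (rule AE_I2) (auto split: split_indicator)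
    qed
    then show "(\<lambda>n. LINT z|N. indicator (A n) (p z) *\<^sub>R a z) sums (LINT z|N. indicator (\<Union>n. A n) (p z) *\<^sub>R a z)"
      unfolding sums_def by (subst (asm) Bochner_Integration.integral_sum) (use int[OF As] in auto)
  qed
  moreover have "(LINT z|N. indicator E (p z) *\<^sub>R a z) \<in> PSD" if E: "E \<in> sets M" for E
  proof -
    let ?b = "\<lambda>z. indicator E (p z) *\<^sub>R a z"
    have b: "AE z in N. ?b z \<in> PSD" using psd
      by eventually_elim (auto split: split_indicator simp: zero_PSD)
    have bl: "bounded_linear (\<lambda>A :: real^'d^'d. x \<bullet> (A *v x))" for x
      by (intro linear_conv_bounded_linear[THEN iffD1] linearI)
        (simp_all add: matrix_vector_mult_add_rdistrib inner_add_right scaleR_matrix_vector_assoc[symmetric])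
    have bl2: "bounded_linear (\<lambda>A :: real^'d^'d. A $ i $ j)" for i j
      by (intro linear_conv_bounded_linear[THEN iffD1] linearI) simp_all
    have "0 \<le> x \<bullet> ((LINT z|N. ?b z) *v x)" for x
    proof -
      have "x \<bullet> ((LINT z|N. ?b z) *v x) = (LINT z|N. x \<bullet> (?b z *v x))"
        by (rule integral_bounded_linear[OF bl int[OF E], symmetric])
      also have "\<dots> \<ge> 0" by (rule integral_nonneg_AE) (use b in eventually_elim, simp add: PSD_def)
      finally show ?thesis .
    qed
    moreover have "(LINT z|N. ?b z) $ i $ j = (LINT z|N. ?b z) $ j $ i" for i j
    proof -
      have "(LINT z|N. ?b z) $ i $ j = (LINT z|N. ?b z $ i $ j)"
        by (rule integral_bounded_linear[OF bl2 int[OF E], symmetric])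
      also have "\<dots> = (LINT z|N. ?b z $ j $ i)"
      proof (rule integral_cong_AE)
        show "(\<lambda>z. ?b z $ i $ j) \<in> borel_measurable N" "(\<lambda>z. ?b z $ j $ i) \<in> borel_measurable N"
          by (rule borel_measurable_integrable, rule integrable_bounded_linear[OF bl2 int[OF E]])+
        show "AE z in N. ?b z $ i $ j = ?b z $ j $ i" using b by eventually_elim (rule PSD_symmetric)
      qed
      also have "\<dots> = (LINT z|N. ?b z) $ j $ i"
        by (rule integral_bounded_linear[OF bl2 int[OF E]])
      finally show ?thesis .
    qed
    ultimately show ?thesis unfolding PSD_def Sym_def by (auto simp: transpose_def vec_eq_iff)
  qed
  ultimately show ?thesis unfolding PSD_measure_def by blast
qed

section \<open>Cutting off bounded test functions\<close>

definition outer :: "real^'d \<Rightarrow> real^'d \<Rightarrow> real^'d^'d" where "outer a b = (\<chi> i. a $ i *\<^sub>R b)"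

lemma outer_vector: "outer a b *v h = (b \<bullet> h) *\<^sub>R a"
  by (simp add: vec_eq_iff outer_def matrix_vector_mul_component mult.commute)

lemma norm_outer: "norm (outer a b) = norm a * norm b"
proof -
  have "norm (outer a b) = L2_set (\<lambda>i. norm (outer a b $ i)) UNIV" by (rule norm_vec_def)
  also have "\<dots> = L2_set (\<lambda>i. norm (a $ i) * norm b) UNIV" by (simp add: outer_def)
  also have "\<dots> = L2_set (\<lambda>i. norm (a $ i)) UNIV * norm b"
    by (rule L2_set_left_distrib[symmetric]) simp
  finally show ?thesis by (simp add: norm_vec_def)
qed

lemma norm_matrix_vector_le: "norm (A *v x) \<le> norm A * norm (x :: real^'d)" for A :: "real^'d^'d"
proof -
  have "norm (A *v x) \<le> L2_set (\<lambda>i. norm (A $ i) * norm x) UNIV"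
    unfolding norm_vec_def[of "A *v x"]
    by (rule L2_set_mono) (simp_all add: matrix_vector_mul_component Cauchy_Schwarz_ineq2)
  also have "\<dots> = L2_set (\<lambda>i. norm (A $ i)) UNIV * norm x"
    by (rule L2_set_left_distrib[symmetric]) simp
  finally show ?thesis by (simp add: norm_vec_def[of A])
qed

lemma C2_map_mult:
  assumes a: "C2_map \<psi>1 g1 D1" and b: "C2_map \<psi>2 g2 D2"
  shows "C2_map (\<lambda>x. \<psi>1 x * \<psi>2 x) (\<lambda>x. \<psi>1 x *\<^sub>R g2 x + \<psi>2 x *\<^sub>R g1 x)
    (\<lambda>x. (\<psi>1 x *\<^sub>R D2 x + outer (g2 x) (g1 x)) + (\<psi>2 x *\<^sub>R D1 x + outer (g1 x) (g2 x)))"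
  unfolding C2_map_def
proof (intro conjI allI)
  fix x
  have "((\<lambda>x. \<psi>1 x * \<psi>2 x) has_derivative (\<lambda>h. \<psi>1 x * (g2 x \<bullet> h) + (g1 x \<bullet> h) * \<psi>2 x)) (at x)"
    by (rule has_derivative_mult[OF C2_mapD(1)[OF a] C2_mapD(1)[OF b]])
  then show "((\<lambda>x. \<psi>1 x * \<psi>2 x) has_derivative (\<lambda>h. (\<psi>1 x *\<^sub>R g2 x + \<psi>2 x *\<^sub>R g1 x) \<bullet> h)) (at x)"
    by (simp add: inner_add_left mult.commute)
  have 1: "((\<lambda>x. \<psi>1 x *\<^sub>R g2 x) has_derivative (\<lambda>h. \<psi>1 x *\<^sub>R (D2 x *v h) + (g1 x \<bullet> h) *\<^sub>R g2 x)) (at x)"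
    by (rule has_derivative_scaleR[OF C2_mapD(1)[OF a] C2_mapD(2)[OF b]])
  have 2: "((\<lambda>x. \<psi>2 x *\<^sub>R g1 x) has_derivative (\<lambda>h. \<psi>2 x *\<^sub>R (D1 x *v h) + (g2 x \<bullet> h) *\<^sub>R g1 x)) (at x)"
    by (rule has_derivative_scaleR[OF C2_mapD(1)[OF b] C2_mapD(2)[OF a]])
  show "((\<lambda>x. \<psi>1 x *\<^sub>R g2 x + \<psi>2 x *\<^sub>R g1 x) has_derivative
      (\<lambda>h. ((\<psi>1 x *\<^sub>R D2 x + outer (g2 x) (g1 x)) + (\<psi>2 x *\<^sub>R D1 x + outer (g1 x) (g2 x))) *v h)) (at x)"
    using has_derivative_add[OF 1 2]
    by (simp add: matrix_vector_mult_add_rdistrib outer_vector scaleR_matrix_vector_assoc[symmetric])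
  have co: "continuous_on UNIV (\<lambda>x. outer (u x) (v x))" if "continuous_on UNIV u" "continuous_on UNIV v" for u v :: "real^'a \<Rightarrow> real^'a"
    unfolding outer_def by (intro continuous_intros that)
  show "continuous_on UNIV (\<lambda>x. (\<psi>1 x *\<^sub>R D2 x + outer (g2 x) (g1 x)) + (\<psi>2 x *\<^sub>R D1 x + outer (g1 x) (g2 x)))"
    by (intro continuous_on_add continuous_on_scaleR co C2_mapD(3)[OF a] C2_mapD(4)[OF a] C2_mapD(5)[OF a]
        C2_mapD(3)[OF b] C2_mapD(4)[OF b] C2_mapD(5)[OF b])
qed

text \<open>The third power of the positive part is twice continuously differentiable.\<close>

definition bump :: "real \<Rightarrow> real^'d \<Rightarrow> real" where "bump c x = (max 0 (1 - c * (x \<bullet> x))) ^ 3"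

definition bump_grad :: "real \<Rightarrow> real^'d \<Rightarrow> real^'d"
  where "bump_grad c x = (-6 * c) *\<^sub>R ((max 0 (1 - c * (x \<bullet> x)))\<^sup>2 *\<^sub>R x)"

definition bump_Hess :: "real \<Rightarrow> real^'d \<Rightarrow> real^'d^'d"
  where "bump_Hess c x = (-6 * c) *\<^sub>R ((max 0 (1 - c * (x \<bullet> x)))\<^sup>2 *\<^sub>R mat 1
    + outer x ((- 4 * c * max 0 (1 - c * (x \<bullet> x))) *\<^sub>R x))"

lemma bump_C2_map: "C2_map (bump c) (bump_grad c) (bump_Hess c)"
  unfolding C2_map_def
proof (intro conjI allI)
  fix x :: "real^'a"
  let ?\<rho> = "\<lambda>x::real^'a. 1 - c * (x \<bullet> x)"
  have \<rho>: "(?\<rho> has_derivative (\<lambda>h. - 2 * c * (x \<bullet> h))) (at x)"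
    by (auto intro!: derivative_eq_intros simp: inner_commute algebra_simps)
  have pw: "((\<lambda>x. (max 0 (?\<rho> x)) ^ Suc (Suc n)) has_derivative
      (\<lambda>h. (real (Suc (Suc n)) * (max 0 (?\<rho> x)) ^ Suc n) * (- 2 * c * (x \<bullet> h)))) (at x)" for n
    using has_derivative_compose[OF \<rho> has_field_derivative_imp_has_derivative[OF pos_part_power_derivative[of n "?\<rho> x"]]]
    by simp
  have "(bump c has_derivative (\<lambda>h. (3 * (max 0 (?\<rho> x))\<^sup>2) * (- 2 * c * (x \<bullet> h)))) (at x)"
    unfolding bump_def[abs_def] using pw[of 1] by (simp add: numeral_3_eq_3 numeral_2_eq_2)
  then show "(bump c has_derivative (\<lambda>h. bump_grad c x \<bullet> h)) (at x)"
    unfolding bump_grad_def by (simp add: mult.assoc mult.left_commute)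
  have p2: "((\<lambda>x. (max 0 (?\<rho> x))\<^sup>2) has_derivative (\<lambda>h. (2 * max 0 (?\<rho> x)) * (- 2 * c * (x \<bullet> h)))) (at x)"
    using pw[of 0] by (simp add: numeral_2_eq_2)
  have "((\<lambda>x. (max 0 (?\<rho> x))\<^sup>2 *\<^sub>R x) has_derivative
      (\<lambda>h. (max 0 (?\<rho> x))\<^sup>2 *\<^sub>R h + ((2 * max 0 (?\<rho> x)) * (- 2 * c * (x \<bullet> h))) *\<^sub>R x)) (at x)"
    by (rule has_derivative_scaleR[OF p2 has_derivative_ident])
  from has_derivative_scaleR_right[OF this, of "-6 * c"]
  have d: "(bump_grad c has_derivative (\<lambda>h. (-6 * c) *\<^sub>R ((max 0 (?\<rho> x))\<^sup>2 *\<^sub>R h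
      + ((2 * max 0 (?\<rho> x)) * (- 2 * c * (x \<bullet> h))) *\<^sub>R x))) (at x)"
    unfolding bump_grad_def[abs_def] .
  have "(\<lambda>h. (-6 * c) *\<^sub>R ((max 0 (?\<rho> x))\<^sup>2 *\<^sub>R h + ((2 * max 0 (?\<rho> x)) * (- 2 * c * (x \<bullet> h))) *\<^sub>R x))
      = (\<lambda>h. bump_Hess c x *v h)"
    unfolding bump_Hess_def
  proof (rule ext)
    fix h
    have "(2 * max 0 (?\<rho> x)) * (- 2 * c * (x \<bullet> h)) = (- 4 * c * max 0 (?\<rho> x)) * (x \<bullet> h)" by simp
    then show "(-6 * c) *\<^sub>R ((max 0 (?\<rho> x))\<^sup>2 *\<^sub>R h + ((2 * max 0 (?\<rho> x)) * (- 2 * c * (x \<bullet> h))) *\<^sub>R x)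
        = ((-6 * c) *\<^sub>R ((max 0 (?\<rho> x))\<^sup>2 *\<^sub>R mat 1 + outer x ((- 4 * c * max 0 (?\<rho> x)) *\<^sub>R x))) *v h"
      by (simp only: scaleR_matrix_vector_assoc[symmetric] matrix_vector_mult_add_rdistrib outer_vector
          inner_scaleR_left matrix_vector_mul_lid)
  qed
  with d show "(bump_grad c has_derivative (\<lambda>h. bump_Hess c x *v h)) (at x)" by (simp only:)
next
  show "continuous_on UNIV (bump_Hess c)"
    unfolding bump_Hess_def outer_def by (intro continuous_intros)
qed

text \<open>The Hessian of the product with a cutoff of radius \<open>R\<close> contains the gradient of \<open>\<theta>\<close> times a
  term of order $1/R$.  A bounded Hessian lets the gradient grow at most linearly, so that
  this stays bounded on the support of the cutoff, and it tends to zero at every point.\<close>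

lemma C2_cutoff:
  fixes \<theta> :: "real^'d \<Rightarrow> real"
  assumes C2: "C2_map \<theta> g D" and \<theta>C: "\<And>x. \<bar>\<theta> x\<bar> \<le> C" and DC: "\<And>x. norm (D x) \<le> C"
  obtains \<theta>' g' D' B where "\<And>n::nat. C2_map (\<theta>' n) (g' n) (D' n)" "\<And>n. bounded {x. \<theta>' n x \<noteq> 0}"
    "\<And>n x. \<bar>\<theta>' n x\<bar> \<le> B" "\<And>n x. norm (D' n x) \<le> B"
    "\<And>x. (\<lambda>n. \<theta>' n x) \<longlonglongrightarrow> \<theta> x" "\<And>x. (\<lambda>n. D' n x) \<longlonglongrightarrow> D x"
proof -
  define c where "c n = 1 / real (Suc n)" for n
  have c: "0 < c n" "c n \<le> 1" for n unfolding c_def by (auto simp: field_simps)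
  have c0: "c \<longlonglongrightarrow> 0" unfolding c_def by (rule LIMSEQ_Suc[OF lim_const_over_n])
  define \<theta>' where "\<theta>' n x = bump (c n) x * \<theta> x" for n x
  define g' where "g' n x = bump (c n) x *\<^sub>R g x + \<theta> x *\<^sub>R bump_grad (c n) x" for n x
  define D' where "D' n x = (bump (c n) x *\<^sub>R D x + outer (g x) (bump_grad (c n) x))
    + (\<theta> x *\<^sub>R bump_Hess (c n) x + outer (bump_grad (c n) x) (g x))" for n x
  have C2': "C2_map (\<theta>' n) (g' n) (D' n)" for n
    unfolding \<theta>'_def[abs_def] g'_def[abs_def] D'_def[abs_def] by (rule C2_map_mult[OF bump_C2_map C2])
  have C0: "C \<ge> 0" using \<theta>C[of 0] by linarith
  define N where "N = norm (mat 1 :: real^'d^'d)"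
  have N0: "N \<ge> 0" unfolding N_def by simp
  define G where "G = norm (g 0)"
  have G0: "G \<ge> 0" unfolding G_def by simp
  have g_growth: "norm (g x) \<le> G + C * norm x" for x
  proof -
    have "norm (g x - g 0) \<le> C * norm (x - 0)"
    proof (rule differentiable_bound[OF convex_UNIV])
      show "(g has_derivative (\<lambda>h. D y *v h)) (at y within UNIV)" for y using C2_mapD(2)[OF C2, of y] by simp
      show "onorm (\<lambda>h. D y *v h) \<le> C" for y
      proof (rule onorm_bound[OF C0])
        fix h :: "real^'d"
        show "norm (D y *v h) \<le> C * norm h"
          using norm_matrix_vector_le[of "D y" h] mult_right_mono[OF DC[of y] norm_ge_zero[of h]] by linarith
      qed
    qed auto
    then show ?thesis unfolding G_def using norm_triangle_sub[of "g x" "g 0"] by simp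
  qed
  let ?p = "\<lambda>n x. max 0 (1 - c n * (x \<bullet> x)) :: real"
  have pb: "0 \<le> ?p n x" "?p n x \<le> 1" for n and x :: "real^'d"
    using c[of n] by auto
  have pin: "c n * (norm x)\<^sup>2 \<le> 1" if "?p n x \<noteq> 0" for n and x :: "real^'d"
    using that by (auto simp: max_def power2_norm_eq_inner split: if_splits)
  have bumpb: "0 \<le> bump (c n) x" "bump (c n) x \<le> 1" for n and x :: "real^'d"
    unfolding bump_def using pb[of n x] by (auto intro: power_le_one)
  have gradb: "norm (bump_grad (c n) x) \<le> 6 * (c n * norm x)" for n and x :: "real^'d"
  proof -
    have "norm (bump_grad (c n) x) = 6 * (c n * ((?p n x)\<^sup>2 * norm x))"
      unfolding bump_grad_def using c[of n] by (simp add: abs_mult)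
    also have "\<dots> \<le> 6 * (c n * (1 * norm x))"
      by (intro mult_left_mono mult_right_mono power_le_one pb) (use c[of n] in auto)
    finally show ?thesis by simp
  qed
  have cx: "c n * norm x \<le> 1" if "c n * (norm x)\<^sup>2 \<le> 1" for n and x :: "real^'d"
  proof -
    have "(c n * norm x)\<^sup>2 = c n * (c n * (norm x)\<^sup>2)" by (simp add: power2_eq_square)
    also have "\<dots> \<le> 1 * 1" by (rule mult_mono) (use c[of n] that in auto)
    finally show ?thesis using power2_le_imp_le[of "c n * norm x" 1] by simp
  qed
  have crossb: "norm (g x) * norm (bump_grad (c n) x) \<le> 6 * (G + C)" for n x
  proof (cases "?p n x = 0")
    case True
    then have "bump_grad (c n) x = 0" unfolding bump_grad_def by simp
    then show ?thesis using G0 C0 by simp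
  next
    case False
    from pin[OF this] have q: "c n * (norm x)\<^sup>2 \<le> 1" .
    have "norm (g x) * norm (bump_grad (c n) x) \<le> (G + C * norm x) * (6 * (c n * norm x))"
      by (intro mult_mono g_growth gradb) (use G0 C0 in auto)
    also have "\<dots> = 6 * (G * (c n * norm x) + C * (c n * (norm x)\<^sup>2))"
      by (simp add: algebra_simps power2_eq_square)
    also have "\<dots> \<le> 6 * (G * 1 + C * 1)"
      by (intro mult_left_mono add_mono cx[OF q] q) (use G0 C0 in auto)
    finally show ?thesis by simp
  qed
  have Hessb: "norm (bump_Hess (c n) x) \<le> 6 * (N + 4)" for n and x :: "real^'d"
  proof (cases "?p n x = 0")
    case True
    then show ?thesis unfolding bump_Hess_def outer_def using N0 by (simp add: zero_vec_def[symmetric])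
  next
    case False
    from pin[OF this] have q: "c n * (norm x)\<^sup>2 \<le> 1" .
    have "norm (bump_Hess (c n) x) = (6 * c n) * norm ((?p n x)\<^sup>2 *\<^sub>R mat 1 + outer x ((- 4 * c n * ?p n x) *\<^sub>R x))"
      unfolding bump_Hess_def using c[of n] by (simp add: abs_mult)
    also have "\<dots> \<le> (6 * 1) * (norm ((?p n x)\<^sup>2 *\<^sub>R (mat 1 :: real^'d^'d)) + norm (outer x ((- 4 * c n * ?p n x) *\<^sub>R x)))"
      by (intro mult_mono norm_triangle_ineq) (use c[of n] in auto)
    also have "norm ((?p n x)\<^sup>2 *\<^sub>R (mat 1 :: real^'d^'d)) \<le> 1 * N"
      unfolding N_def using mult_right_mono[of "(?p n x)\<^sup>2" 1 "norm (mat 1 :: real^'d^'d)"] pb[of n x]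
      by (simp add: power_le_one)
    also have "norm (outer x ((- 4 * c n * ?p n x) *\<^sub>R x)) = 4 * (?p n x * (c n * (norm x)\<^sup>2))"
      unfolding norm_outer using c[of n] pb[of n x] by (simp add: abs_mult power2_eq_square)
    also have "\<dots> \<le> 4 * (1 * 1)"
      by (intro mult_left_mono mult_mono pb q) (use c[of n] in auto)
    finally show ?thesis by simp
  qed
  define B where "B = C + 12 * (G + C) + C * (6 * (N + 4))"
  show thesis
  proof (rule that[of \<theta>' g' D' B])
    show "C2_map (\<theta>' n) (g' n) (D' n)" for n by (rule C2')
    show "bounded {x. \<theta>' n x \<noteq> 0}" for n
    proof (rule bounded_subset[OF bounded_cball[of 0 "1 / c n"]], rule subsetI)
      fix x assume "x \<in> {x. \<theta>' n x \<noteq> 0}"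
      then have "?p n x \<noteq> 0" unfolding \<theta>'_def bump_def by auto
      from cx[OF pin[OF this]] show "x \<in> cball 0 (1 / c n)" using c[of n] by (simp add: field_simps)
    qed
    show "\<bar>\<theta>' n x\<bar> \<le> B" for n x
    proof -
      have "\<bar>\<theta>' n x\<bar> \<le> 1 * C" unfolding \<theta>'_def abs_mult by (intro mult_mono \<theta>C) (use bumpb[of n x] in auto)
      also have "\<dots> \<le> B" unfolding B_def using C0 G0 N0 by simp
      finally show ?thesis .
    qed
    show "norm (D' n x) \<le> B" for n x
    proof -
      have 1: "norm (bump (c n) x *\<^sub>R D x) \<le> 1 * C"
        unfolding norm_scaleR by (intro mult_mono DC) (use bumpb[of n x] in auto)
      have 2: "norm (\<theta> x *\<^sub>R bump_Hess (c n) x) \<le> C * (6 * (N + 4))"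
        unfolding norm_scaleR by (intro mult_mono Hessb \<theta>C) (use C0 in auto)
      have 3: "norm (outer (g x) (bump_grad (c n) x)) \<le> 6 * (G + C)" "norm (outer (bump_grad (c n) x) (g x)) \<le> 6 * (G + C)"
        unfolding norm_outer using crossb[of x n] by (simp_all add: mult.commute)
      have "norm (D' n x) \<le> (norm (bump (c n) x *\<^sub>R D x) + norm (outer (g x) (bump_grad (c n) x)))
          + (norm (\<theta> x *\<^sub>R bump_Hess (c n) x) + norm (outer (bump_grad (c n) x) (g x)))"
        unfolding D'_def by (intro order_trans[OF norm_triangle_ineq] add_mono norm_triangle_ineq)
      then show ?thesis unfolding B_def using 1 2 3 by linarith
    qed
    have bump_lim: "(\<lambda>n. bump (c n) x) \<longlonglongrightarrow> 1" for x :: "real^'d"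
    proof -
      have "(\<lambda>n. bump (c n) x) \<longlonglongrightarrow> (max 0 (1 - 0 * (x \<bullet> x))) ^ 3"
        unfolding bump_def by (intro tendsto_intros c0)
      then show ?thesis by simp
    qed
    have grad_lim: "(\<lambda>n. bump_grad (c n) x) \<longlonglongrightarrow> 0" for x :: "real^'d"
    proof -
      have "(\<lambda>n. bump_grad (c n) x) \<longlonglongrightarrow> (-6 * 0) *\<^sub>R ((max 0 (1 - 0 * (x \<bullet> x)))\<^sup>2 *\<^sub>R x)"
        unfolding bump_grad_def by (intro tendsto_intros c0)
      then show ?thesis by simp
    qed
    have Hess_lim: "(\<lambda>n. bump_Hess (c n) x) \<longlonglongrightarrow> 0" for x :: "real^'d"
    proof (rule Lim_null_comparison)
      have e: "norm (bump_Hess (c n) x) \<le> c n * (6 * (N + 4 * (norm x)\<^sup>2))" for n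
      proof -
        have "norm (bump_Hess (c n) x) = (6 * c n) * norm ((?p n x)\<^sup>2 *\<^sub>R mat 1 + outer x ((- 4 * c n * ?p n x) *\<^sub>R x))"
          unfolding bump_Hess_def using c[of n] by (simp add: abs_mult)
        also have "\<dots> \<le> (6 * c n) * (norm ((?p n x)\<^sup>2 *\<^sub>R (mat 1 :: real^'d^'d)) + norm (outer x ((- 4 * c n * ?p n x) *\<^sub>R x)))"
          by (intro mult_left_mono norm_triangle_ineq) (use c[of n] in auto)
        also have "\<dots> \<le> (6 * c n) * (1 * N + 4 * (1 * 1 * (norm x)\<^sup>2))"
        proof (intro mult_left_mono add_mono)
          show "norm ((?p n x)\<^sup>2 *\<^sub>R (mat 1 :: real^'d^'d)) \<le> 1 * N"
            unfolding N_def using mult_right_mono[of "(?p n x)\<^sup>2" 1 "norm (mat 1 :: real^'d^'d)"] pb[of n x]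
            by (simp add: power_le_one)
          have "norm (outer x ((- 4 * c n * ?p n x) *\<^sub>R x)) = 4 * (c n * ?p n x * (norm x)\<^sup>2)"
            unfolding norm_outer using c[of n] pb[of n x] by (simp add: abs_mult power2_eq_square)
          also have "\<dots> \<le> 4 * (1 * 1 * (norm x)\<^sup>2)"
            by (intro mult_left_mono mult_mono pb c) (use c[of n] pb[of n x] in auto)
          finally show "norm (outer x ((- 4 * c n * ?p n x) *\<^sub>R x)) \<le> 4 * (1 * 1 * (norm x)\<^sup>2)" .
        qed (use c[of n] in auto)
        finally show ?thesis by (simp add: mult.assoc mult.left_commute)
      qed
      then show "\<forall>\<^sub>F n in sequentially. norm (bump_Hess (c n) x) \<le> c n * (6 * (N + 4 * (norm x)\<^sup>2))"
        by (intro always_eventually allI)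
      have "(\<lambda>n. c n * (6 * (N + 4 * (norm x)\<^sup>2))) \<longlonglongrightarrow> 0 * (6 * (N + 4 * (norm x)\<^sup>2))"
        by (intro tendsto_mult c0 tendsto_const)
      then show "(\<lambda>n. c n * (6 * (N + 4 * (norm x)\<^sup>2))) \<longlonglongrightarrow> 0" by simp
    qed
    show "(\<lambda>n. \<theta>' n x) \<longlonglongrightarrow> \<theta> x" for x
      unfolding \<theta>'_def using tendsto_mult[OF bump_lim[of x] tendsto_const[of "\<theta> x"]] by simp
    have outer0: "(\<lambda>n. outer (u n) (v n)) \<longlonglongrightarrow> 0" if "(\<lambda>n. norm (u n) * norm (v n)) \<longlonglongrightarrow> 0" for u v :: "nat \<Rightarrow> real^'d"
      by (rule tendsto_norm_zero_cancel) (use that in \<open>simp add: norm_outer\<close>)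
    show "(\<lambda>n. D' n x) \<longlonglongrightarrow> D x" for x
    proof -
      have o1: "(\<lambda>n. outer (g x) (bump_grad (c n) x)) \<longlonglongrightarrow> 0"
        by (rule outer0) (use tendsto_mult[OF tendsto_const tendsto_norm_zero[OF grad_lim[of x]], of "norm (g x)"] in simp)
      have o2: "(\<lambda>n. outer (bump_grad (c n) x) (g x)) \<longlonglongrightarrow> 0"
        by (rule outer0) (use tendsto_mult[OF tendsto_norm_zero[OF grad_lim[of x]] tendsto_const, of "norm (g x)"] in simp)
      have "(\<lambda>n. D' n x) \<longlonglongrightarrow> (1 *\<^sub>R D x + 0) + (\<theta> x *\<^sub>R 0 + 0)"
        unfolding D'_def by (intro tendsto_add tendsto_scaleR bump_lim Hess_lim tendsto_const o1 o2)
      then show ?thesis by simp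
    qed
  qed
qed

section \<open>The static dual problem\<close>

context cost_function
begin

text \<open>The flux is looked for as a measure on positions and matrices of trace at most one, scaled by \<open>T\<close>:
  the pair of a position and a matrix stands for an infinitesimal diffusion at that position.  Coercivity
  makes the bound on the trace harmless, since cheap fluxes have little mass.  The cone consists of
  the multiples of the cost minus \<open>s\<close> and the defects in the equation for compactly supported
  functions; an element with a positive lower bound would
  yield a potential whose gap is too large.\<close>

lemma static_measure:
  fixes \<mu> \<nu> :: "(real^'d) measure" and B :: "nat \<Rightarrow> real^'d^'d"
  assumes s: "0 \<le> s"
    and fin: "finite_measure \<mu>" "finite_measure \<nu>" "sets \<mu> = sets borel" "sets \<nu> = sets borel"
    and gap: "\<And>\<psi>. \<psi> \<in> potentials 1 \<Longrightarrow> bounded {x. \<psi> x \<noteq> 0} \<Longrightarrow> (LINT x|\<nu>. \<psi> x) - (LINT x|\<mu>. \<psi> x) \<le> s"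
    and B: "B 0 = 0" "\<And>i. B i \<in> K"
  obtains m :: "((real^'d) \<times> (real^'d^'d)) measure" and T where
    "T \<ge> 0" "finite_measure m" "sets m = sets borel" "AE z in m. snd z \<in> PSD \<and> trace (snd z) \<le> 1"
    "\<And>\<psi> g D. C2_map \<psi> g D \<Longrightarrow> bounded {x. \<psi> x \<noteq> 0} \<Longrightarrow>
      (LINT z|m. T * (D (fst z) \<bullet> snd z / 2)) = (LINT x|\<nu>. \<psi> x) - (LINT x|\<mu>. \<psi> x)"
    "\<And>n. T * (LINT z|m. Max ((\<lambda>i. B i \<bullet> snd z) ` {..n})) \<le> s"
proof -
  obtain c where c: "c > 0" "\<And>A. A \<in> PSD \<Longrightarrow> c * trace A \<le> fr A" using fr_lower by blast
  \<comment> \<open>A flux of cost at most \<open>s\<close> has trace at most \<open>s / c\<close>; the strict excess of \<open>T\<close> over it gives room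
      in the separation.\<close>
  define T where "T = (s + 1) / c"
  have T: "T > 0" "T * c = s + 1" unfolding T_def using c s by auto
  define \<Sigma> where "\<Sigma> = {A \<in> PSD. trace A \<le> (1::real)} \<inter> (UNIV :: (real^'d^'d) set)"
  define X where "X = (UNIV :: (real^'d) set) \<times> \<Sigma>"
  define gapv where "gapv \<psi> = (LINT x|\<nu>. \<psi> x) - (LINT x|\<mu>. \<psi> x)" for \<psi> :: "real^'d \<Rightarrow> real"
  define N where "N = (real CARD('d))\<^sup>2"
  have \<Sigma>: "A \<in> PSD" "trace A \<le> 1" "0 \<le> trace A" "norm A \<le> N" "fr A \<le> \<kappa>" "0 \<le> fr A" if "A \<in> \<Sigma>" for A
  proof -
    show 1: "A \<in> PSD" "trace A \<le> 1" using that unfolding \<Sigma>_def by auto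
    show "0 \<le> trace A" by (rule PSD_trace_nonneg[OF 1(1)])
    have "norm A \<le> N * trace A" unfolding N_def by (rule PSD_norm_le_trace[OF 1(1)])
    also have "\<dots> \<le> N * 1" by (rule mult_left_mono[OF 1(2)]) (simp add: N_def)
    finally show "norm A \<le> N" by simp
    have "fr A \<le> \<kappa> * trace A" by (rule fr_upper[OF 1(1)])
    also have "\<dots> \<le> \<kappa> * 1" by (rule mult_left_mono[OF 1(2)]) (use \<kappa>_pos in simp)
    finally show "fr A \<le> \<kappa>" by simp
    show "0 \<le> fr A" by (rule fr_nonneg)
  qed
  have zero\<Sigma>: "0 \<in> \<Sigma>" unfolding \<Sigma>_def by (simp add: zero_PSD trace_def)
  have "\<Sigma> = PSD \<inter> {A. trace A \<le> 1}" unfolding \<Sigma>_def by auto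
  then have cl\<Sigma>: "closed \<Sigma>"
    using closed_Collect_le[of "trace :: real^'d^'d \<Rightarrow> real" "\<lambda>_. 1"] bounded_linear.continuous_on[OF bounded_linear_trace continuous_on_id]
    by (auto intro!: closed_Int closed_PSD)
  have X: "closed X" "X \<noteq> {}" unfolding X_def using cl\<Sigma> zero\<Sigma> by (auto intro: closed_Times)
  have Xsnd: "snd z \<in> \<Sigma>" if "z \<in> X" for z using that unfolding X_def by auto
  have Hess_bound: "\<exists>C\<ge>0. \<forall>z\<in>X. \<bar>D (fst z) \<bullet> snd z / 2\<bar> \<le> C" if bD: "bounded (range D)" for D :: "real^'d \<Rightarrow> real^'d^'d"
  proof -
    obtain C where "\<forall>y\<in>range D. norm y \<le> C" using bD unfolding bounded_iff ..
    then have C: "norm (D x) \<le> C" for x by simp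
    have "\<bar>D (fst z) \<bullet> snd z / 2\<bar> \<le> C * N" if "z \<in> X" for z
    proof -
      have "\<bar>D (fst z) \<bullet> snd z\<bar> \<le> norm (D (fst z)) * norm (snd z)" by (rule Cauchy_Schwarz_ineq2)
      also have "\<dots> \<le> C * N" using \<Sigma>(4)[OF Xsnd[OF that]] C[of "fst z"] by (intro mult_mono) (auto intro: order_trans[OF norm_ge_zero])
      finally show ?thesis by simp
    qed
    moreover have "0 \<le> C * N" using order_trans[OF norm_ge_zero C] by (simp add: N_def)
    ultimately show ?thesis by blast
  qed
  define H where "H = {h. \<exists>w \<psi> g D. 0 \<le> w \<and> C2_map \<psi> g D \<and> bounded {x. \<psi> x \<noteq> 0} \<and>
      h = (\<lambda>z. w * (T * fr (snd z) - s) + (gapv \<psi> - T * (D (fst z) \<bullet> snd z / 2)))}"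
  have HI: "(\<lambda>z. w * (T * fr (snd z) - s) + (gapv \<psi> - T * (D (fst z) \<bullet> snd z / 2))) \<in> H"
    if "0 \<le> w" "C2_map \<psi> g D" "bounded {x. \<psi> x \<noteq> 0}" for w \<psi> g D
    unfolding H_def using that by blast
  have HE: "\<exists>w \<psi> g D. 0 \<le> w \<and> C2_map \<psi> g D \<and> bounded {x. \<psi> x \<noteq> 0} \<and>
      h = (\<lambda>z. w * (T * fr (snd z) - s) + (gapv \<psi> - T * (D (fst z) \<bullet> snd z / 2)))" if "h \<in> H" for h
    using that unfolding H_def by simp
  have int: "integrable \<mu> \<psi>" "integrable \<nu> \<psi>" if C2: "C2_map \<psi> g D" and supp: "bounded {x. \<psi> x \<noteq> 0}" for \<psi> g D
  proof -
    have cont: "continuous_on UNIV \<psi>" by (rule C2_mapD(5)[OF C2])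
    then have m: "\<psi> \<in> borel_measurable borel" by (rule borel_measurable_continuous_onI)
    have m': "\<psi> \<in> borel_measurable \<mu>" "\<psi> \<in> borel_measurable \<nu>" using m fin(3,4) by (simp_all cong: measurable_cong_sets)
    obtain C where C: "\<And>y. \<bar>\<psi> y\<bar> \<le> C" using continuous_bounded_support_bound[OF cont supp] by metis
    show "integrable \<mu> \<psi>" by (rule finite_measure.integrable_const_bound[OF fin(1) _ m'(1), of C]) (simp add: C)
    show "integrable \<nu> \<psi>" by (rule finite_measure.integrable_const_bound[OF fin(2) _ m'(2), of C]) (simp add: C)
  qed
  have zeroC2: "C2_map (\<lambda>x::real^'d. 0) (\<lambda>x. 0) (\<lambda>x. 0)" by (rule C2_map_const)
  have gap0: "gapv (\<lambda>x. 0) = 0" unfolding gapv_def by simp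
  have frb: "(\<lambda>z. fr (snd z)) \<in> bdd_on X"
  proof (rule bdd_onI[of _ _ \<kappa>])
    fix z assume "z \<in> X"
    note S = Xsnd[OF this]
    show "\<bar>fr (snd z)\<bar> \<le> \<kappa>" using \<Sigma>(5)[OF S] \<Sigma>(6)[OF S] by simp
  qed
  have Hb: "(\<lambda>z. D (fst z) \<bullet> snd z / 2) \<in> bdd_on X" if "bounded (range D)" for D :: "real^'d \<Rightarrow> real^'d^'d"
  proof -
    from Hess_bound[OF that] obtain C where "\<forall>z\<in>X. \<bar>D (fst z) \<bullet> snd z / 2\<bar> \<le> C" by blast
    then show ?thesis by (intro bdd_onI[of X _ C]) simp
  qed
  have Hsub: "H \<subseteq> bdd_on X"
  proof
    fix h assume "h \<in> H"
    from HE[OF this] obtain w \<psi> g D where h: "C2_map \<psi> g D" "bounded {x. \<psi> x \<noteq> 0}"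
      "h = (\<lambda>z. w * (T * fr (snd z) - s) + (gapv \<psi> - T * (D (fst z) \<bullet> snd z / 2)))"
      by (elim exE conjE) (rule that; assumption)
    show "h \<in> bdd_on X" unfolding h(3)
      by (intro bdd_on_add bdd_on_diff bdd_on_cmult bdd_on_const frb Hb C2_map_Hessian_support(2)[OF h(1,2)])
  qed
  have "\<exists>L. mean_on X L \<and> (\<forall>h\<in>H. L h \<le> 0)"
  proof (rule mean_alternative[OF X(2) Hsub])
    show "(\<lambda>z. 0) \<in> H" using HI[of 0, OF order_refl zeroC2] gap0 by simp
    fix h k assume hH: "h \<in> H" and kH: "k \<in> H"
    from HE[OF hH] obtain w \<psi> g D where h: "0 \<le> w" "C2_map \<psi> g D" "bounded {x. \<psi> x \<noteq> 0}"
      "h = (\<lambda>z. w * (T * fr (snd z) - s) + (gapv \<psi> - T * (D (fst z) \<bullet> snd z / 2)))"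
      by (elim exE conjE) (rule that; assumption)
    from HE[OF kH] obtain w' \<psi>' g' D' where k: "0 \<le> w'" "C2_map \<psi>' g' D'" "bounded {x. \<psi>' x \<noteq> 0}"
      "k = (\<lambda>z. w' * (T * fr (snd z) - s) + (gapv \<psi>' - T * (D' (fst z) \<bullet> snd z / 2)))"
      by (elim exE conjE) (rule that; assumption)
    have sup: "bounded {x. \<psi> x + \<psi>' x \<noteq> 0}"
      by (rule bounded_subset[of "{x. \<psi> x \<noteq> 0} \<union> {x. \<psi>' x \<noteq> 0}"]) (use h k in auto)
    have "gapv (\<lambda>x. \<psi> x + \<psi>' x) = gapv \<psi> + gapv \<psi>'"
      unfolding gapv_def using int[OF h(2,3)] int[OF k(2,3)] by simp
    then have "(\<lambda>z. h z + k z) = (\<lambda>z. (w + w') * (T * fr (snd z) - s) + (gapv (\<lambda>x. \<psi> x + \<psi>' x) - T * ((D (fst z) + D' (fst z)) \<bullet> snd z / 2)))"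
      unfolding h(4) k(4) by (simp add: fun_eq_iff inner_add_left algebra_simps add_divide_distrib)
    then show "(\<lambda>z. h z + k z) \<in> H"
      using HI[OF _ C2_map_add[OF h(2) k(2)] sup, of "w + w'"] h(1) k(1) by simp
  next
    fix h and r :: real assume hH: "h \<in> H" and r: "r > 0"
    from HE[OF hH] obtain w \<psi> g D where h: "0 \<le> w" "C2_map \<psi> g D" "bounded {x. \<psi> x \<noteq> 0}"
      "h = (\<lambda>z. w * (T * fr (snd z) - s) + (gapv \<psi> - T * (D (fst z) \<bullet> snd z / 2)))"
      by (elim exE conjE) (rule that; assumption)
    have sup: "bounded {x. r * \<psi> x \<noteq> 0}" using h(3) r by simp
    have "gapv (\<lambda>x. r * \<psi> x) = r * gapv \<psi>" unfolding gapv_def by (simp add: right_diff_distrib)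
    then have "(\<lambda>z. r * h z) = (\<lambda>z. (r * w) * (T * fr (snd z) - s) + (gapv (\<lambda>x. r * \<psi> x) - T * ((r *\<^sub>R D (fst z)) \<bullet> snd z / 2)))"
      unfolding h(4) by (simp add: fun_eq_iff algebra_simps)
    then show "(\<lambda>z. r * h z) \<in> H"
      using HI[OF _ C2_map_scale[OF h(2)] sup, of "r * w"] h(1) r by simp
  next
    fix h and \<epsilon> :: real assume hH: "h \<in> H" and \<epsilon>: "\<epsilon> > 0"
    from HE[OF hH] obtain w \<psi> g D where h: "0 \<le> w" "C2_map \<psi> g D" "bounded {x. \<psi> x \<noteq> 0}"
      "h = (\<lambda>z. w * (T * fr (snd z) - s) + (gapv \<psi> - T * (D (fst z) \<bullet> snd z / 2)))"
      by (elim exE conjE) (rule that; assumption)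
    show "\<exists>z\<in>X. h z < \<epsilon>"
    proof (rule ccontr)
      assume "\<not> ?thesis"
      then have ge: "\<epsilon> \<le> h z" if "z \<in> X" for z using that by force
      define e where "e = gapv \<psi> - w * s"
      have hA: "\<epsilon> \<le> w * (T * fr A) - T * (D x \<bullet> A / 2) + e" if "A \<in> \<Sigma>" for x A
        using ge[of "(x, A)"] that unfolding X_def h(4) e_def by (simp add: algebra_simps)
      have e: "e > 0" using hA[OF zero\<Sigma>, of 0] \<epsilon> by (simp add: fr_zero)
      \<comment> \<open>The constant \<open>e\<close> is absorbed into the level of the potential through \<open>T * c = s + 1\<close> and the lower
          bound of the cost by the trace.\<close>
      define w' where "w' = w + e / (s + 1)"
      have w': "w' > 0" unfolding w'_def using h(1) e s by (simp add: add_nonneg_pos)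
      have feas: "D x \<bullet> A / 2 \<le> w' * fr A" if A: "A \<in> PSD" for x A
      proof (cases "trace A = 0")
        case True
        then have "A = 0" using PSD_norm_le_trace[OF A] by simp
        then show ?thesis by (simp add: fr_zero)
      next
        case False
        define \<tau> where "\<tau> = trace A"
        have \<tau>: "\<tau> > 0" using PSD_trace_nonneg[OF A] False unfolding \<tau>_def by simp
        have "(1/\<tau>) *\<^sub>R A \<in> \<Sigma>" unfolding \<Sigma>_def using PSD_scaleR[OF A, of "1/\<tau>"] \<tau>
          by (simp add: trace_eq_inner \<tau>_def)
        from hA[OF this, of x] have "0 \<le> w * (T * (fr A / \<tau>)) - T * ((D x \<bullet> A / \<tau>) / 2) + e"
          using fr_scale[OF A, of "1/\<tau>"] \<tau> \<epsilon> by simp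
        then have "0 \<le> \<tau> * (w * (T * (fr A / \<tau>)) - T * ((D x \<bullet> A / \<tau>) / 2) + e)" using \<tau> by simp
        also have "\<dots> = T * (w * fr A - D x \<bullet> A / 2) + e * \<tau>" using \<tau> by (simp add: field_simps)
        finally have "T * (D x \<bullet> A / 2) \<le> T * (w * fr A) + e * \<tau>" by (simp add: algebra_simps)
        moreover have "e * \<tau> \<le> T * (e / (s + 1) * fr A)"
        proof -
          have "e * \<tau> = (e / (s + 1)) * (T * c) * \<tau>" unfolding T(2) using s by simp
          also have "\<dots> = (e / (s + 1)) * T * (c * \<tau>)" by (simp only: mult.assoc)
          also have "\<dots> \<le> (e / (s + 1)) * T * fr A"
            by (rule mult_left_mono) (use c(2)[OF A] \<tau>_def T e s in auto)
          finally show ?thesis by (simp add: mult_ac)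
        qed
        moreover have "T * (w' * fr A) = T * (w * fr A) + T * (e / (s + 1) * fr A)"
          unfolding w'_def by (simp only: distrib_left distrib_right)
        ultimately have "T * (D x \<bullet> A / 2) \<le> T * (w' * fr A)" by linarith
        then show ?thesis using T(1) by (simp add: mult_le_cancel_left_pos)
      qed
      have pot: "\<psi> \<in> potentials w'" unfolding potentials_def
      proof (intro CollectI exI conjI allI ballI)
        show "C2_map \<psi> g D" by (rule h(2))
        obtain C where C: "\<And>y. \<bar>\<psi> y\<bar> \<le> C" using continuous_bounded_support_bound[OF C2_mapD(5)[OF h(2)] h(3)] by metis
        show "bounded (range \<psi>)" unfolding bounded_iff using C by auto
        show "bounded (range D)" by (rule C2_map_Hessian_support(2)[OF h(2,3)])
      qed (rule feas)
      then have "(\<lambda>x. (1/w') * \<psi> x) \<in> potentials 1" using potentials_scale[OF pot, of "1/w'"] w' by simp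
      then have "gapv (\<lambda>x. (1/w') * \<psi> x) \<le> s" unfolding gapv_def by (rule gap) (use h(3) w' in simp)
      moreover have "gapv (\<lambda>x. (1/w') * \<psi> x) = (1/w') * gapv \<psi>"
        unfolding gapv_def integral_mult_right_zero by (rule right_diff_distrib[symmetric])
      ultimately have "(1/w') * gapv \<psi> \<le> s" by (simp only:)
      then have "gapv \<psi> \<le> w' * s" using w' by (simp add: field_simps)
      moreover have "w' * s = w * s + e * (s / (s + 1))" by (simp add: w'_def distrib_right)
      moreover have "e = gapv \<psi> - w * s" by (rule e_def)
      ultimately have "e \<le> e * (s / (s + 1))" by linarith
      moreover have "e * (s / (s + 1)) < e * 1" using e s by (intro mult_strict_left_mono) (auto simp: field_simps)
      ultimately show False by simp
    qed
  qed blast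
  then obtain L where L: "mean_on X L" "\<And>h. h \<in> H \<Longrightarrow> L h \<le> 0" by blast
  from measure_of_mean_closed[OF L(1) X] obtain m where fm: "finite_measure m" and sm: "sets m = sets borel"
    and mX: "AE z in m. z \<in> X"
    and rep: "\<And>u. continuous_on UNIV u \<Longrightarrow> u \<in> bdd_on X \<Longrightarrow> bounded {z \<in> X. u z \<noteq> 0} \<Longrightarrow> L u = (LINT z|m. u z)" by blast
  interpret finite_measure m by (rule fm)
  have L_lower: "gapv \<psi> \<le> T * L (\<lambda>z. D (fst z) \<bullet> snd z / 2)" if C2: "C2_map \<psi> g D" "bounded {x. \<psi> x \<noteq> 0}" for \<psi> g D
  proof -
    have hb: "(\<lambda>z. D (fst z) \<bullet> snd z / 2) \<in> bdd_on X" by (rule Hb[OF C2_map_Hessian_support(2)[OF C2]])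
    have "L (\<lambda>z. gapv \<psi> - T * (D (fst z) \<bullet> snd z / 2)) \<le> 0"
      using L(2)[OF HI[OF order_refl C2]] by simp
    moreover have "L (\<lambda>z. gapv \<psi> - T * (D (fst z) \<bullet> snd z / 2)) = gapv \<psi> - T * L (\<lambda>z. D (fst z) \<bullet> snd z / 2)"
      by (simp only: mean_on_diff[OF L(1) bdd_on_const bdd_on_cmult[OF hb]] mean_on_const[OF L(1)] mean_on_cmult[OF L(1) hb])
    ultimately show ?thesis by simp
  qed
  have cp: "continuous_on UNIV (\<lambda>z::(real^'d) \<times> (real^'d^'d). D (fst z) \<bullet> snd z / 2)" if "continuous_on UNIV D" for D :: "real^'d \<Rightarrow> real^'d^'d"
    by (intro continuous_intros continuous_on_compose2[OF that]) auto
  have Mx: "Max ((\<lambda>i. B i \<bullet> A) ` {..n}) \<le> fr A" "0 \<le> Max ((\<lambda>i. B i \<bullet> A) ` {..n})" if "A \<in> PSD" for A n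
  proof -
    show "Max ((\<lambda>i. B i \<bullet> A) ` {..n}) \<le> fr A" using B(2) that unfolding K_def by (subst Max_le_iff) auto
    have "B 0 \<bullet> A \<le> Max ((\<lambda>i. B i \<bullet> A) ` {..n})" by (rule Max_ge) auto
    then show "0 \<le> Max ((\<lambda>i. B i \<bullet> A) ` {..n})" using B(1) by simp
  qed
  have cMx: "continuous_on UNIV (\<lambda>A. Max ((\<lambda>i. B i \<bullet> A) ` {..n}))" for n
  proof (induction n)
    case 0 show ?case by (simp, intro continuous_intros)
  next
    case (Suc n)
    have "Max ((\<lambda>i. B i \<bullet> A) ` {..Suc n}) = max (B (Suc n) \<bullet> A) (Max ((\<lambda>i. B i \<bullet> A) ` {..n}))" for A
      by (simp add: atMost_Suc)
    then show ?case using Suc by (simp, intro continuous_intros)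
  qed
  show thesis
  proof (rule that[of T m])
    show "T \<ge> 0" using T by simp
    show "AE z in m. snd z \<in> PSD \<and> trace (snd z) \<le> 1" using mX by eventually_elim (simp add: \<Sigma>(1,2) Xsnd)
    fix \<psi> g D assume C2: "C2_map \<psi> g D" and supp: "bounded {x::real^'d. \<psi> x \<noteq> 0}"
    have hb: "(\<lambda>z. D (fst z) \<bullet> snd z / 2) \<in> bdd_on X" by (rule Hb[OF C2_map_Hessian_support(2)[OF C2 supp]])
    have "L (\<lambda>z. D (fst z) \<bullet> snd z / 2) = (LINT z|m. D (fst z) \<bullet> snd z / 2)"
    proof (rule rep[OF cp[OF C2_mapD(3)[OF C2]] hb])
      have "{z \<in> X. D (fst z) \<bullet> snd z / 2 \<noteq> 0} \<subseteq> {x. D x \<noteq> 0} \<times> cball 0 N"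
        using \<Sigma>(4) Xsnd by auto
      then show "bounded {z \<in> X. D (fst z) \<bullet> snd z / 2 \<noteq> 0}"
        by (rule bounded_subset[rotated]) (intro bounded_Times bounded_cball C2_map_Hessian_support(1)[OF C2 supp])
    qed
    moreover have "gapv \<psi> \<le> T * L (\<lambda>z. D (fst z) \<bullet> snd z / 2)" by (rule L_lower[OF C2 supp])
    moreover have "T * L (\<lambda>z. D (fst z) \<bullet> snd z / 2) \<le> gapv \<psi>"
    proof -
      have "gapv (\<lambda>x. -1 * \<psi> x) \<le> T * L (\<lambda>z. (-1 *\<^sub>R D (fst z)) \<bullet> snd z / 2)"
        by (rule L_lower[OF C2_map_scale[OF C2]]) (use supp in simp)
      also have "(\<lambda>z. (-1 *\<^sub>R D (fst z)) \<bullet> snd z / 2) = (\<lambda>z. -1 * (D (fst z) \<bullet> snd z / 2))" by auto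
      also have "L \<dots> = -1 * L (\<lambda>z. D (fst z) \<bullet> snd z / 2)" by (rule mean_on_cmult[OF L(1) hb])
      finally show ?thesis unfolding gapv_def by simp
    qed
    ultimately show "(LINT z|m. T * (D (fst z) \<bullet> snd z / 2)) = (LINT x|\<nu>. \<psi> x) - (LINT x|\<mu>. \<psi> x)"
      unfolding gapv_def by (simp only: integral_mult_right_zero)
  next
    fix n
    let ?M = "\<lambda>z :: (real^'d) \<times> (real^'d^'d). Max ((\<lambda>i. B i \<bullet> snd z) ` {..n})"
    have Lfr: "T * L (\<lambda>z. fr (snd z)) \<le> s"
    proof -
      have "L (\<lambda>z. T * fr (snd z) - s) \<le> 0"
        using L(2)[OF HI[of 1, OF _ zeroC2]] gap0 by simp
      moreover have "L (\<lambda>z. T * fr (snd z) - s) = T * L (\<lambda>z. fr (snd z)) - s"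
        by (simp only: mean_on_diff[OF L(1) bdd_on_cmult[OF frb] bdd_on_const] mean_on_const[OF L(1)] mean_on_cmult[OF L(1) frb])
      ultimately show ?thesis by simp
    qed
    define \<zeta> where "\<zeta> R x = max 0 (min 1 (R + 1 - norm x))" for R :: real and x :: "real^'d"
    have \<zeta>b: "0 \<le> \<zeta> R x" "\<zeta> R x \<le> 1" for R x unfolding \<zeta>_def by auto
    have c\<zeta>: "continuous_on UNIV (\<zeta> R)" for R unfolding \<zeta>_def by (intro continuous_intros)
    have cM: "continuous_on UNIV ?M" by (rule continuous_on_compose2[OF cMx]) (auto intro: continuous_intros)
    have mM: "?M \<in> borel_measurable m" using borel_measurable_continuous_onI[OF cM] sm by (simp cong: measurable_cong_sets)
    have cu: "continuous_on UNIV (\<lambda>z. ?M z * \<zeta> R (fst z))" for R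
      by (intro continuous_on_mult cM continuous_on_compose2[OF c\<zeta>]) (auto intro: continuous_intros)
    have Mb: "0 \<le> ?M z" "?M z \<le> \<kappa>" "?M z \<le> fr (snd z)" if "z \<in> X" for z
      using Mx[OF \<Sigma>(1)[OF Xsnd[OF that]], of n] \<Sigma>(5)[OF Xsnd[OF that]] by linarith+
    have ub: "(\<lambda>z. ?M z * \<zeta> R (fst z)) \<in> bdd_on X" for R
      by (intro bdd_on_mult bdd_onI[of _ ?M \<kappa>] bdd_onI[of _ "\<lambda>z. \<zeta> R (fst z)" 1]) (use Mb \<zeta>b in auto)
    have each: "T * (LINT z|m. ?M z * \<zeta> R (fst z)) \<le> s" for R
    proof -
      have "(LINT z|m. ?M z * \<zeta> R (fst z)) = L (\<lambda>z. ?M z * \<zeta> R (fst z))"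
      proof (rule rep[OF cu ub, symmetric])
        have "{z \<in> X. ?M z * \<zeta> R (fst z) \<noteq> 0} \<subseteq> cball 0 (R + 1) \<times> cball 0 N"
          using \<Sigma>(4) Xsnd unfolding \<zeta>_def by (auto simp: max_def min_def split: if_splits)
        then show "bounded {z \<in> X. ?M z * \<zeta> R (fst z) \<noteq> 0}"
          by (rule bounded_subset[rotated]) (intro bounded_Times bounded_cball)
      qed
      also have "\<dots> \<le> L (\<lambda>z. fr (snd z))"
      proof (rule mean_on_mono[OF L(1) ub frb])
        fix z assume z: "z \<in> X"
        have "?M z * \<zeta> R (fst z) \<le> ?M z * 1" by (rule mult_left_mono) (use \<zeta>b Mb[OF z] in auto)
        then show "?M z * \<zeta> R (fst z) \<le> fr (snd z)" using Mb(3)[OF z] by linarith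
      qed
      finally have "T * (LINT z|m. ?M z * \<zeta> R (fst z)) \<le> T * L (\<lambda>z. fr (snd z))" using T(1) by simp
      then show ?thesis using Lfr by simp
    qed
    have "(\<lambda>k. (LINT z|m. ?M z * \<zeta> (real k) (fst z))) \<longlonglongrightarrow> (LINT z|m. ?M z)"
    proof (rule integral_dominated_convergence[where w="\<lambda>_. \<kappa>"])
      show "?M \<in> borel_measurable m" by (rule mM)
      show "(\<lambda>z. ?M z * \<zeta> (real k) (fst z)) \<in> borel_measurable m" for k
        using borel_measurable_continuous_onI[OF cu[of "real k"]] sm by (simp cong: measurable_cong_sets)
      show "AE z in m. (\<lambda>k. ?M z * \<zeta> (real k) (fst z)) \<longlonglongrightarrow> ?M z"
      proof (rule AE_I2)
        fix z :: "(real^'d) \<times> (real^'d^'d)"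
        obtain k0 :: nat where "norm (fst z) \<le> real k0" using real_arch_simple by blast
        then have "\<forall>\<^sub>F k in sequentially. ?M z * \<zeta> (real k) (fst z) = ?M z"
          unfolding \<zeta>_def by (intro eventually_sequentiallyI[of k0]) simp
        then show "(\<lambda>k. ?M z * \<zeta> (real k) (fst z)) \<longlonglongrightarrow> ?M z" by (rule tendsto_eventually)
      qed
      show "AE z in m. norm (?M z * \<zeta> (real k) (fst z)) \<le> \<kappa>" for k
        using mX
      proof eventually_elim
        case (elim z)
        have "?M z * \<zeta> (real k) (fst z) \<le> ?M z * 1" by (rule mult_left_mono) (use \<zeta>b Mb[OF elim] in auto)
        moreover have "0 \<le> ?M z * \<zeta> (real k) (fst z)" by (rule mult_nonneg_nonneg) (use \<zeta>b Mb[OF elim] in auto)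
        ultimately show ?case using Mb(2)[OF elim] unfolding real_norm_def by linarith
      qed
    qed simp
    then have "(\<lambda>k. T * (LINT z|m. ?M z * \<zeta> (real k) (fst z))) \<longlonglongrightarrow> T * (LINT z|m. ?M z)"
      by (intro tendsto_mult tendsto_const)
    then show "T * (LINT z|m. ?M z) \<le> s" by (rule LIMSEQ_le_const2) (use each in blast)
  qed (rule fm sm)+
qed

end

section \<open>Solutions of the Fokker-Planck equation with a constant flux\<close>

text \<open>The point $(1-t)\mu+t\nu$ of the segment, as the law of a random choice between the two measures.\<close>

definition mixture :: "(real^'d) measure \<Rightarrow> (real^'d) measure \<Rightarrow> real \<Rightarrow> (real^'d) measure"
  where "mixture \<mu> \<nu> t = measure_pmf (bernoulli_pmf t) \<bind> (\<lambda>b. if b then \<nu> else \<mu>)"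

context
  fixes \<mu> \<nu> :: "(real^'d) measure"
  assumes \<mu>: "prob_space \<mu>" "sets \<mu> = sets borel" and \<nu>: "prob_space \<nu>" "sets \<nu> = sets borel"
begin

lemma mixture_kernel: "(\<lambda>b. if b then \<nu> else \<mu>) \<in> measure_pmf p \<rightarrow>\<^sub>M prob_algebra borel"
  unfolding measurable_pmf_measure1 using \<mu> \<nu> by (auto simp: space_prob_algebra)

lemma mixture_prob: "prob_space (mixture \<mu> \<nu> t)" and sets_mixture: "sets (mixture \<mu> \<nu> t) = sets borel"
proof -
  have p: "measure_pmf (bernoulli_pmf t) \<in> space (prob_algebra (measure_pmf (bernoulli_pmf t)))"
    by (simp add: space_prob_algebra measure_pmf.prob_space_axioms)
  show "prob_space (mixture \<mu> \<nu> t)" unfolding mixture_def by (rule prob_space_bind'[OF p mixture_kernel])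
  show "sets (mixture \<mu> \<nu> t) = sets borel" unfolding mixture_def by (rule sets_bind'[OF p mixture_kernel])
qed

lemma nn_integral_mixture:
  assumes t: "t \<in> {0..1}" and h: "h \<in> borel_measurable borel"
  shows "(\<integral>\<^sup>+x. h x \<partial>mixture \<mu> \<nu> t) = ennreal t * (\<integral>\<^sup>+x. h x \<partial>\<nu>) + ennreal (1 - t) * (\<integral>\<^sup>+x. h x \<partial>\<mu>)"
proof -
  have "(\<integral>\<^sup>+x. h x \<partial>mixture \<mu> \<nu> t) = (\<integral>\<^sup>+b. (\<integral>\<^sup>+x. h x \<partial>(if b then \<nu> else \<mu>)) \<partial>measure_pmf (bernoulli_pmf t))"
    unfolding mixture_def by (rule nn_integral_bind[OF h measurable_prob_algebraD[OF mixture_kernel]])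
  also have "\<dots> = (\<integral>\<^sup>+x. h x \<partial>\<nu>) * ennreal t + (\<integral>\<^sup>+x. h x \<partial>\<mu>) * ennreal (1 - t)"
    using t by (subst nn_integral_measure_pmf_support[where A=UNIV]) (auto simp: UNIV_bool)
  finally show ?thesis by (simp add: mult.commute)
qed

lemma emeasure_mixture:
  assumes t: "t \<in> {0..1}" and E: "E \<in> sets borel"
  shows "emeasure (mixture \<mu> \<nu> t) E = ennreal t * emeasure \<nu> E + ennreal (1 - t) * emeasure \<mu> E"
  using nn_integral_mixture[OF t, of "indicator E"] E sets_mixture \<mu>(2) \<nu>(2) by simp

lemma integral_mixture:
  fixes h :: "real^'d \<Rightarrow> real"
  assumes t: "t \<in> {0..1}" and h: "h \<in> borel_measurable borel" and b: "\<And>x. \<bar>h x\<bar> \<le> C"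
  shows "(LINT x|mixture \<mu> \<nu> t. h x) = (1 - t) * (LINT x|\<mu>. h x) + t * (LINT x|\<nu>. h x)"
proof -
  have int: "integrable \<sigma> h" if "prob_space \<sigma>" "sets \<sigma> = sets borel" for \<sigma>
  proof -
    interpret prob_space \<sigma> by (rule that)
    have "h \<in> borel_measurable \<sigma>" using h that(2) by (simp cong: measurable_cong_sets)
    then show ?thesis by (intro integrable_const_bound[of _ C]) (auto simp: b)
  qed
  have shift: "(\<integral>\<^sup>+x. ennreal (h x + C) \<partial>\<sigma>) = ennreal ((LINT x|\<sigma>. h x) + C)" "0 \<le> (LINT x|\<sigma>. h x) + C"
    if s: "prob_space \<sigma>" "sets \<sigma> = sets borel" for \<sigma>
  proof -
    interpret prob_space \<sigma> by (rule s)
    have nn: "0 \<le> h x + C" for x using b[of x] by (auto simp: abs_le_iff)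
    have i: "integrable \<sigma> (\<lambda>x. h x + C)" using int[OF s] by simp
    have e: "(LINT x|\<sigma>. h x + C) = (LINT x|\<sigma>. h x) + C" using int[OF s] by (simp add: prob_space)
    show "(\<integral>\<^sup>+x. ennreal (h x + C) \<partial>\<sigma>) = ennreal ((LINT x|\<sigma>. h x) + C)"
      using nn_integral_eq_integral[OF i] nn e by simp
    show "0 \<le> (LINT x|\<sigma>. h x) + C" unfolding e[symmetric] by (rule integral_nonneg_AE) (simp add: nn)
  qed
  let ?a = "(LINT x|mixture \<mu> \<nu> t. h x) + C" and ?m = "(LINT x|\<mu>. h x) + C" and ?n = "(LINT x|\<nu>. h x) + C"
  have nn: "0 \<le> ?a" "0 \<le> ?m" "0 \<le> ?n"
    by (rule shift(2)[OF mixture_prob sets_mixture] shift(2)[OF \<mu>] shift(2)[OF \<nu>])+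
  have "(\<lambda>x. ennreal (h x + C)) \<in> borel_measurable borel" using h by measurable
  from nn_integral_mixture[OF t this]
  have "ennreal ?a = ennreal t * ennreal ?n + ennreal (1 - t) * ennreal ?m"
    unfolding shift(1)[OF mixture_prob sets_mixture] shift(1)[OF \<mu>] shift(1)[OF \<nu>] .
  also have "\<dots> = ennreal (t * ?n + (1 - t) * ?m)"
    using t nn by (simp add: ennreal_mult ennreal_plus del: ennreal_plus[symmetric] flip: ennreal_mult)
  finally have "?a = t * ?n + (1 - t) * ?m"
    using t nn by (subst (asm) ennreal_inj) (auto intro!: add_nonneg_nonneg mult_nonneg_nonneg)
  then show ?thesis by (simp add: algebra_simps)
qed

lemma mixture_endpoints: "mixture \<mu> \<nu> 0 = \<mu>" "mixture \<mu> \<nu> 1 = \<nu>"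
proof -
  show "mixture \<mu> \<nu> 0 = \<mu>"
    by (rule measure_eqI) (use emeasure_mixture[of 0] sets_mixture \<mu>(2) in simp_all)
  show "mixture \<mu> \<nu> 1 = \<nu>"
    by (rule measure_eqI) (use emeasure_mixture[of 1] sets_mixture \<nu>(2) in simp_all)
qed

lemma mixture_measurable: "mixture \<mu> \<nu> \<in> unit_time \<rightarrow>\<^sub>M prob_algebra borel"
proof (rule measurable_prob_algebraI[OF mixture_prob measurable_subprob_algebra])
  show "subprob_space (mixture \<mu> \<nu> t)" for t by (rule prob_space_imp_subprob_space[OF mixture_prob])
  show "sets (mixture \<mu> \<nu> t) = sets borel" for t by (rule sets_mixture)
  fix E :: "(real^'d) set" assume E: "E \<in> sets borel"
  have "(\<lambda>t. ennreal t * emeasure \<nu> E + ennreal (1 - t) * emeasure \<mu> E) \<in> borel_measurable unit_time"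
    by (rule measurable_restrict_space1) measurable
  then show "(\<lambda>t. emeasure (mixture \<mu> \<nu> t) E) \<in> borel_measurable unit_time"
    by (rule measurable_cong[THEN iffD1, rotated]) (simp add: space_restrict_space emeasure_mixture E)
qed

end

lemma strip_pairs_measurable:
  assumes "sets \<sigma> = sets (borel :: (real^'d) measure)"
  shows "(\<lambda>w. w) \<in> unit_time \<Otimes>\<^sub>M \<sigma> \<rightarrow>\<^sub>M (strip_borel :: (real \<times> (real^'d)) measure)"
proof (rule measurable_restrict_space2)
  have 1: "fst \<in> unit_time \<Otimes>\<^sub>M \<sigma> \<rightarrow>\<^sub>M borel"
    by (rule measurable_compose[OF measurable_fst]) (rule measurable_restrict_space1, simp)
  have 2: "snd \<in> unit_time \<Otimes>\<^sub>M \<sigma> \<rightarrow>\<^sub>M borel"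
    using measurable_snd[of unit_time \<sigma>] assms by (simp cong: measurable_cong_sets)
  show "(\<lambda>w. w) \<in> unit_time \<Otimes>\<^sub>M \<sigma> \<rightarrow>\<^sub>M borel"
    using measurable_Pair[OF 1 2] by (simp add: borel_prod)
  show "(\<lambda>w. w) \<in> space (unit_time \<Otimes>\<^sub>M \<sigma>) \<rightarrow> time_strip"
    by (auto simp: space_pair_measure space_restrict_space)
qed

lemma strip_Fubini:
  fixes u :: "real \<times> (real^'d) \<Rightarrow> real"
  assumes fin: "finite_measure \<sigma>" and s: "sets \<sigma> = sets borel" and u: "continuous_on time_strip u"
    and b: "\<And>z. z \<in> time_strip \<Longrightarrow> \<bar>u z\<bar> \<le> C"
  shows "(LINT t|unit_time. LINT x|\<sigma>. u (t, x)) = (LINT x|\<sigma>. LINT t|unit_time. u (t, x))"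
    and "integrable unit_time (\<lambda>t. LINT x|\<sigma>. u (t, x))"
proof -
  interpret U: finite_measure unit_time by (rule finite_measure_unit_time)
  interpret S: finite_measure \<sigma> by (rule fin)
  interpret P: pair_sigma_finite unit_time \<sigma> by unfold_locales
  have m: "u \<in> borel_measurable (unit_time \<Otimes>\<^sub>M \<sigma>)"
    by (rule measurable_compose[OF strip_pairs_measurable[OF s] borel_measurable_continuous_on_restrict[OF u]])
  have sp: "z \<in> time_strip" if "z \<in> space (unit_time \<Otimes>\<^sub>M \<sigma>)" for z
    using that by (auto simp: space_pair_measure space_restrict_space)
  have "emeasure (unit_time \<Otimes>\<^sub>M \<sigma>) (space (unit_time \<Otimes>\<^sub>M \<sigma>)) = emeasure unit_time (space unit_time) * emeasure \<sigma> (space \<sigma>)"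
    unfolding space_pair_measure by (rule S.emeasure_pair_measure_Times[OF sets.top sets.top])
  also have "\<dots> < \<infinity>" by (simp add: U.emeasure_eq_measure S.emeasure_eq_measure flip: ennreal_mult)
  finally have "finite_measure (unit_time \<Otimes>\<^sub>M \<sigma>)" by (intro finite_measureI) simp
  then interpret PF: finite_measure "unit_time \<Otimes>\<^sub>M \<sigma>" .
  have i: "integrable (unit_time \<Otimes>\<^sub>M \<sigma>) (\<lambda>(t, x). u (t, x))"
    by (rule PF.integrable_const_bound[of _ C]) (use m b sp in auto)
  show "(LINT t|unit_time. LINT x|\<sigma>. u (t, x)) = (LINT x|\<sigma>. LINT t|unit_time. u (t, x))"
    by (rule P.Fubini_integral[OF i, symmetric])
  show "integrable unit_time (\<lambda>t. LINT x|\<sigma>. u (t, x))"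
    by (rule P.integrable_fst[OF i])
qed

context cost_function
begin

text \<open>Because the cost does not see the density of the particles, the straight line between the two
  end measures, driven by a flux that does not depend on time, is as good as any other path.  The
  cost of the flux is tested with finite selections of linear functionals, each of which is at most the
  integral of the pointwise maximum over the matrix variable.\<close>

theorem dyn_cost_le_potential_gap:
  assumes \<mu>: "\<mu> \<in> P2" and \<nu>: "\<nu> \<in> P2" and s: "0 \<le> s"
    and gap: "\<And>\<psi>. \<psi> \<in> potentials 1 \<Longrightarrow> bounded {x. \<psi> x \<noteq> 0} \<Longrightarrow> (LINT x|\<nu>. \<psi> x) - (LINT x|\<mu>. \<psi> x) \<le> s"
  shows "dyn_cost f \<mu> \<nu> \<le> ennreal s"
proof -
  have p\<mu>: "prob_space \<mu>" "sets \<mu> = sets borel" and p\<nu>: "prob_space \<nu>" "sets \<nu> = sets borel"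
    and mom: "(\<integral>\<^sup>+x. ennreal ((norm x)\<^sup>2) \<partial>\<mu>) < \<infinity>" "(\<integral>\<^sup>+x. ennreal ((norm x)\<^sup>2) \<partial>\<nu>) < \<infinity>"
    using \<mu> \<nu> unfolding P2_def by auto
  have f\<mu>: "finite_measure \<mu>" and f\<nu>: "finite_measure \<nu>" using p\<mu>(1) p\<nu>(1) by (simp_all add: prob_space.finite_measure)
  obtain B where B: "B 0 = 0" "\<And>i::nat. B i \<in> K" "\<And>A. A \<in> PSD \<Longrightarrow> f A = (SUP i. ennreal (B i \<bullet> A))"
    using countable_support by blast
  obtain m T where
    T: "T \<ge> 0" and fm: "finite_measure m" and sm: "sets m = sets borel"
    and mPSD: "AE z in m. snd z \<in> PSD \<and> trace (snd z) \<le> 1"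
    and eqc: "\<And>\<psi> g D. C2_map \<psi> g D \<Longrightarrow> bounded {x. \<psi> x \<noteq> 0} \<Longrightarrow>
      (LINT z|m. T * (D (fst z) \<bullet> snd z / 2)) = (LINT x|\<nu>. \<psi> x) - (LINT x|\<mu>. \<psi> x)"
    and cost: "\<And>n. T * (LINT z|m. Max ((\<lambda>i. B i \<bullet> snd z) ` {..n})) \<le> s"
    by (rule static_measure[where B=B, OF s f\<mu> f\<nu> p\<mu>(2) p\<nu>(2) gap B(1) B(2)])
      (assumption | (rule that; assumption))+
  interpret m: finite_measure m by (rule fm)
  have m_fst: "fst \<in> m \<rightarrow>\<^sub>M borel" and m_snd: "snd \<in> m \<rightarrow>\<^sub>M borel"
    using sm by (auto intro!: borel_measurable_continuous_onI continuous_intros cong: measurable_cong_sets)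
  define N where "N = (real CARD('d))\<^sup>2"
  define a where "a z = (if snd z \<in> PSD \<and> trace (snd z) \<le> 1 then T *\<^sub>R snd z else 0)" for z :: "(real^'d) \<times> (real^'d^'d)"
  have a_PSD: "a z \<in> PSD" for z unfolding a_def using T by (auto intro: PSD_scaleR zero_PSD)
  have a_norm: "norm (a z) \<le> T * N" for z
  proof (cases "snd z \<in> PSD \<and> trace (snd z) \<le> 1")
    case True
    then have "norm (snd z) \<le> N * trace (snd z)" unfolding N_def by (intro PSD_norm_le_trace) simp
    also have "\<dots> \<le> N * 1" by (rule mult_left_mono) (use True in \<open>auto simp: N_def\<close>)
    finally have "T * norm (snd z) \<le> T * N" using T by (intro mult_left_mono) simp_all
    then show ?thesis unfolding a_def using True T by simp
  next
    case False
    then have "a z = 0" unfolding a_def by (rule if_not_P)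
    then show ?thesis using T by (simp add: N_def)
  qed
  have a_AE: "AE z in m. a z = T *\<^sub>R snd z" using mPSD by eventually_elim (simp add: a_def)
  have cltr: "closed {A :: real^'d^'d. A \<in> PSD \<and> trace A \<le> 1}"
    by (intro closed_Collect_conj closed_Collect_le bounded_linear.continuous_on[OF bounded_linear_trace] continuous_intros)
      (simp add: closed_PSD)
  have a_meas: "a \<in> borel_measurable m"
  proof -
    have "{A :: real^'d^'d. A \<in> PSD \<and> trace A \<le> 1} \<in> sets borel" by (rule borel_closed[OF cltr])
    from measurable_sets[OF m_snd this] have pr: "{z \<in> space m. snd z \<in> PSD \<and> trace (snd z) \<le> 1} \<in> sets m"
      by (simp add: vimage_def Int_def conj_commute)
    show ?thesis unfolding a_def[abs_def]
      by (rule measurable_If[OF borel_measurable_scaleR[OF borel_measurable_const m_snd] borel_measurable_const pr])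
  qed
  have a_int: "integrable m a" by (rule m.integrable_const_bound[of _ "T * N"]) (simp_all add: a_norm a_meas)
  define \<Lambda> where "\<Lambda> E = (LINT z|m. indicator E (fst z) *\<^sub>R a z)" for E
  have \<Lambda>: "PSD_measure borel \<Lambda>"
    unfolding \<Lambda>_def[abs_def] by (rule PSD_measure_of_density[OF a_int _ m_fst]) (simp add: a_PSD)
  note V = polar_density_spec[OF \<Lambda>]
  have imx: "integral_matrix borel b \<Lambda> = (LINT z|m. b (fst z) \<bullet> a z)"
    if "b \<in> borel_measurable borel" "\<And>x. norm (b x) \<le> C" for b and C :: real
    unfolding integral_matrix_def
  proof (rule vector_measure_integral_unique[where ?p1.0="\<lambda>x. x" and M=borel])
    show "integrable (total_variation borel \<Lambda>) (polar_density borel \<Lambda>)" by (rule V(3))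
    show "integrable m a" by (rule a_int)
    show "(\<lambda>x. x) \<in> total_variation borel \<Lambda> \<rightarrow>\<^sub>M borel" using V(2) by (rule measurable_ident_sets)
    show "(LINT z|total_variation borel \<Lambda>. indicator E z *\<^sub>R polar_density borel \<Lambda> z) = (LINT z|m. indicator E (fst z) *\<^sub>R a z)"
      if "E \<in> sets borel" for E
      using V(4)[OF that] unfolding \<Lambda>_def set_lebesgue_integral_def by simp
  qed (rule m_fst, rule that(1), rule that(2))
  \<comment> \<open>From compactly supported to bounded test functions, by cutting off in space.\<close>
  have eqb: "integral_matrix borel (\<lambda>x. (1/2) *\<^sub>R D x) \<Lambda> = (LINT x|\<nu>. \<theta> x) - (LINT x|\<mu>. \<theta> x)"
    if C2: "C2_map \<theta> g D" and \<theta>C: "\<And>x. \<bar>\<theta> x\<bar> \<le> C" and DC: "\<And>x. norm (D x) \<le> C" for \<theta> g D C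
  proof -
    from C2_cutoff[OF C2 \<theta>C DC] obtain \<theta>' g' D' Cb where
      n: "\<And>n::nat. C2_map (\<theta>' n) (g' n) (D' n)" "\<And>n. bounded {x. \<theta>' n x \<noteq> 0}"
        "\<And>n x. \<bar>\<theta>' n x\<bar> \<le> Cb" "\<And>n x. norm (D' n x) \<le> Cb"
        "\<And>x. (\<lambda>n. \<theta>' n x) \<longlonglongrightarrow> \<theta> x" "\<And>x. (\<lambda>n. D' n x) \<longlonglongrightarrow> D x" by blast
    have scal: "(\<lambda>n. LINT x|\<sigma>. \<theta>' n x) \<longlonglongrightarrow> (LINT x|\<sigma>. \<theta> x)" if \<sigma>: "finite_measure \<sigma>" "sets \<sigma> = sets borel" for \<sigma>
    proof (rule integral_dominated_convergence[where w="\<lambda>_. Cb"])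
      interpret finite_measure \<sigma> by (rule \<sigma>)
      show "\<theta> \<in> borel_measurable \<sigma>" "\<theta>' n \<in> borel_measurable \<sigma>" for n
        using \<sigma>(2) C2_mapD(5)[OF C2] C2_mapD(5)[OF n(1)]
        by (auto intro!: borel_measurable_continuous_onI cong: measurable_cong_sets)
      show "integrable \<sigma> (\<lambda>_. Cb)" by simp
    qed (use n in auto)
    have Dm: "D \<in> borel_measurable borel" by (rule borel_measurable_continuous_onI[OF C2_mapD(3)[OF C2]])
    have mDn: "D' n \<in> borel_measurable borel" for n by (rule borel_measurable_continuous_onI[OF C2_mapD(3)[OF n(1)]])
    have mm: "(\<lambda>z. b (fst z) \<bullet> a z / 2) \<in> borel_measurable m" if "b \<in> borel_measurable borel" for b :: "real^'d \<Rightarrow> real^'d^'d"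
      by (intro borel_measurable_divide borel_measurable_inner measurable_compose[OF m_fst that] a_meas borel_measurable_const)
    have vec: "(\<lambda>n. LINT z|m. D' n (fst z) \<bullet> a z / 2) \<longlonglongrightarrow> (LINT z|m. D (fst z) \<bullet> a z / 2)"
    proof (rule integral_dominated_convergence[where w="\<lambda>_. Cb * (T * N)"])
      show "(\<lambda>z. D (fst z) \<bullet> a z / 2) \<in> borel_measurable m" by (rule mm[OF Dm])
      show "(\<lambda>z. D' n (fst z) \<bullet> a z / 2) \<in> borel_measurable m" for n by (rule mm[OF mDn])
      show "integrable m (\<lambda>_. Cb * (T * N))" by simp
      show "AE z in m. (\<lambda>n. D' n (fst z) \<bullet> a z / 2) \<longlonglongrightarrow> D (fst z) \<bullet> a z / 2"
        by (intro AE_I2 tendsto_divide tendsto_inner n(6) tendsto_const) simp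
      show "AE z in m. norm (D' n (fst z) \<bullet> a z / 2) \<le> Cb * (T * N)" for n
      proof (rule AE_I2)
        fix z
        have "\<bar>D' n (fst z) \<bullet> a z\<bar> \<le> norm (D' n (fst z)) * norm (a z)" by (rule Cauchy_Schwarz_ineq2)
        also have "\<dots> \<le> Cb * (T * N)"
          by (intro mult_mono n(4) a_norm) (use order_trans[OF norm_ge_zero n(4)] in auto)
        finally show "norm (D' n (fst z) \<bullet> a z / 2) \<le> Cb * (T * N)" by simp
      qed
    qed
    have eqn: "(LINT z|m. D' n (fst z) \<bullet> a z / 2) = (LINT x|\<nu>. \<theta>' n x) - (LINT x|\<mu>. \<theta>' n x)" for n
    proof -
      have "(LINT z|m. D' n (fst z) \<bullet> a z / 2) = (LINT z|m. T * (D' n (fst z) \<bullet> snd z / 2))"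
      proof (rule integral_cong_AE[OF mm[OF mDn]])
        show "(\<lambda>z. T * (D' n (fst z) \<bullet> snd z / 2)) \<in> borel_measurable m"
          by (intro borel_measurable_times borel_measurable_divide borel_measurable_inner measurable_compose[OF m_fst mDn] m_snd borel_measurable_const)
        show "AE z in m. D' n (fst z) \<bullet> a z / 2 = T * (D' n (fst z) \<bullet> snd z / 2)"
          using a_AE by eventually_elim simp
      qed
      then show ?thesis using eqc[OF n(1,2)] by simp
    qed
    have "(\<lambda>n. (LINT x|\<nu>. \<theta>' n x) - (LINT x|\<mu>. \<theta>' n x)) \<longlonglongrightarrow> (LINT z|m. D (fst z) \<bullet> a z / 2)"
      using vec unfolding eqn .
    then have "(LINT z|m. D (fst z) \<bullet> a z / 2) = (LINT x|\<nu>. \<theta> x) - (LINT x|\<mu>. \<theta> x)"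
      by (rule LIMSEQ_unique[OF _ tendsto_diff[OF scal[OF f\<nu> p\<nu>(2)] scal[OF f\<mu> p\<mu>(2)]]])
    moreover have "integral_matrix borel (\<lambda>x. (1/2) *\<^sub>R D x) \<Lambda> = (LINT z|m. ((1/2) *\<^sub>R D (fst z)) \<bullet> a z)"
      by (rule imx[of _ "C / 2"]) (use Dm DC in auto)
    ultimately show ?thesis by simp
  qed
  define r where "r = mixture \<mu> \<nu>"
  define l where "l t = \<Lambda>" for t :: real
  note mix = mixture_prob[OF p\<mu> p\<nu>] sets_mixture[OF p\<mu> p\<nu>] mixture_measurable[OF p\<mu> p\<nu>]
  interpret U: finite_measure unit_time by (rule finite_measure_unit_time)
  have U_prob: "prob_space unit_time"
    by (rule prob_spaceI) (simp add: emeasure_restrict_space space_restrict_space)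
  have U_space: "space unit_time = {0<..<1}" by (simp add: space_restrict_space)
  define k where "k t = distr (r t) strip_borel (Pair t)" for t
  have pairs: "(\<lambda>(t, x). (t, x)) \<in> unit_time \<Otimes>\<^sub>M borel \<rightarrow>\<^sub>M (strip_borel :: (real \<times> (real^'d)) measure)"
    using strip_pairs_measurable[of borel] by (simp add: id_def)
  have k: "k \<in> unit_time \<rightarrow>\<^sub>M prob_algebra strip_borel"
    unfolding k_def[abs_def] r_def by (rule measurable_distr_prob_space2[OF mix(3) pairs])
  have Pair_meas: "Pair t \<in> borel \<rightarrow>\<^sub>M (strip_borel :: (real \<times> (real^'d)) measure)" if "t \<in> {0<..<1}" for t
    by (rule measurable_restrict_space2) (use that in \<open>auto intro!: borel_measurable_continuous_onI continuous_intros\<close>)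
  have Pair_meas_r: "Pair t \<in> r t \<rightarrow>\<^sub>M (strip_borel :: (real \<times> (real^'d)) measure)" if "t \<in> {0<..<1}" for t
    using Pair_meas[OF that] mix(2) unfolding r_def by (simp cong: measurable_cong_sets)
  have r_space: "space (r t) = UNIV" for t using sets_eq_imp_space_eq[OF mix(2)] unfolding r_def by simp
  define \<rho> where "\<rho> = unit_time \<bind> k"
  have Ualg: "unit_time \<in> space (prob_algebra unit_time)" using U_prob by (simp add: space_prob_algebra)
  have \<rho>_prob: "prob_space \<rho>" and \<rho>_sets: "sets \<rho> = sets strip_borel"
    unfolding \<rho>_def by (rule prob_space_bind'[OF Ualg k] sets_bind'[OF Ualg k])+
  have \<rho>_em: "emeasure \<rho> E = (\<integral>\<^sup>+t. emeasure (r t) (Pair t -` E) \<partial>unit_time)" if E: "E \<in> sets \<rho>" for E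
  proof -
    have E': "E \<in> sets strip_borel" using E \<rho>_sets by simp
    have "emeasure \<rho> E = (\<integral>\<^sup>+t. emeasure (k t) E \<partial>unit_time)"
      unfolding \<rho>_def by (rule emeasure_bind[OF _ measurable_prob_algebraD[OF k] E']) (simp add: U_space)
    also have "\<dots> = (\<integral>\<^sup>+t. emeasure (r t) (Pair t -` E) \<partial>unit_time)"
      by (rule nn_integral_cong) (simp add: U_space k_def emeasure_distr[OF Pair_meas_r E'] r_space)
    finally show ?thesis .
  qed
  have mom_r: "(\<integral>\<^sup>+x. ennreal ((norm x)\<^sup>2) \<partial>r t) \<le> (\<integral>\<^sup>+x. ennreal ((norm x)\<^sup>2) \<partial>\<nu>) + (\<integral>\<^sup>+x. ennreal ((norm x)\<^sup>2) \<partial>\<mu>)"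
    if t: "t \<in> {0..1}" for t
  proof -
    have "(\<integral>\<^sup>+x. ennreal ((norm x)\<^sup>2) \<partial>r t) = ennreal t * (\<integral>\<^sup>+x. ennreal ((norm x)\<^sup>2) \<partial>\<nu>) + ennreal (1 - t) * (\<integral>\<^sup>+x. ennreal ((norm x)\<^sup>2) \<partial>\<mu>)"
      unfolding r_def by (rule nn_integral_mixture[OF p\<mu> p\<nu> t]) measurable
    also have "\<dots> \<le> 1 * (\<integral>\<^sup>+x. ennreal ((norm x)\<^sup>2) \<partial>\<nu>) + 1 * (\<integral>\<^sup>+x. ennreal ((norm x)\<^sup>2) \<partial>\<mu>)"
      using t by (intro add_mono mult_right_mono) (auto simp: ennreal_le_1)
    finally show ?thesis by simp
  qed
  have \<rho>_P2: "\<rho> \<in> P2_strip" unfolding P2_strip_def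
  proof (intro CollectI conjI \<rho>_prob \<rho>_sets)
    have sm2: "(\<lambda>z :: real \<times> (real^'d). ennreal ((norm (snd z))\<^sup>2)) \<in> borel_measurable strip_borel"
      by (rule measurable_restrict_space1) (auto intro!: measurable_compose[OF _ measurable_ennreal] borel_measurable_continuous_onI continuous_intros)
    have "(\<integral>\<^sup>+z. ennreal ((norm (snd z))\<^sup>2) \<partial>\<rho>) = (\<integral>\<^sup>+t. \<integral>\<^sup>+z. ennreal ((norm (snd z))\<^sup>2) \<partial>k t \<partial>unit_time)"
      unfolding \<rho>_def by (rule nn_integral_bind[OF sm2 measurable_prob_algebraD[OF k]])
    also have "\<dots> = (\<integral>\<^sup>+t. \<integral>\<^sup>+x. ennreal ((norm x)\<^sup>2) \<partial>r t \<partial>unit_time)"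
      by (rule nn_integral_cong) (simp add: U_space k_def nn_integral_distr[OF Pair_meas_r] sm2)
    also have "\<dots> \<le> (\<integral>\<^sup>+t. (\<integral>\<^sup>+x. ennreal ((norm x)\<^sup>2) \<partial>\<nu>) + (\<integral>\<^sup>+x. ennreal ((norm x)\<^sup>2) \<partial>\<mu>) \<partial>unit_time)"
      by (rule nn_integral_mono) (rule mom_r, simp add: U_space)
    also have "\<dots> = (\<integral>\<^sup>+x. ennreal ((norm x)\<^sup>2) \<partial>\<nu>) + (\<integral>\<^sup>+x. ennreal ((norm x)\<^sup>2) \<partial>\<mu>)"
      using prob_space.emeasure_space_1[OF U_prob] by simp
    also have "\<dots> < \<infinity>" using mom by simp
    finally show "(\<integral>\<^sup>+z. ennreal ((norm (snd z))\<^sup>2) \<partial>\<rho>) < \<infinity>" .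
  qed
  interpret P: pair_sigma_finite unit_time m by unfold_locales
  let ?N = "unit_time \<Otimes>\<^sub>M m"
  define p where "p w = (fst w, fst (snd w))" for w :: "real \<times> ((real^'d) \<times> (real^'d^'d))"
  have p_meas: "p \<in> ?N \<rightarrow>\<^sub>M (strip_borel :: (real \<times> (real^'d)) measure)"
  proof -
    have "(\<lambda>w. (fst w, fst (snd w))) \<in> ?N \<rightarrow>\<^sub>M unit_time \<Otimes>\<^sub>M borel"
      by (intro measurable_Pair measurable_fst measurable_compose[OF measurable_snd m_fst])
    from measurable_compose[OF this strip_pairs_measurable[OF refl]] show ?thesis unfolding p_def[abs_def] .
  qed
  have "emeasure ?N (space ?N) = emeasure unit_time (space unit_time) * emeasure m (space m)"
    unfolding space_pair_measure by (rule m.emeasure_pair_measure_Times[OF sets.top sets.top])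
  also have "\<dots> < \<infinity>" by (simp add: U.emeasure_eq_measure m.emeasure_eq_measure flip: ennreal_mult)
  finally have "finite_measure ?N" by (intro finite_measureI) simp
  then interpret PF: finite_measure ?N .
  have aN_meas: "(\<lambda>w. a (snd w)) \<in> borel_measurable ?N" by (rule measurable_compose[OF measurable_snd a_meas])
  have aN_int: "integrable ?N (\<lambda>w. a (snd w))"
    by (rule PF.integrable_const_bound[of _ "T * N"]) (simp_all add: a_norm aN_meas)
  define \<Lambda>' where "\<Lambda>' E = (LINT w|?N. indicator E (p w) *\<^sub>R a (snd w))" for E
  have \<Lambda>': "PSD_measure strip_borel \<Lambda>'"
    unfolding \<Lambda>'_def[abs_def] by (rule PSD_measure_of_density[OF aN_int _ p_meas]) (simp add: a_PSD)
  have dis: "disintegrates_matrix \<Lambda>' l" unfolding disintegrates_matrix_def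
  proof (intro conjI ballI)
    show "PSD_measure borel (l t)" for t unfolding l_def by (rule \<Lambda>)
    fix E :: "(real \<times> (real^'d)) set" assume E: "E \<in> sets strip_borel"
    have "(\<lambda>w. indicator E (p w) :: real) \<in> borel_measurable ?N"
      by (rule measurable_compose[OF p_meas borel_measurable_indicator[OF E]])
    then have m: "(\<lambda>w. indicator E (p w) *\<^sub>R a (snd w)) \<in> borel_measurable ?N"
      by (rule borel_measurable_scaleR[OF _ aN_meas])
    have i: "integrable ?N (\<lambda>w. indicator E (p w) *\<^sub>R a (snd w))"
    proof (rule Bochner_Integration.integrable_bound[OF aN_int m], rule AE_I2)
      fix w
      show "norm (indicator E (p w) *\<^sub>R a (snd w)) \<le> norm (a (snd w))" by (auto split: split_indicator)
    qed
    have lt: "l t (Pair t -` E) = (LINT z|m. indicator E (p (t, z)) *\<^sub>R a (snd (t, z)))" for t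
      unfolding l_def \<Lambda>_def p_def by (rule Bochner_Integration.integral_cong) (auto split: split_indicator)
    show "integrable unit_time (\<lambda>t. l t (Pair t -` E))" unfolding lt by (rule P.integrable_fst'[OF i])
    show "\<Lambda>' E = (LINT t|unit_time. l t (Pair t -` E))"
      unfolding lt \<Lambda>'_def by (rule P.integral_fst'[OF i, symmetric])
  qed
  have FP: "FP_solution \<rho> \<Lambda>' r l"
    unfolding FP_solution_def
  proof (intro conjI allI impI \<rho>_P2 \<Lambda>' dis)
    show "disintegrates \<rho> unit_time r" unfolding disintegrates_def using mix(3) \<rho>_em by (simp add: r_def)
    have "emeasure (total_variation borel \<Lambda>) UNIV < \<infinity>"
      using finite_measure.emeasure_finite[OF V(1)] by (simp add: less_top)
    then show "(\<integral>\<^sup>+t. emeasure (total_variation borel (l t)) UNIV \<partial>unit_time) < \<infinity>"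
      using prob_space.emeasure_space_1[OF U_prob] unfolding l_def by simp
    fix \<phi> \<phi>' D assume test: "C12b_test \<phi> \<phi>' (D :: real \<times> (real^'d) \<Rightarrow> real^'d^'d)"
    from C12b_test_bounds[OF test] obtain C where C: "C \<ge> 0" and b\<phi>': "\<And>z. z \<in> time_strip \<Longrightarrow> \<bar>\<phi>' z\<bar> \<le> C"
      and bD: "\<And>z. z \<in> time_strip \<Longrightarrow> norm (D z) \<le> C" and b\<phi>: "\<And>z. z \<in> time_strip \<Longrightarrow> \<bar>\<phi> z\<bar> \<le> C" by metis
    from C12b_test_slice[OF test] obtain g
      where g: "\<And>t. t \<in> {0<..<1} \<Longrightarrow> C2_map (\<lambda>x. \<phi> (t, x)) (\<lambda>x. g (t, x)) (\<lambda>x. D (t, x))" by blast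
    have c\<phi>': "continuous_on time_strip \<phi>'" using test unfolding C12b_test_def by blast
    have c\<phi>: "continuous_on time_strip \<phi>" by (rule C12b_test_continuous[OF test])
    have ct1: "continuous_on time_strip (\<lambda>z. (1 - fst z) * \<phi>' z)" and ct2: "continuous_on time_strip (\<lambda>z. fst z * \<phi>' z)"
      by (intro continuous_on_mult c\<phi>' continuous_intros)+
    have bt1: "\<bar>(1 - fst z) * \<phi>' z\<bar> \<le> C" and bt2: "\<bar>fst z * \<phi>' z\<bar> \<le> C" if z: "z \<in> time_strip" for z
    proof -
      have "\<bar>1 - fst z\<bar> * \<bar>\<phi>' z\<bar> \<le> 1 * C" "\<bar>fst z\<bar> * \<bar>\<phi>' z\<bar> \<le> 1 * C"
        by (intro mult_mono b\<phi>'[OF z]; use z C in auto)+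
      then show "\<bar>(1 - fst z) * \<phi>' z\<bar> \<le> C" "\<bar>fst z * \<phi>' z\<bar> \<le> C" by (simp_all only: abs_mult mult_1)
    qed
    define i0 where "i0 \<sigma> = (LINT t|unit_time. LINT x|\<sigma>. \<phi> (t, x))" for \<sigma> :: "(real^'d) measure"
    have swap: "(LINT t|unit_time. LINT x|\<sigma>. (1 - t) * \<phi>' (t, x)) = i0 \<sigma>"
        "(LINT t|unit_time. LINT x|\<sigma>. t * \<phi>' (t, x)) = - i0 \<sigma>"
        "integrable unit_time (\<lambda>t. LINT x|\<sigma>. (1 - t) * \<phi>' (t, x))" "integrable unit_time (\<lambda>t. LINT x|\<sigma>. t * \<phi>' (t, x))"
        "integrable unit_time (\<lambda>t. LINT x|\<sigma>. \<phi> (t, x))"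
      if \<sigma>: "finite_measure \<sigma>" "sets \<sigma> = sets borel" for \<sigma>
    proof -
      note F1 = strip_Fubini[where u="\<lambda>z. (1 - fst z) * \<phi>' z", OF \<sigma> ct1 bt1, unfolded fst_conv]
      note F2 = strip_Fubini[where u="\<lambda>z. fst z * \<phi>' z", OF \<sigma> ct2 bt2, unfolded fst_conv]
      note F3 = strip_Fubini[where u=\<phi>, OF \<sigma> c\<phi> b\<phi>]
      show "integrable unit_time (\<lambda>t. LINT x|\<sigma>. (1 - t) * \<phi>' (t, x))" by (rule F1(2))
      show "integrable unit_time (\<lambda>t. LINT x|\<sigma>. t * \<phi>' (t, x))" by (rule F2(2))
      show "integrable unit_time (\<lambda>t. LINT x|\<sigma>. \<phi> (t, x))" by (rule F3(2))
      have "(LINT t|unit_time. LINT x|\<sigma>. (1 - t) * \<phi>' (t, x)) = (LINT x|\<sigma>. LINT t|unit_time. (1 - t) * \<phi>' (t, x))"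
        by (rule F1(1))
      also have "\<dots> = (LINT x|\<sigma>. LINT t|unit_time. \<phi> (t, x))" by (simp only: C12b_test_by_parts(2)[OF test])
      also note F3(1)[symmetric]
      finally show "(LINT t|unit_time. LINT x|\<sigma>. (1 - t) * \<phi>' (t, x)) = i0 \<sigma>" unfolding i0_def .
      have "(LINT t|unit_time. LINT x|\<sigma>. t * \<phi>' (t, x)) = (LINT x|\<sigma>. LINT t|unit_time. t * \<phi>' (t, x))"
        by (rule F2(1))
      also have "\<dots> = (LINT x|\<sigma>. - (LINT t|unit_time. \<phi> (t, x)))" by (simp only: C12b_test_by_parts(1)[OF test])
      also have "\<dots> = - (LINT x|\<sigma>. LINT t|unit_time. \<phi> (t, x))" by simp
      also have "\<dots> = - (LINT t|unit_time. LINT x|\<sigma>. \<phi> (t, x))" by (rule arg_cong[OF F3(1)[symmetric]])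
      finally show "(LINT t|unit_time. LINT x|\<sigma>. t * \<phi>' (t, x)) = - i0 \<sigma>" unfolding i0_def .
    qed
    have "(LINT t|unit_time. LINT x|r t. \<phi>' (t, x)) = (LINT t|unit_time. (LINT x|\<mu>. (1 - t) * \<phi>' (t, x)) + (LINT x|\<nu>. t * \<phi>' (t, x)))"
    proof (rule Bochner_Integration.integral_cong[OF refl])
      fix t assume "t \<in> space unit_time"
      then have t: "t \<in> {0<..<1}" by (simp add: U_space)
      have "(\<lambda>x. \<phi>' (t, x)) \<in> borel_measurable borel"
        by (rule borel_measurable_continuous_onI, rule continuous_on_compose2[OF c\<phi>']) (use t in \<open>auto intro!: continuous_intros\<close>)
      then have "(LINT x|r t. \<phi>' (t, x)) = (1 - t) * (LINT x|\<mu>. \<phi>' (t, x)) + t * (LINT x|\<nu>. \<phi>' (t, x))"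
        unfolding r_def by (intro integral_mixture[OF p\<mu> p\<nu>, where C=C] b\<phi>') (use t in auto)
      then show "(LINT x|r t. \<phi>' (t, x)) = (LINT x|\<mu>. (1 - t) * \<phi>' (t, x)) + (LINT x|\<nu>. t * \<phi>' (t, x))" by simp
    qed
    also have "\<dots> = i0 \<mu> - i0 \<nu>"
      by (simp only: Bochner_Integration.integral_add[OF swap(3)[OF f\<mu> p\<mu>(2)] swap(4)[OF f\<nu> p\<nu>(2)]]
          swap(1)[OF f\<mu> p\<mu>(2)] swap(2)[OF f\<nu> p\<nu>(2)])
    also have "\<dots> = - (LINT t|unit_time. (LINT x|\<nu>. \<phi> (t, x)) - (LINT x|\<mu>. \<phi> (t, x)))"
      unfolding i0_def by (simp only: Bochner_Integration.integral_diff[OF swap(5)[OF f\<nu> p\<nu>(2)] swap(5)[OF f\<mu> p\<mu>(2)]])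
    also have "\<dots> = - (LINT t|unit_time. integral_matrix borel (\<lambda>x. (1/2) *\<^sub>R D (t, x)) (l t))"
    proof (rule arg_cong[where f=uminus], rule Bochner_Integration.integral_cong[OF refl])
      fix t assume "t \<in> space unit_time"
      then have t: "t \<in> {0<..<1}" by (simp add: U_space)
      show "(LINT x|\<nu>. \<phi> (t, x)) - (LINT x|\<mu>. \<phi> (t, x)) = integral_matrix borel (\<lambda>x. (1/2) *\<^sub>R D (t, x)) (l t)"
        unfolding l_def by (rule eqb[OF g[OF t], of C, symmetric]) (use t b\<phi> bD in auto)
    qed
    finally show "(LINT t|unit_time. LINT x|r t. \<phi>' (t, x)) = - (LINT t|unit_time. integral_matrix borel (\<lambda>x. (1/2) *\<^sub>R D (t, x)) (l t))" .
  qed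
  have nc: "narrowly_continuous_P2 r" unfolding narrowly_continuous_P2_def
  proof (intro conjI ballI)
    fix t :: real assume t: "t \<in> {0..1}"
    have "(\<integral>\<^sup>+x. ennreal ((norm x)\<^sup>2) \<partial>r t) < \<infinity>" using mom_r[OF t] mom by (auto intro: le_less_trans)
    then show "r t \<in> P2" unfolding P2_def r_def using mix(1,2) by simp
  next
    fix h :: "real^'d \<Rightarrow> real" assume h: "h \<in> bcontfun"
    have hc: "continuous_on UNIV h" and hb: "bounded (range h)" using h unfolding bcontfun_def by auto
    obtain C where "\<forall>y\<in>range h. norm y \<le> C" using hb unfolding bounded_iff ..
    then have C: "\<bar>h x\<bar> \<le> C" for x by simp
    have "continuous_on {0..1} (\<lambda>t. (1 - t) * (LINT x|\<mu>. h x) + t * (LINT x|\<nu>. h x))" by (intro continuous_intros)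
    then show "continuous_on {0..1} (\<lambda>t. (LINT x|r t. h x))"
      by (rule continuous_on_eq) (simp add: r_def integral_mixture[OF p\<mu> p\<nu> _ borel_measurable_continuous_onI[OF hc] C])
  qed
  have sel: "(\<Sum>i\<le>n. B i \<bullet> \<Lambda> (E i)) \<le> s" if E: "\<And>i. E i \<in> sets borel" "disjoint_family E" for n and E :: "nat \<Rightarrow> (real^'d) set"
  proof -
    let ?M = "\<lambda>z :: (real^'d) \<times> (real^'d^'d). Max ((\<lambda>i. B i \<bullet> snd z) ` {..n})"
    have int: "integrable m (\<lambda>z. indicator (E i) (fst z) *\<^sub>R a z)" for i
    proof (rule Bochner_Integration.integrable_bound[OF a_int])
      show "(\<lambda>z. indicator (E i) (fst z) *\<^sub>R a z) \<in> borel_measurable m"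
        by (intro borel_measurable_scaleR measurable_compose[OF m_fst borel_measurable_indicator[OF E(1)]] a_meas)
    qed (auto split: split_indicator)
    have Mm: "?M \<in> borel_measurable m"
    proof -
      have [measurable]: "(\<lambda>z. B i \<bullet> snd z) \<in> borel_measurable m" for i
        by (intro borel_measurable_inner borel_measurable_const m_snd)
      show ?thesis by measurable
    qed
    have M0: "0 \<le> ?M z" for z
    proof -
      have "B 0 \<bullet> snd z \<le> ?M z" by (rule Max_ge) auto
      then show ?thesis using B(1) by simp
    qed
    have Mint: "integrable m ?M"
    proof (rule m.integrable_const_bound[OF _ Mm, of \<kappa>])
      show "AE z in m. norm (?M z) \<le> \<kappa>" using mPSD
      proof eventually_elim
        case (elim z)
        have "?M z \<le> fr (snd z)" using B(2) elim unfolding K_def by (subst Max_le_iff) auto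
        also have "\<dots> \<le> \<kappa> * trace (snd z)" by (rule fr_upper) (use elim in simp)
        also have "\<dots> \<le> \<kappa> * 1" by (rule mult_left_mono) (use elim \<kappa>_pos in auto)
        finally show ?case using M0[of z] by simp
      qed
    qed
    have "(\<Sum>i\<le>n. B i \<bullet> \<Lambda> (E i)) = (\<Sum>i\<le>n. LINT z|m. B i \<bullet> (indicator (E i) (fst z) *\<^sub>R a z))"
      unfolding \<Lambda>_def by (intro sum.cong refl integral_inner_right[symmetric] int)
    also have "\<dots> = (LINT z|m. (\<Sum>i\<le>n. B i \<bullet> (indicator (E i) (fst z) *\<^sub>R a z)))"
      by (rule Bochner_Integration.integral_sum[symmetric]) (intro integrable_inner_right int)
    also have "\<dots> \<le> (LINT z|m. T * ?M z)"
    proof (rule integral_mono_AE)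
      show "integrable m (\<lambda>z. \<Sum>i\<le>n. B i \<bullet> (indicator (E i) (fst z) *\<^sub>R a z))"
        by (intro Bochner_Integration.integrable_sum integrable_inner_right int)
      show "integrable m (\<lambda>z. T * ?M z)" using Mint by simp
      show "AE z in m. (\<Sum>i\<le>n. B i \<bullet> (indicator (E i) (fst z) *\<^sub>R a z)) \<le> T * ?M z"
        using a_AE
      proof eventually_elim
        case (elim z)
        show ?case
        proof (cases "\<exists>j\<le>n. fst z \<in> E j")
          case True
          then obtain j where j: "j \<le> n" "fst z \<in> E j" by blast
          have ne: "fst z \<notin> E i" if "i \<noteq> j" for i
            using E(2) j that unfolding disjoint_family_on_def by blast
          have "(\<Sum>i\<le>n. B i \<bullet> (indicator (E i) (fst z) *\<^sub>R a z)) = (\<Sum>i\<le>n. if i = j then B i \<bullet> a z else 0)"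
            by (rule sum.cong) (use j ne in auto)
          also have "\<dots> = B j \<bullet> a z" using j by (simp add: sum.delta)
          also have "\<dots> = T * (B j \<bullet> snd z)" unfolding elim by simp
          also have "\<dots> \<le> T * ?M z" by (rule mult_left_mono[OF Max_ge T]) (use j in auto)
          finally show ?thesis .
        next
          case False
          then have "(\<Sum>i\<le>n. B i \<bullet> (indicator (E i) (fst z) *\<^sub>R a z)) = 0" by (intro sum.neutral) auto
          then show ?thesis using T M0[of z] by simp
        qed
      qed
    qed
    also have "\<dots> = T * (LINT z|m. ?M z)" by simp
    also have "\<dots> \<le> s" by (rule cost)
    finally show ?thesis .
  qed
  have "FP_cost f l = (\<integral>\<^sup>+x. f (polar_density borel \<Lambda> x) \<partial>total_variation borel \<Lambda>)"
    unfolding FP_cost_def l_def using prob_space.emeasure_space_1[OF U_prob] by simp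
  also have "\<dots> \<le> ennreal s" by (rule FP_cost_slice_le[OF \<Lambda> B(2,1,3) sel])
  finally have cost_le: "FP_cost f l \<le> ennreal s" .
  have "r 0 = \<mu>" "r 1 = \<nu>" unfolding r_def by (rule mixture_endpoints[OF p\<mu> p\<nu>])+
  then have "dyn_cost f \<mu> \<nu> \<le> FP_cost f l"
    unfolding dyn_cost_def using FP nc by (intro Inf_lower) blast
  then show ?thesis using cost_le by (rule order_trans)
qed

end

section \<open>Dual potentials of the weak transport problem\<close>

lemma bcontfun_integrable:
  fixes \<psi> :: "real^'d \<Rightarrow> real"
  assumes \<psi>: "\<psi> \<in> bcontfun" and p: "finite_measure p" "sets p = sets borel"
  shows "integrable p \<psi>"
proof -
  interpret finite_measure p by (rule p)
  have c: "continuous_on UNIV \<psi>" and b: "bounded (range \<psi>)" using \<psi> unfolding bcontfun_def by auto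
  obtain C where "\<forall>y\<in>range \<psi>. norm y \<le> C" using b unfolding bounded_iff ..
  then have C: "\<bar>\<psi> x\<bar> \<le> C" for x by simp
  have "\<psi> \<in> borel_measurable p" using borel_measurable_continuous_onI[OF c] p(2) by (simp cong: measurable_cong_sets)
  then show ?thesis by (intro integrable_const_bound[of _ C]) (simp_all add: C)
qed

lemma P2_D: "p \<in> P2 \<Longrightarrow> prob_space p" "p \<in> P2 \<Longrightarrow> finite_measure p" "p \<in> P2 \<Longrightarrow> sets p = sets borel"
  unfolding P2_def by (auto intro: prob_space.finite_measure)

lemma return_P2: "return borel x \<in> (P2 :: (real^'d) measure set)"
  unfolding P2_def by (simp add: prob_space_return nn_integral_return)

context cost_function
begin

definition feasible :: "(real^'d \<Rightarrow> real) \<Rightarrow> bool"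
  where "feasible \<psi> \<longleftrightarrow> \<psi> \<in> bcontfun \<and> (\<forall>x. \<forall>p\<in>P2. ennreal ((LINT y|p. \<psi> y) - \<psi> x) \<le> G_cost f x p)"

text \<open>The lower envelope of the smooth potentials above a Lipschitz function inherits the Lipschitz
  constant, because the potentials may be translated, and it inherits feasibility, because the
  defining inequality is an upper bound for an integral of the envelope.\<close>

lemma potential_envelope:
  assumes w: "0 < w" and gC: "\<And>x. \<bar>g x\<bar> \<le> C" and gL: "\<And>x y. \<bar>g x - g y\<bar> \<le> M * dist x y" and M: "0 \<le> M"
  obtains P where "feasible (\<lambda>x. P x / w)" "\<And>x. g x \<le> P x"
    "\<And>\<theta> x. \<theta> \<in> potentials w \<Longrightarrow> (\<And>y. g y \<le> \<theta> y) \<Longrightarrow> P x \<le> \<theta> x"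
proof -
  define \<Theta> where "\<Theta> = {\<theta> \<in> potentials w. \<forall>y. g y \<le> \<theta> y}"
  define P where "P x = (INF \<theta>\<in>\<Theta>. \<theta> x)" for x
  have const: "(\<lambda>x. C) \<in> \<Theta>"
    unfolding \<Theta>_def using potentials_mono[OF potentials_const[of C], of w] w gC by (auto simp: abs_le_iff)
  then have ne: "\<Theta> \<noteq> {}" by blast
  have bdd: "bdd_below ((\<lambda>\<theta>. \<theta> x) ` \<Theta>)" for x unfolding \<Theta>_def by (rule bdd_belowI[of _ "g x"]) auto
  have P_le: "P x \<le> \<theta> x" if "\<theta> \<in> \<Theta>" for \<theta> x unfolding P_def by (rule cINF_lower[OF bdd that])
  have P_ge: "a \<le> P x" if "\<And>\<theta>. \<theta> \<in> \<Theta> \<Longrightarrow> a \<le> \<theta> x" for a x unfolding P_def by (rule cINF_greatest[OF ne that])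
  have gP: "g x \<le> P x" for x by (rule P_ge) (simp add: \<Theta>_def)
  have PC: "\<bar>P x\<bar> \<le> C" for x using P_le[OF const, of x] gP[of x] gC[of x] by (auto simp: abs_le_iff)
  have shift: "P x \<le> P y + M * dist x y" for x y
  proof -
    have "P x - M * dist x y \<le> P y"
    proof (rule P_ge)
      fix \<theta> assume \<theta>: "\<theta> \<in> \<Theta>"
      let ?\<theta> = "\<lambda>v. \<theta> (v + (y - x)) + M * dist x y"
      have "?\<theta> \<in> potentials w" using \<theta> unfolding \<Theta>_def by (intro potentials_add_const potentials_translate) simp
      moreover have "g v \<le> ?\<theta> v" for v
      proof -
        have "g (v + (y - x)) \<le> \<theta> (v + (y - x))" using \<theta> unfolding \<Theta>_def by simp
        moreover have "\<bar>g v - g (v + (y - x))\<bar> \<le> M * dist x y" using gL[of v "v + (y - x)"] by (simp add: dist_norm)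
        ultimately show ?thesis by (simp add: abs_le_iff)
      qed
      ultimately have "?\<theta> \<in> \<Theta>" unfolding \<Theta>_def by simp
      from P_le[OF this, of x] show "P x - M * dist x y \<le> \<theta> y" by simp
    qed
    then show ?thesis by simp
  qed
  have lip: "\<bar>P x - P y\<bar> \<le> M * dist x y" for x y
    using shift[of x y] shift[of y x] by (simp add: abs_le_iff dist_commute)
  have "(M + 1)-lipschitz_on UNIV P"
  proof (rule lipschitz_onI)
    fix x y
    have "dist (P x) (P y) \<le> M * dist x y" using lip[of x y] by (simp add: dist_real_def)
    also have "\<dots> \<le> (M + 1) * dist x y" by (rule mult_right_mono) auto
    finally show "dist (P x) (P y) \<le> (M + 1) * dist x y" .
  qed (use M in simp)
  then have Pc: "continuous_on UNIV P" by (rule lipschitz_on_continuous_on)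
  have "bounded (range P)" unfolding bounded_iff using PC by auto
  then have Pb: "P \<in> bcontfun" using Pc unfolding bcontfun_def by simp
  have Pwb: "(\<lambda>x. P x / w) \<in> bcontfun"
  proof -
    have "continuous_on UNIV (\<lambda>x. P x / w)" by (intro continuous_intros Pc) (use w in simp)
    moreover have "bounded (range (\<lambda>x. P x / w))"
      unfolding bounded_iff using PC w by (intro exI[of _ "C / w"]) (auto simp: divide_right_mono)
    ultimately show ?thesis unfolding bcontfun_def by simp
  qed
  have "feasible (\<lambda>x. P x / w)"
    unfolding feasible_def
  proof (intro conjI allI ballI Pwb)
    fix x and p :: "(real^'d) measure" assume p: "p \<in> P2"
    note p' = P2_D[OF p]
    have int: "integrable p P" by (rule bcontfun_integrable[OF Pb p'(2,3)])
    show "ennreal ((LINT y|p. P y / w) - P x / w) \<le> G_cost f x p"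
    proof (cases "G_cost f x p")
      case (real g0)
      have "(LINT y|p. P y) - w * g0 \<le> P x"
      proof (rule P_ge)
        fix \<theta> assume \<theta>: "\<theta> \<in> \<Theta>"
        then have \<theta>p: "\<theta> \<in> potentials w" unfolding \<Theta>_def by simp
        note \<theta>b = potentials_bcontfun[OF \<theta>p]
        have "(\<lambda>x. 1 / w * \<theta> x) \<in> potentials (1 / w * w)" by (rule potentials_scale[OF \<theta>p]) (use w in simp)
        then have "(\<lambda>x. 1 / w * \<theta> x) \<in> potentials 1" using w by simp
        from potential_gap_le_dyn_cost[OF this, of p "return borel x"]
        have "ennreal ((LINT y|p. 1 / w * \<theta> y) - (LINT y|return borel x. 1 / w * \<theta> y)) \<le> ennreal g0"
          using real unfolding G_cost_def by simp
        moreover have "(LINT y|return borel x. 1 / w * \<theta> y) = 1 / w * \<theta> x"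
          by (rule integral_return, simp, intro borel_measurable_times borel_measurable_const
              borel_measurable_continuous_onI potentials_continuous[OF \<theta>p])
        ultimately have "ennreal ((LINT y|p. 1 / w * \<theta> y) - 1 / w * \<theta> x) \<le> ennreal g0" by (simp only:)
        then have "(LINT y|p. 1 / w * \<theta> y) - 1 / w * \<theta> x \<le> g0" by (simp only: ennreal_le_iff[OF real(1)])
        then have "(LINT y|p. \<theta> y) - \<theta> x \<le> w * g0" using w by (simp add: field_simps)
        moreover have "(LINT y|p. P y) \<le> (LINT y|p. \<theta> y)"
          by (rule integral_mono[OF int bcontfun_integrable[OF \<theta>b p'(2,3)]]) (rule P_le[OF \<theta>])
        ultimately show "(LINT y|p. P y) - w * g0 \<le> \<theta> x" by simp
      qed
      then have "(LINT y|p. P y / w) - P x / w \<le> g0" using w by (simp add: field_simps)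
      then show ?thesis unfolding real(2) by (rule ennreal_leI)
    qed simp
  qed
  then show thesis using gP P_le unfolding \<Theta>_def by (intro that) auto
qed

lemma G_cost_return: "G_cost f x (return borel x) = 0"
proof -
  have "dyn_cost f (return borel x) (return borel x) \<le> ennreal 0"
    by (rule dyn_cost_le_potential_gap[OF return_P2 return_P2]) simp_all
  then show ?thesis unfolding G_cost_def by simp
qed

end

section \<open>An optimal kernel from duality\<close>

lemma kernel_integrable:
  fixes \<psi> :: "real^'d \<Rightarrow> real"
  assumes \<mu>: "finite_measure \<mu>" and k: "k \<in> \<mu> \<rightarrow>\<^sub>M subprob_algebra borel" and \<psi>: "\<psi> \<in> bcontfun"
  shows "integrable \<mu> (\<lambda>x. LINT y|k x. \<psi> y)"
proof -
  interpret M: finite_measure \<mu> by (rule \<mu>)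
  have c: "continuous_on UNIV \<psi>" and b: "bounded (range \<psi>)" using \<psi> unfolding bcontfun_def by auto
  obtain C where "\<forall>y\<in>range \<psi>. norm y \<le> C" using b unfolding bounded_iff ..
  then have C: "\<bar>\<psi> x\<bar> \<le> C" for x by simp
  have C0: "0 \<le> C" using order_trans[OF abs_ge_zero C] .
  have km: "(\<lambda>x. LINT y|k x. \<psi> y) \<in> borel_measurable \<mu>"
    by (rule measurable_compose[OF k integral_measurable_subprob_algebra[OF borel_measurable_continuous_onI[OF c]]])
  have "\<bar>LINT y|k x. \<psi> y\<bar> \<le> C" if x: "x \<in> space \<mu>" for x
  proof -
    have "k x \<in> space (subprob_algebra borel)" by (rule measurable_space[OF k x])
    then have "subprob_space (k x)" by (simp add: space_subprob_algebra)
    then interpret K: subprob_space "k x" .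
    have "\<bar>LINT y|k x. \<psi> y\<bar> \<le> (LINT y|k x. \<bar>\<psi> y\<bar>)" by (rule integral_abs_bound)
    also have "\<dots> \<le> (LINT y|k x. C)" by (rule integral_mono') (use C C0 in auto)
    also have "\<dots> \<le> 1 * C" unfolding lebesgue_integral_const real_scaleR_def
      by (rule mult_right_mono) (use K.subprob_measure_le_1 C0 in auto)
    finally show ?thesis by simp
  qed
  then show ?thesis by (intro M.integrable_const_bound[OF _ km, of C] AE_I2) simp
qed

text \<open>The second marginal is only tested with Lipschitz functions, since the lower envelope of potentials
  inherits its continuity from the function below it.\<close>

definition Lipschitz_bdd :: "('a::metric_space \<Rightarrow> real) \<Rightarrow> bool"
  where "Lipschitz_bdd g \<longleftrightarrow> (\<exists>C. \<forall>x. \<bar>g x\<bar> \<le> C) \<and> (\<exists>M\<ge>0. \<forall>x y. \<bar>g x - g y\<bar> \<le> M * dist x y)"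

lemma Lipschitz_bdd_continuous:
  assumes "Lipschitz_bdd g" shows "continuous_on UNIV g"
proof -
  obtain M where M: "M \<ge> 0" "\<And>x y. \<bar>g x - g y\<bar> \<le> M * dist x y" using assms unfolding Lipschitz_bdd_def by blast
  have "M-lipschitz_on UNIV g" by (rule lipschitz_onI) (use M in \<open>auto simp: dist_real_def\<close>)
  then show ?thesis by (rule lipschitz_on_continuous_on)
qed

lemma Lipschitz_bdd_bcontfun: "Lipschitz_bdd g \<Longrightarrow> g \<in> bcontfun"
  using Lipschitz_bdd_continuous[of g] unfolding bcontfun_def Lipschitz_bdd_def bounded_iff by auto

lemma Lipschitz_bdd_const: "Lipschitz_bdd (\<lambda>x. c)"
  unfolding Lipschitz_bdd_def by auto

lemma Lipschitz_bdd_cmult: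
  assumes "Lipschitz_bdd g" shows "Lipschitz_bdd (\<lambda>x. c * g x)"
proof -
  obtain C M where C: "\<And>x. \<bar>g x\<bar> \<le> C" and M: "M \<ge> 0" "\<And>x y. \<bar>g x - g y\<bar> \<le> M * dist x y"
    using assms unfolding Lipschitz_bdd_def by blast
  have "\<bar>c * g x\<bar> \<le> \<bar>c\<bar> * C" for x unfolding abs_mult by (rule mult_left_mono[OF C]) simp
  moreover have "\<bar>c * g x - c * g y\<bar> \<le> (\<bar>c\<bar> * M) * dist x y" for x y
  proof -
    have "\<bar>c * g x - c * g y\<bar> = \<bar>c\<bar> * \<bar>g x - g y\<bar>" unfolding abs_mult[symmetric] right_diff_distrib ..
    also have "\<dots> \<le> \<bar>c\<bar> * (M * dist x y)" by (rule mult_left_mono[OF M(2)]) simp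
    finally show ?thesis by simp
  qed
  moreover have "0 \<le> \<bar>c\<bar> * M" using M(1) by simp
  ultimately show ?thesis unfolding Lipschitz_bdd_def by blast
qed

lemma Lipschitz_bdd_add:
  assumes "Lipschitz_bdd g" "Lipschitz_bdd h" shows "Lipschitz_bdd (\<lambda>x. g x + h x)"
proof -
  obtain C M where C: "\<And>x. \<bar>g x\<bar> \<le> C" and M: "M \<ge> 0" "\<And>x y. \<bar>g x - g y\<bar> \<le> M * dist x y"
    using assms(1) unfolding Lipschitz_bdd_def by blast
  obtain C' M' where C': "\<And>x. \<bar>h x\<bar> \<le> C'" and M': "M' \<ge> 0" "\<And>x y. \<bar>h x - h y\<bar> \<le> M' * dist x y"
    using assms(2) unfolding Lipschitz_bdd_def by blast
  have "\<bar>g x + h x\<bar> \<le> C + C'" for x by (rule order_trans[OF abs_triangle_ineq add_mono[OF C C']])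
  moreover have "\<bar>(g x + h x) - (g y + h y)\<bar> \<le> (M + M') * dist x y" for x y
  proof -
    have "(g x + h x) - (g y + h y) = (g x - g y) + (h x - h y)" by simp
    also have "\<bar>\<dots>\<bar> \<le> M * dist x y + M' * dist x y" by (rule order_trans[OF abs_triangle_ineq add_mono[OF M(2) M'(2)]])
    finally show ?thesis by (simp add: distrib_right)
  qed
  moreover have "0 \<le> M + M'" using M(1) M'(1) by simp
  ultimately show ?thesis unfolding Lipschitz_bdd_def by blast
qed

context cost_function
begin

text \<open>The dual variables: potentials in \<open>y\<close> anchored at \<open>x\<close>, and centred functions of one variable,
  on which a functional below zero must vanish.\<close>

definition dual_cone ::
    "(real^'d) measure \<Rightarrow> (real^'d) measure \<Rightarrow> real \<Rightarrow> ((real^'d) \<times> (real^'d) \<Rightarrow> real) set"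
  where "dual_cone \<mu> \<nu> s = {u. \<exists>w \<phi> g h. 0 \<le> w \<and> \<phi> \<in> bdd_on UNIV \<and> (\<forall>x. \<phi> (x, x) = 0 \<and> (\<lambda>y. \<phi> (x, y)) \<in> potentials w) \<and>
    Lipschitz_bdd g \<and> h \<in> borel_measurable borel \<and> h \<in> bdd_on UNIV \<and>
    u = (\<lambda>z. \<phi> z - w * s + (g (snd z) - (LINT y|\<nu>. g y)) + (h (fst z) - (LINT x|\<mu>. h x)))}"

lemma dual_coneI:
  assumes "0 \<le> w" "\<phi> \<in> bdd_on UNIV" "\<And>x. \<phi> (x, x) = 0" "\<And>x. (\<lambda>y. \<phi> (x, y)) \<in> potentials w"
    "Lipschitz_bdd g" "h \<in> borel_measurable borel" "h \<in> bdd_on UNIV"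
  shows "(\<lambda>z. \<phi> z - w * s + (g (snd z) - (LINT y|\<nu>. g y)) + (h (fst z) - (LINT x|\<mu>. h x))) \<in> dual_cone \<mu> \<nu> s"
  unfolding dual_cone_def
  by (rule CollectI, rule exI[of _ w], rule exI[of _ \<phi>], rule exI[of _ g], rule exI[of _ h]) (intro conjI allI refl assms)

lemma dual_coneE:
  assumes "u \<in> dual_cone \<mu> \<nu> s"
  obtains w \<phi> g h where "0 \<le> w" "\<phi> \<in> bdd_on UNIV" "\<And>x. \<phi> (x, x) = 0" "\<And>x. (\<lambda>y. \<phi> (x, y)) \<in> potentials w"
    "Lipschitz_bdd g" "h \<in> borel_measurable borel" "h \<in> bdd_on UNIV"
    "u = (\<lambda>z. \<phi> z - w * s + (g (snd z) - (LINT y|\<nu>. g y)) + (h (fst z) - (LINT x|\<mu>. h x)))"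
proof -
  from assms obtain w \<phi> g h where a: "0 \<le> w" "\<phi> \<in> bdd_on UNIV" "\<forall>x. \<phi> (x, x) = 0 \<and> (\<lambda>y. \<phi> (x, y)) \<in> potentials w"
    "Lipschitz_bdd g" "h \<in> borel_measurable borel" "h \<in> bdd_on UNIV"
    "u = (\<lambda>z. \<phi> z - w * s + (g (snd z) - (LINT y|\<nu>. g y)) + (h (fst z) - (LINT x|\<mu>. h x)))"
    unfolding dual_cone_def by (elim CollectE exE conjE) (rule that; assumption)
  show thesis
  proof (rule that[OF a(1,2) _ _ a(4-7)])
    show "\<phi> (x, x) = 0" "(\<lambda>y. \<phi> (x, y)) \<in> potentials w" for x using spec[OF a(3), of x] by simp_all
  qed
qed

lemma bdd_on_UNIV_integrable:
  assumes "h \<in> borel_measurable borel" "h \<in> bdd_on UNIV" "finite_measure p" "sets p = sets borel"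
  shows "integrable p h"
proof -
  interpret finite_measure p by (rule assms)
  obtain C where C: "\<And>x. \<bar>h x\<bar> \<le> C" using bdd_onE[OF assms(2)] by (metis UNIV_I)
  have "h \<in> borel_measurable p" using assms(1,4) by (simp cong: measurable_cong_sets)
  then show ?thesis by (intro integrable_const_bound[of _ C]) (simp_all add: C)
qed

text \<open>No element of the cone has a positive lower bound: from such an element one obtains, through
  the lower envelope of potentials, a feasible potential whose gap exceeds the supremum.\<close>

lemma dual_cone_no_positive:
  assumes \<mu>: "\<mu> \<in> P2" and \<nu>: "\<nu> \<in> P2" and s: "0 \<le> s"
    and gap: "\<And>\<psi>. feasible \<psi> \<Longrightarrow> (LINT y|\<nu>. \<psi> y) - (LINT x|\<mu>. \<psi> x) \<le> s"
    and u: "u \<in> dual_cone \<mu> \<nu> s" and \<epsilon>: "0 < \<epsilon>"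
  shows "\<exists>z\<in>UNIV. u z < \<epsilon>"
proof (rule ccontr)
  assume "\<not> ?thesis"
  then have ge: "\<epsilon> \<le> u z" for z by (meson UNIV_I leI)
  obtain w \<phi> g h where w: "0 \<le> w" and \<phi>0: "\<And>x. \<phi> (x, x) = 0"
    and \<phi>: "\<And>x. (\<lambda>y. \<phi> (x, y)) \<in> potentials w" and g: "Lipschitz_bdd g" and h: "h \<in> borel_measurable borel" "h \<in> bdd_on UNIV"
    and ueq: "u = (\<lambda>z. \<phi> z - w * s + (g (snd z) - (LINT y|\<nu>. g y)) + (h (fst z) - (LINT x|\<mu>. h x)))"
    by (rule dual_coneE[OF u]) (rule that; assumption)
  note m = P2_D[OF \<mu>] and n = P2_D[OF \<nu>]
  define \<delta> where "\<delta> = \<epsilon> / (2 * (s + 1))"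
  have \<delta>: "0 < \<delta>" unfolding \<delta>_def using s \<epsilon> by simp
  have \<delta>s: "\<delta> * s < \<epsilon>"
  proof -
    have "\<epsilon> * s < \<epsilon> * (2 * (s + 1))" by (rule mult_strict_left_mono[OF _ \<epsilon>]) (use s in simp)
    then show ?thesis unfolding \<delta>_def using s by (simp add: divide_less_eq)
  qed
  define w' where "w' = w + \<delta>"
  have w': "0 < w'" "w \<le> w'" unfolding w'_def using w \<delta> by simp_all
  obtain C M where C: "\<And>x. \<bar>g x\<bar> \<le> C" and M: "M \<ge> 0" "\<And>x y. \<bar>g x - g y\<bar> \<le> M * dist x y"
    using g unfolding Lipschitz_bdd_def by blast
  have gC': "\<bar>- g x\<bar> \<le> C" and gL': "\<bar>- g x - - g y\<bar> \<le> M * dist x y" for x y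
    using C[of x] M(2)[of y x] by (simp_all add: dist_commute)
  obtain P where P: "feasible (\<lambda>x. P x / w')" "\<And>x. - g x \<le> P x"
    "\<And>\<theta> x. \<theta> \<in> potentials w' \<Longrightarrow> (\<And>y. - g y \<le> \<theta> y) \<Longrightarrow> P x \<le> \<theta> x"
    by (rule potential_envelope[where g="\<lambda>x. - g x", OF w'(1) gC' gL' M(1)]) blast
  have Pb: "P \<in> bcontfun"
  proof -
    have b: "(\<lambda>x. P x / w') \<in> bcontfun" using P(1) unfolding feasible_def by blast
    then have c: "continuous_on UNIV (\<lambda>x. P x / w')" and bd: "bounded (range (\<lambda>x. P x / w'))" unfolding bcontfun_def by auto
    have e: "P = (\<lambda>x. w' * (P x / w'))" using w' by auto
    have "continuous_on UNIV (\<lambda>x. w' * (P x / w'))" by (intro continuous_on_mult continuous_on_const c)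
    moreover have "bounded (range (\<lambda>x. w' * (P x / w')))" by (rule bounded_range_cmult[OF bd])
    ultimately show ?thesis unfolding bcontfun_def e[symmetric] by simp
  qed
  have iP: "integrable \<mu> P" "integrable \<nu> P" using bcontfun_integrable[OF Pb] m n by simp_all
  have ih: "integrable \<mu> h" by (rule bdd_on_UNIV_integrable[OF h m(2,3)])
  have ig: "integrable \<nu> g" by (rule bcontfun_integrable[OF Lipschitz_bdd_bcontfun[OF g] n(2,3)])
  let ?Ig = "LINT y|\<nu>. g y" and ?Ih = "LINT x|\<mu>. h x"
  have Ple: "P x \<le> h x + (- w * s - ?Ig - ?Ih - \<epsilon>)" for x
  proof -
    let ?c = "h x + (- w * s - ?Ig - ?Ih - \<epsilon>)"
    have "(\<lambda>y. \<phi> (x, y) + ?c) \<in> potentials w'" by (intro potentials_add_const potentials_mono[OF \<phi> w'(2)])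
    moreover have "- g y \<le> \<phi> (x, y) + ?c" for y using ge[of "(x, y)"] unfolding ueq by simp
    ultimately have "P x \<le> \<phi> (x, x) + ?c" by (rule P(3))
    then show ?thesis by (simp add: \<phi>0)
  qed
  interpret M: prob_space \<mu> by (rule m)
  have "(LINT x|\<mu>. P x) \<le> (LINT x|\<mu>. h x + (- w * s - ?Ig - ?Ih - \<epsilon>))"
    by (rule integral_mono[OF iP(1) _ Ple]) (simp add: ih)
  also have "\<dots> = - w * s - ?Ig - \<epsilon>" using ih by (simp add: M.prob_space)
  finally have up: "(LINT x|\<mu>. P x) \<le> - w * s - ?Ig - \<epsilon>" .
  have low: "- ?Ig \<le> (LINT x|\<nu>. P x)"
    using integral_mono[OF _ iP(2), of "\<lambda>x. - g x"] ig P(2) by simp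
  have "(LINT x|\<nu>. P x / w') - (LINT x|\<mu>. P x / w') \<le> s" by (rule gap[OF P(1)])
  then have "(LINT x|\<nu>. P x) - (LINT x|\<mu>. P x) \<le> w' * s" using w' by (simp add: field_simps)
  then show False using up low \<delta>s unfolding w'_def by (simp add: algebra_simps)
qed

lemma dual_cone_bdd: "dual_cone \<mu> \<nu> s \<subseteq> bdd_on UNIV"
proof
  fix u assume "u \<in> dual_cone \<mu> \<nu> s"
  then obtain w \<phi> g h where \<phi>: "\<phi> \<in> bdd_on UNIV" and g: "Lipschitz_bdd g" and h: "h \<in> bdd_on UNIV"
    and ueq: "u = (\<lambda>z. \<phi> z - w * s + (g (snd z) - (LINT y|\<nu>. g y)) + (h (fst z) - (LINT x|\<mu>. h x)))"
    by (rule dual_coneE) (rule that; assumption)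
  obtain C where C: "\<And>x. \<bar>g x\<bar> \<le> C" using g unfolding Lipschitz_bdd_def by blast
  obtain D where D: "\<And>x. \<bar>h x\<bar> \<le> D" using bdd_onE[OF h] by (metis UNIV_I)
  have "(\<lambda>z. g (snd z)) \<in> bdd_on UNIV" "(\<lambda>z. h (fst z)) \<in> bdd_on UNIV"
    by (rule bdd_onI[where C=C], rule C) (rule bdd_onI[where C=D], rule D)
  then show "u \<in> bdd_on UNIV" unfolding ueq
    by (intro bdd_on_add bdd_on_diff bdd_on_const \<phi>)
qed

lemma dual_cone_add:
  assumes m: "\<mu> \<in> P2" and n: "\<nu> \<in> P2" and u: "u \<in> dual_cone \<mu> \<nu> s" and v: "v \<in> dual_cone \<mu> \<nu> s"
  shows "(\<lambda>z. u z + v z) \<in> dual_cone \<mu> \<nu> s"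
proof -
  obtain w \<phi> g h where a: "0 \<le> w" "\<phi> \<in> bdd_on UNIV" "\<And>x. \<phi> (x, x) = 0" "\<And>x. (\<lambda>y. \<phi> (x, y)) \<in> potentials w"
    "Lipschitz_bdd g" "h \<in> borel_measurable borel" "h \<in> bdd_on UNIV"
    and ueq: "u = (\<lambda>z. \<phi> z - w * s + (g (snd z) - (LINT y|\<nu>. g y)) + (h (fst z) - (LINT x|\<mu>. h x)))"
    by (rule dual_coneE[OF u]) (rule that; assumption)
  obtain w' \<phi>' g' h' where b: "0 \<le> w'" "\<phi>' \<in> bdd_on UNIV" "\<And>x. \<phi>' (x, x) = 0" "\<And>x. (\<lambda>y. \<phi>' (x, y)) \<in> potentials w'"
    "Lipschitz_bdd g'" "h' \<in> borel_measurable borel" "h' \<in> bdd_on UNIV"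
    and veq: "v = (\<lambda>z. \<phi>' z - w' * s + (g' (snd z) - (LINT y|\<nu>. g' y)) + (h' (fst z) - (LINT x|\<mu>. h' x)))"
    by (rule dual_coneE[OF v]) (rule that; assumption)
  have g: "(LINT y|\<nu>. g y + g' y) = (LINT y|\<nu>. g y) + (LINT y|\<nu>. g' y)"
    by (intro Bochner_Integration.integral_add bcontfun_integrable Lipschitz_bdd_bcontfun a b P2_D[OF n])
  have h: "(LINT y|\<mu>. h y + h' y) = (LINT y|\<mu>. h y) + (LINT y|\<mu>. h' y)"
    by (intro Bochner_Integration.integral_add bdd_on_UNIV_integrable a b P2_D[OF m])
  have "(\<lambda>z. (\<phi> z + \<phi>' z) - (w + w') * s + ((g (snd z) + g' (snd z)) - (LINT y|\<nu>. g y + g' y))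
      + ((h (fst z) + h' (fst z)) - (LINT x|\<mu>. h x + h' x))) \<in> dual_cone \<mu> \<nu> s"
    by (rule dual_coneI[where \<phi>="\<lambda>z. \<phi> z + \<phi>' z" and g="\<lambda>y. g y + g' y" and h="\<lambda>x. h x + h' x"])
      (intro add_nonneg_nonneg bdd_on_add potentials_add Lipschitz_bdd_add borel_measurable_add a b | simp add: a(3) b(3))+
  then show ?thesis unfolding g h ueq veq by (simp add: algebra_simps)
qed

lemma dual_cone_scale:
  assumes u: "u \<in> dual_cone \<mu> \<nu> s" and c: "0 < c"
  shows "(\<lambda>z. c * u z) \<in> dual_cone \<mu> \<nu> s"
proof -
  obtain w \<phi> g h where a: "0 \<le> w" "\<phi> \<in> bdd_on UNIV" "\<And>x. \<phi> (x, x) = 0" "\<And>x. (\<lambda>y. \<phi> (x, y)) \<in> potentials w"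
    "Lipschitz_bdd g" "h \<in> borel_measurable borel" "h \<in> bdd_on UNIV"
    and ueq: "u = (\<lambda>z. \<phi> z - w * s + (g (snd z) - (LINT y|\<nu>. g y)) + (h (fst z) - (LINT x|\<mu>. h x)))"
    by (rule dual_coneE[OF u]) (rule that; assumption)
  have c0: "0 \<le> c" using c by simp
  have "(\<lambda>z. c * \<phi> z - (c * w) * s + (c * g (snd z) - (LINT y|\<nu>. c * g y))
      + (c * h (fst z) - (LINT x|\<mu>. c * h x))) \<in> dual_cone \<mu> \<nu> s"
    by (rule dual_coneI[where \<phi>="\<lambda>z. c * \<phi> z" and g="\<lambda>y. c * g y" and h="\<lambda>x. c * h x"])
      (intro mult_nonneg_nonneg c0 bdd_on_cmult potentials_scale Lipschitz_bdd_cmult borel_measurable_times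
        borel_measurable_const a | simp add: a(3))+
  then show ?thesis unfolding ueq by (simp add: algebra_simps)
qed

lemma potentials_const_nonneg: "0 \<le> w \<Longrightarrow> (\<lambda>y. c) \<in> potentials w"
  by (rule potentials_mono[OF potentials_const])

text \<open>The separating functional has first marginal \<open>\<mu>\<close> on Borel functions, and is therefore given by a
  kernel.  The last property is the inequality for the functions of the cone that choose the
  potential \<open>\<psi> j\<close> if \<open>x\<close> lies in \<open>E j\<close>.\<close>

lemma optimal_kernel:
  assumes m: "\<mu> \<in> P2" and n: "\<nu> \<in> P2" and s: "0 \<le> s"
    and gap: "\<And>\<psi>. feasible \<psi> \<Longrightarrow> (LINT y|\<nu>. \<psi> y) - (LINT x|\<mu>. \<psi> x) \<le> s"
  obtains k where "k \<in> \<mu> \<rightarrow>\<^sub>M subprob_algebra borel"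
    "\<And>g. Lipschitz_bdd g \<Longrightarrow> bounded {y. g y \<noteq> 0} \<Longrightarrow> (LINT x|\<mu>. LINT y|k x. g y) = (LINT y|\<nu>. g y)"
    "\<And>\<psi> E n. (\<And>j. \<psi> j \<in> potentials 1) \<Longrightarrow> (\<And>j. bounded {y. \<psi> j y \<noteq> 0}) \<Longrightarrow> (\<And>j. E j \<in> sets \<mu>) \<Longrightarrow>
      disjoint_family E \<Longrightarrow> (\<Sum>j\<le>n::nat. LINT x:E j|\<mu>. (LINT y|k x. \<psi> j y) - \<psi> j x) \<le> s"
proof -
  note M = P2_D[OF m] and N = P2_D[OF n]
  interpret M: prob_space \<mu> by (rule M)
  have sp: "space \<mu> = UNIV" using sets_eq_imp_space_eq[OF M(3)] by simp
  have z: "(\<lambda>z. 0) \<in> bdd_on UNIV" "Lipschitz_bdd (\<lambda>x. 0)" by (rule bdd_on_const Lipschitz_bdd_const)+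
  have zero: "(\<lambda>z. 0) \<in> dual_cone \<mu> \<nu> s"
    using dual_coneI[of 0 "\<lambda>z. 0" "\<lambda>x. 0" "\<lambda>x. 0" s \<nu> \<mu>, OF _ z(1) _ potentials_const_nonneg z(2) borel_measurable_const z(1)] by simp
  obtain L where L: "mean_on (UNIV :: ((real^'d) \<times> (real^'d)) set) L" "\<And>u. u \<in> dual_cone \<mu> \<nu> s \<Longrightarrow> L u \<le> 0"
    by (rule mean_alternative[OF UNIV_not_empty dual_cone_bdd zero dual_cone_add[OF m n] dual_cone_scale
          dual_cone_no_positive[OF m n s gap]]) (assumption | (rule that; assumption))+
  have marg_h: "L (\<lambda>z. h (fst z)) = (LINT x|\<mu>. h x)" if h: "h \<in> borel_measurable borel" "h \<in> bdd_on UNIV" for h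
  proof -
    obtain D where D: "\<And>x. \<bar>h x\<bar> \<le> D" using bdd_onE[OF h(2)] by (metis UNIV_I)
    have hf: "(\<lambda>z. h (fst z)) \<in> bdd_on (UNIV :: ((real^'d) \<times> (real^'d)) set)" by (rule bdd_onI[where C=D], rule D)
    have 1: "L (\<lambda>z. h (fst z)) \<le> (LINT x|\<mu>. h x)" if h: "h \<in> borel_measurable borel" "h \<in> bdd_on UNIV" "(\<lambda>z. h (fst z)) \<in> bdd_on (UNIV :: ((real^'d) \<times> (real^'d)) set)" for h
    proof -
      have "(\<lambda>z. h (fst z) - (LINT x|\<mu>. h x)) \<in> dual_cone \<mu> \<nu> s"
        using dual_coneI[of 0 "\<lambda>z. 0" "\<lambda>x. 0" h s \<nu> \<mu>, OF _ z(1) _ potentials_const_nonneg z(2) h(1,2)] by simp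
      from L(2)[OF this] show ?thesis
        by (simp add: mean_on_diff[OF L(1) h(3) bdd_on_const] mean_on_const[OF L(1)])
    qed
    have h': "(\<lambda>x. -1 * h x) \<in> borel_measurable borel" using h(1) by simp
    have "L (\<lambda>z. -1 * h (fst z)) \<le> (LINT x|\<mu>. -1 * h x)"
      by (rule 1[OF h' bdd_on_cmult[OF h(2)] bdd_on_cmult[OF hf]])
    then show ?thesis using 1[OF h hf] mean_on_cmult[OF L(1) hf, of "-1"] by simp
  qed
  have marg_g: "L (\<lambda>z. g (snd z)) = (LINT x|\<nu>. g x)" if g: "Lipschitz_bdd g" for g
  proof -
    have gf: "(\<lambda>z. g (snd z)) \<in> bdd_on (UNIV :: ((real^'d) \<times> (real^'d)) set)" if g: "Lipschitz_bdd g" for g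
    proof -
      obtain D where D: "\<And>x. \<bar>g x\<bar> \<le> D" using g unfolding Lipschitz_bdd_def by blast
      show ?thesis by (rule bdd_onI[where C=D], rule D)
    qed
    have 1: "L (\<lambda>z. g (snd z)) \<le> (LINT x|\<nu>. g x)" if g: "Lipschitz_bdd g" for g
    proof -
      have "(\<lambda>z. g (snd z) - (LINT x|\<nu>. g x)) \<in> dual_cone \<mu> \<nu> s"
        using dual_coneI[of 0 "\<lambda>z. 0" g "\<lambda>x. 0" s \<nu> \<mu>, OF _ z(1) _ potentials_const_nonneg g borel_measurable_const z(1)] by simp
      from L(2)[OF this] show ?thesis
        by (simp add: mean_on_diff[OF L(1) gf[OF g] bdd_on_const] mean_on_const[OF L(1)])
    qed
    have "L (\<lambda>z. -1 * g (snd z)) \<le> (LINT x|\<nu>. -1 * g x)" by (rule 1[OF Lipschitz_bdd_cmult[OF g]])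
    then show ?thesis using 1[OF g] mean_on_cmult[OF L(1) gf[OF g], of "-1"] by simp
  qed
  have L': "mean_on (space \<mu> \<times> UNIV) L" using L(1) by (simp add: sp)
  have ind: "(\<lambda>x. indicator E x :: real) \<in> bdd_on UNIV" for E :: "(real^'d) set"
    by (rule bdd_onI[where C=1]) (auto split: split_indicator)
  have "L (\<lambda>z. indicator E (fst z)) = measure \<mu> E" if "E \<in> sets \<mu>" for E
    using marg_h[of "indicator E"] ind[of E] that M(3) by (simp add: sp)
  from kernel_of_mean[OF M(1) L' this] obtain k where k: "k \<in> \<mu> \<rightarrow>\<^sub>M subprob_algebra borel"
    and kL: "\<And>E \<psi>. E \<in> sets \<mu> \<Longrightarrow> continuous_on UNIV \<psi> \<Longrightarrow> bounded {y. \<psi> y \<noteq> 0} \<Longrightarrow>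
      L (\<lambda>z. indicator E (fst z) * \<psi> (snd z)) = (LINT x:E|\<mu>. LINT y|k x. \<psi> y)" by blast
  show thesis
  proof (rule that[OF k])
    fix g :: "real^'d \<Rightarrow> real" assume g: "Lipschitz_bdd g" "bounded {y. g y \<noteq> 0}"
    have "(LINT x|\<mu>. LINT y|k x. g y) = (LINT x:UNIV|\<mu>. LINT y|k x. g y)" by (simp add: set_lebesgue_integral_def)
    also have "\<dots> = L (\<lambda>z. indicator UNIV (fst z) * g (snd z))"
      by (rule kL[OF _ Lipschitz_bdd_continuous[OF g(1)] g(2), symmetric]) (simp add: M(3))
    also have "\<dots> = (LINT y|\<nu>. g y)" using marg_g[OF g(1)] by simp
    finally show "(LINT x|\<mu>. LINT y|k x. g y) = (LINT y|\<nu>. g y)" .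
  next
    fix \<psi> :: "nat \<Rightarrow> real^'d \<Rightarrow> real" and E :: "nat \<Rightarrow> (real^'d) set" and n
    assume \<psi>: "\<And>j. \<psi> j \<in> potentials 1" "\<And>j. bounded {y. \<psi> j y \<noteq> 0}" and E: "\<And>j. E j \<in> sets \<mu>" "disjoint_family E"
    have E': "E j \<in> sets borel" for j using E(1)[of j] M(3) by simp
    have c: "continuous_on UNIV (\<psi> j)" for j by (rule potentials_continuous[OF \<psi>(1)])
    have "\<exists>C. \<forall>y. \<bar>\<psi> j y\<bar> \<le> C" for j using continuous_bounded_support_bound[OF c \<psi>(2), of j] by metis
    then obtain C where C: "\<And>j y. \<bar>\<psi> j y\<bar> \<le> C j" by metis
    define t where "t j z = indicator (E j) (fst z) * \<psi> j (snd z) - indicator (E j) (fst z) * \<psi> j (fst z)" for j and z :: "(real^'d) \<times> (real^'d)"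
    have t1: "(\<lambda>z. indicator (E j) (fst z) * \<psi> j (snd z)) \<in> bdd_on UNIV" and t2: "(\<lambda>z. indicator (E j) (fst z) * \<psi> j (fst z)) \<in> bdd_on UNIV"
      and t3: "(\<lambda>x. indicator (E j) x * \<psi> j x) \<in> bdd_on UNIV" for j
      by (rule bdd_onI[where C="C j"], use C[of j] order_trans[OF abs_ge_zero C[of j]] in \<open>auto split: split_indicator\<close>)+
    have tb: "t j \<in> bdd_on UNIV" for j unfolding t_def[abs_def] by (rule bdd_on_diff[OF t1 t2])
    have meas: "(\<lambda>x. indicator (E j) x * \<psi> j x) \<in> borel_measurable borel" for j
      by (intro borel_measurable_times borel_measurable_indicator E' borel_measurable_continuous_onI c)
    have int1: "set_integrable \<mu> (E j) (\<psi> j)" for j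
      using bdd_on_UNIV_integrable[OF meas t3 M(2,3), of j] by (simp add: set_integrable_def)
    have int2: "set_integrable \<mu> (E j) (\<lambda>x. LINT y|k x. \<psi> j y)" for j
      unfolding set_integrable_def
      by (rule integrable_mult_indicator[OF E(1) kernel_integrable[OF M(2) k potentials_bcontfun[OF \<psi>(1)]]])
    have Lt: "L (t j) = (LINT x:E j|\<mu>. (LINT y|k x. \<psi> j y) - \<psi> j x)" for j
    proof -
      have "L (t j) = L (\<lambda>z. indicator (E j) (fst z) * \<psi> j (snd z)) - L (\<lambda>z. indicator (E j) (fst z) * \<psi> j (fst z))"
        unfolding t_def[abs_def] by (rule mean_on_diff[OF L(1) t1 t2])
      also have "\<dots> = (LINT x:E j|\<mu>. LINT y|k x. \<psi> j y) - (LINT x:E j|\<mu>. \<psi> j x)"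
        using kL[OF E(1) c \<psi>(2)] marg_h[OF meas t3] by (simp add: set_lebesgue_integral_def)
      also have "\<dots> = (LINT x:E j|\<mu>. (LINT y|k x. \<psi> j y) - \<psi> j x)" by (rule set_integral_diff(2)[OF int2 int1, symmetric])
      finally show ?thesis .
    qed
    define \<phi> where "\<phi> z = (\<Sum>j\<le>n. t j z)" for z
    have \<phi>b: "\<phi> \<in> bdd_on UNIV" unfolding \<phi>_def[abs_def] by (rule bdd_on_sum[OF tb])
    have \<phi>p: "(\<lambda>y. \<phi> (x, y)) \<in> potentials 1" for x
    proof (cases "\<exists>j\<le>n. x \<in> E j")
      case True
      then obtain j where j: "j \<le> n" "x \<in> E j" by blast
      have ne: "x \<notin> E i" if "i \<noteq> j" for i using E(2) j that unfolding disjoint_family_on_def by blast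
      have "\<phi> (x, y) = (\<Sum>i\<le>n. if i = j then \<psi> j y - \<psi> j x else 0)" for y
        unfolding \<phi>_def t_def by (rule sum.cong) (use j ne in auto)
      then have "(\<lambda>y. \<phi> (x, y)) = (\<lambda>y. \<psi> j y + - \<psi> j x)" using j by (simp add: sum.delta)
      then show ?thesis using potentials_add_const[OF \<psi>(1), of j "- \<psi> j x"] by simp
    next
      case False
      then have "\<phi> (x, y) = 0" for y unfolding \<phi>_def t_def by (intro sum.neutral) auto
      then show ?thesis using potentials_const_nonneg[of 1 0] by simp
    qed
    have "(\<lambda>z. \<phi> z - s) \<in> dual_cone \<mu> \<nu> s"
      using dual_coneI[of 1 \<phi> "\<lambda>x. 0" "\<lambda>x. 0" s \<nu> \<mu>, OF _ \<phi>b _ \<phi>p z(2) borel_measurable_const z(1)]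
      by (simp add: \<phi>_def t_def)
    from L(2)[OF this] have "L \<phi> \<le> s" by (simp add: mean_on_diff[OF L(1) \<phi>b bdd_on_const] mean_on_const[OF L(1)])
    moreover have "L \<phi> = (\<Sum>j\<le>n. L (t j))" unfolding \<phi>_def[abs_def] by (rule mean_on_sum[OF L(1) _ tb]) simp
    ultimately show "(\<Sum>j\<le>n. LINT x:E j|\<mu>. (LINT y|k x. \<psi> j y) - \<psi> j x) \<le> s" unfolding Lt by simp
  qed
qed

end

section \<open>Couplings from kernels\<close>

text \<open>Multiples of the distance to the complement, cut off at one, increase to the indicator of a
  bounded open set.\<close>

lemma measure_eqI_Lipschitz:
  fixes M N :: "'a::euclidean_space measure"
  assumes sets: "sets M = sets borel" "sets N = sets borel" and fin: "finite_measure M"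
    and eq: "\<And>g. Lipschitz_bdd g \<Longrightarrow> (\<And>x. 0 \<le> g x) \<Longrightarrow> bounded {x. g x \<noteq> 0} \<Longrightarrow>
      (\<integral>\<^sup>+x. ennreal (g x) \<partial>M) = (\<integral>\<^sup>+x. ennreal (g x) \<partial>N)"
  shows "M = N"
proof (rule measure_eqI_generator_eq)
  let ?E = "range (\<lambda>(a, b). box a b :: 'a set)"
  show "Int_stable ?E" by (auto simp: Int_stable_def box_Int_box)
  show "?E \<subseteq> Pow UNIV" "sets M = sigma_sets UNIV ?E" "sets N = sigma_sets UNIV ?E"
    by (simp_all add: borel_eq_box sets)
  let ?A = "\<lambda>n::nat. box (- (real n *\<^sub>R One)) (real n *\<^sub>R One) :: 'a set"
  show "range ?A \<subseteq> ?E" "(\<Union>i. ?A i) = UNIV" unfolding UN_box_eq_UNIV by auto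
  show "emeasure M (?A i) \<noteq> \<infinity>" for i using finite_measure.emeasure_finite[OF fin] by simp
  show "emeasure M X = emeasure N X" if "X \<in> ?E" for X
  proof -
    from that obtain a b where X: "X = box a b" by auto
    have oX: "open X" and bX: "bounded X" unfolding X by (simp_all add: open_box bounded_box)
    have ne: "- X \<noteq> {}" using bX not_bounded_UNIV by (metis Compl_empty_eq double_compl)
    define g where "g n x = min 1 (real n * infdist x (- X))" for n x
    have g0: "0 \<le> g n x" "g n x \<le> 1" for n x unfolding g_def by (auto simp: infdist_nonneg)
    have out: "g n x = 0" if "x \<notin> X" for n x unfolding g_def using that by simp
    have lip: "Lipschitz_bdd (g n)" for n
      unfolding Lipschitz_bdd_def
    proof (intro conjI exI allI)
      show "\<bar>g n x\<bar> \<le> 1" for x using g0[of n x] by simp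
      show "0 \<le> real n" by simp
      fix x y
      have "\<bar>g n x - g n y\<bar> \<le> \<bar>real n * infdist x (- X) - real n * infdist y (- X)\<bar>" unfolding g_def by (auto simp: min_def)
      also have "\<dots> = real n * \<bar>infdist x (- X) - infdist y (- X)\<bar>" by (simp add: abs_mult flip: right_diff_distrib)
      also have "\<dots> \<le> real n * dist x y" by (rule mult_left_mono[OF infdist_triangle_abs]) simp
      finally show "\<bar>g n x - g n y\<bar> \<le> real n * dist x y" .
    qed
    have supp: "bounded {x. g n x \<noteq> 0}" for n by (rule bounded_subset[OF bX]) (use out in auto)
    have inc: "incseq (\<lambda>n x. ennreal (g n x))"
      unfolding incseq_def le_fun_def g_def
      by (intro allI impI ennreal_leI min.mono mult_right_mono) (auto simp: infdist_nonneg)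
    have SUPg: "(SUP n. ennreal (g n x)) = indicator X x" for x
    proof (cases "x \<in> X")
      case False
      then show ?thesis by (simp add: out)
    next
      case True
      then have p: "0 < infdist x (- X)" using oX ne by (intro infdist_pos_not_in_closed) auto
      obtain n :: nat where "1 / infdist x (- X) \<le> real n" using real_arch_simple by blast
      then have "g n x = 1" using p unfolding g_def by (simp add: field_simps)
      moreover have "ennreal (g m x) \<le> 1" for m using g0(2)[of m x] ennreal_leI[of "g m x" 1] by simp
      ultimately have "(SUP n. ennreal (g n x)) = 1"
        by (intro antisym SUP_least SUP_upper2[of n]) auto
      then show ?thesis using True by simp
    qed
    have lim: "emeasure K X = (SUP n. \<integral>\<^sup>+x. ennreal (g n x) \<partial>K)" if K: "sets K = sets borel" for K
    proof -
      have "X \<in> sets K" using oX K by simp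
      then have "emeasure K X = (\<integral>\<^sup>+x. (SUP n. ennreal (g n x)) \<partial>K)" unfolding SUPg by simp
      also have "\<dots> = (SUP n. \<integral>\<^sup>+x. ennreal (g n x) \<partial>K)"
      proof (rule nn_integral_monotone_convergence_SUP[OF inc])
        show "(\<lambda>x. ennreal (g n x)) \<in> borel_measurable K" for n
          using borel_measurable_continuous_onI[OF Lipschitz_bdd_continuous[OF lip[of n]]] K
          by (intro measurable_compose[OF _ measurable_ennreal]) (simp cong: measurable_cong_sets)
      qed
      finally show ?thesis .
    qed
    show ?thesis unfolding lim[OF sets(1)] lim[OF sets(2)] by (simp only: eq[OF lip g0(1) supp])
  qed
qed

lemma coupling_of_kernel:
  fixes \<mu> \<nu> :: "(real^'d) measure"
  assumes \<mu>: "prob_space \<mu>" "sets \<mu> = sets borel" and \<nu>: "sets \<nu> = sets borel"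
    and k: "k \<in> \<mu> \<rightarrow>\<^sub>M prob_algebra borel"
    and mar: "\<And>A. A \<in> sets borel \<Longrightarrow> (\<integral>\<^sup>+x. emeasure (k x) A \<partial>\<mu>) = emeasure \<nu> A"
  obtains \<gamma> where "\<gamma> \<in> couplings \<mu> \<nu>" "disintegrates \<gamma> \<mu> k"
proof -
  define h where "h x = distr (k x) borel (Pair x)" for x
  have sp: "space \<mu> = UNIV" using sets_eq_imp_space_eq[OF \<mu>(2)] by simp
  have "(\<lambda>(x, y). (x, y)) \<in> \<mu> \<Otimes>\<^sub>M (borel :: (real^'d) measure) \<rightarrow>\<^sub>M (borel :: ((real^'d) \<times> (real^'d)) measure)"
  proof -
    have 1: "fst \<in> \<mu> \<Otimes>\<^sub>M (borel :: (real^'d) measure) \<rightarrow>\<^sub>M borel"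
      using measurable_fst[of \<mu> borel] \<mu>(2) by (simp cong: measurable_cong_sets)
    have "(\<lambda>w. (fst w, snd w)) \<in> \<mu> \<Otimes>\<^sub>M (borel :: (real^'d) measure) \<rightarrow>\<^sub>M borel \<Otimes>\<^sub>M borel"
      by (rule measurable_Pair[OF 1 measurable_snd])
    then show ?thesis unfolding borel_prod by (simp add: case_prod_unfold)
  qed
  then have h: "h \<in> \<mu> \<rightarrow>\<^sub>M prob_algebra borel"
    unfolding h_def[abs_def] by (rule measurable_distr_prob_space2[OF k])
  define \<gamma> where "\<gamma> = \<mu> \<bind> h"
  have alg: "\<mu> \<in> space (prob_algebra \<mu>)" using \<mu> by (simp add: space_prob_algebra)
  have \<gamma>: "prob_space \<gamma>" "sets \<gamma> = sets borel"
    unfolding \<gamma>_def by (rule prob_space_bind'[OF alg h], rule sets_bind'[OF alg h])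
  have kx: "prob_space (k x)" "sets (k x) = sets borel" for x
    using measurable_space[OF k, of x] by (simp_all add: sp space_prob_algebra)
  have ks: "space (k x) = UNIV" for x using sets_eq_imp_space_eq[OF kx(2)] by simp
  have Pm: "Pair x \<in> k x \<rightarrow>\<^sub>M borel" for x
  proof -
    have "Pair x \<in> borel \<rightarrow>\<^sub>M (borel :: ((real^'d) \<times> (real^'d)) measure)"
      by (rule borel_measurable_continuous_onI) (intro continuous_intros)
    then show ?thesis using kx(2) by (simp cong: measurable_cong_sets)
  qed
  have em: "emeasure \<gamma> E = (\<integral>\<^sup>+x. emeasure (k x) (Pair x -` E) \<partial>\<mu>)" if E: "E \<in> sets borel" for E
  proof -
    have "emeasure \<gamma> E = (\<integral>\<^sup>+x. emeasure (h x) E \<partial>\<mu>)" unfolding \<gamma>_def by (rule emeasure_bind_prob_algebra[OF alg h E])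
    then show ?thesis by (simp only: h_def emeasure_distr[OF Pm E] ks Int_UNIV_right)
  qed
  have mf: "(fst :: (real^'d) \<times> (real^'d) \<Rightarrow> _) \<in> \<gamma> \<rightarrow>\<^sub>M borel" and ms: "(snd :: (real^'d) \<times> (real^'d) \<Rightarrow> _) \<in> \<gamma> \<rightarrow>\<^sub>M borel"
    using \<gamma>(2) by (auto intro!: borel_measurable_continuous_onI continuous_intros cong: measurable_cong_sets)
  have pre: "f -` A \<in> sets borel" if "f \<in> \<gamma> \<rightarrow>\<^sub>M borel" "A \<in> sets borel" for f :: "(real^'d) \<times> (real^'d) \<Rightarrow> real^'d" and A
    using measurable_sets[OF that] \<gamma>(2) sets_eq_imp_space_eq[OF \<gamma>(2)] by simp
  have spg: "space \<gamma> = UNIV" using sets_eq_imp_space_eq[OF \<gamma>(2)] by simp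
  have "distr \<gamma> borel fst = \<mu>"
  proof (rule measure_eqI)
    fix A assume "A \<in> sets (distr \<gamma> borel fst)"
    then have A: "A \<in> sets borel" by simp
    have "emeasure (k x) (Pair x -` (fst -` A)) = indicator A x" for x
      using prob_space.emeasure_space_1[OF kx(1), of x] ks[of x] by (cases "x \<in> A") (auto simp: vimage_def)
    then show "emeasure (distr \<gamma> borel fst) A = emeasure \<mu> A"
      using A \<mu>(2) by (simp add: emeasure_distr[OF mf A] spg em[OF pre[OF mf A]])
  qed (simp add: \<mu>(2))
  moreover have "distr \<gamma> borel snd = \<nu>"
  proof (rule measure_eqI)
    fix A assume "A \<in> sets (distr \<gamma> borel snd)"
    then have A: "A \<in> sets borel" by simp
    have "Pair x -` (snd -` A) = A" for x :: "real^'d" by auto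
    then show "emeasure (distr \<gamma> borel snd) A = emeasure \<nu> A"
      by (simp add: emeasure_distr[OF ms A] spg em[OF pre[OF ms A]] mar[OF A])
  qed (simp add: \<nu>)
  ultimately have "\<gamma> \<in> couplings \<mu> \<nu>" unfolding couplings_def using \<gamma> by simp
  moreover have "disintegrates \<gamma> \<mu> k" unfolding disintegrates_def using k em \<gamma>(2) by simp
  ultimately show thesis by (rule that)
qed

section \<open>Countably many potentials suffice\<close>

context cost_function
begin

text \<open>The gradient is continuous with compact support, hence bounded.\<close>

lemma potentials_Lipschitz:
  assumes \<theta>: "\<theta> \<in> potentials w" and supp: "bounded {x. \<theta> x \<noteq> 0}"
  obtains M where "0 \<le> M" "\<And>x y. \<bar>\<theta> x - \<theta> y\<bar> \<le> M * dist x y"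
proof -
  obtain g D where C2: "C2_map \<theta> g D" using \<theta> unfolding potentials_def by blast
  let ?S = "closure {x. \<theta> x \<noteq> 0}"
  have g0: "g x = 0" if "x \<notin> ?S" for x
  proof (rule C2_map_local_zero(1)[OF C2, of "- ?S"])
    show "open (- ?S)" by (rule open_Compl[OF closed_closure])
    show "x \<in> - ?S" using that by simp
    show "\<theta> y = 0" if "y \<in> - ?S" for y
    proof (rule ccontr)
      assume "\<theta> y \<noteq> 0"
      then have "y \<in> ?S" by (intro subsetD[OF closure_subset]) simp
      then show False using that by simp
    qed
  qed
  have "continuous_on UNIV (\<lambda>x. norm (g x))" by (intro continuous_on_norm C2_mapD(4)[OF C2])
  moreover have "bounded {x. norm (g x) \<noteq> 0}"
    by (rule bounded_subset[of ?S]) (use g0 supp in auto)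
  ultimately obtain C where C: "C \<ge> 0" "\<And>x. \<bar>norm (g x)\<bar> \<le> C" by (rule continuous_bounded_support_bound) blast
  show thesis
  proof (rule that[OF C(1)])
    fix x y
    have "norm (\<theta> x - \<theta> y) \<le> C * norm (x - y)"
    proof (rule differentiable_bound[where S=UNIV and f'="\<lambda>x h. g x \<bullet> h"])
      show "(\<theta> has_derivative (\<lambda>h. g z \<bullet> h)) (at z within UNIV)" for z using C2_mapD(1)[OF C2] by simp
      show "onorm (\<lambda>h. g z \<bullet> h) \<le> C" for z
      proof (rule onorm_le)
        fix h
        have "norm (g z \<bullet> h) \<le> norm (g z) * norm h" unfolding real_norm_def by (rule Cauchy_Schwarz_ineq2)
        also have "\<dots> \<le> C * norm h" by (rule mult_right_mono) (use C(2)[of z] in auto)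
        finally show "norm (g z \<bullet> h) \<le> C * norm h" .
      qed
    qed auto
    then show "\<bar>\<theta> x - \<theta> y\<bar> \<le> C * dist x y" by (simp add: dist_norm)
  qed
qed

definition Lipschitz_class :: "nat \<Rightarrow> (real^'d \<Rightarrow> real) set"
  where "Lipschitz_class N = {\<theta> \<in> potentials 1. bounded {x. \<theta> x \<noteq> 0} \<and> (\<forall>x. \<bar>\<theta> x\<bar> \<le> real N) \<and>
    (\<forall>x y. \<bar>\<theta> x - \<theta> y\<bar> \<le> real N * dist x y)}"

lemma Lipschitz_classE:
  assumes "\<theta> \<in> potentials 1" "bounded {x. \<theta> x \<noteq> 0}"
  obtains N where "\<theta> \<in> Lipschitz_class N"
proof -
  obtain M where M: "0 \<le> M" "\<And>x y. \<bar>\<theta> x - \<theta> y\<bar> \<le> M * dist x y" using potentials_Lipschitz[OF assms] by blast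
  obtain C where C: "C \<ge> 0" "\<And>x. \<bar>\<theta> x\<bar> \<le> C"
    by (rule continuous_bounded_support_bound[OF potentials_continuous[OF assms(1)] assms(2)]) blast
  obtain N :: nat where N: "max M C \<le> real N" using real_arch_simple by blast
  have "\<bar>\<theta> x - \<theta> y\<bar> \<le> real N * dist x y" for x y
    by (rule order_trans[OF M(2) mult_right_mono]) (use N in auto)
  moreover have "\<bar>\<theta> x\<bar> \<le> real N" for x using C(2)[of x] N by simp
  ultimately show thesis using assms by (intro that[of N]) (simp add: Lipschitz_class_def)
qed

text \<open>Uniformly Lipschitz functions are determined, together with their limits, by the values on a
  countable dense set, and the space of real sequences is separable.\<close>

lemma countable_potentials:
  obtains \<psi> :: "nat \<Rightarrow> real^'d \<Rightarrow> real" where "\<psi> 0 = (\<lambda>x. 0)" "\<And>j. \<psi> j \<in> potentials 1" "\<And>j. bounded {x. \<psi> j x \<noteq> 0}"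
    "\<And>\<theta> p x. \<theta> \<in> potentials 1 \<Longrightarrow> bounded {x. \<theta> x \<noteq> 0} \<Longrightarrow> finite_measure p \<Longrightarrow> sets p = sets borel \<Longrightarrow>
      ennreal ((LINT y|p. \<theta> y) - \<theta> x) \<le> (SUP j. ennreal ((LINT y|p. \<psi> j y) - \<psi> j x))"
proof -
  obtain Q :: "(real^'d) set" where Q: "countable Q" "UNIV \<subseteq> closure Q"
    using separable[of "UNIV :: (real^'d) set"] by metis
  have Qne: "Q \<noteq> {}" using Q(2) by auto
  define q where "q = from_nat_into Q"
  have rq: "range q = Q" unfolding q_def by (rule range_from_nat_into[OF Qne Q(1)])
  define R where "R \<theta> = (\<lambda>n. \<theta> (q n))" for \<theta> :: "real^'d \<Rightarrow> real"
  have "\<exists>T. countable T \<and> T \<subseteq> R ` Lipschitz_class N \<and> R ` Lipschitz_class N \<subseteq> closure T" for N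
    by (rule separable[of "R ` Lipschitz_class N"]) blast
  then obtain T where T: "\<And>N. countable (T N)" "\<And>N. T N \<subseteq> R ` Lipschitz_class N" "\<And>N. R ` Lipschitz_class N \<subseteq> closure (T N)"
    by metis
  define pick where "pick N = inv_into (Lipschitz_class N) R" for N
  have pick: "pick N t \<in> Lipschitz_class N" "R (pick N t) = t" if "t \<in> T N" for N t
  proof -
    have "t \<in> R ` Lipschitz_class N" using subsetD[OF T(2) that] .
    then show "pick N t \<in> Lipschitz_class N" "R (pick N t) = t" unfolding pick_def by (rule inv_into_into, rule f_inv_into_f)
  qed
  define U where "U = (\<Union>N. pick N ` T N)"
  have cU: "countable (insert (\<lambda>x. 0) U)" unfolding U_def using T(1) by (intro countable_insert countable_UN countable_image) auto
  define e where "e = from_nat_into (insert (\<lambda>x. 0) U)"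
  have re: "range e = insert (\<lambda>x. 0) U" unfolding e_def by (rule range_from_nat_into[OF insert_not_empty cU])
  define \<psi> where "\<psi> j = (case j of 0 \<Rightarrow> (\<lambda>x. 0) | Suc i \<Rightarrow> e i)" for j
  have good: "\<theta> \<in> potentials 1 \<and> bounded {x. \<theta> x \<noteq> 0}" if "\<theta> \<in> insert (\<lambda>x. 0) U" for \<theta>
  proof (cases "\<theta> = (\<lambda>x. 0)")
    case True
    then show ?thesis using potentials_const_nonneg[of 1 0] by simp
  next
    case False
    with that have "\<theta> \<in> U" by simp
    then obtain N t where "t \<in> T N" "\<theta> = pick N t" unfolding U_def by blast
    then show ?thesis using pick(1)[of t N] unfolding Lipschitz_class_def by simp
  qed
  have \<psi>in: "\<psi> j \<in> insert (\<lambda>x. 0) U" for j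
  proof (cases j)
    case (Suc i)
    have "e i \<in> insert (\<lambda>x. 0) U" unfolding re[symmetric] by (rule rangeI)
    then show ?thesis unfolding \<psi>_def Suc by simp
  qed (simp add: \<psi>_def)
  show thesis
  proof (rule that[of \<psi>])
    show "\<psi> 0 = (\<lambda>x. 0)" unfolding \<psi>_def by simp
    show "\<psi> j \<in> potentials 1" "bounded {x. \<psi> j x \<noteq> 0}" for j using good[OF \<psi>in] by simp_all
    fix \<theta> p x assume \<theta>: "\<theta> \<in> potentials 1" "bounded {x. \<theta> x \<noteq> 0}" and p: "finite_measure p" "sets p = sets (borel :: (real^'d) measure)"
    interpret finite_measure p by (rule p)
    obtain N where N: "\<theta> \<in> Lipschitz_class N" by (rule Lipschitz_classE[OF \<theta>])
    have "R \<theta> \<in> closure (T N)" by (rule subsetD[OF T(3)]) (rule imageI[OF N])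
    then obtain t where t: "\<And>n. t n \<in> T N" "t \<longlonglongrightarrow> R \<theta>" unfolding closure_sequential by blast
    define \<theta>n where "\<theta>n n = pick N (t n)" for n
    have \<theta>n: "\<theta>n n \<in> Lipschitz_class N" and \<theta>q: "\<theta>n n (q i) = t n i" for n i
    proof -
      show "\<theta>n n \<in> Lipschitz_class N" unfolding \<theta>n_def by (rule pick(1)[OF t(1)])
      show "\<theta>n n (q i) = t n i" using fun_cong[OF pick(2)[OF t(1)[of n]], of i] unfolding \<theta>n_def R_def .
    qed
    have bd: "\<bar>\<eta> y\<bar> \<le> real N" and lip: "\<bar>\<eta> y - \<eta> y'\<bar> \<le> real N * dist y y'" if "\<eta> \<in> Lipschitz_class N" for \<eta> y y'
      using that unfolding Lipschitz_class_def by simp_all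
    have cont: "continuous_on UNIV \<eta>" if "\<eta> \<in> Lipschitz_class N" for \<eta>
      by (rule potentials_continuous[of _ 1]) (use that in \<open>simp add: Lipschitz_class_def\<close>)
    have limq: "(\<lambda>n. \<theta>n n (q i)) \<longlonglongrightarrow> \<theta> (q i)" for i
    proof -
      have "(\<lambda>n. t n i) \<longlonglongrightarrow> R \<theta> i"
        by (rule continuous_on_tendsto_compose[OF continuous_on_product_coordinates t(2)]) simp_all
      then show ?thesis unfolding \<theta>q R_def .
    qed
    have limx: "(\<lambda>n. \<theta>n n y) \<longlonglongrightarrow> \<theta> y" for y
    proof (rule tendstoI)
      fix \<epsilon> :: real assume \<epsilon>: "0 < \<epsilon>"
      define d where "d = \<epsilon> / (3 * (real N + 1))"
      have d: "0 < d" unfolding d_def using \<epsilon> by simp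
      have Nd: "real N * d \<le> \<epsilon> / 3"
      proof -
        have "real N * d \<le> (real N + 1) * d" by (rule mult_right_mono) (use d in auto)
        also have "\<dots> = \<epsilon> / 3" unfolding d_def by (simp add: field_simps)
        finally show ?thesis .
      qed
      have "y \<in> closure Q" using Q(2) by auto
      then obtain v where "v \<in> Q" "dist v y < d" using d unfolding closure_approachable by blast
      then obtain i where i: "dist (q i) y < d" using rq by auto
      have near: "\<bar>\<eta> y - \<eta> (q i)\<bar> \<le> \<epsilon> / 3" if "\<eta> \<in> Lipschitz_class N" for \<eta>
      proof -
        have "\<bar>\<eta> y - \<eta> (q i)\<bar> \<le> real N * dist y (q i)" by (rule lip[OF that])
        also have "\<dots> \<le> real N * d" by (rule mult_left_mono) (use i in \<open>auto simp: dist_commute\<close>)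
        finally show ?thesis using Nd by simp
      qed
      have "\<forall>\<^sub>F n in sequentially. dist (\<theta>n n (q i)) (\<theta> (q i)) < \<epsilon> / 3" by (rule tendstoD[OF limq]) (use \<epsilon> in simp)
      then show "\<forall>\<^sub>F n in sequentially. dist (\<theta>n n y) (\<theta> y) < \<epsilon>"
      proof eventually_elim
        case (elim n)
        show ?case using elim near[OF \<theta>n[of n]] near[OF N] unfolding dist_real_def by linarith
      qed
    qed
    have mp: "\<eta> \<in> borel_measurable p" if "\<eta> \<in> Lipschitz_class N" for \<eta>
      using borel_measurable_continuous_onI[OF cont[OF that]] p(2) by (simp cong: measurable_cong_sets)
    have "(\<lambda>n. (LINT y|p. \<theta>n n y)) \<longlonglongrightarrow> (LINT y|p. \<theta> y)"
    proof (rule integral_dominated_convergence[where w="\<lambda>_. real N"])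
      show "\<theta> \<in> borel_measurable p" by (rule mp[OF N])
      show "\<theta>n n \<in> borel_measurable p" for n by (rule mp[OF \<theta>n])
      show "AE y in p. (\<lambda>n. \<theta>n n y) \<longlonglongrightarrow> \<theta> y" by (intro AE_I2 limx)
      show "AE y in p. norm (\<theta>n n y) \<le> real N" for n unfolding real_norm_def by (intro AE_I2 bd[OF \<theta>n])
    qed simp
    from tendsto_ennrealI[OF tendsto_diff[OF this limx[of x]]]
    show "ennreal ((LINT y|p. \<theta> y) - \<theta> x) \<le> (SUP j. ennreal ((LINT y|p. \<psi> j y) - \<psi> j x))"
    proof (rule LIMSEQ_le_const2)
      have "ennreal ((LINT y|p. \<theta>n n y) - \<theta>n n x) \<le> (SUP j. ennreal ((LINT y|p. \<psi> j y) - \<psi> j x))" for n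
      proof -
        have "\<theta>n n \<in> U" unfolding U_def \<theta>n_def using t(1)[of n] by blast
        then have "\<theta>n n \<in> range e" unfolding re by simp
        then obtain i where "\<theta>n n = e i" by blast
        then have eq: "\<theta>n n = \<psi> (Suc i)" unfolding \<psi>_def by simp
        show ?thesis unfolding eq by (rule SUP_upper) simp
      qed
      then show "\<exists>n0. \<forall>n\<ge>n0. ennreal ((LINT y|p. \<theta>n n y) - \<theta>n n x) \<le> (SUP j. ennreal ((LINT y|p. \<psi> j y) - \<psi> j x))" by blast
    qed
  qed
qed

end

section \<open>Duality for the weak transport problem\<close>

text \<open>The mean of the second moments of the kernel is the second moment of its second marginal.\<close>

lemma kernel_second_moment:
  assumes k: "k \<in> \<mu> \<rightarrow>\<^sub>M subprob_algebra borel" and \<nu>: "\<mu> \<bind> k \<in> (P2 :: (real^'d) measure set)"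
  shows "AE x in \<mu>. (\<integral>\<^sup>+y. ennreal ((norm y)\<^sup>2) \<partial>k x) < \<infinity>"
proof -
  have m: "(\<lambda>y :: real^'d. ennreal ((norm y)\<^sup>2)) \<in> borel_measurable borel" by measurable
  have "(\<integral>\<^sup>+x. (\<integral>\<^sup>+y. ennreal ((norm y)\<^sup>2) \<partial>k x) \<partial>\<mu>) < \<infinity>"
    using \<nu> unfolding P2_def by (simp add: nn_integral_bind[OF m k])
  then have "AE x in \<mu>. (\<integral>\<^sup>+y. ennreal ((norm y)\<^sup>2) \<partial>k x) \<noteq> \<infinity>"
    by (intro nn_integral_PInf_AE measurable_compose[OF k nn_integral_measurable_subprob_algebra[OF m]]) simp
  then show ?thesis by eventually_elim (simp add: less_top)
qed

context cost_function
begin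

text \<open>The inequality of feasibility, integrated along the kernel of a coupling; it may be used at
  almost every point, where the kernel has finite second moment.\<close>

lemma gap_le_weak_transport:
  assumes m: "\<mu> \<in> P2" and n: "\<nu> \<in> P2" and \<psi>: "feasible \<psi>"
  shows "ennreal ((LINT y|\<nu>. \<psi> y) - (LINT x|\<mu>. \<psi> x)) \<le> weak_transport f \<mu> \<nu>"
  unfolding weak_transport_def
proof (rule Inf_greatest, elim CollectE exE conjE)
  fix v \<gamma> k assume v: "v = (\<integral>\<^sup>+x. G_cost f x (k x) \<partial>\<mu>)" and \<gamma>: "\<gamma> \<in> couplings \<mu> \<nu>" and dis: "disintegrates \<gamma> \<mu> k"
  note M = P2_D[OF m] and N = P2_D[OF n]
  have k: "k \<in> \<mu> \<rightarrow>\<^sub>M prob_algebra borel" and em: "\<And>E. E \<in> sets \<gamma> \<Longrightarrow> emeasure \<gamma> E = (\<integral>\<^sup>+x. emeasure (k x) (Pair x -` E) \<partial>\<mu>)"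
    using dis unfolding disintegrates_def by auto
  have k': "k \<in> \<mu> \<rightarrow>\<^sub>M subprob_algebra borel" by (rule measurable_prob_algebraD[OF k])
  have g: "sets \<gamma> = sets borel" "distr \<gamma> borel snd = \<nu>" using \<gamma> unfolding couplings_def by auto
  have sp: "space \<mu> = UNIV" using sets_eq_imp_space_eq[OF M(3)] by simp
  have spg: "space \<gamma> = UNIV" using sets_eq_imp_space_eq[OF g(1)] by simp
  have kx: "prob_space (k x)" "sets (k x) = sets borel" for x
    using measurable_space[OF k, of x] by (simp_all add: sp space_prob_algebra)
  have bind: "\<mu> \<bind> k = \<nu>"
  proof (rule measure_eqI)
    show s: "sets (\<mu> \<bind> k) = sets \<nu>" using N(3) kx(2) sp by (subst sets_bind[of _ _ borel]) auto
    fix A assume "A \<in> sets (\<mu> \<bind> k)"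
    then have A: "A \<in> sets borel" using s N(3) by simp
    have ms: "(snd :: (real^'d) \<times> (real^'d) \<Rightarrow> _) \<in> \<gamma> \<rightarrow>\<^sub>M borel"
      using g(1) by (auto intro!: borel_measurable_continuous_onI continuous_intros cong: measurable_cong_sets)
    have pre: "snd -` A \<in> sets \<gamma>" using measurable_sets[OF ms A] spg by simp
    have "Pair x -` (snd -` A) = A" for x :: "real^'d" by auto
    then have "emeasure \<nu> A = (\<integral>\<^sup>+x. emeasure (k x) A \<partial>\<mu>)"
      using emeasure_distr[OF ms A] em[OF pre] spg unfolding g(2) by simp
    then show "emeasure (\<mu> \<bind> k) A = emeasure \<nu> A" by (simp add: emeasure_bind[OF _ k' A] sp)
  qed
  have \<psi>b: "\<psi> \<in> bcontfun" using \<psi> unfolding feasible_def by simp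
  then have c: "continuous_on UNIV \<psi>" and b: "bounded (range \<psi>)" unfolding bcontfun_def by auto
  obtain C where "\<forall>y\<in>range \<psi>. norm y \<le> C" using b unfolding bounded_iff ..
  then have C: "\<bar>\<psi> x\<bar> \<le> C" for x by simp
  have "(LINT y|(\<mu> \<bind> k). \<psi> y) = (LINT x|\<mu>. LINT y|k x. \<psi> y)"
  proof (rule integral_bind[OF borel_measurable_continuous_onI[OF c] C k' M(2), of 1])
    show "AE x in \<mu>. emeasure (k x) (space (k x)) \<le> ennreal 1" by (rule AE_I2) (simp add: prob_space.emeasure_space_1[OF kx(1)])
  qed
  then have "(LINT y|\<nu>. \<psi> y) - (LINT x|\<mu>. \<psi> x) = (LINT x|\<mu>. (LINT y|k x. \<psi> y) - \<psi> x)"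
    unfolding bind
    by (simp add: Bochner_Integration.integral_diff[OF kernel_integrable[OF M(2) k' \<psi>b] bcontfun_integrable[OF \<psi>b M(2,3)]])
  moreover have "ennreal (LINT x|\<mu>. (LINT y|k x. \<psi> y) - \<psi> x) \<le> (\<integral>\<^sup>+x. G_cost f x (k x) \<partial>\<mu>)"
  proof (rule ennreal_integral_le_nn_integral)
    have "\<mu> \<bind> k \<in> P2" unfolding bind by (rule n)
    from kernel_second_moment[OF k' this]
    show "AE x in \<mu>. ennreal ((LINT y|k x. \<psi> y) - \<psi> x) \<le> G_cost f x (k x)"
    proof eventually_elim
      case (elim x)
      then have "k x \<in> P2" unfolding P2_def using kx by simp
      then show ?case using \<psi> unfolding feasible_def by simp
    qed
  qed
  ultimately show "ennreal ((LINT y|\<nu>. \<psi> y) - (LINT x|\<mu>. \<psi> x)) \<le> v" unfolding v by simp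
qed

text \<open>The kernel is a priori of mass at most one.  Its second marginal is \<open>\<nu>\<close>, of full mass, so that almost
  every value is a probability measure, and the others may be replaced by a point mass.\<close>

lemma weak_transport_le:
  assumes m: "\<mu> \<in> P2" and n: "\<nu> \<in> P2" and s: "0 \<le> s"
    and gap: "\<And>\<psi>. feasible \<psi> \<Longrightarrow> (LINT y|\<nu>. \<psi> y) - (LINT x|\<mu>. \<psi> x) \<le> s"
  shows "weak_transport f \<mu> \<nu> \<le> ennreal s"
proof -
  note M = P2_D[OF m] and N = P2_D[OF n]
  interpret M: prob_space \<mu> by (rule M)
  have sp: "space \<mu> = UNIV" using sets_eq_imp_space_eq[OF M(3)] by simp
  obtain k where k: "k \<in> \<mu> \<rightarrow>\<^sub>M subprob_algebra borel"
    and kg: "\<And>g. Lipschitz_bdd g \<Longrightarrow> bounded {y. g y \<noteq> 0} \<Longrightarrow> (LINT x|\<mu>. LINT y|k x. g y) = (LINT y|\<nu>. g y)"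
    and ksum: "\<And>\<psi> E n. (\<And>j. \<psi> j \<in> potentials 1) \<Longrightarrow> (\<And>j. bounded {y. \<psi> j y \<noteq> 0}) \<Longrightarrow> (\<And>j. E j \<in> sets \<mu>) \<Longrightarrow>
      disjoint_family E \<Longrightarrow> (\<Sum>j\<le>n::nat. LINT x:E j|\<mu>. (LINT y|k x. \<psi> j y) - \<psi> j x) \<le> s"
  proof (rule optimal_kernel[OF m n s gap])
    show "feasible \<psi>" if "feasible \<psi>" for \<psi> by (rule that)
    fix k assume k: "k \<in> \<mu> \<rightarrow>\<^sub>M subprob_algebra borel"
      and a: "\<And>g. Lipschitz_bdd g \<Longrightarrow> bounded {y. g y \<noteq> 0} \<Longrightarrow> (LINT x|\<mu>. LINT y|k x. g y) = (LINT y|\<nu>. g y)"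
      and b: "\<And>\<psi> E n. (\<And>j. \<psi> j \<in> potentials 1) \<Longrightarrow> (\<And>j. bounded {y. \<psi> j y \<noteq> 0}) \<Longrightarrow> (\<And>j. E j \<in> sets \<mu>) \<Longrightarrow>
        disjoint_family E \<Longrightarrow> (\<Sum>j\<le>n::nat. LINT x:E j|\<mu>. (LINT y|k x. \<psi> j y) - \<psi> j x) \<le> s"
    show thesis
    proof (rule that[OF k])
      show "(LINT x|\<mu>. LINT y|k x. g y) = (LINT y|\<nu>. g y)" if "Lipschitz_bdd g" "bounded {y. g y \<noteq> 0}" for g
        by (rule a[OF that])
      show "(\<Sum>j\<le>n::nat. LINT x:E j|\<mu>. (LINT y|k x. \<psi> j y) - \<psi> j x) \<le> s"
        if p: "\<And>j. \<psi> j \<in> potentials 1" "\<And>j. bounded {y. \<psi> j y \<noteq> 0}" "\<And>j. E j \<in> sets \<mu>" "disjoint_family E" for \<psi> E n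
        by (rule b[OF p(1) p(2) p(3) p(4)])
    qed
  qed
  have kx: "subprob_space (k x)" "sets (k x) = sets borel" for x
    using measurable_space[OF k, of x] by (simp_all add: sp space_subprob_algebra)
  have ks: "space (k x) = UNIV" for x using sets_eq_imp_space_eq[OF kx(2)] by simp
  have kf: "finite_measure (k x)" for x by (rule subprob_space.axioms(1)[OF kx(1)])
  have bind: "\<nu> = \<mu> \<bind> k"
  proof (rule measure_eqI_Lipschitz[OF N(3) _ N(2)])
    show "sets (\<mu> \<bind> k) = sets borel" using kx(2) sp by (subst sets_bind[of _ _ borel]) auto
    fix g :: "real^'d \<Rightarrow> real" assume g: "Lipschitz_bdd g" "\<And>x. 0 \<le> g x" "bounded {x. g x \<noteq> 0}"
    note gb = Lipschitz_bdd_bcontfun[OF g(1)]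
    have gm: "(\<lambda>x. ennreal (g x)) \<in> borel_measurable borel"
      by (rule measurable_compose[OF borel_measurable_continuous_onI[OF Lipschitz_bdd_continuous[OF g(1)]] measurable_ennreal])
    have "(\<integral>\<^sup>+x. ennreal (g x) \<partial>(\<mu> \<bind> k)) = (\<integral>\<^sup>+x. \<integral>\<^sup>+y. ennreal (g y) \<partial>k x \<partial>\<mu>)" by (rule nn_integral_bind[OF gm k])
    also have "\<dots> = (\<integral>\<^sup>+x. ennreal (LINT y|k x. g y) \<partial>\<mu>)"
      by (rule nn_integral_cong) (rule nn_integral_eq_integral[OF bcontfun_integrable[OF gb kf kx(2)]], simp add: g(2))
    also have "\<dots> = ennreal (LINT x|\<mu>. LINT y|k x. g y)"
      by (rule nn_integral_eq_integral[OF kernel_integrable[OF M(2) k gb]]) (simp add: g(2))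
    also have "\<dots> = ennreal (LINT y|\<nu>. g y)" by (simp only: kg[OF g(1,3)])
    also have "\<dots> = (\<integral>\<^sup>+x. ennreal (g x) \<partial>\<nu>)"
      by (rule nn_integral_eq_integral[symmetric, OF bcontfun_integrable[OF gb N(2,3)]]) (simp add: g(2))
    finally show "(\<integral>\<^sup>+x. ennreal (g x) \<partial>\<nu>) = (\<integral>\<^sup>+x. ennreal (g x) \<partial>(\<mu> \<bind> k))" ..
  qed
  have mar: "(\<integral>\<^sup>+x. emeasure (k x) A \<partial>\<mu>) = emeasure \<nu> A" if A: "A \<in> sets borel" for A
    unfolding bind by (rule emeasure_bind[OF _ k A, symmetric]) (simp add: sp)
  have mem: "(\<lambda>x. emeasure (k x) UNIV) \<in> borel_measurable \<mu>"
    by (rule measurable_compose[OF k measurable_emeasure_subprob_algebra]) simp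
  have k1: "emeasure (k x) UNIV \<le> 1" for x using subprob_space.emeasure_space_le_1[OF kx(1), of x] by (simp add: ks)
  have one: "(\<integral>\<^sup>+x. emeasure (k x) UNIV \<partial>\<mu>) = 1"
    using mar[of UNIV] prob_space.emeasure_space_1[OF N(1)] sets_eq_imp_space_eq[OF N(3)] by simp
  have "(\<integral>\<^sup>+x. 1 - emeasure (k x) UNIV \<partial>\<mu>) = (\<integral>\<^sup>+x. 1 \<partial>\<mu>) - (\<integral>\<^sup>+x. emeasure (k x) UNIV \<partial>\<mu>)"
    by (rule nn_integral_diff) (use mem k1 one in auto)
  also have "\<dots> = 0" unfolding one by (simp add: M.emeasure_space_1)
  finally have "AE x in \<mu>. 1 - emeasure (k x) UNIV = 0"
    by (subst (asm) nn_integral_0_iff_AE) (use mem in auto)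
  then have full: "AE x in \<mu>. emeasure (k x) UNIV = 1"
    by eventually_elim (rule antisym[OF k1 ennreal_minus_eq_0])
  define k' where "k' x = (if emeasure (k x) UNIV = 1 then k x else return borel 0)" for x
  have kk: "AE x in \<mu>. k' x = k x" using full by eventually_elim (simp add: k'_def)
  have pr: "prob_space (k' x)" "sets (k' x) = sets borel" for x
    using kx(2)[of x] ks[of x] unfolding k'_def by (auto intro!: prob_spaceI prob_space_return)
  have k': "k' \<in> \<mu> \<rightarrow>\<^sub>M prob_algebra borel"
  proof (rule measurable_prob_algebraI[OF pr(1)])
    have "(\<lambda>x. emeasure (k x) UNIV) -` {1} \<inter> space \<mu> \<in> sets \<mu>" by (rule measurable_sets[OF mem]) simp
    then have st: "{x \<in> space \<mu>. emeasure (k x) UNIV = 1} \<in> sets \<mu>" by (simp add: vimage_def Int_def conj_commute)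
    show "k' \<in> \<mu> \<rightarrow>\<^sub>M subprob_algebra borel" unfolding k'_def[abs_def]
    proof (rule measurable_If[OF k _ st])
      show "(\<lambda>x. return borel 0) \<in> \<mu> \<rightarrow>\<^sub>M subprob_algebra borel"
        by (rule measurable_const) (simp add: space_subprob_algebra prob_space_return prob_space_imp_subprob_space)
    qed
  qed
  have "(\<integral>\<^sup>+x. emeasure (k' x) A \<partial>\<mu>) = emeasure \<nu> A" if A: "A \<in> sets borel" for A
    unfolding mar[OF A, symmetric] by (rule nn_integral_cong_AE) (use kk in \<open>eventually_elim, simp\<close>)
  from coupling_of_kernel[OF M(1,3) N(3) k' this] obtain \<gamma> where \<gamma>: "\<gamma> \<in> couplings \<mu> \<nu>" "disintegrates \<gamma> \<mu> k'" by blast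
  have "\<mu> \<bind> k \<in> P2" using n unfolding bind .
  from kernel_second_moment[OF k this] have mom: "AE x in \<mu>. (\<integral>\<^sup>+y. ennreal ((norm y)\<^sup>2) \<partial>k x) < \<infinity>" .
  obtain \<psi> where \<psi>: "\<psi> 0 = (\<lambda>x. 0)" "\<And>j::nat. \<psi> j \<in> potentials 1" "\<And>j. bounded {x. \<psi> j x \<noteq> 0}"
    and dense: "\<And>\<theta> p x. \<theta> \<in> potentials 1 \<Longrightarrow> bounded {x. \<theta> x \<noteq> 0} \<Longrightarrow> finite_measure p \<Longrightarrow> sets p = sets borel \<Longrightarrow>
      ennreal ((LINT y|p. \<theta> y) - \<theta> x) \<le> (SUP j. ennreal ((LINT y|p. \<psi> j y) - \<psi> j x))"
    by (rule countable_potentials) (rule that; assumption)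
  have G_le: "G_cost f x p \<le> (SUP j. ennreal ((LINT y|p. \<psi> j y) - \<psi> j x))" (is "_ \<le> ?S") if p: "p \<in> P2" for x p
  proof (cases ?S)
    case (real S)
    have "dyn_cost f (return borel x) p \<le> ennreal S"
    proof (rule dyn_cost_le_potential_gap[OF return_P2 p real(1)])
      fix \<theta> assume \<theta>: "\<theta> \<in> potentials 1" "bounded {x. \<theta> x \<noteq> 0}"
      have e: "(LINT x|return borel x. \<theta> x) = \<theta> x"
        by (rule integral_return, simp, rule borel_measurable_continuous_onI[OF potentials_continuous[OF \<theta>(1)]])
      have "ennreal ((LINT y|p. \<theta> y) - \<theta> x) \<le> ennreal S"
        unfolding real(2)[symmetric] by (rule dense[OF \<theta> P2_D(2,3)[OF p]])
      then show "(LINT x|p. \<theta> x) - (LINT x|return borel x. \<theta> x) \<le> S" unfolding e by (simp only: ennreal_le_iff[OF real(1)])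
    qed
    then show ?thesis unfolding real(2) G_cost_def .
  next
    case top
    show ?thesis unfolding top by (rule top_greatest)
  qed
  have "weak_transport f \<mu> \<nu> \<le> (\<integral>\<^sup>+x. G_cost f x (k' x) \<partial>\<mu>)"
    unfolding weak_transport_def using \<gamma> by (intro Inf_lower) blast
  also have "\<dots> \<le> (\<integral>\<^sup>+x. (SUP j. ennreal ((LINT y|k x. \<psi> j y) - \<psi> j x)) \<partial>\<mu>)"
  proof (rule nn_integral_mono_AE)
    show "AE x in \<mu>. G_cost f x (k' x) \<le> (SUP j. ennreal ((LINT y|k x. \<psi> j y) - \<psi> j x))"
      using kk mom
    proof eventually_elim
      case (elim x)
      have "k x \<in> P2" using elim pr[of x] unfolding P2_def by simp
      then show ?case using G_le elim(1) by simp
    qed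
  qed
  also have "\<dots> \<le> ennreal s"
  proof (rule nn_integral_SUP_le)
    show "integrable \<mu> (\<lambda>x. (LINT y|k x. \<psi> j y) - \<psi> j x)" for j
      by (intro Bochner_Integration.integrable_diff kernel_integrable[OF M(2) k] bcontfun_integrable M(2,3) potentials_bcontfun[OF \<psi>(2)])
    show "(LINT y|k x. \<psi> 0 y) - \<psi> 0 x = 0" for x by (simp add: \<psi>(1))
    show "(\<Sum>j\<le>n. LINT x:E j|\<mu>. (LINT y|k x. \<psi> j y) - \<psi> j x) \<le> s"
      if E: "\<And>j. E j \<in> sets \<mu>" "disjoint_family E" for n and E :: "nat \<Rightarrow> (real^'d) set"
      by (rule ksum[OF \<psi>(2,3) E])
  qed
  finally show ?thesis .
qed

text \<open>The infimum in the transform is at most \<open>- \<psi> x\<close>, because the point mass at \<open>x\<close> has cost zero.\<close>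

lemma feasible_iff_G_transform:
  assumes \<psi>: "\<psi> \<in> bcontfun"
  shows "(\<forall>x. ereal (- \<psi> x) = G_transform f (\<lambda>y. - \<psi> y) x) \<longleftrightarrow> feasible \<psi>"
proof -
  have c: "continuous_on UNIV \<psi>" using \<psi> unfolding bcontfun_def by simp
  have m: "(\<lambda>y. - \<psi> y) \<in> borel_measurable borel" by (rule borel_measurable_continuous_onI) (intro continuous_intros c)
  have compl: "(LINT y|completion p. - \<psi> y) = - (LINT y|p. \<psi> y)" if "p \<in> P2" for p
  proof -
    have "(\<lambda>y. - \<psi> y) \<in> borel_measurable p" using m P2_D(3)[OF that] by (simp cong: measurable_cong_sets)
    then show ?thesis by (simp add: integral_completion)
  qed
  have G: "G_transform f (\<lambda>y. - \<psi> y) x = (INF p\<in>P2. ereal (- (LINT y|p. \<psi> y)) + enn2ereal (G_cost f x p))" for x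
    unfolding G_transform_def by (rule INF_cong[OF refl]) (simp only: compl)
  have conv: "ereal (- b) \<le> ereal (- a) + enn2ereal c \<longleftrightarrow> ennreal (a - b) \<le> c" for a b :: real and c
  proof (cases c)
    case (real r)
    then show ?thesis by (auto simp: enn2ereal_ennreal ennreal_le_iff)
  qed (simp add: top_ereal_def)
  have at_x: "(INF p\<in>P2. ereal (- (LINT y|p. \<psi> y)) + enn2ereal (G_cost f x p)) \<le> ereal (- \<psi> x)" for x
  proof (rule INF_lower2[OF return_P2[of x]])
    have "(LINT y|return borel x. \<psi> y) = \<psi> x"
      by (rule integral_return, simp, rule borel_measurable_continuous_onI[OF c])
    then show "ereal (- (LINT y|return borel x. \<psi> y)) + enn2ereal (G_cost f x (return borel x)) \<le> ereal (- \<psi> x)"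
      by (simp add: G_cost_return zero_ennreal.rep_eq)
  qed
  have "ereal (- \<psi> x) = G_transform f (\<lambda>y. - \<psi> y) x \<longleftrightarrow> (\<forall>p\<in>P2. ennreal ((LINT y|p. \<psi> y) - \<psi> x) \<le> G_cost f x p)" for x
  proof -
    have "ereal (- \<psi> x) = G_transform f (\<lambda>y. - \<psi> y) x \<longleftrightarrow>
        ereal (- \<psi> x) \<le> (INF p\<in>P2. ereal (- (LINT y|p. \<psi> y)) + enn2ereal (G_cost f x p))"
      unfolding G using at_x[of x] by (auto intro: antisym)
    then show ?thesis by (simp only: le_INF_iff conv)
  qed
  then show ?thesis unfolding feasible_def using \<psi> by simp
qed

end

theorem theorem3p26:
  fixes f :: "real^'d^'d \<Rightarrow> ennreal"
    and \<kappa>\<^sub>1 :: real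
    and \<mu> \<nu> :: "(real^'d) measure"
  assumes "convex_fun f"
    and "pos_homogeneous f"
    and "lower_semicont f"
    and "dom_fun f \<subseteq> PSD"
    and "dom_fun f \<noteq> {}"
    and "dom_fun f \<subseteq> closure (dom_fun f \<inter> PD)"
    and "coercive f"
    and "dom_fun f = PSD"
    and "\<kappa>\<^sub>1 > 0"
    and "\<forall>A\<in>PSD. f A \<le> ennreal (\<kappa>\<^sub>1 * trace A)"
    and "\<mu> \<in> P2"
    and "\<nu> \<in> P2"
  shows "enn2ereal (weak_transport f \<mu> \<nu>) =
    (SUP \<psi> \<in> {\<psi> \<in> bcontfun. \<forall>x. ereal (- \<psi> x) = G_transform f (\<lambda>y. - \<psi> y) x}.
       ereal ((LINT y|\<nu>. \<psi> y) - (LINT x|\<mu>. \<psi> x)))"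
proof -
  interpret cost_function f "\<kappa>\<^sub>1" by unfold_locales (use assms in auto)
  let ?gap = "\<lambda>\<psi>. (LINT y|\<nu>. \<psi> y) - (LINT x|\<mu>. \<psi> x)"
  have set_eq: "{\<psi> \<in> bcontfun. \<forall>x. ereal (- \<psi> x) = G_transform f (\<lambda>y. - \<psi> y) x} = Collect feasible"
  proof (rule Collect_cong)
    fix \<psi> :: "real^'d \<Rightarrow> real"
    show "(\<psi> \<in> bcontfun \<and> (\<forall>x. ereal (- \<psi> x) = G_transform f (\<lambda>y. - \<psi> y) x)) = feasible \<psi>"
    proof (cases "\<psi> \<in> bcontfun")
      case True
      then show ?thesis using feasible_iff_G_transform[OF True] by simp
    next
      case False
      then show ?thesis unfolding feasible_def by simp
    qed
  qed
  have zero: "feasible (\<lambda>x. 0)" unfolding feasible_def by (simp add: const_bcontfun)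
  show ?thesis unfolding set_eq
  proof (rule antisym)
    show "(SUP \<psi>\<in>Collect feasible. ereal (?gap \<psi>)) \<le> enn2ereal (weak_transport f \<mu> \<nu>)"
    proof (rule SUP_least)
      fix \<psi> assume "\<psi> \<in> Collect feasible"
      then have le: "ennreal (?gap \<psi>) \<le> weak_transport f \<mu> \<nu>" by (intro gap_le_weak_transport assms) simp
      have "ereal (?gap \<psi>) \<le> ereal (max 0 (?gap \<psi>))" by simp
      also have "\<dots> = enn2ereal (ennreal (?gap \<psi>))" by (simp add: ennreal.rep_eq max_def)
      also have "\<dots> \<le> enn2ereal (weak_transport f \<mu> \<nu>)" using le by (simp add: less_eq_ennreal.rep_eq)
      finally show "ereal (?gap \<psi>) \<le> enn2ereal (weak_transport f \<mu> \<nu>)" .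
    qed
    let ?S = "SUP \<psi>\<in>Collect feasible. ereal (?gap \<psi>)"
    have nn: "0 \<le> ?S" by (rule SUP_upper2[of "\<lambda>x. 0"]) (simp_all add: zero zero_ereal_def)
    show "enn2ereal (weak_transport f \<mu> \<nu>) \<le> ?S"
    proof (cases ?S)
      case (real s)
      then have s: "0 \<le> s" using nn by simp
      have "?gap \<psi> \<le> s" if "feasible \<psi>" for \<psi>
      proof -
        have "ereal (?gap \<psi>) \<le> ?S" by (rule SUP_upper) (simp add: that)
        then show ?thesis unfolding real by simp
      qed
      then have "weak_transport f \<mu> \<nu> \<le> ennreal s" by (rule weak_transport_le[OF assms(11,12) s])
      then have "enn2ereal (weak_transport f \<mu> \<nu>) \<le> enn2ereal (ennreal s)" by (simp add: less_eq_ennreal.rep_eq)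
      then show ?thesis unfolding real using s by (simp add: enn2ereal_ennreal)
    next
      case PInf
      then show ?thesis by simp
    next
      case MInf
      then show ?thesis using nn by simp
    qed
  qed
qed

end
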